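(* The decision problems Roman Hitting Function (RHF) and Roman Hitting Set (RHS) are both NP-complete. Moreover, when parameterized by the standard parameter $k$ (the upper bound on the weight), both RHF and RHS are W[2]-complete.
   Context: A hypergraph is $H=(X,\hat S)$ with $X$ a finite set and $\hat S=(s_i)_{i\in I}$ a sequence of subsets $s_i\subseteq X$ indexed by a finite index set $I$ (the same subset may occur for several indices). A correspondence is a map $\tau:X\to I$ with $x\in s_{\tau(x)}$ for all $x\in X$. A function $f:X\to\{0,1,2\}$ is a Roman hitting function (rhf) for $(H,\tau)$ if for every $i\in I$ there is $x\in s_i$ with $f(x)=2$ or there is $x\in X$ with $\tau(x)=i$ and $f(x)=1$; its weight is $\omega(f)=\sum_{x\in X}f(x)$. A pair $(R_1,R_2)$ with $R_1\subseteq I$, $R_2\subseteq X$ is a Roman hitting set (rhs) of $H$ if for every $i\in I$, $s_i\cap R_2\neq\emptyset$ or $i\in R_1$; its weight is $\omega(R_1,R_2)=|R_1|+2|R_2|$. RHF: given $H$, a correspondence $\tau$ and $k\in\mathbb N$, is there an rhf of weight at most $k$? RHS: given $H$ and $k\in\mathbb N$, is there an rhs of weight at most $k$? The standard parameter is $k$. *)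

theory Defs
  imports Main "HOL-Computational_Algebra.Polynomial"
begin

section \<open>Hypergraphs and Roman hitting\<close>

text \<open>
  A hypergraph is given by its vertex set \<open>X\<close>, its index set \<open>I\<close> and the indexed family \<open>s\<close> of its
  edges. Distinct indices may carry the same edge; values of \<open>s\<close> outside \<open>I\<close> are irrelevant.
\<close>

definition hypergraph :: "'x set \<Rightarrow> 'i set \<Rightarrow> ('i \<Rightarrow> 'x set) \<Rightarrow> bool" where
  "hypergraph X I s \<longleftrightarrow> finite X \<and> finite I \<and> (\<forall>i\<in>I. s i \<subseteq> X)"

definition correspondence :: "'x set \<Rightarrow> 'i set \<Rightarrow> ('i \<Rightarrow> 'x set) \<Rightarrow> ('x \<Rightarrow> 'i) \<Rightarrow> bool" where
  "correspondence X I s \<tau> \<longleftrightarrow> (\<forall>x\<in>X. \<tau> x \<in> I \<and> x \<in> s (\<tau> x))"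

definition roman_hitting_function ::
    "'x set \<Rightarrow> 'i set \<Rightarrow> ('i \<Rightarrow> 'x set) \<Rightarrow> ('x \<Rightarrow> 'i) \<Rightarrow> ('x \<Rightarrow> nat) \<Rightarrow> bool" where
  "roman_hitting_function X I s \<tau> f \<longleftrightarrow>
     (\<forall>x\<in>X. f x \<in> {0, 1, 2}) \<and>
     (\<forall>i\<in>I. (\<exists>x\<in>s i. f x = 2) \<or> (\<exists>x\<in>X. \<tau> x = i \<and> f x = 1))"

definition rhf_weight :: "'x set \<Rightarrow> ('x \<Rightarrow> nat) \<Rightarrow> nat" where
  "rhf_weight X f = (\<Sum>x\<in>X. f x)"

definition roman_hitting_set ::
    "'x set \<Rightarrow> 'i set \<Rightarrow> ('i \<Rightarrow> 'x set) \<Rightarrow> 'i set \<Rightarrow> 'x set \<Rightarrow> bool" where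
  "roman_hitting_set X I s R1 R2 \<longleftrightarrow>
     R1 \<subseteq> I \<and> R2 \<subseteq> X \<and> (\<forall>i\<in>I. s i \<inter> R2 \<noteq> {} \<or> i \<in> R1)"

definition rhs_weight :: "'i set \<Rightarrow> 'x set \<Rightarrow> nat" where
  "rhs_weight R1 R2 = card R1 + 2 * card R2"


section \<open>Turing machines\<close>

text \<open>
  Nondeterministic multi-tape machines with two-way infinite tapes. States and tape symbols are
  initial segments of the natural numbers; symbol 0 is the blank, symbols 1 and 2 are the input
  bits. A transition \<open>(q, r, q', a)\<close> applies in state \<open>q\<close> when the scanned symbols are \<open>r\<close>; it moves
  to \<open>q'\<close> and, on each tape, writes a symbol and then moves the head as prescribed by \<open>a\<close>.
\<close>

datatype move = MoveLeft | Stay | MoveRight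

record machine =
  num_tapes :: nat
  num_states :: nat
  num_symbols :: nat
  start_state :: nat
  accept_state :: nat
  transitions :: "(nat \<times> nat list \<times> nat \<times> (nat \<times> move) list) set"

definition turing_machine :: "machine \<Rightarrow> bool" where
  "turing_machine M \<longleftrightarrow>
     1 \<le> num_tapes M \<and> 3 \<le> num_symbols M \<and>
     start_state M < num_states M \<and> accept_state M < num_states M \<and>
     (\<forall>(q, r, q', a) \<in> transitions M.
        q < num_states M \<and> q' < num_states M \<and>
        length r = num_tapes M \<and> (\<forall>b\<in>set r. b < num_symbols M) \<and>
        length a = num_tapes M \<and> (\<forall>(b, d)\<in>set a. b < num_symbols M))"

definition deterministic :: "machine \<Rightarrow> bool" where
  "deterministic M \<longleftrightarrow>
     (\<forall>q r q1 a1 q2 a2. (q, r, q1, a1) \<in> transitions M \<longrightarrow> (q, r, q2, a2) \<in> transitions M \<longrightarrow>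
        q1 = q2 \<and> a1 = a2)"

text \<open>
  Tape contents are recorded relative to the head, which always scans cell 0; a head movement
  shifts the contents. A configuration is a state together with the list of tapes.
\<close>

type_synonym tape = "int \<Rightarrow> nat"
type_synonym config = "nat \<times> tape list"

fun shift :: "move \<Rightarrow> tape \<Rightarrow> tape" where
  "shift MoveLeft t = (\<lambda>z. t (z - 1))"
| "shift Stay t = t"
| "shift MoveRight t = (\<lambda>z. t (z + 1))"

definition tm_step :: "machine \<Rightarrow> config \<Rightarrow> config \<Rightarrow> bool" where
  "tm_step M c c' \<longleftrightarrow>
     (\<exists>a. (fst c, map (\<lambda>t. t 0) (snd c), fst c', a) \<in> transitions M \<and>
          snd c' = map2 (\<lambda>t (b, d). shift d (t(0 := b))) (snd c) a)"

definition halted :: "machine \<Rightarrow> config \<Rightarrow> bool" where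
  "halted M c \<longleftrightarrow> (\<nexists>c'. tm_step M c c')"

definition word_tape :: "bool list \<Rightarrow> tape" where
  "word_tape w = (\<lambda>z. if 0 \<le> z \<and> z < int (length w) then if w ! nat z then 2 else 1 else 0)"

definition init_config :: "machine \<Rightarrow> bool list \<Rightarrow> config" where
  "init_config M w = (start_state M, word_tape w # replicate (num_tapes M - 1) (\<lambda>_. 0))"

text \<open>
  On input \<open>w\<close>, the machine halts after at most \<open>t\<close> steps, with its first tape
  containing exactly \<open>u\<close> and the head on the first symbol of \<open>u\<close>.
\<close>

definition tm_outputs :: "machine \<Rightarrow> bool list \<Rightarrow> bool list \<Rightarrow> nat \<Rightarrow> bool" where
  "tm_outputs M w u t \<longleftrightarrow>
     (\<exists>n c. n \<le> t \<and> (tm_step M ^^ n) (init_config M w) c \<and> halted M c \<and>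
            hd (snd c) = word_tape u)"

definition ntm_decides :: "machine \<Rightarrow> bool list set \<Rightarrow> (nat \<Rightarrow> nat) \<Rightarrow> bool" where
  "ntm_decides M L T \<longleftrightarrow>
     (\<forall>w. (\<forall>n c. (tm_step M ^^ n) (init_config M w) c \<longrightarrow> n \<le> T (length w)) \<and>
          (w \<in> L \<longleftrightarrow>
             (\<exists>n c. (tm_step M ^^ n) (init_config M w) c \<and> halted M c \<and>
                    fst c = accept_state M)))"


section \<open>NP-completeness\<close>

definition in_NP :: "bool list set \<Rightarrow> bool" where
  "in_NP L \<longleftrightarrow>
     (\<exists>M (p :: nat poly). turing_machine M \<and> ntm_decides M L (\<lambda>n. poly p n))"

definition poly_time_computable :: "(bool list \<Rightarrow> bool list) \<Rightarrow> bool" where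
  "poly_time_computable F \<longleftrightarrow>
     (\<exists>M (p :: nat poly). turing_machine M \<and> deterministic M \<and>
        (\<forall>w. tm_outputs M w (F w) (poly p (length w))))"

definition poly_reducible :: "bool list set \<Rightarrow> bool list set \<Rightarrow> bool" where
  "poly_reducible L L' \<longleftrightarrow>
     (\<exists>F. poly_time_computable F \<and> (\<forall>w. w \<in> L \<longleftrightarrow> F w \<in> L'))"

definition NP_hard :: "bool list set \<Rightarrow> bool" where
  "NP_hard L \<longleftrightarrow> (\<forall>L'. in_NP L' \<longrightarrow> poly_reducible L' L)"

definition NP_complete :: "bool list set \<Rightarrow> bool" where
  "NP_complete L \<longleftrightarrow> in_NP L \<and> NP_hard L"


section \<open>Parameterized problems and fpt reductions\<close>

text \<open>
  A parameterized problem is a set of pairs \<open>(x, k)\<close> of a word \<open>x\<close> and a parameter \<open>k\<close>. Machines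
  receive such a pair as a self-delimiting code of \<open>k\<close> in binary, followed by \<open>x\<close>.
\<close>

type_synonym parameterized_problem = "(bool list \<times> nat) set"

fun binary :: "nat \<Rightarrow> bool list" where \<comment> \<open>least significant bit first\<close>
  "binary n = (if n = 0 then [] else odd n # binary (n div 2))"

declare binary.simps [simp del]

definition encode_nat :: "nat \<Rightarrow> bool list" where
  "encode_nat n = concat (map (\<lambda>b. [True, b]) (binary n)) @ [False]"

definition encode_instance :: "bool list \<times> nat \<Rightarrow> bool list" where
  "encode_instance = (\<lambda>(x, k). encode_nat k @ x)"

definition computable :: "(nat \<Rightarrow> nat) \<Rightarrow> bool" where
  "computable f \<longleftrightarrow>
     (\<exists>M. turing_machine M \<and> deterministic M \<and>
        (\<forall>n. \<exists>t. tm_outputs M (binary n) (binary (f n)) t))"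

definition fpt_reducible :: "parameterized_problem \<Rightarrow> parameterized_problem \<Rightarrow> bool" where
  "fpt_reducible P P' \<longleftrightarrow>
     (\<exists>F f g M (p :: nat poly).
        computable f \<and> computable g \<and> turing_machine M \<and> deterministic M \<and>
        (\<forall>x k. ((x, k) \<in> P \<longleftrightarrow> F (x, k) \<in> P') \<and>
               snd (F (x, k)) \<le> g k \<and>
               tm_outputs M (encode_instance (x, k)) (encode_instance (F (x, k)))
                 (f k * poly p (length (encode_instance (x, k))))))"


section \<open>Boolean circuits and the W-hierarchy\<close>

text \<open>
  A circuit is a directed acyclic graph whose nodes are listed in a topological order, each gate
  naming the positions of its in-neighbours. The last node is the output node; other nodes
  of out-degree 0 may exist.
\<close>

datatype gate = Input | Neg nat | Conj "nat list" | Disj "nat list"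

type_synonym circuit = "gate list"

fun preds :: "gate \<Rightarrow> nat list" where
  "preds Input = []"
| "preds (Neg j) = [j]"
| "preds (Conj js) = js"
| "preds (Disj js) = js"

definition large :: "gate \<Rightarrow> bool" where
  "large g \<longleftrightarrow> 2 < length (preds g)"

definition circuit :: "circuit \<Rightarrow> bool" where
  "circuit C \<longleftrightarrow>
     C \<noteq> [] \<and>
     (\<forall>i<length C.
        distinct (preds (C ! i)) \<and> (\<forall>j\<in>set (preds (C ! i)). j < i) \<and>
        (case C ! i of
           Conj js \<Rightarrow> 2 \<le> length js
         | Disj js \<Rightarrow> 2 \<le> length js
         | _ \<Rightarrow> True))"

definition input_output_path :: "circuit \<Rightarrow> nat list \<Rightarrow> bool" where
  "input_output_path C p \<longleftrightarrow>
     p \<noteq> [] \<and> set p \<subseteq> {..<length C} \<and> C ! hd p = Input \<and> last p = length C - 1 \<and>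
     successively (\<lambda>u v. u \<in> set (preds (C ! v))) p"

definition circuit_depth :: "circuit \<Rightarrow> nat" where
  "circuit_depth C = Max {length p - 1 | p. input_output_path C p}"

definition weft :: "circuit \<Rightarrow> nat" where
  "weft C = Max {length (filter (\<lambda>v. large (C ! v)) p) | p. input_output_path C p}"

text \<open>
  The truth values \<open>v\<close> of all nodes obey the gates. Since circuits are acyclic, \<open>v\<close> is determined
  on the nodes of \<open>C\<close> by its values at the input nodes, which are unconstrained.
\<close>

definition valuation :: "circuit \<Rightarrow> (nat \<Rightarrow> bool) \<Rightarrow> bool" where
  "valuation C v \<longleftrightarrow>
     (\<forall>i<length C.
        case C ! i of
          Input \<Rightarrow> True
        | Neg j \<Rightarrow> v i = (\<not> v j)
        | Conj js \<Rightarrow> v i = (\<forall>j\<in>set js. v j)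
        | Disj js \<Rightarrow> v i = (\<exists>j\<in>set js. v j))"

definition weighted_satisfiable :: "circuit \<Rightarrow> nat \<Rightarrow> bool" where
  "weighted_satisfiable C k \<longleftrightarrow>
     (\<exists>v. valuation C v \<and> v (length C - 1) \<and>
          card {i. i < length C \<and> C ! i = Input \<and> v i} = k)"

text \<open>
  Unary codes are used only for numbers bounded by the number of elements of the encoded
  structure, so all codes below are polynomially related to the usual ones.
\<close>

definition unary :: "nat \<Rightarrow> bool list" where
  "unary n = replicate n True @ [False]"

definition encode_list :: "('a \<Rightarrow> bool list) \<Rightarrow> 'a list \<Rightarrow> bool list" where
  "encode_list e xs = unary (length xs) @ concat (map e xs)"

fun encode_gate :: "gate \<Rightarrow> bool list" where
  "encode_gate Input = [False, False]"
| "encode_gate (Neg j) = [False, True] @ unary j"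
| "encode_gate (Conj js) = [True, False] @ encode_list unary js"
| "encode_gate (Disj js) = [True, True] @ encode_list unary js"

definition encode_circuit :: "circuit \<Rightarrow> bool list" where
  "encode_circuit = encode_list encode_gate"

definition weighted_circuit_sat :: "nat \<Rightarrow> nat \<Rightarrow> parameterized_problem" where
  "weighted_circuit_sat t d =
     {(encode_circuit C, k) | C k.
        circuit C \<and> weft C \<le> t \<and> circuit_depth C \<le> d \<and> weighted_satisfiable C k}"

definition in_W :: "nat \<Rightarrow> parameterized_problem \<Rightarrow> bool" where
  "in_W t P \<longleftrightarrow> (\<exists>d\<ge>1. fpt_reducible P (weighted_circuit_sat t d))"

definition W_hard :: "nat \<Rightarrow> parameterized_problem \<Rightarrow> bool" where
  "W_hard t P \<longleftrightarrow> (\<forall>P'. in_W t P' \<longrightarrow> fpt_reducible P' P)"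

definition W_complete :: "nat \<Rightarrow> parameterized_problem \<Rightarrow> bool" where
  "W_complete t P \<longleftrightarrow> in_W t P \<and> W_hard t P"


section \<open>The decision problems\<close>

text \<open>
  In instances, the vertices are \<open>0, \<dots>, n - 1\<close> and the edge indices \<open>0, \<dots>, m - 1\<close>. A hypergraph is
  encoded by \<open>n\<close>, \<open>m\<close> and its incidence matrix, a correspondence by the list of its values.
\<close>

definition encode_hypergraph :: "nat \<Rightarrow> nat \<Rightarrow> (nat \<Rightarrow> nat set) \<Rightarrow> bool list" where
  "encode_hypergraph n m s =
     unary n @ unary m @ concat (map (\<lambda>i. map (\<lambda>x. x \<in> s i) [0..<n]) [0..<m])"

definition encode_correspondence :: "nat \<Rightarrow> (nat \<Rightarrow> nat) \<Rightarrow> bool list" where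
  "encode_correspondence n \<tau> = concat (map (\<lambda>x. unary (\<tau> x)) [0..<n])"

definition RHF :: parameterized_problem where
  "RHF =
     {(encode_hypergraph n m s @ encode_correspondence n \<tau>, k) | n m s \<tau> k.
        hypergraph {..<n} {..<m} s \<and> correspondence {..<n} {..<m} s \<tau> \<and>
        (\<exists>f. roman_hitting_function {..<n} {..<m} s \<tau> f \<and> rhf_weight {..<n} f \<le> k)}"

definition RHS :: parameterized_problem where
  "RHS =
     {(encode_hypergraph n m s, k) | n m s k.
        hypergraph {..<n} {..<m} s \<and>
        (\<exists>R1 R2. roman_hitting_set {..<n} {..<m} s R1 R2 \<and> rhs_weight R1 R2 \<le> k)}"

text \<open>The underlying classical problem, in which the parameter is an ordinary part of the input.\<close>

definition classical :: "parameterized_problem \<Rightarrow> bool list set" where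
  "classical P = encode_instance ` P"

end

theory Submission
  imports Defs
begin

text \<open>
  Hardness goes through a constraint satisfaction problem: groups take values subject to clauses
  of literals "group \<open>g\<close> has value \<open>v\<close>". Taking the pairs \<open>(g, v)\<close> as vertices, a hitting set with
  one vertex per group is an assignment, and enough copies of each edge make index elements and
  values 1 useless, so \<open>RHS\<close> and \<open>RHF\<close> with \<open>k\<close> twice the number of groups ask for a satisfying
  assignment. Tableaux of Turing machines yield such constraints. A circuit of depth \<open>d\<close> and
  weft 2 with \<open>k\<close> true inputs yields them with a number of groups depending on \<open>k\<close> and \<open>d\<close> only: with the \<open>k\<close>
  inputs in increasing order, groups are the tuples of about \<open>2 ^ d\<close> of them, so a false input is
  witnessed positively by the gap around it, and nodes below the large gates depend on boundedly
  many inputs, so negations disappear.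

  For membership, both problems say that at most \<open>k\<close> literals can be chosen such that each clause
  contains a pair of chosen literals; this is guessed and checked in polynomial time, and
  it is the weighted satisfiability of a monotone circuit of weft 2.

  Polynomial time is reached through a small stack language, compiled to Turing machines, and a
  predicate \<open>PT\<close> on functions between tree-coded types, closed under composition,
  pairs, lists and folds of polynomially bounded size.
\<close>

section \<open>Stack programs\<close>

text \<open>Hardness is defined by arbitrary machines on one side and by circuits with negations on
  the other, so a single constraint format has to receive both a tableau and a circuit. Both Roman
  problems are then given the same hypergraph: its first edge contains all vertices, hence the
  constant 0 is a correspondence.

  The length of the tuples comes from the two positions of a gap, doubled by every gate of fan-in
  two along a path of \<open>d\<close> gates: \<open>2 ^ (d + 1)\<close>. With the sentinels there
  are \<open>(k + 2) ^ (2 ^ (d + 1))\<close> groups, and one more that selects an alternative of the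
  disjunction at the top.

  The binary code of the parameter is an obstacle of its own. Its value can be exponential in the
  length of the input, so polynomial-time functions only see it capped, and new parameters are
  bounded by powers of two, whose binary codes can be written down at once. In a composed reduction
  the intermediate instance can be longer than any polynomial in the input; its length is controlled
  by counting nonblank cells.\<close>

datatype com =
    Skip
  | Push nat bool
  | Seq com com
  | Case nat com com com
  | While nat com

type_synonym stacks = "nat \<Rightarrow> bool list"

text \<open>
  \<^term>\<open>Case\<close> and \<^term>\<open>While\<close> pop the stack they inspect; a loop continues as long as it pops \<^term>\<open>True\<close>.
  The time is that of the compiled Turing machine.
\<close>

inductive exec :: "com \<Rightarrow> stacks \<Rightarrow> nat \<Rightarrow> stacks \<Rightarrow> bool" where
  Skip: "exec Skip s 0 s"
| Push: "exec (Push r b) s 2 (s(r := b # s r))"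
| Seq: "exec c1 s t1 s1 \<Longrightarrow> exec c2 s1 t2 s2 \<Longrightarrow> exec (Seq c1 c2) s (t1 + t2) s2"
| CaseE: "s r = [] \<Longrightarrow> exec c0 s t s' \<Longrightarrow> exec (Case r c0 c1 c2) s (Suc t) s'"
| CaseF: "s r = False # xs \<Longrightarrow> exec c1 (s(r := xs)) t s' \<Longrightarrow> exec (Case r c0 c1 c2) s (Suc t) s'"
| CaseT: "s r = True # xs \<Longrightarrow> exec c2 (s(r := xs)) t s' \<Longrightarrow> exec (Case r c0 c1 c2) s (Suc t) s'"
| WhileE: "s r = [] \<Longrightarrow> exec (While r c) s 1 s"
| WhileF: "s r = False # xs \<Longrightarrow> exec (While r c) s 1 (s(r := xs))"
| WhileT: "s r = True # xs \<Longrightarrow> exec c (s(r := xs)) t1 s1 \<Longrightarrow> exec (While r c) s1 t2 s2 \<Longrightarrow>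
    exec (While r c) s (Suc (t1 + t2)) s2"

text \<open>Only \<open>Push\<close> lengthens a stack, by one symbol in two steps. Through
  \<open>PT_E\<close> a bound on the time thus becomes a bound on the size of the result.\<close>

lemma exec_length: "exec c s t s' \<Longrightarrow> length (s' r) \<le> length (s r) + t"
  by (induction rule: exec.induct) (auto split: if_splits)

fun below :: "nat \<Rightarrow> com \<Rightarrow> bool" where
  "below k Skip = True"
| "below k (Push r b) = (r < k)"
| "below k (Seq c1 c2) = (below k c1 \<and> below k c2)"
| "below k (Case r c0 c1 c2) = (r < k \<and> below k c0 \<and> below k c1 \<and> below k c2)"
| "below k (While r c) = (r < k \<and> below k c)"


section \<open>Compilation to Turing machines\<close>

text \<open>
  A local instruction \<open>(q, r, x, y, d, q')\<close> only looks at tape \<open>r\<close>: in state \<open>q\<close>, if it scans \<open>x\<close>,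
  it writes \<open>y\<close>, moves by \<open>d\<close> and continues in state \<open>q'\<close>.
\<close>

type_synonym instr = "nat \<times> nat \<times> nat \<times> nat \<times> move \<times> nat"

definition sym :: "bool \<Rightarrow> nat" where
  "sym b = (if b then 2 else 1)"

text \<open>There is one transition for every content \<open>m\<close> of the scanned cells: tapes
  other than \<open>r\<close> write back what they read and stay put.\<close>

definition local_machine :: "nat \<Rightarrow> nat \<Rightarrow> nat \<Rightarrow> nat \<Rightarrow> instr set \<Rightarrow> machine" where
  "local_machine k N st acc I = \<lparr>num_tapes = k, num_states = N, num_symbols = 3,
     start_state = st, accept_state = acc,
     transitions = {(q, m, q', (map (\<lambda>a. (a, Stay)) m)[r := (y, d)]) | q r x y d q' m.
        (q, r, x, y, d, q') \<in> I \<and> length m = k \<and> set m \<subseteq> {..<3} \<and> m ! r = x}\<rparr>"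

text \<open>\<^term>\<open>comp c e n\<close> uses states from \<open>n\<close> on and exits to state \<open>e\<close>; it yields the start state, the instructions and
  the next unused state.\<close>

fun comp :: "com \<Rightarrow> nat \<Rightarrow> nat \<Rightarrow> nat \<times> instr set \<times> nat" where
  "comp Skip e n = (e, {}, n)"
| "comp (Push r b) e n =
    (n, {(n, r, 0, 0, MoveLeft, Suc n), (n, r, 1, 1, MoveLeft, Suc n), (n, r, 2, 2, MoveLeft, Suc n),
         (Suc n, r, 0, sym b, Stay, e)}, n + 2)"
| "comp (Seq c1 c2) e n =
    (let (s2, I2, n2) = comp c2 e n; (s1, I1, n1) = comp c1 s2 n2 in (s1, I1 \<union> I2, n1))"
| "comp (Case r c0 c1 c2) e n =
    (let (s0, I0, n0) = comp c0 e (Suc n); (s1, I1, n1) = comp c1 e n0; (s2, I2, n2) = comp c2 e n1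
     in (n, {(n, r, 0, 0, Stay, s0), (n, r, 1, 0, MoveRight, s1), (n, r, 2, 0, MoveRight, s2)}
            \<union> I0 \<union> I1 \<union> I2, n2))"
| "comp (While r c) e n =
    (let (s1, I1, n1) = comp c n (Suc n)
     in (n, {(n, r, 0, 0, Stay, e), (n, r, 1, 0, MoveRight, e), (n, r, 2, 0, MoveRight, s1)} \<union> I1, n1))"

text \<open>All instructions of a state have to use the same tape: two of them on different tapes
  could be enabled at once.\<close>

definition functional :: "instr set \<Rightarrow> bool" where
  "functional I \<longleftrightarrow> (\<forall>q r x y d q' r2 x2 y2 d2 q2.
     (q, r, x, y, d, q') \<in> I \<longrightarrow> (q, r2, x2, y2, d2, q2) \<in> I \<longrightarrow>
       r = r2 \<and> (x = x2 \<longrightarrow> y = y2 \<and> d = d2 \<and> q' = q2))"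

definition instrs_within :: "nat \<Rightarrow> nat set \<Rightarrow> nat set \<Rightarrow> instr set \<Rightarrow> bool" where
  "instrs_within k Q Q' I \<longleftrightarrow>
     (\<forall>(q, r, x, y, d, q') \<in> I. q \<in> Q \<and> r < k \<and> x < 3 \<and> y < 3 \<and> q' \<in> Q')"

lemma instrs_within_Un:
  "instrs_within k Q Q' (I \<union> J) \<longleftrightarrow> instrs_within k Q Q' I \<and> instrs_within k Q Q' J"
  by (simp add: instrs_within_def ball_Un)

lemma instrs_withinD:
  assumes "instrs_within k Q Q' I" "(q, r, x, y, d, q') \<in> I"
  shows "q \<in> Q" "r < k" "x < 3" "y < 3" "q' \<in> Q'"
  using bspec[OF assms(1)[unfolded instrs_within_def] assms(2)] by simp_all

lemma instrs_within_mono: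
  "instrs_within k Q Q' I \<Longrightarrow> Q \<subseteq> R \<Longrightarrow> Q' \<subseteq> R' \<Longrightarrow> instrs_within k R R' I"
  unfolding instrs_within_def by (rule ballI, drule (1) bspec) auto

lemma functional_Un:
  assumes "functional I" "functional J" "instrs_within k Q Q' I" "instrs_within k R R' J" "Q \<inter> R = {}"
  shows "functional (I \<union> J)"
proof -
  have 1: "(q, r2, x2, y2, d2, q2) \<notin> J" if "(q, r, x, y, d, q') \<in> I" for q r x y d q' r2 x2 y2 d2 q2
    using that assms(5) instrs_withinD(1)[OF assms(3) that] instrs_withinD(1)[OF assms(4)] by blast
  have 2: "(q, r2, x2, y2, d2, q2) \<notin> I" if "(q, r, x, y, d, q') \<in> J" for q r x y d q' r2 x2 y2 d2 q2
    using that assms(5) instrs_withinD(1)[OF assms(4) that] instrs_withinD(1)[OF assms(3)] by blast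
  show ?thesis
    unfolding functional_def
  proof (intro allI impI)
    fix q r x y d q' r2 x2 y2 d2 q2
    assume a: "(q, r, x, y, d, q') \<in> I \<union> J" and b: "(q, r2, x2, y2, d2, q2) \<in> I \<union> J"
    show "r = r2 \<and> (x = x2 \<longrightarrow> y = y2 \<and> d = d2 \<and> q' = q2)"
    proof (cases "(q, r, x, y, d, q') \<in> I")
      case True
      then have "(q, r2, x2, y2, d2, q2) \<in> I" using 1 b by blast
      then show ?thesis using True assms(1) unfolding functional_def by blast
    next
      case False
      then have c: "(q, r, x, y, d, q') \<in> J" using a by blast
      then have "(q, r2, x2, y2, d2, q2) \<in> J" using 2 b by blast
      then show ?thesis using c assms(2) unfolding functional_def by blast
    qed
  qed
qed

text \<open>Every subprogram owns the states \<open>{n..<n'}\<close> and leaves them only for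
  \<open>e\<close>, so the pieces of a program have disjoint source states and stay functional when
  united. The start state can be \<open>e\<close> itself, as for \<open>Skip\<close>.\<close>

lemma comp_within:
  "comp c e n = (s, I, n') \<Longrightarrow> below k c \<Longrightarrow>
     n \<le> n' \<and> s \<in> insert e {n..<n'} \<and> instrs_within k {n..<n'} (insert e {n..<n'}) I \<and> functional I"
proof (induction c arbitrary: e n s I n')
  case Skip
  then show ?case by (auto simp: instrs_within_def functional_def)
next
  case (Push r b)
  then show ?case by (auto simp: instrs_within_def functional_def sym_def)
next
  case (Seq c1 c2)
  obtain s2 I2 n2 where 2: "comp c2 e n = (s2, I2, n2)" by (cases "comp c2 e n")
  obtain s1 I1 n1 where 1: "comp c1 s2 n2 = (s1, I1, n1)" by (cases "comp c1 s2 n2")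
  have eq: "s = s1" "I = I1 \<union> I2" "n' = n1" using Seq.prems 1 2 by auto
  have h2: "n \<le> n2 \<and> s2 \<in> insert e {n..<n2} \<and> instrs_within k {n..<n2} (insert e {n..<n2}) I2 \<and> functional I2"
    using Seq.IH(2)[OF 2] Seq.prems by simp
  have h1: "n2 \<le> n1 \<and> s1 \<in> insert s2 {n2..<n1} \<and> instrs_within k {n2..<n1} (insert s2 {n2..<n1}) I1 \<and> functional I1"
    using Seq.IH(1)[OF 1] Seq.prems by simp
  have f: "functional (I1 \<union> I2)"
    by (rule functional_Un[OF _ _ h1[THEN conjunct2, THEN conjunct2, THEN conjunct1] h2[THEN conjunct2, THEN conjunct2, THEN conjunct1]]) (use h1 h2 in auto)
  have "instrs_within k {n..<n1} (insert e {n..<n1}) I1" "instrs_within k {n..<n1} (insert e {n..<n1}) I2"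
    by (rule instrs_within_mono[OF h1[THEN conjunct2, THEN conjunct2, THEN conjunct1]]; use h1 h2 in auto)
       (rule instrs_within_mono[OF h2[THEN conjunct2, THEN conjunct2, THEN conjunct1]]; use h1 h2 in auto)
  then show ?case using f h1 h2 unfolding eq instrs_within_Un by auto
next
  case (Case r c0 c1 c2)
  obtain s0 I0 n0 where 0: "comp c0 e (Suc n) = (s0, I0, n0)" by (cases "comp c0 e (Suc n)")
  obtain s1 I1 n1 where 1: "comp c1 e n0 = (s1, I1, n1)" by (cases "comp c1 e n0")
  obtain s2 I2 n2 where 2: "comp c2 e n1 = (s2, I2, n2)" by (cases "comp c2 e n1")
  let ?B = "{(n, r, 0, 0, Stay, s0), (n, r, 1, 0, MoveRight, s1), (n, r, 2, 0, MoveRight, s2)} :: instr set"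
  have eq: "s = n" "I = ?B \<union> I0 \<union> I1 \<union> I2" "n' = n2" using Case.prems 0 1 2 by auto
  note h = Case.IH(1)[OF 0] Case.IH(2)[OF 1] Case.IH(3)[OF 2]
  have h0: "Suc n \<le> n0 \<and> s0 \<in> insert e {Suc n..<n0} \<and> instrs_within k {Suc n..<n0} (insert e {Suc n..<n0}) I0 \<and> functional I0"
    and h1: "n0 \<le> n1 \<and> s1 \<in> insert e {n0..<n1} \<and> instrs_within k {n0..<n1} (insert e {n0..<n1}) I1 \<and> functional I1"
    and h2: "n1 \<le> n2 \<and> s2 \<in> insert e {n1..<n2} \<and> instrs_within k {n1..<n2} (insert e {n1..<n2}) I2 \<and> functional I2"
    using h Case.prems by auto
  have w0: "instrs_within k {Suc n..<n2} (insert e {n..<n2}) I0" "instrs_within k {Suc n..<n2} (insert e {n..<n2}) I1"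
     "instrs_within k {Suc n..<n2} (insert e {n..<n2}) I2"
    subgoal by (rule instrs_within_mono[OF h0[THEN conjunct2, THEN conjunct2, THEN conjunct1]]) (use h0 h1 h2 in auto)
    subgoal by (rule instrs_within_mono[OF h1[THEN conjunct2, THEN conjunct2, THEN conjunct1]]) (use h0 h1 h2 in auto)
    subgoal by (rule instrs_within_mono[OF h2[THEN conjunct2, THEN conjunct2, THEN conjunct1]]) (use h0 h1 h2 in auto)
    done
  have wB: "instrs_within k {n} (insert e {n..<n2}) ?B"
    using h0 h1 h2 Case.prems by (auto simp: instrs_within_def)
  have f1: "functional (I0 \<union> I1)"
    by (rule functional_Un[OF _ _ h0[THEN conjunct2, THEN conjunct2, THEN conjunct1] h1[THEN conjunct2, THEN conjunct2, THEN conjunct1]]) (use h0 h1 in auto)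
  have u1: "instrs_within k {Suc n..<n1} UNIV (I0 \<union> I1)"
    unfolding instrs_within_Un
    using instrs_within_mono[OF h0[THEN conjunct2, THEN conjunct2, THEN conjunct1], of "{Suc n..<n1}" UNIV]
      instrs_within_mono[OF h1[THEN conjunct2, THEN conjunct2, THEN conjunct1], of "{Suc n..<n1}" UNIV] h0 h1 by auto
  have f2: "functional ((I0 \<union> I1) \<union> I2)"
    by (rule functional_Un[OF f1 _ u1 h2[THEN conjunct2, THEN conjunct2, THEN conjunct1]]) (use h2 in auto)
  have "functional (?B \<union> ((I0 \<union> I1) \<union> I2))"
    by (rule functional_Un[OF _ f2 wB, of "{Suc n..<n2}" "insert e {n..<n2}"])
       (use w0 in \<open>auto simp: instrs_within_Un functional_def\<close>)
  moreover have "instrs_within k {n..<n2} (insert e {n..<n2}) (?B \<union> ((I0 \<union> I1) \<union> I2))"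
    unfolding instrs_within_Un
    using h0 h1 h2 by (intro conjI instrs_within_mono[OF wB] instrs_within_mono[OF w0(1)]
      instrs_within_mono[OF w0(2)] instrs_within_mono[OF w0(3)]) auto
  moreover have "I = ?B \<union> ((I0 \<union> I1) \<union> I2)" unfolding eq by blast
  ultimately show ?case using h0 h1 h2 eq by auto
next
  case (While r c)
  obtain s1 I1 n1 where 1: "comp c n (Suc n) = (s1, I1, n1)" by (cases "comp c n (Suc n)")
  let ?B = "{(n, r, 0, 0, Stay, e), (n, r, 1, 0, MoveRight, e), (n, r, 2, 0, MoveRight, s1)} :: instr set"
  have eq: "s = n" "I = ?B \<union> I1" "n' = n1" using While.prems 1 by auto
  have h1: "Suc n \<le> n1 \<and> s1 \<in> insert n {Suc n..<n1} \<and> instrs_within k {Suc n..<n1} (insert n {Suc n..<n1}) I1 \<and> functional I1"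
    using While.IH[OF 1] While.prems by simp
  have wB: "instrs_within k {n} (insert e {n..<n1}) ?B"
    using h1 While.prems by (auto simp: instrs_within_def)
  have w1: "instrs_within k {Suc n..<n1} (insert e {n..<n1}) I1"
    by (rule instrs_within_mono[OF h1[THEN conjunct2, THEN conjunct2, THEN conjunct1]]) (use h1 in auto)
  have "functional (?B \<union> I1)"
    by (rule functional_Un[OF _ _ wB w1]) (use h1 in \<open>auto simp: functional_def\<close>)
  moreover have "instrs_within k {n..<n1} (insert e {n..<n1}) (?B \<union> I1)"
    unfolding instrs_within_Un
    using h1 by (intro conjI instrs_within_mono[OF wB] instrs_within_mono[OF w1]) auto
  ultimately show ?case using h1 eq by auto
qed

lemma local_machine_simps [simp]:
  "num_tapes (local_machine k N st acc I) = k" "num_states (local_machine k N st acc I) = N"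
  "num_symbols (local_machine k N st acc I) = 3" "start_state (local_machine k N st acc I) = st"
  "accept_state (local_machine k N st acc I) = acc"
  by (simp_all add: local_machine_def)

lemma local_machine_transition_iff:
  "(q, m, q', a) \<in> transitions (local_machine k N st acc I) \<longleftrightarrow>
     (\<exists>r x y d. (q, r, x, y, d, q') \<in> I \<and> length m = k \<and> set m \<subseteq> {..<3} \<and> m ! r = x \<and>
        a = (map (\<lambda>a. (a, Stay)) m)[r := (y, d)])"
  unfolding local_machine_def by simp blast

lemma turing_machine_local:
  assumes "instrs_within k {..<N} {..<N} I" "1 \<le> k" "st < N" "acc < N"
  shows "turing_machine (local_machine k N st acc I)"
proof -
  have "q < N \<and> q' < N \<and> length m = k \<and> (\<forall>b\<in>set m. b < 3) \<and> length a = k \<and> (\<forall>(b, d)\<in>set a. b < 3)"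
    if tr: "(q, m, q', a) \<in> transitions (local_machine k N st acc I)" for q m q' a
  proof -
    obtain r x y d where *: "(q, r, x, y, d, q') \<in> I" "length m = k" "set m \<subseteq> {..<3}" "m ! r = x"
        "a = (map (\<lambda>a. (a, Stay)) m)[r := (y, d)]"
      using tr unfolding local_machine_transition_iff by blast
    have i: "q < N" "q' < N" "r < k" "y < 3" using assms(1) *(1) by (auto simp: instrs_within_def)
    have "(b, d') \<in> set a \<Longrightarrow> b < 3" for b d'
      using *(3,5) i(4) set_update_subset_insert[of "map (\<lambda>a. (a, Stay)) m" r "(y, d)"] by auto
    then show ?thesis using i * by auto
  qed
  then show ?thesis
    using assms(2-4) by (fastforce simp: turing_machine_def)
qed

lemma deterministic_local:
  assumes "functional I"
  shows "deterministic (local_machine k N st acc I)"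
  unfolding deterministic_def
proof (intro allI impI)
  fix q m q1 a1 q2 a2
  assume "(q, m, q1, a1) \<in> transitions (local_machine k N st acc I)"
    "(q, m, q2, a2) \<in> transitions (local_machine k N st acc I)"
  then obtain r y d r2 y2 d2 where "(q, r, m ! r, y, d, q1) \<in> I" "(q, r2, m ! r2, y2, d2, q2) \<in> I"
    "a1 = (map (\<lambda>a. (a, Stay)) m)[r := (y, d)]" "a2 = (map (\<lambda>a. (a, Stay)) m)[r2 := (y2, d2)]"
    unfolding local_machine_transition_iff by blast
  with assms show "q1 = q2 \<and> a1 = a2" unfolding functional_def by metis
qed

lemma local_machine_step_iff:
  assumes "length ts = k" "\<forall>t\<in>set ts. t 0 < 3" "instrs_within k Q Q' I"
  shows "tm_step (local_machine k N st acc I) (q, ts) c' \<longleftrightarrow>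
    (\<exists>r x y d q'. (q, r, x, y, d, q') \<in> I \<and> (ts ! r) 0 = x \<and> c' = (q', ts[r := shift d ((ts ! r)(0 := y))]))"
    (is "?L \<longleftrightarrow> ?R")
proof -
  have eq: "map2 (\<lambda>t (b, d). shift d (t(0 := b))) ts ((map ((\<lambda>a. (a, Stay)) \<circ> (\<lambda>t. t 0)) ts)[r := (y, d)])
    = ts[r := shift d ((ts ! r)(0 := y))]" if "r < k" for r y d
    by (rule nth_equalityI) (use that assms(1) in \<open>auto simp: nth_list_update\<close>)
  show ?thesis
  proof
    assume ?L
    then obtain a where a: "(q, map (\<lambda>t. t 0) ts, fst c', a) \<in> transitions (local_machine k N st acc I)"
      "snd c' = map2 (\<lambda>t (b, d). shift d (t(0 := b))) ts a"
      by (auto simp: tm_step_def)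
    then obtain r x y d where i: "(q, r, x, y, d, fst c') \<in> I" "map (\<lambda>t. t 0) ts ! r = x"
      "a = (map ((\<lambda>a. (a, Stay)) \<circ> (\<lambda>t. t 0)) ts)[r := (y, d)]"
      by (auto simp: local_machine_def)
    have "r < k" using i(1) assms(3) by (auto simp: instrs_within_def)
    then have "snd c' = ts[r := shift d ((ts ! r)(0 := y))]" "(ts ! r) 0 = x"
      using a(2) i eq assms(1) by auto
    then show ?R using i(1) by (metis prod.collapse)
  next
    assume ?R
    then obtain r x y d q' where i: "(q, r, x, y, d, q') \<in> I" "(ts ! r) 0 = x"
       "c' = (q', ts[r := shift d ((ts ! r)(0 := y))])" by blast
    have "r < k" using i(1) assms(3) by (auto simp: instrs_within_def)
    have "set (map (\<lambda>t. t 0) ts) \<subseteq> {..<3}" using assms(2) by auto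
    then have "(q, map (\<lambda>t. t 0) ts, q', (map (\<lambda>a. (a, Stay)) (map (\<lambda>t. t 0) ts))[r := (y, d)])
       \<in> transitions (local_machine k N st acc I)"
      unfolding local_machine_transition_iff
      by (intro exI[of _ r] exI[of _ x] exI[of _ y] exI[of _ d] conjI i(1))
         (use i(2) assms(1) \<open>r < k\<close> in simp_all)
    then show ?L
      unfolding tm_step_def i(3) fst_conv snd_conv
      using eq[OF \<open>r < k\<close>, of y d] by (intro exI conjI) (assumption, simp)
  qed
qed

section \<open>Stacks as tapes, and correctness of the compiled machine\<close>

definition tapes_of :: "nat \<Rightarrow> stacks \<Rightarrow> tape list" where
  "tapes_of k s = map (\<lambda>i. word_tape (s i)) [0..<k]"

lemma length_tapes_of [simp]: "length (tapes_of k s) = k"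
  by (simp add: tapes_of_def)

lemma word_tape_less_3: "word_tape w z < 3"
  by (simp add: word_tape_def)

lemma tapes_of_less_3: "\<forall>t\<in>set (tapes_of k s). t 0 < 3"
  by (simp add: tapes_of_def word_tape_less_3)

lemma word_tape_0: "word_tape [] 0 = 0" "word_tape (b # w) 0 = sym b"
  by (auto simp: word_tape_def sym_def)

text \<open>The top of a stack is under the head and everything to its left is blank, so erasing and
  moving right is a pop. A step writes before it moves, hence a push takes two: move left onto a
  blank, then write.\<close>

lemma word_tape_pop: "shift MoveRight ((word_tape (b # w))(0 := 0)) = word_tape w"
proof
  fix z :: int
  have "nat (z + 1) = Suc (nat z)" if "0 \<le> z" using that by simp
  then show "shift MoveRight ((word_tape (b # w))(0 := 0)) z = word_tape w z"
    by (auto simp: word_tape_def)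
qed

lemma word_tape_push: "(shift MoveLeft (word_tape w))(0 := sym b) = word_tape (b # w)"
proof
  fix z :: int
  have "nat z = Suc (nat (z - 1))" if "0 < z" using that by simp
  then show "((shift MoveLeft (word_tape w))(0 := sym b)) z = word_tape (b # w) z"
    by (auto simp: word_tape_def sym_def)
qed

lemma tapes_of_update: "r < k \<Longrightarrow> (tapes_of k s)[r := word_tape w] = tapes_of k (s(r := w))"
  by (rule nth_equalityI) (auto simp: tapes_of_def nth_list_update)

lemma tapes_of_nth: "r < k \<Longrightarrow> tapes_of k s ! r = word_tape (s r)"
  by (simp add: tapes_of_def)

lemma relpowp_SucI: "P x y \<Longrightarrow> (P ^^ n) y z \<Longrightarrow> (P ^^ Suc n) x z"
  by (rule relpowp_Suc_I2)

lemma relpowp_add_I: "(P ^^ m) x y \<Longrightarrow> (P ^^ n) y z \<Longrightarrow> (P ^^ (m + n)) x z"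
  by (auto simp: relpowp_add)

text \<open>The instruction set \<open>J\<close> may exceed \<open>I\<close>: in the induction a
  subprogram runs inside the machine of the whole program, and in \<open>in_NP_I\<close> several
  programs are parts of one machine.\<close>

lemma comp_correct:
  assumes "exec c s t s'" "comp c e n = (p, I, n')" "I \<subseteq> J" "below k c" "instrs_within k Q Q' J"
  shows "(tm_step (local_machine k N st acc J) ^^ t) (p, tapes_of k s) (e, tapes_of k s')"
  using assms
proof (induction arbitrary: e n p I n' rule: exec.induct)
  let ?M = "local_machine k N st acc J"
  have step: "tm_step ?M (q, tapes_of k s) (q', (tapes_of k s)[r := shift d ((word_tape (s r))(0 := y))])"
    if "(q, r, x, y, d, q') \<in> J" "word_tape (s r) 0 = x" for q r x y d q' s
  proof -
    have "r < k" using that(1) assms(5) by (auto simp: instrs_within_def)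
    then have "(tapes_of k s ! r) 0 = x" "tapes_of k s ! r = word_tape (s r)"
      using that(2) by (simp_all add: tapes_of_nth)
    then show ?thesis
      using that(1) by (subst local_machine_step_iff[OF length_tapes_of tapes_of_less_3 assms(5)]) metis
  qed
  {
    case (Skip s)
    then show ?case by simp
  next
    case (Push r b s)
    have r: "r < k" using Push.prems by simp
    have p: "p = n" using Push.prems by simp
    have I: "(n, r, x, x, MoveLeft, Suc n) \<in> J" if "x < 3" for x
    proof -
      have "x = 0 \<or> x = 1 \<or> x = 2" using that by arith
      then show ?thesis using Push.prems by auto
    qed
    have I2: "(Suc n, r, 0, sym b, Stay, e) \<in> J" using Push.prems by auto
    \<comment> \<open>Whatever symbol is scanned, the first of the two steps writes it back.\<close>
    have t: "(word_tape (s r))(0 := word_tape (s r) 0) = word_tape (s r)" by simp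
    let ?ts = "(tapes_of k s)[r := shift MoveLeft (word_tape (s r))]"
    have 1: "tm_step ?M (n, tapes_of k s) (Suc n, ?ts)"
      using step[OF I[OF word_tape_less_3[of "s r" 0]], where s = s] unfolding t by simp
    have l: "\<forall>t\<in>set ?ts. t 0 < 3"
      using set_update_subset_insert[of "tapes_of k s" r "shift MoveLeft (word_tape (s r))"]
      by (auto simp: tapes_of_def word_tape_less_3 dest!: subsetD)
    have e: "?ts[r := shift Stay ((?ts ! r)(0 := sym b))] = tapes_of k (s(r := b # s r))"
      using r by (simp add: word_tape_push[simplified] tapes_of_update)
    have z: "(?ts ! r) 0 = 0" using r by (simp add: word_tape_def)
    have 2: "tm_step ?M (Suc n, ?ts) (e, tapes_of k (s(r := b # s r)))"
      using I2 z e by (subst local_machine_step_iff[OF _ l assms(5)]) (simp, metis)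
    show ?case unfolding p numeral_2_eq_2 by (rule relpowp_SucI, rule 1, rule relpowp_SucI, rule 2, simp add: fun_upd_def)
  next
    case (Seq c1 s t1 s1 c2 t2 s2)
    obtain p2 I2 n2 where 2: "comp c2 e n = (p2, I2, n2)" by (cases "comp c2 e n")
    obtain p1 I1 n1 where 1: "comp c1 p2 n2 = (p1, I1, n1)" by (cases "comp c1 p2 n2")
    have "(tm_step ?M ^^ t1) (p1, tapes_of k s) (p2, tapes_of k s1)"
      using Seq.IH(1)[OF 1] Seq.prems 1 2 by auto
    moreover have "(tm_step ?M ^^ t2) (p2, tapes_of k s1) (e, tapes_of k s2)"
      using Seq.IH(2)[OF 2] Seq.prems 1 2 by auto
    ultimately show ?case using Seq.prems 1 2 by (auto intro: relpowp_add_I)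
  next
    case (CaseE s r c0 t s' c1 c2)
    obtain p0 I0 n0 where 0: "comp c0 e (Suc n) = (p0, I0, n0)" by (cases "comp c0 e (Suc n)")
    have I: "(n, r, 0, 0, Stay, p0) \<in> J" "p = n" "I0 \<subseteq> J"
      using CaseE.prems 0 by (auto split: prod.splits)
    have r: "r < k" using CaseE.prems by simp
    have "tm_step ?M (n, tapes_of k s) (p0, tapes_of k s)"
      using step[OF I(1), of s] CaseE.hyps(1) r tapes_of_update[OF r, of s "[]"]
      by (simp add: word_tape_0 fun_upd_idem)
    moreover have "(tm_step ?M ^^ t) (p0, tapes_of k s) (e, tapes_of k s')"
      using CaseE.IH[OF 0] CaseE.prems I by auto
    ultimately show ?case unfolding I(2) by (rule relpowp_SucI)
  next
    case (CaseF s r xs c1 t s' c0 c2)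
    obtain p0 I0 n0 where 0: "comp c0 e (Suc n) = (p0, I0, n0)" by (cases "comp c0 e (Suc n)")
    obtain p1 I1 n1 where 1: "comp c1 e n0 = (p1, I1, n1)" by (cases "comp c1 e n0")
    have I: "(n, r, 1, 0, MoveRight, p1) \<in> J" "p = n" "I1 \<subseteq> J"
      using CaseF.prems 0 1 by (auto split: prod.splits)
    have r: "r < k" using CaseF.prems by simp
    have "tm_step ?M (n, tapes_of k s) (p1, tapes_of k (s(r := xs)))"
      using step[OF I(1), of s] CaseF.hyps(1) tapes_of_update[OF r, of s xs]
      by (simp add: word_tape_0 sym_def word_tape_pop del: shift.simps)
    moreover have "(tm_step ?M ^^ t) (p1, tapes_of k (s(r := xs))) (e, tapes_of k s')"
      using CaseF.IH[OF 1] CaseF.prems I by (auto simp: fun_upd_def)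
    ultimately show ?case unfolding I(2) by (rule relpowp_SucI)
  next
    case (CaseT s r xs c2 t s' c0 c1)
    obtain p0 I0 n0 where 0: "comp c0 e (Suc n) = (p0, I0, n0)" by (cases "comp c0 e (Suc n)")
    obtain p1 I1 n1 where 1: "comp c1 e n0 = (p1, I1, n1)" by (cases "comp c1 e n0")
    obtain p2 I2 n2 where 2: "comp c2 e n1 = (p2, I2, n2)" by (cases "comp c2 e n1")
    have I: "(n, r, 2, 0, MoveRight, p2) \<in> J" "p = n" "I2 \<subseteq> J"
      using CaseT.prems 0 1 2 by (auto split: prod.splits)
    have r: "r < k" using CaseT.prems by simp
    have "tm_step ?M (n, tapes_of k s) (p2, tapes_of k (s(r := xs)))"
      using step[OF I(1), of s] CaseT.hyps(1) tapes_of_update[OF r, of s xs]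
      by (simp add: word_tape_0 sym_def word_tape_pop del: shift.simps)
    moreover have "(tm_step ?M ^^ t) (p2, tapes_of k (s(r := xs))) (e, tapes_of k s')"
      using CaseT.IH[OF 2] CaseT.prems I by (auto simp: fun_upd_def)
    ultimately show ?case unfolding I(2) by (rule relpowp_SucI)
  next
    case (WhileE s r c)
    have I: "(n, r, 0, 0, Stay, e) \<in> J" "p = n"
      using WhileE.prems by (auto split: prod.splits)
    have r: "r < k" using WhileE.prems by simp
    have "tm_step ?M (n, tapes_of k s) (e, tapes_of k s)"
      using step[OF I(1), of s] WhileE.hyps(1) r tapes_of_update[OF r, of s "[]"]
      by (simp add: word_tape_0 fun_upd_idem)
    then show ?case unfolding I(2) by (simp add: eq_OO fun_upd_def)
  next
    case (WhileF s r xs c)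
    have I: "(n, r, 1, 0, MoveRight, e) \<in> J" "p = n"
      using WhileF.prems by (auto split: prod.splits)
    have r: "r < k" using WhileF.prems by simp
    have "tm_step ?M (n, tapes_of k s) (e, tapes_of k (s(r := xs)))"
      using step[OF I(1), of s] WhileF.hyps(1) tapes_of_update[OF r, of s xs]
      by (simp add: word_tape_0 sym_def word_tape_pop del: shift.simps)
    then show ?case unfolding I(2) by (simp add: eq_OO fun_upd_def)
  next
    case (WhileT s r xs c t1 s1 t2 s2)
    obtain p1 I1 n1 where 1: "comp c n (Suc n) = (p1, I1, n1)" by (cases "comp c n (Suc n)")
    have I: "(n, r, 2, 0, MoveRight, p1) \<in> J" "p = n" "I1 \<subseteq> J"
      using WhileT.prems 1 by auto
    have r: "r < k" using WhileT.prems by simp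
    have a: "tm_step ?M (n, tapes_of k s) (p1, tapes_of k (s(r := xs)))"
      using step[OF I(1), of s] WhileT.hyps(1) tapes_of_update[OF r, of s xs]
      by (simp add: word_tape_0 sym_def word_tape_pop del: shift.simps)
    have b: "(tm_step ?M ^^ t1) (p1, tapes_of k (s(r := xs))) (n, tapes_of k s1)"
      using WhileT.IH(1)[OF 1] WhileT.prems I by (auto simp: fun_upd_def)
    have c: "(tm_step ?M ^^ t2) (n, tapes_of k s1) (e, tapes_of k s2)"
      using WhileT.IH(2)[OF WhileT.prems(1)] WhileT.prems I by auto
    show ?case unfolding I(2) by (rule relpowp_SucI, rule a, rule relpowp_add_I, rule b, rule c)
  }
qed

definition program_machine :: "nat \<Rightarrow> com \<Rightarrow> machine" where
  "program_machine k c = (let (p, I, n) = comp c 0 1 in local_machine k n p 0 I)"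

lemma program_machine_correct:
  assumes "below k c" "1 \<le> k"
  shows "turing_machine (program_machine k c)" "deterministic (program_machine k c)"
    "exec c (\<lambda>i. if i = 0 then w else []) t s' \<Longrightarrow> tm_outputs (program_machine k c) w (s' 0) t"
proof -
  obtain p I n where c: "comp c 0 1 = (p, I, n)" by (cases "comp c 0 1")
  note w = comp_within[OF c assms(1)]
  have M: "program_machine k c = local_machine k n p 0 I" unfolding program_machine_def c by simp
  have wi: "instrs_within k {1..<n} (insert 0 {1..<n}) I" using w by auto
  have n: "1 \<le> n" "p < n" using w by auto
  show "turing_machine (program_machine k c)" unfolding M
    by (rule turing_machine_local[OF instrs_within_mono[OF wi]]) (use n assms in auto)
  show "deterministic (program_machine k c)" unfolding M
    by (rule deterministic_local) (use w in auto)
  assume e: "exec c (\<lambda>i. if i = 0 then w else []) t s'"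
  have r: "(tm_step (local_machine k n p 0 I) ^^ t) (p, tapes_of k (\<lambda>i. if i = 0 then w else [])) (0, tapes_of k s')"
    by (rule comp_correct[OF e c order_refl assms(1) wi])
  have i: "init_config (local_machine k n p 0 I) w = (p, tapes_of k (\<lambda>i. if i = 0 then w else []))"
  proof -
    have "word_tape w # replicate (k - 1) (\<lambda>_. 0) = tapes_of k (\<lambda>i. if i = 0 then w else [])"
      using assms(2) by (intro nth_equalityI) (auto simp: tapes_of_def nth_Cons' word_tape_def)
    then show ?thesis by (simp add: init_config_def)
  qed
  \<comment> \<open>Compiled states start at 1, so no instruction leaves the exit state 0.\<close>
  have h: "halted (local_machine k n p 0 I) (0, tapes_of k s')"
    using instrs_withinD(1)[OF wi]
    unfolding halted_def local_machine_step_iff[OF length_tapes_of tapes_of_less_3 wi] by fastforce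
  have "hd (tapes_of k s') = word_tape (s' 0)"
    using assms(2) tapes_of_nth[of 0 k s'] hd_conv_nth[of "tapes_of k s'"] by (auto simp: tapes_of_def)
  then show "tm_outputs (program_machine k c) w (s' 0) t"
    unfolding M tm_outputs_def i using r h by (metis order_refl snd_conv)
qed

section \<open>Trees on stacks\<close>

datatype tree = Leaf | Node tree tree

text \<open>Preorder words are self-delimiting, so a stack can hold a sequence of trees.\<close>

fun word :: "tree \<Rightarrow> bool list" where
  "word Leaf = [False]"
| "word (Node a b) = True # word a @ word b"

definition runs :: "com \<Rightarrow> stacks \<Rightarrow> nat \<Rightarrow> stacks \<Rightarrow> bool" where
  "runs c s T s' \<longleftrightarrow> (\<exists>t\<le>T. exec c s t s')"

lemma runs_mono: "runs c s T s' \<Longrightarrow> T \<le> T' \<Longrightarrow> runs c s T' s'"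
  unfolding runs_def using order_trans by blast

lemma runs_Skip: "runs Skip s 0 s"
  unfolding runs_def using exec.Skip by blast

lemma runs_Push: "runs (Push r b) s 2 (s(r := b # s r))"
  unfolding runs_def using exec.Push by blast

lemma runs_Seq: "runs c1 s T1 s1 \<Longrightarrow> runs c2 s1 T2 s2 \<Longrightarrow> runs (Seq c1 c2) s (T1 + T2) s2"
  unfolding runs_def by (meson add_mono exec.Seq)

lemma runs_CaseE: "s r = [] \<Longrightarrow> runs c0 s T s' \<Longrightarrow> runs (Case r c0 c1 c2) s (Suc T) s'"
  unfolding runs_def by (meson Suc_le_mono exec.CaseE)

lemma runs_CaseF: "s r = False # xs \<Longrightarrow> runs c1 (s(r := xs)) T s' \<Longrightarrow> runs (Case r c0 c1 c2) s (Suc T) s'"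
  unfolding runs_def by (meson Suc_le_mono exec.CaseF)

lemma runs_CaseT: "s r = True # xs \<Longrightarrow> runs c2 (s(r := xs)) T s' \<Longrightarrow> runs (Case r c0 c1 c2) s (Suc T) s'"
  unfolding runs_def by (meson Suc_le_mono exec.CaseT)

lemma runs_WhileE: "s r = [] \<Longrightarrow> runs (While r c) s 1 s"
  unfolding runs_def using exec.WhileE by blast

lemma runs_WhileF: "s r = False # xs \<Longrightarrow> runs (While r c) s 1 (s(r := xs))"
  unfolding runs_def using exec.WhileF by blast

lemma runs_WhileT:
  "s r = True # xs \<Longrightarrow> runs c (s(r := xs)) T1 s1 \<Longrightarrow> runs (While r c) s1 T2 s2 \<Longrightarrow>
    runs (While r c) s (Suc (T1 + T2)) s2"
  unfolding runs_def by (meson Suc_le_mono add_mono exec.WhileT)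

notation Seq (infixr ";;" 60)

text \<open>
  Stacks 0 and 1 hold the data, stacks 2 and 3 are scratch space, empty between operations.
\<close>

definition st :: "bool list \<Rightarrow> bool list \<Rightarrow> bool list \<Rightarrow> bool list \<Rightarrow> stacks" where
  "st a b c d = (\<lambda>i. if i = 0 then a else if i = 1 then b else if i = 2 then c else if i = 3 then d else [])"

lemma st_simps [simp]:
  "st a b c d 0 = a" "st a b c d (Suc 0) = b" "st a b c d 2 = c" "st a b c d 3 = d"
  "(st a b c d)(0 := x) = st x b c d" "(st a b c d)(Suc 0 := x) = st a x c d"
  "(st a b c d)(2 := x) = st a b x d" "(st a b c d)(3 := x) = st a b c x"
  by (auto simp: st_def fun_eq_iff)

text \<open>Stack 3 counts in unary the trees still to be read: the loop pops one, and a node adds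
  two for its children. Each symbol moved to stack 2 is guarded by a \<open>True\<close>, so that a
  later loop on that stack stops at its end and not at a \<open>False\<close> of the word.\<close>

definition parse_body :: "nat \<Rightarrow> com" where
  "parse_body i = Case i Skip (Push 2 False ;; Push 2 True)
     (Push 3 True ;; Push 3 True ;; Push 2 True ;; Push 2 True)"

definition parse :: "nat \<Rightarrow> com" where
  "parse i = Push 3 True ;; While 3 (parse_body i)"

definition mark :: "bool list \<Rightarrow> bool list" where
  "mark w = concat (map (\<lambda>b. [True, b]) w)"

lemma mark_simps [simp]: "mark [] = []" "mark (b # w) = True # b # mark w" "mark (u @ v) = mark u @ mark v"
  by (simp_all add: mark_def)

text \<open>Stack \<open>i\<close> is the one being read and the other data stack is
  \<open>y\<close>; both directions of transfer are thus treated at once.\<close>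

definition sti :: "nat \<Rightarrow> bool list \<Rightarrow> bool list \<Rightarrow> bool list \<Rightarrow> bool list \<Rightarrow> stacks" where
  "sti i x y c d = (if i = 0 then st x y c d else st y x c d)"

lemma sti_simps [simp]:
  "sti i x y c d 2 = c" "sti i x y c d 3 = d"
  "(sti i x y c d)(2 := z) = sti i x y z d" "(sti i x y c d)(3 := z) = sti i x y c z"
  "i < 2 \<Longrightarrow> sti i x y c d i = x" "i < 2 \<Longrightarrow> (sti i x y c d)(i := z) = sti i z y c d"
  by (auto simp: sti_def less_2_cases_iff)

lemma runs_While3T:
  "runs c (sti i x y v n) T1 s1 \<Longrightarrow> runs (While 3 c) s1 T2 s2 \<Longrightarrow>
     runs (While 3 c) (sti i x y v (True # n)) (Suc (T1 + T2)) s2"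
  by (rule runs_WhileT) auto

text \<open>The form is backward: a run of the loop from after \<open>x\<close> is extended to one
  from before it. Both children of a node are consumed by one and the same loop, so reading a single
  child is no complete run that could be composed forward.\<close>

lemma parse_loop:
  assumes "runs (While 3 (parse_body i)) (sti i r y (mark (rev (word x)) @ v) n) T s'" "i < 2"
  shows "runs (While 3 (parse_body i)) (sti i (word x @ r) y v (True # n)) (T + 10 * length (word x)) s'"
  using assms
proof (induction x arbitrary: r v n T)
  case Leaf
  have "runs (Push 2 False ;; Push 2 True) (sti i r y v n) (2 + 2) (sti i r y (True # False # v) n)"
    using runs_Seq[OF runs_Push[of 2 False "sti i r y v n"] runs_Push[of 2 True]] by simp
  then have "runs (parse_body i) (sti i (False # r) y v n) (Suc (2 + 2)) (sti i r y (True # False # v) n)"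
    unfolding parse_body_def using Leaf.prems by (intro runs_CaseF) auto
  then have "runs (While 3 (parse_body i)) (sti i (False # r) y v (True # n)) (Suc (Suc (2 + 2) + T)) s'"
    by (rule runs_While3T) (use Leaf.prems in simp)
  then show ?case by (auto elim: runs_mono)
next
  case (Node a b)
  let ?x = "word a @ word b @ r"
  have "runs (Push 3 True ;; Push 3 True ;; Push 2 True ;; Push 2 True) (sti i ?x y v n) (2 + (2 + (2 + 2)))
     (sti i ?x y (True # True # v) (True # True # n))"
    using runs_Seq[OF runs_Push[of 3 True "sti i ?x y v n"] runs_Seq[OF runs_Push[of 3 True]
      runs_Seq[OF runs_Push[of 2 True] runs_Push[of 2 True]]]] by simp
  then have 1: "runs (parse_body i) (sti i (True # ?x) y v n) (Suc (2 + (2 + (2 + 2))))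
     (sti i ?x y (True # True # v) (True # True # n))"
    unfolding parse_body_def using Node.prems by (intro runs_CaseT) auto
  have "runs (While 3 (parse_body i)) (sti i (word b @ r) y (mark (rev (word a)) @ True # True # v) (True # n))
      (T + 10 * length (word b)) s'"
    using Node.prems by (intro Node.IH(2)) auto
  then have "runs (While 3 (parse_body i)) (sti i ?x y (True # True # v) (True # True # n))
      (T + 10 * length (word b) + 10 * length (word a)) s'"
    using Node.prems by (intro Node.IH(1)) auto
  from runs_While3T[OF 1 this]
  have "runs (While 3 (parse_body i)) (sti i (True # ?x) y v (True # n))
      (Suc (Suc (2 + (2 + (2 + 2))) + (T + 10 * length (word b) + 10 * length (word a)))) s'" .
  then show ?case by (auto elim: runs_mono)
qed

lemma parse_correct:
  assumes "i < 2"
  shows "runs (parse i) (sti i (word x @ r) y v []) (10 * length (word x) + 3) (sti i r y (mark (rev (word x)) @ v) [])"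
proof -
  let ?t = "sti i r y (mark (rev (word x)) @ v) []"
  have "runs (While 3 (parse_body i)) ?t 1 ?t" by (rule runs_WhileE) simp
  from parse_loop[OF this assms]
  have "runs (While 3 (parse_body i)) (sti i (word x @ r) y v [True]) (1 + 10 * length (word x)) ?t" .
  with runs_Seq[OF runs_Push[of 3 True "sti i (word x @ r) y v []"]]
  have "runs (parse i) (sti i (word x @ r) y v []) (2 + (1 + 10 * length (word x))) ?t"
    by (simp add: parse_def)
  then show ?thesis by (rule runs_mono) simp
qed

fun pushes :: "nat list \<Rightarrow> bool \<Rightarrow> com" where
  "pushes [] b = Skip"
| "pushes (j # js) b = Push j b ;; pushes js b"

text \<open>Parsing has reversed the word on stack 2; unloading reverses it again. Writing to
  several stacks at once produces copies.\<close>

definition unload :: "nat list \<Rightarrow> com" where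
  "unload js = While 2 (Case 2 Skip (pushes js False) (pushes js True))"

lemma runs_pushes:
  "distinct js \<Longrightarrow> runs (pushes js b) s (2 * length js) (\<lambda>i. if i \<in> set js then b # s i else s i)"
proof (induction js arbitrary: s)
  case Nil
  then show ?case by (simp add: runs_Skip)
next
  case (Cons j js)
  have "(\<lambda>i. if i \<in> set js then b # (s(j := b # s j)) i else (s(j := b # s j)) i)
    = (\<lambda>i. if i \<in> set (j # js) then b # s i else s i)"
    using Cons.prems by auto
  then show ?case
    using runs_Seq[OF runs_Push[of j b s] Cons.IH[of "s(j := b # s j)"]] Cons.prems by simp
qed

lemma unload_correct:
  assumes "s 2 = mark u" "distinct js" "2 \<notin> set js"
  shows "runs (unload js) s ((2 + 2 * length js) * length u + 1)
     (\<lambda>i. if i \<in> set js then rev u @ s i else if i = 2 then [] else s i)"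
  using assms
proof (induction u arbitrary: s)
  case Nil
  have "(\<lambda>i. if i \<in> set js then rev [] @ s i else if i = 2 then [] else s i) = s"
    using Nil.prems by (auto simp: fun_eq_iff)
  then show ?case using runs_WhileE[of s 2] Nil.prems by (simp add: unload_def)
next
  case (Cons b u)
  let ?s1 = "s(2 := mark u)"
  let ?s2 = "\<lambda>i. if i \<in> set js then b # ?s1 i else ?s1 i"
  let ?c = "Case 2 Skip (pushes js False) (pushes js True)"
  have "runs ?c (s(2 := b # mark u)) (Suc (2 * length js)) ?s2"
    using runs_pushes[OF Cons.prems(2), of b ?s1]
      runs_CaseF[of "s(2 := b # mark u)" 2 "mark u"] runs_CaseT[of "s(2 := b # mark u)" 2 "mark u"]
    by (cases b) auto
  moreover have "runs (While 2 ?c) ?s2 ((2 + 2 * length js) * length u + 1)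
      (\<lambda>i. if i \<in> set js then rev u @ ?s2 i else if i = 2 then [] else ?s2 i)"
    using Cons.IH[of ?s2] Cons.prems by (simp add: unload_def)
  moreover have "(\<lambda>i. if i \<in> set js then rev u @ ?s2 i else if i = 2 then [] else ?s2 i) =
      (\<lambda>i. if i \<in> set js then rev (b # u) @ s i else if i = 2 then [] else s i)"
    using Cons.prems by (auto simp: fun_eq_iff)
  ultimately have a: "runs ?c (s(2 := b # mark u)) (Suc (2 * length js)) ?s2"
    and b: "runs (While 2 ?c) ?s2 ((2 + 2 * length js) * length u + 1)
      (\<lambda>i. if i \<in> set js then rev (b # u) @ s i else if i = 2 then [] else s i)"
    by argo+
  have "s 2 = True # b # mark u" using Cons.prems by simp
  from runs_WhileT[of s 2, OF this a b]
  have "runs (unload js) s (Suc (Suc (2 * length js) + ((2 + 2 * length js) * length u + 1)))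
      (\<lambda>i. if i \<in> set js then rev (b # u) @ s i else if i = 2 then [] else s i)"
    unfolding unload_def .
  then show ?case by (rule runs_mono) simp
qed

definition move_top :: "nat \<Rightarrow> nat \<Rightarrow> com" where
  "move_top i j = parse i ;; unload [j]"

definition drop_top :: com where
  "drop_top = parse 0 ;; unload []"

definition dup_top :: com where
  "dup_top = parse 0 ;; unload [0, 1] ;; move_top 1 0"

definition lin :: "tree \<Rightarrow> nat" where
  "lin x = 40 * length (word x) + 20"

lemma word_nonempty: "1 \<le> length (word x)"
  by (cases x) auto

lemma runs_move_01: "runs (move_top 0 1) (st (word x @ r) a [] []) (lin x) (st r (word x @ a) [] [])"
proof -
  let ?s = "st r a (mark (rev (word x))) []"
  have "runs (parse 0) (st (word x @ r) a [] []) (10 * length (word x) + 3) ?s"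
    using parse_correct[of 0 x r a "[]"] by (simp add: sti_def)
  moreover have "(\<lambda>i. if i \<in> set [1] then rev (rev (word x)) @ ?s i else if i = 2 then [] else ?s i)
      = st r (word x @ a) [] []"
    by (auto simp: st_def fun_eq_iff)
  then have "runs (unload [1]) ?s (4 * length (word x) + 1) (st r (word x @ a) [] [])"
    using unload_correct[of ?s "rev (word x)" "[1]"] by simp
  ultimately show ?thesis
    unfolding move_top_def by (rule runs_mono[OF runs_Seq]) (simp add: lin_def)
qed

lemma runs_move_10: "runs (move_top 1 0) (st r (word x @ a) [] []) (lin x) (st (word x @ r) a [] [])"
proof -
  let ?s = "st r a (mark (rev (word x))) []"
  have "runs (parse 1) (st r (word x @ a) [] []) (10 * length (word x) + 3) ?s"
    using parse_correct[of 1 x a r "[]"] by (simp add: sti_def)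
  moreover have "(\<lambda>i. if i \<in> set [0] then rev (rev (word x)) @ ?s i else if i = 2 then [] else ?s i)
      = st (word x @ r) a [] []"
    by (auto simp: st_def fun_eq_iff)
  then have "runs (unload [0]) ?s (4 * length (word x) + 1) (st (word x @ r) a [] [])"
    using unload_correct[of ?s "rev (word x)" "[0]"] by simp
  ultimately show ?thesis
    unfolding move_top_def by (rule runs_mono[OF runs_Seq]) (simp add: lin_def)
qed

lemma runs_drop: "runs drop_top (st (word x @ r) a [] []) (lin x) (st r a [] [])"
proof -
  let ?s = "st r a (mark (rev (word x))) []"
  have "runs (parse 0) (st (word x @ r) a [] []) (10 * length (word x) + 3) ?s"
    using parse_correct[of 0 x r a "[]"] by (simp add: sti_def)
  moreover have "(\<lambda>i. if i \<in> set [] then rev (rev (word x)) @ ?s i else if i = 2 then [] else ?s i)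
      = st r a [] []"
    by (auto simp: st_def fun_eq_iff)
  then have "runs (unload []) ?s (2 * length (word x) + 1) (st r a [] [])"
    using unload_correct[of ?s "rev (word x)" "[]"] by simp
  ultimately show ?thesis
    unfolding drop_top_def by (rule runs_mono[OF runs_Seq]) (simp add: lin_def)
qed

lemma runs_dup: "runs dup_top (st (word x @ r) a [] []) (2 * lin x) (st (word x @ word x @ r) a [] [])"
proof -
  let ?s = "st r a (mark (rev (word x))) []"
  have 1: "runs (parse 0) (st (word x @ r) a [] []) (10 * length (word x) + 3) ?s"
    using parse_correct[of 0 x r a "[]"] by (simp add: sti_def)
  have "(\<lambda>i. if i \<in> set [0, 1] then rev (rev (word x)) @ ?s i else if i = 2 then [] else ?s i)
      = st (word x @ r) (word x @ a) [] []"
    by (auto simp: st_def fun_eq_iff)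
  then have 2: "runs (unload [0, 1]) ?s (6 * length (word x) + 1) (st (word x @ r) (word x @ a) [] [])"
    using unload_correct[of ?s "rev (word x)" "[0, 1]"] by simp
  show ?thesis
    unfolding dup_top_def
    by (rule runs_mono[OF runs_Seq[OF 1 runs_Seq[OF 2 runs_move_10]]]) (simp add: lin_def)
qed

lemma below_4 [simp]: "below 4 (move_top 0 1)" "below 4 (move_top 1 0)" "below 4 (move_top 0 (Suc 0))"
  "below 4 (move_top (Suc 0) 0)" "below 4 drop_top" "below 4 dup_top"
  by (simp_all add: move_top_def drop_top_def dup_top_def parse_def parse_body_def unload_def)

lemma runs_Push0: "runs (Push 0 b) (st x a u v) 2 (st (b # x) a u v)"
  using runs_Push[of 0 b "st x a u v"] by simp

lemma runs_Case0F: "runs c1 (st x a u v) T s \<Longrightarrow> runs (Case 0 c0 c1 c2) (st (False # x) a u v) (Suc T) s"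
  by (rule runs_CaseF) auto

lemma runs_Case0T: "runs c2 (st x a u v) T s \<Longrightarrow> runs (Case 0 c0 c1 c2) (st (True # x) a u v) (Suc T) s"
  by (rule runs_CaseT) auto

primrec push_word :: "bool list \<Rightarrow> com" where
  "push_word [] = Skip"
| "push_word (b # w) = push_word w ;; Push 0 b"

lemma runs_push_word: "runs (push_word w) (st x a u v) (2 * length w) (st (w @ x) a u v)"
proof (induction w)
  case (Cons b w)
  show ?case using runs_Seq[OF Cons runs_Push0, of b] by simp
qed (simp add: runs_Skip)

lemma below_push_word [simp]: "below 4 (push_word w)"
  by (induction w) auto


section \<open>Polynomial-time functions\<close>

class enc =
  fixes enc :: "'a \<Rightarrow> tree"
  assumes enc_inj: "enc x = enc y \<Longrightarrow> x = y"

definition cw :: "'a::enc \<Rightarrow> bool list" where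
  "cw x = word (enc x)"

definition sz :: "'a::enc \<Rightarrow> nat" where
  "sz x = length (cw x)"

text \<open>The arbitrary remainders \<open>r\<close> and \<open>a\<close> below the argument make
  programs composable: other values can wait on either data stack, and the time depends on the size
  of the argument only.\<close>

definition PT :: "('a::enc \<Rightarrow> 'b::enc) \<Rightarrow> bool" where
  "PT f \<longleftrightarrow> (\<exists>c (p :: nat poly). below 4 c \<and>
     (\<forall>x r a. runs c (st (cw x @ r) a [] []) (poly p (sz x)) (st (cw (f x) @ r) a [] [])))"

lemma poly_mono_nat: "x \<le> y \<Longrightarrow> poly p x \<le> poly p y" for p :: "nat poly"
  by (induction p) (auto intro: add_mono mult_mono)

lemma PT_I:
  assumes "below 4 c" "\<And>x r a. runs c (st (cw x @ r) a [] []) (poly p (sz x)) (st (cw (f x) @ r) a [] [])"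
  shows "PT f"
  using assms unfolding PT_def by blast

lemma PT_E:
  assumes "PT f"
  obtains c p where "below 4 c"
    "\<And>x r a. runs c (st (cw x @ r) a [] []) (poly p (sz x)) (st (cw (f x) @ r) a [] [])"
    "\<And>x. sz (f x) \<le> poly p (sz x)"
proof -
  obtain c p where c: "below 4 c"
    "\<And>x r a. runs c (st (cw x @ r) a [] []) (poly p (sz x)) (st (cw (f x) @ r) a [] [])"
    using assms unfolding PT_def by blast
  have s: "sz (f x) \<le> poly (p + [:0, 1:]) (sz x)" for x
  proof -
    from c(2)[of x "[]" "[]"] obtain t where "t \<le> poly p (sz x)"
      "exec c (st (cw x) [] [] []) t (st (cw (f x)) [] [] [])"
      by (auto simp: runs_def)
    with exec_length[OF this(2), of 0] show ?thesis by (simp add: sz_def)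
  qed
  have "runs c (st (cw x @ r) a [] []) (poly (p + [:0, 1:]) (sz x)) (st (cw (f x) @ r) a [] [])" for x r a
    using c(2) by (rule runs_mono) simp
  from that[OF c(1) this s] show ?thesis .
qed

lemma PT_size: "PT f \<Longrightarrow> \<exists>p. \<forall>x. sz (f x) \<le> poly p (sz x)"
  by (metis PT_E)

text \<open>A change of type is free when the codes agree: a pair and a list built by
  \<open>#\<close> have the same code, and so have a number and a list of units.\<close>

lemma PT_same_word:
  assumes "\<And>x. cw (f x) = cw x"
  shows "PT f"
  by (rule PT_I[of Skip "0"]) (simp_all add: assms runs_Skip)

named_theorems PT_intros

lemma PT_id [PT_intros]: "PT (\<lambda>x. x)"
  by (rule PT_same_word) simp

lemma PT_comp:
  assumes "PT f" "PT g"
  shows "PT (\<lambda>x. g (f x))"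
proof -
  obtain c p where c: "below 4 c"
    "\<And>x r a. runs c (st (cw x @ r) a [] []) (poly p (sz x)) (st (cw (f x) @ r) a [] [])"
    "\<And>x. sz (f x) \<le> poly p (sz x)" by (rule PT_E[OF assms(1)]) blast
  obtain d q where d: "below 4 d"
    "\<And>x r a. runs d (st (cw x @ r) a [] []) (poly q (sz x)) (st (cw (g x) @ r) a [] [])"
    by (rule PT_E[OF assms(2)]) blast
  show ?thesis
  proof (rule PT_I[of "c ;; d" "p + pcompose q p"])
    fix x r a
    have "poly q (sz (f x)) \<le> poly q (poly p (sz x))" by (rule poly_mono_nat[OF c(3)])
    then show "runs (c ;; d) (st (cw x @ r) a [] []) (poly (p + pcompose q p) (sz x)) (st (cw (g (f x)) @ r) a [] [])"
      by (intro runs_mono[OF runs_Seq[OF c(2) d(2)]]) (simp add: poly_pcompose)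
  qed (use c d in simp)
qed

definition lin_poly :: "nat poly" where
  "lin_poly = [:20, 40:]"

lemma lin_enc: "lin (enc x) = poly lin_poly (sz x)"
  by (simp add: lin_def lin_poly_def sz_def cw_def)

lemma PT_const [PT_intros]: "PT (\<lambda>x. c)"
proof (rule PT_I[of "drop_top ;; push_word (cw c)" "lin_poly + [:2 * sz c:]"])
  fix x :: 'a and r a
  show "runs (drop_top ;; push_word (cw c)) (st (cw x @ r) a [] []) (poly (lin_poly + [:2 * sz c:]) (sz x))
          (st (cw c @ r) a [] [])"
    using runs_Seq[OF runs_drop runs_push_word[of "cw c" r a "[]" "[]"], of "enc x"]
    by (simp add: cw_def[symmetric] lin_enc sz_def[symmetric])
qed simp

section \<open>Pairs and projections\<close>

instantiation prod :: (enc, enc) enc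
begin
definition enc_prod :: "'a \<times> 'b \<Rightarrow> tree" where
  "enc_prod p = Node (enc (fst p)) (enc (snd p))"
instance
  by standard (auto simp: enc_prod_def prod_eq_iff dest: enc_inj)
end

lemma cw_pair: "cw (x, y) = True # cw x @ cw y"
  by (simp add: cw_def enc_prod_def)

lemma sz_pair [simp]: "sz (x, y) = Suc (sz x + sz y)"
  by (simp add: sz_def cw_pair)

text \<open>While \<open>g\<close> is applied to the copy of the argument, the value of
  \<open>f\<close> waits on stack 1, where it is just part of the remainder
  \<open>a\<close>.\<close>

lemma PT_Pair [PT_intros]:
  assumes "PT f" "PT g"
  shows "PT (\<lambda>x. (f x, g x))"
proof -
  obtain c p where c: "below 4 c"
    "\<And>x r a. runs c (st (cw x @ r) a [] []) (poly p (sz x)) (st (cw (f x) @ r) a [] [])"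
    "\<And>x. sz (f x) \<le> poly p (sz x)" by (rule PT_E[OF assms(1)]) blast
  obtain d q where d: "below 4 d"
    "\<And>x r a. runs d (st (cw x @ r) a [] []) (poly q (sz x)) (st (cw (g x) @ r) a [] [])"
    by (rule PT_E[OF assms(2)]) blast
  let ?p = "2 * lin_poly + p + 2 * pcompose lin_poly p + q + [:2:]"
  show ?thesis
  proof (rule PT_I[of "dup_top ;; c ;; move_top 0 1 ;; d ;; move_top 1 0 ;; Push 0 True" ?p])
    fix x r a
    have l: "lin (enc (f x)) \<le> poly lin_poly (poly p (sz x))"
      unfolding lin_enc by (rule poly_mono_nat[OF c(3)])
    have 1: "runs dup_top (st (cw x @ r) a [] []) (2 * lin (enc x)) (st (cw x @ cw x @ r) a [] [])"
      unfolding cw_def by (rule runs_dup)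
    have 2: "runs (move_top 0 1) (st (cw (f x) @ cw x @ r) a [] []) (lin (enc (f x))) (st (cw x @ r) (cw (f x) @ a) [] [])"
      unfolding cw_def by (rule runs_move_01)
    have 3: "runs (move_top 1 0) (st (cw (g x) @ r) (cw (f x) @ a) [] []) (lin (enc (f x))) (st (cw (f x) @ cw (g x) @ r) a [] [])"
      unfolding cw_def by (rule runs_move_10)
    have 4: "runs (Push 0 True) (st (cw (f x) @ cw (g x) @ r) a [] []) 2 (st (cw (f x, g x) @ r) a [] [])"
      using runs_Push0 by (simp add: cw_pair)
    show "runs (dup_top ;; c ;; move_top 0 1 ;; d ;; move_top 1 0 ;; Push 0 True) (st (cw x @ r) a [] [])
       (poly ?p (sz x)) (st (cw (f x, g x) @ r) a [] [])"
      by (rule runs_mono[OF runs_Seq[OF 1 runs_Seq[OF c(2) runs_Seq[OF 2 runs_Seq[OF d(2) runs_Seq[OF 3 4]]]]]])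
         (use l in \<open>simp add: lin_enc poly_pcompose\<close>)
  qed (use c d in simp)
qed

lemma word_Node_case:
  "runs c2 (st (word a @ word b @ r) s [] []) T t \<Longrightarrow>
     runs (Case 0 c0 c1 c2) (st (word (Node a b) @ r) s [] []) (Suc T) t"
  by (simp add: runs_Case0T)

lemma runs_first:
  "runs (move_top 0 1 ;; drop_top ;; move_top 1 0) (st (word x @ word y @ r) a [] [])
     (2 * lin x + lin y) (st (word x @ r) a [] [])"
  by (rule runs_mono[OF runs_Seq[OF runs_move_01 runs_Seq[OF runs_drop runs_move_10]]]) simp

lemma PT_fst_raw: "PT (fst :: 'a::enc \<times> 'b::enc \<Rightarrow> 'a)"
proof (rule PT_I[of "Case 0 Skip Skip (move_top 0 1 ;; drop_top ;; move_top 1 0)" "3 * lin_poly + [:1:]"])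
  fix x :: "'a \<times> 'b" and r a
  have "lin (enc (fst x)) \<le> poly lin_poly (sz x)" "lin (enc (snd x)) \<le> poly lin_poly (sz x)"
    unfolding lin_enc by (rule poly_mono_nat; cases x; simp)+
  then show "runs (Case 0 Skip Skip (move_top 0 1 ;; drop_top ;; move_top 1 0)) (st (cw x @ r) a [] [])
          (poly (3 * lin_poly + [:1:]) (sz x)) (st (cw (fst x) @ r) a [] [])"
    unfolding cw_def enc_prod_def
    by (intro runs_mono[OF word_Node_case[OF runs_first]]) simp
qed simp

lemma PT_snd_raw: "PT (snd :: 'a::enc \<times> 'b::enc \<Rightarrow> 'b)"
proof (rule PT_I[of "Case 0 Skip Skip drop_top" "3 * lin_poly + [:1:]"])
  fix x :: "'a \<times> 'b" and r a
  have "lin (enc (fst x)) \<le> poly lin_poly (sz x)"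
    unfolding lin_enc by (rule poly_mono_nat; cases x; simp)+
  then show "runs (Case 0 Skip Skip drop_top) (st (cw x @ r) a [] [])
          (poly (3 * lin_poly + [:1:]) (sz x)) (st (cw (snd x) @ r) a [] [])"
    unfolding cw_def enc_prod_def
    by (intro runs_mono[OF word_Node_case[OF runs_drop]]) simp
qed simp

lemma PT_fst [PT_intros]: "PT f \<Longrightarrow> PT (\<lambda>x. fst (f x))"
  by (rule PT_comp[OF _ PT_fst_raw])

lemma PT_snd [PT_intros]: "PT f \<Longrightarrow> PT (\<lambda>x. snd (f x))"
  by (rule PT_comp[OF _ PT_snd_raw])

lemma PT_comp2: "PT (\<lambda>p. h (fst p) (snd p)) \<Longrightarrow> PT f \<Longrightarrow> PT g \<Longrightarrow> PT (\<lambda>x. h (f x) (g x))"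
  using PT_comp[OF PT_Pair, of f g "\<lambda>p. h (fst p) (snd p)"] by simp

lemma PT_comp3:
  "PT (\<lambda>p. h (fst p) (fst (snd p)) (snd (snd p))) \<Longrightarrow> PT f \<Longrightarrow> PT g \<Longrightarrow> PT k \<Longrightarrow> PT (\<lambda>x. h (f x) (g x) (k x))"
  using PT_comp[OF PT_Pair[OF _ PT_Pair], of f g k "\<lambda>p. h (fst p) (fst (snd p)) (snd (snd p))"] by simp

lemma PT_Let [PT_intros]:
  "PT f \<Longrightarrow> PT (\<lambda>p. g (fst p) (snd p)) \<Longrightarrow> PT (\<lambda>x. let y = f x in g x y)"
  unfolding Let_def by (rule PT_comp2[of g]) (simp_all add: PT_id)

section \<open>Truth values and case distinctions\<close>

instantiation bool :: enc
begin
definition enc_bool :: "bool \<Rightarrow> tree" where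
  "enc_bool b = (if b then Node Leaf Leaf else Leaf)"
instance
  by standard (auto simp: enc_bool_def split: if_splits)
end

lemma cw_bool [simp]: "cw True = [True, False, False]" "cw False = [False]"
  by (simp_all add: cw_def enc_bool_def)

lemma sz_bool: "sz (b :: bool) \<le> 3"
  by (cases b) (simp_all add: sz_def)

lemma PT_if [PT_intros]:
  fixes f :: "'a::enc \<Rightarrow> 'b::enc"
  assumes "PT b" "PT f" "PT g"
  shows "PT (\<lambda>x. if b x then f x else g x)"
proof -
  obtain e o' where e: "below 4 e"
    "\<And>x r a. runs e (st (cw x @ r) a [] []) (poly o' (sz x)) (st (cw (b x) @ r) a [] [])"
    by (rule PT_E[OF assms(1)]) blast
  obtain c p where c: "below 4 c"
    "\<And>x r a. runs c (st (cw x @ r) a [] []) (poly p (sz x)) (st (cw (f x) @ r) a [] [])"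
    by (rule PT_E[OF assms(2)]) blast
  obtain d q where d: "below 4 d"
    "\<And>x r a. runs d (st (cw x @ r) a [] []) (poly q (sz x)) (st (cw (g x) @ r) a [] [])"
    by (rule PT_E[OF assms(3)]) blast
  \<comment> \<open>\<open>True\<close> is coded as a node with two leaves, whose two
    \<open>False\<close> symbols the nested cases discard.\<close>
  let ?c = "dup_top ;; e ;; Case 0 Skip d (Case 0 Skip (Case 0 Skip c Skip) Skip)"
  let ?p = "2 * lin_poly + o' + p + q + [:3:]"
  show ?thesis
  proof (rule PT_I[of ?c ?p])
    fix x :: 'a and r a
    have 1: "runs dup_top (st (cw x @ r) a [] []) (2 * lin (enc x)) (st (cw x @ cw x @ r) a [] [])"
      unfolding cw_def by (rule runs_dup)
    have 2: "runs (Case 0 Skip d (Case 0 Skip (Case 0 Skip c Skip) Skip)) (st (cw (b x) @ cw x @ r) a [] [])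
       (poly p (sz x) + poly q (sz x) + 3) (st (cw (if b x then f x else g x) @ r) a [] [])"
    proof (cases "b x")
      case True
      then show ?thesis
        using runs_mono[OF runs_Case0T[OF runs_Case0F[OF runs_Case0F[OF c(2)]]]] by simp
    next
      case False
      then show ?thesis
        using runs_mono[OF runs_Case0F[OF d(2)]] by simp
    qed
    show "runs ?c (st (cw x @ r) a [] []) (poly ?p (sz x)) (st (cw (if b x then f x else g x) @ r) a [] [])"
      by (rule runs_mono[OF runs_Seq[OF 1 runs_Seq[OF e(2) 2]]]) (simp add: lin_enc)
  qed (use c d e in simp)
qed

lemma PT_eqI: "PT g \<Longrightarrow> (\<And>x. f x = g x) \<Longrightarrow> PT f"
  by (metis ext)

lemma PT_not [PT_intros]: "PT f \<Longrightarrow> PT (\<lambda>x. \<not> f x)"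
  by (rule PT_eqI[OF PT_if[of f "\<lambda>_. False" "\<lambda>_. True"]]) (simp_all add: PT_const)

lemma PT_conj [PT_intros]: "PT f \<Longrightarrow> PT g \<Longrightarrow> PT (\<lambda>x. f x \<and> g x)"
  by (rule PT_eqI[OF PT_if[of f g "\<lambda>_. False"]]) (simp_all add: PT_const)

lemma PT_disj [PT_intros]: "PT f \<Longrightarrow> PT g \<Longrightarrow> PT (\<lambda>x. f x \<or> g x)"
  using PT_not[OF PT_conj[OF PT_not PT_not], of f g] by simp

lemma PT_imp [PT_intros]: "PT f \<Longrightarrow> PT g \<Longrightarrow> PT (\<lambda>x. f x \<longrightarrow> g x)"
  by (rule PT_eqI[OF PT_disj[OF PT_not, of f g]]) auto

lemma PT_bool_eq: "PT f \<Longrightarrow> PT g \<Longrightarrow> PT (\<lambda>x. f x = (g x :: bool))"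
  by (rule PT_eqI[OF PT_if[OF _ _ PT_not, of f g g]]) auto

subsection \<open>Folds\<close>

instantiation list :: (enc) enc
begin
primrec enc_list :: "'a list \<Rightarrow> tree" where
  "enc_list [] = Leaf"
| "enc_list (x # xs) = Node (enc x) (enc_list xs)"
instance
proof
  show "xs = ys" if "enc xs = enc ys" for xs ys :: "'a list"
    using that
  proof (induction xs arbitrary: ys)
    case Nil
    then show ?case by (cases ys) auto
  next
    case (Cons x xs)
    then show ?case by (cases ys) (auto dest: enc_inj)
  qed
qed
end

lemma cw_list: "cw [] = [False]" "cw (x # xs) = True # cw x @ cw xs"
  by (simp_all add: cw_def)

lemma sz_list [simp]: "sz [] = 1" "sz (x # xs) = Suc (sz x + sz xs)"
  by (simp_all add: sz_def cw_list)

lemma sz_append: "Suc (sz (xs @ ys)) = sz xs + sz ys"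
  by (induction xs) auto

lemma sz_rev [simp]: "sz (rev xs) = sz xs"
proof (induction xs)
  case (Cons x xs)
  then show ?case using sz_append[of "rev xs" "[x]"] by simp
qed simp

lemma sz_member: "x \<in> set xs \<Longrightarrow> sz x \<le> sz xs"
  by (induction xs) auto

lemma length_le_sz: "length xs \<le> sz xs"
  by (induction xs) auto

lemma sz_ge_1: "1 \<le> sz x"
  unfolding sz_def cw_def by (rule word_nonempty)

instantiation unit :: enc
begin
definition enc_unit :: "unit \<Rightarrow> tree" where
  "enc_unit u = Leaf"
instance
  by standard simp
end

lemma cw_unit: "cw () = [False]"
  by (simp add: cw_def enc_unit_def)

instantiation nat :: enc
begin
primrec enc_nat :: "nat \<Rightarrow> tree" where
  "enc_nat 0 = Leaf"
| "enc_nat (Suc n) = Node Leaf (enc_nat n)"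
instance
proof
  show "m = n" if "enc m = enc n" for m n :: nat
    using that
  proof (induction m arbitrary: n)
    case 0
    then show ?case by (cases n) auto
  next
    case (Suc m)
    then show ?case by (cases n) auto
  qed
qed
end

lemma cw_nat: "cw (0 :: nat) = [False]" "cw (Suc n) = True # False # cw n"
  by (simp_all add: cw_def)

lemma sz_nat [simp]: "sz (n :: nat) = Suc (2 * n)"
  by (induction n) (simp_all add: sz_def cw_nat)

lemma PT_Cons [PT_intros]:
  assumes "PT f" "PT g"
  shows "PT (\<lambda>x. f x # g x)"
proof -
  have "PT (\<lambda>p. fst p # snd p)"
    by (rule PT_same_word) (auto simp: cw_list cw_pair)
  from PT_comp[OF PT_Pair[OF assms] this] show ?thesis by simp
qed

text \<open>The code of a list has a \<open>True\<close> before each element and a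
  \<open>False\<close> at the end, exactly what a loop on stack 1 pops. Once the element lies above
  the accumulator on stack 0, a further \<open>True\<close> turns the two into the pair expected by
  the body.\<close>

definition fold_loop :: "com \<Rightarrow> com" where
  "fold_loop c = While 1 (move_top 1 0 ;; Push 0 True ;; c)"

lemma fold_loop_correct:
  assumes c: "\<And>y s r a. runs c (st (cw (y, s) @ r) a [] []) (poly p (sz (y, s))) (st (cw (g s y) @ r) a [] [])"
    and "\<And>ys1 y ys2. ys = ys1 @ y # ys2 \<Longrightarrow> sz y \<le> B \<and> sz (foldl g s ys1) \<le> B"
  shows "runs (fold_loop c) (st (cw s @ r) (cw ys @ a) [] [])
     (length ys * (3 + poly lin_poly B + poly p (Suc (B + B))) + 1) (st (cw (foldl g s ys) @ r) a [] [])"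
  using assms(2)
proof (induction ys arbitrary: s)
  case Nil
  have "runs (fold_loop c) (st (cw s @ r) (False # a) [] []) 1 ((st (cw s @ r) (False # a) [] [])(1 := a))"
    unfolding fold_loop_def by (rule runs_WhileF) simp
  then show ?case by (simp add: cw_list)
next
  case (Cons y ys)
  have sz: "sz y \<le> B" "sz s \<le> B" using Cons.prems[of "[]" y ys] by auto
  let ?t = "lin (enc y) + (2 + poly p (sz (y, s)))"
  have 1: "runs (move_top 1 0) (st (cw s @ r) (cw y @ cw ys @ a) [] []) (lin (enc y)) (st (cw y @ cw s @ r) (cw ys @ a) [] [])"
    unfolding cw_def by (rule runs_move_10)
  have "runs (move_top 1 0 ;; Push 0 True ;; c) (st (cw s @ r) (cw y @ cw ys @ a) [] []) ?t
     (st (cw (g s y) @ r) (cw ys @ a) [] [])"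
    by (intro runs_Seq[OF 1] runs_Seq[OF runs_Push0]) (use c[of y s] in \<open>simp add: cw_pair\<close>)
  then have 2: "runs (move_top 1 0 ;; Push 0 True ;; c) ((st (cw s @ r) (cw (y # ys) @ a) [] [])(1 := cw y @ cw ys @ a)) ?t
     (st (cw (g s y) @ r) (cw ys @ a) [] [])"
    by simp
  have 3: "st (cw s @ r) (cw (y # ys) @ a) [] [] 1 = True # cw y @ cw ys @ a"
    by (simp add: cw_list)
  have 4: "runs (fold_loop c) (st (cw (g s y) @ r) (cw ys @ a) [] [])
     (length ys * (3 + poly lin_poly B + poly p (Suc (B + B))) + 1) (st (cw (foldl g (g s y) ys) @ r) a [] [])"
  proof (rule Cons.IH)
    fix ys1 z ys2 assume "ys = ys1 @ z # ys2"
    then show "sz z \<le> B \<and> sz (foldl g (g s y) ys1) \<le> B"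
      using Cons.prems[of "y # ys1" z ys2] by simp
  qed
  have "?t \<le> 2 + poly lin_poly B + poly p (Suc (B + B))"
    using sz poly_mono_nat[of "sz y" B lin_poly] poly_mono_nat[of "sz (y, s)" "Suc (B + B)" p]
    by (simp add: lin_enc)
  then show ?case
    using runs_mono[OF runs_WhileT[OF 3 2 4[unfolded fold_loop_def]]] by (simp add: fold_loop_def)
qed

lemma PT_fold_closed:
  fixes h :: "'a::enc \<Rightarrow> 'b::enc list" and i :: "'a \<Rightarrow> 'c::enc"
  assumes "PT h" "PT i" "PT (\<lambda>p. g (snd p) (fst p))"
    and q: "\<And>x ys1 ys2. h x = ys1 @ ys2 \<Longrightarrow> sz (foldl g (i x) ys1) \<le> poly q (sz x)"
  shows "PT (\<lambda>x. foldl g (i x) (h x))"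
proof -
  obtain c p where c: "below 4 c"
    "\<And>x r a. runs c (st (cw x @ r) a [] []) (poly p (sz x)) (st (cw (h x, i x) @ r) a [] [])"
    "\<And>x. sz (h x, i x) \<le> poly p (sz x)" by (rule PT_E[OF PT_Pair[OF assms(1,2)]]) blast
  obtain d e where d: "below 4 d"
    "\<And>x r a. runs d (st (cw x @ r) a [] []) (poly e (sz x)) (st (cw (g (snd x) (fst x)) @ r) a [] [])"
    by (rule PT_E[OF assms(3)]) blast
  let ?c = "c ;; Case 0 Skip Skip (move_top 0 1 ;; fold_loop d)"
  let ?K = "[:3:] + pcompose lin_poly (p + q) + pcompose e (1 + (p + q) + (p + q))"
  show ?thesis
  proof (rule PT_I[of ?c "p + pcompose lin_poly p + p * ?K + [:2:]"])
    show "below 4 ?c" using c(1) d(1) by (simp add: fold_loop_def)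
    fix x :: 'a and r a
    define B where "B = poly p (sz x) + poly q (sz x)"
    have 1: "runs (move_top 0 1) (st (cw (h x) @ cw (i x) @ r) a [] []) (lin (enc (h x))) (st (cw (i x) @ r) (cw (h x) @ a) [] [])"
      unfolding cw_def by (rule runs_move_01)
    have szh: "sz (h x) \<le> poly p (sz x)" using c(3)[of x] by simp
    have 2: "runs (fold_loop d) (st (cw (i x) @ r) (cw (h x) @ a) [] [])
      (length (h x) * (3 + poly lin_poly B + poly e (Suc (B + B))) + 1) (st (cw (foldl g (i x) (h x)) @ r) a [] [])"
    proof (rule fold_loop_correct)
      fix ys1 y ys2 assume *: "h x = ys1 @ y # ys2"
      then have "sz y \<le> sz (h x)" by (intro sz_member) simp
      then show "sz y \<le> B \<and> sz (foldl g (i x) ys1) \<le> B"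
        using q[OF *] szh by (simp add: B_def)
    qed (use d(2) in force)
    have 3: "runs (Case 0 Skip Skip (move_top 0 1 ;; fold_loop d)) (st (cw (h x, i x) @ r) a [] [])
       (Suc (lin (enc (h x)) + (length (h x) * (3 + poly lin_poly B + poly e (Suc (B + B))) + 1)))
       (st (cw (foldl g (i x) (h x)) @ r) a [] [])"
      using runs_Case0T[OF runs_Seq[OF 1 2]] by (simp add: cw_pair)
    have "lin (enc (h x)) \<le> poly lin_poly (poly p (sz x))"
      unfolding lin_enc by (rule poly_mono_nat[OF szh])
    moreover have "length (h x) \<le> poly p (sz x)" using szh length_le_sz order_trans by blast
    then have "length (h x) * (3 + poly lin_poly B + poly e (Suc (B + B))) \<le>
        poly p (sz x) * (3 + poly lin_poly B + poly e (Suc (B + B)))" by simp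
    ultimately show "runs ?c (st (cw x @ r) a [] []) (poly (p + pcompose lin_poly p + p * ?K + [:2:]) (sz x))
        (st (cw (foldl g (i x) (h x)) @ r) a [] [])"
      by (intro runs_mono[OF runs_Seq[OF c(2) 3]])
         (auto simp: poly_pcompose B_def intro!: add_mono mult_le_mono1)
  qed
qed

text \<open>
  Unlike the other closure properties, folding needs a polynomial bound on the intermediate results.
\<close>

lemma PT_foldl:
  assumes "PT h" "PT i" "PT (\<lambda>p. g (fst p) (fst (snd p)) (snd (snd p)))"
    and q: "\<And>x ys1 ys2. h x = ys1 @ ys2 \<Longrightarrow> sz (foldl (g x) (i x) ys1) \<le> poly q (sz x)"
  shows "PT (\<lambda>x. foldl (\<lambda>s y. g x s y) (i x) (h x))"
proof -
  \<comment> \<open>The parameter \<open>x\<close> travels along in the accumulator, since the loop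
    body sees nothing else.\<close>
  let ?G = "\<lambda>s y. (fst s, g (fst s) (snd s) y)"
  have *: "foldl ?G (x, s) ys = (x, foldl (g x) s ys)" for x s ys
    by (induction ys arbitrary: s) auto
  have 1: "PT (\<lambda>p. ?G (snd p) (fst p))"
    by (rule PT_Pair, intro PT_intros, rule PT_comp3[of g, OF assms(3)]) (intro PT_intros)+
  have "PT (\<lambda>x. foldl ?G (x, i x) (h x))"
  proof (rule PT_fold_closed[OF assms(1) _ 1, where q = "q + [:1, 1:]"])
    show "PT (\<lambda>x. (x, i x))" by (rule PT_Pair[OF PT_id assms(2)])
    show "sz (foldl ?G (x, i x) ys1) \<le> poly (q + [:1, 1:]) (sz x)" if "h x = ys1 @ ys2" for x ys1 ys2
      using q[OF that] by (simp add: *)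
  qed
  from PT_snd[OF this] show ?thesis by (simp add: *)
qed

text \<open>If a round adds an amount that does not depend on the accumulator, the total is at most
  the number of rounds times that amount. A bound that multiplied the accumulator would allow
  exponential growth.\<close>

lemma PT_foldl_add:
  assumes "PT h" "PT i" "PT (\<lambda>p. g (fst p) (fst (snd p)) (snd (snd p)))"
    and q: "\<And>x s y. sz (g x s y) \<le> sz s + poly q (sz x + sz y)"
  shows "PT (\<lambda>x. foldl (\<lambda>s y. g x s y) (i x) (h x))"
proof -
  obtain ph where ph: "\<And>x. sz (h x) \<le> poly ph (sz x)" using PT_size[OF assms(1)] by blast
  obtain pi where pi: "\<And>x. sz (i x) \<le> poly pi (sz x)" using PT_size[OF assms(2)] by blast
  let ?q = "pcompose q ([:0, 1:] + ph)"
  show ?thesis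
  proof (rule PT_foldl[OF assms(1-3), where q = "pi + ph * ?q"])
    fix x ys1 ys2 assume h: "h x = ys1 @ ys2"
    have "sz (foldl (g x) s ys) \<le> sz s + length ys * poly ?q (sz x)" if "set ys \<subseteq> set (h x)" for s ys
      using that
    proof (induction ys arbitrary: s)
      case (Cons y ys)
      have "sz y \<le> poly ph (sz x)" using Cons.prems sz_member[of y "h x"] ph[of x] by simp
      then have "poly q (sz x + sz y) \<le> poly ?q (sz x)"
        by (simp add: poly_pcompose poly_mono_nat)
      then have "sz (g x s y) \<le> sz s + poly ?q (sz x)" using q[of x s y] by linarith
      then show ?case using Cons.IH[of "g x s y"] Cons.prems by simp
    qed simp
    from this[of ys1 "i x"] have "sz (foldl (g x) (i x) ys1) \<le> sz (i x) + length ys1 * poly ?q (sz x)"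
      using h by simp
    also have "length ys1 \<le> poly ph (sz x)"
      using length_le_sz[of "h x"] ph[of x] h by simp
    then have "length ys1 * poly ?q (sz x) \<le> poly ph (sz x) * poly ?q (sz x)" by simp
    finally show "sz (foldl (g x) (i x) ys1) \<le> poly (pi + ph * ?q) (sz x)"
      using pi[of x] by (simp add: h)
  qed
qed

lemma PT_foldl_map:
  assumes "PT h" "PT (\<lambda>p. g (fst p) (snd p))"
  shows "PT (\<lambda>x. foldl (\<lambda>s y. g x y # s) [] (h x))"
proof -
  obtain q where q: "\<And>p. sz (g (fst p) (snd p)) \<le> poly q (sz p)" using PT_size[OF assms(2)] by blast
  show ?thesis
  proof (rule PT_foldl_add[OF assms(1) PT_const, where q = "1 + pcompose q [:1, 1:]"])
    show "PT (\<lambda>p. g (fst p) (snd (snd p)) # fst (snd p))"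
      by (intro PT_intros PT_comp2[of g, OF assms(2)])
    show "sz (g x y # s) \<le> sz s + poly (1 + pcompose q [:1, 1:]) (sz x + sz y)" for x s y
      using q[of "(x, y)"] by (simp add: poly_pcompose)
  qed
qed

lemma foldl_map_rev: "foldl (\<lambda>s y. g y # s) s ys = rev (map g ys) @ s"
  by (induction ys arbitrary: s) auto

lemma PT_rev [PT_intros]: "PT h \<Longrightarrow> PT (\<lambda>x. rev (h x))"
  using PT_foldl_map[of h "\<lambda>x y. y"] by (simp add: foldl_map_rev PT_snd PT_id)

lemma PT_map [PT_intros]:
  "PT h \<Longrightarrow> PT (\<lambda>p. g (fst p) (snd p)) \<Longrightarrow> PT (\<lambda>x. map (\<lambda>y. g x y) (h x))"
  using PT_rev[OF PT_foldl_map[of h g]] by (simp add: foldl_map_rev)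

lemma PT_append [PT_intros]: "PT f \<Longrightarrow> PT g \<Longrightarrow> PT (\<lambda>x. f x @ g x)"
proof -
  assume "PT f" "PT g"
  then have "PT (\<lambda>x. foldl (\<lambda>s y. y # s) (g x) (rev (f x)))"
    by (intro PT_foldl_add[where q = "1 + [:0, 1:]"] PT_intros) simp_all
  then show ?thesis
    using foldl_map_rev[of "\<lambda>y. y" "g _" "rev (f _)"] by simp
qed

lemma PT_concat [PT_intros]: "PT f \<Longrightarrow> PT (\<lambda>x. concat (f x))"
proof -
  assume "PT f"
  then have "PT (\<lambda>x. foldl (\<lambda>s y. s @ y) [] (f x))"
  proof (rule PT_foldl_add[where q = "[:0, 1:]"])
    show "sz (s @ y) \<le> sz s + poly [:0, 1:] (sz x + sz y)" for x :: 'a and s y :: "'b list"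
      using sz_append[of s y] by simp
  qed (intro PT_intros)+
  moreover have "foldl (\<lambda>s y. s @ y) s ys = s @ concat ys" for s :: "'b list" and ys
    by (induction ys arbitrary: s) auto
  ultimately show ?thesis by simp
qed

lemma PT_filter [PT_intros]:
  "PT h \<Longrightarrow> PT (\<lambda>p. P (fst p) (snd p)) \<Longrightarrow> PT (\<lambda>x. filter (\<lambda>y. P x y) (h x))"
proof -
  assume "PT h" "PT (\<lambda>p. P (fst p) (snd p))"
  then have "PT (\<lambda>x. concat (map (\<lambda>y. if P x y then [y] else []) (h x)))"
    by (intro PT_intros)
  moreover have "concat (map (\<lambda>y. if P x y then [y] else []) ys) = filter (P x) ys" for x ys
    by (induction ys) auto
  ultimately show ?thesis by simp
qed

lemma PT_null [PT_intros]:
  fixes f :: "'b::enc \<Rightarrow> 'a::enc list"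
  shows "PT f \<Longrightarrow> PT (\<lambda>x. f x = [])"
proof -
  have "PT (\<lambda>xs :: 'a list. xs = [])"
  proof (rule PT_I[of "Case 0 Skip (push_word (cw True)) (drop_top ;; drop_top ;; push_word (cw False))" "2 * lin_poly + [:10:]"])
    fix xs :: "'a list" and r a
    show "runs (Case 0 Skip (push_word (cw True)) (drop_top ;; drop_top ;; push_word (cw False)))
       (st (cw xs @ r) a [] []) (poly (2 * lin_poly + [:10:]) (sz xs)) (st (cw (xs = []) @ r) a [] [])"
    proof (cases xs)
      case Nil
      then show ?thesis
        using runs_mono[OF runs_Case0F[OF runs_push_word[of "cw True"]]] by (simp add: cw_list)
    next
      case (Cons y ys)
      have 1: "runs drop_top (st (cw y @ cw ys @ r) a [] []) (lin (enc y)) (st (cw ys @ r) a [] [])"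
        and 2: "runs drop_top (st (cw ys @ r) a [] []) (lin (enc ys)) (st r a [] [])"
        unfolding cw_def by (rule runs_drop)+
      have "lin (enc y) \<le> poly lin_poly (sz xs)" "lin (enc ys) \<le> poly lin_poly (sz xs)"
        unfolding lin_enc by (rule poly_mono_nat; simp add: Cons)+
      then have "Suc (lin (enc y) + (lin (enc ys) + 2 * length (cw False))) \<le> poly (2 * lin_poly + [:10:]) (sz xs)"
        by simp
      from runs_mono[OF runs_Case0T[OF runs_Seq[OF 1 runs_Seq[OF 2 runs_push_word[of "cw False"]]]] this]
      show ?thesis by (simp add: Cons cw_list)
    qed
  qed simp
  then show "PT f \<Longrightarrow> PT (\<lambda>x. f x = [])" using PT_comp by blast
qed

lemma PT_hd [PT_intros]:
  fixes f :: "'b::enc \<Rightarrow> 'a::enc list"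
  shows "PT f \<Longrightarrow> PT (\<lambda>x. hd (f x))"
proof -
  \<comment> \<open>The value at the empty list is unspecified but fixed, so the program can write
    out its code.\<close>
  let ?u = "cw (hd [] :: 'a)"
  let ?c = "Case 0 Skip (push_word ?u) (move_top 0 1 ;; drop_top ;; move_top 1 0)"
  let ?p = "3 * lin_poly + [:1 + 2 * length ?u:]"
  have "PT (hd :: 'a list \<Rightarrow> 'a)"
  proof (rule PT_I[of ?c ?p])
    fix xs :: "'a list" and r a
    show "runs ?c (st (cw xs @ r) a [] []) (poly ?p (sz xs)) (st (cw (hd xs) @ r) a [] [])"
    proof (cases xs)
      case Nil
      then show ?thesis
        using runs_mono[OF runs_Case0F[OF runs_push_word[of ?u]]] by (simp add: cw_list)
    next
      case (Cons y ys)
      have "lin (enc y) \<le> poly lin_poly (sz xs)" "lin (enc ys) \<le> poly lin_poly (sz xs)"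
        unfolding lin_enc by (rule poly_mono_nat; simp add: Cons)+
      then show ?thesis
        using runs_mono[OF runs_Case0T[OF runs_first[of "enc y" "enc ys" r a]]]
        by (simp add: Cons cw_list) (simp add: cw_def)
    qed
  qed simp
  then show "PT f \<Longrightarrow> PT (\<lambda>x. hd (f x))" using PT_comp by blast
qed

lemma PT_tl [PT_intros]:
  fixes f :: "'b::enc \<Rightarrow> 'a::enc list"
  shows "PT f \<Longrightarrow> PT (\<lambda>x. tl (f x))"
proof -
  let ?c = "Case 0 Skip (push_word (cw ([] :: 'a list))) drop_top"
  let ?p = "lin_poly + [:3:]"
  have "PT (tl :: 'a list \<Rightarrow> 'a list)"
  proof (rule PT_I[of ?c ?p])
    fix xs :: "'a list" and r a
    show "runs ?c (st (cw xs @ r) a [] []) (poly ?p (sz xs)) (st (cw (tl xs) @ r) a [] [])"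
    proof (cases xs)
      case Nil
      then show ?thesis
        using runs_mono[OF runs_Case0F[OF runs_push_word[of "cw ([] :: 'a list)"]]] by (simp add: cw_list)
    next
      case (Cons y ys)
      have "lin (enc y) \<le> poly lin_poly (sz xs)"
        unfolding lin_enc by (rule poly_mono_nat; simp add: Cons)+
      then show ?thesis
        using runs_mono[OF runs_Case0T[OF runs_drop[of "enc y" "cw ys @ r" a]]]
        by (simp add: Cons cw_list) (simp add: cw_def)
    qed
  qed simp
  then show "PT f \<Longrightarrow> PT (\<lambda>x. tl (f x))" using PT_comp by blast
qed

subsection \<open>Natural numbers\<close>

text \<open>Numbers are in unary, with the same word as a list of units, and inherit their
  arithmetic from lists.\<close>

lemma PT_units [PT_intros]: "PT f \<Longrightarrow> PT (\<lambda>x. replicate (f x) ())"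
proof -
  have "cw (replicate n ()) = cw n" for n
    by (induction n) (auto simp: cw_nat cw_list cw_unit)
  then show "PT f \<Longrightarrow> PT (\<lambda>x. replicate (f x) ())" using PT_comp[OF _ PT_same_word, of f "\<lambda>n. replicate n ()"] by blast
qed

lemma PT_length [PT_intros]: "PT f \<Longrightarrow> PT (\<lambda>x. length (f x))"
proof -
  assume "PT f"
  then have "PT (\<lambda>x. map (\<lambda>y. ()) (f x))" by (intro PT_intros)
  moreover have "cw (length us) = cw us" for us :: "unit list"
    by (induction us) (auto simp: cw_nat cw_list cw_unit)
  ultimately have "PT (\<lambda>x. length (map (\<lambda>y. ()) (f x)))" using PT_comp[OF _ PT_same_word, of _ length] by blast
  then show ?thesis by simp
qed

lemma PT_Suc [PT_intros]: "PT f \<Longrightarrow> PT (\<lambda>x. Suc (f x))"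
  by (rule PT_eqI[OF PT_length[OF PT_Cons[OF PT_const[of "()"] PT_units]]]) simp_all

lemma PT_plus [PT_intros]: "PT f \<Longrightarrow> PT g \<Longrightarrow> PT (\<lambda>x. f x + g x :: nat)"
  by (rule PT_eqI[OF PT_length[OF PT_append[OF PT_units PT_units]]]) simp_all

lemma foldl_units: "foldl (\<lambda>s (y :: unit). G s) s (replicate n ()) = (G ^^ n) s"
  by (induction n arbitrary: s) (simp_all add: funpow_swap1)

lemma PT_drop [PT_intros]: "PT f \<Longrightarrow> PT g \<Longrightarrow> PT (\<lambda>x. drop (f x) (g x))"
proof -
  assume "PT f" "PT g"
  then have "PT (\<lambda>x. foldl (\<lambda>s y. tl s) (g x) (replicate (f x) ()))"
  proof (intro PT_foldl_add[where q = 0] PT_intros)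
    show "sz (tl s) \<le> sz s + poly 0 (sz x + sz y)" for x :: 'a and s :: "'b list" and y :: unit
      by (cases s) auto
  qed
  moreover have "(tl ^^ n) xs = drop n xs" for n and xs :: "'b list"
    by (induction n arbitrary: xs) (simp_all add: drop_Suc tl_drop)
  ultimately show ?thesis by (simp add: foldl_units)
qed

lemma PT_minus [PT_intros]: "PT f \<Longrightarrow> PT g \<Longrightarrow> PT (\<lambda>x. f x - g x :: nat)"
  by (rule PT_eqI[OF PT_length[OF PT_drop[OF _ PT_units], of g f]]) simp_all

lemma PT_replicate [PT_intros]: "PT f \<Longrightarrow> PT g \<Longrightarrow> PT (\<lambda>x. replicate (f x) (g x))"
proof -
  assume "PT f" "PT g"
  then have "PT (\<lambda>x. map (\<lambda>y. g x) (replicate (f x) ()))"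
    by (intro PT_intros PT_comp[OF PT_fst[OF PT_id], of g])
  then show ?thesis by simp
qed

lemma PT_times [PT_intros]: "PT f \<Longrightarrow> PT g \<Longrightarrow> PT (\<lambda>x. f x * g x :: nat)"
proof -
  assume "PT f" "PT g"
  then have "PT (\<lambda>x. length (concat (replicate (f x) (replicate (g x) ()))))"
    by (intro PT_intros)
  moreover have "length (concat (replicate n (replicate m ()))) = n * m" for n m
    by (induction n) auto
  ultimately show ?thesis by simp
qed

lemma PT_eq_0: "PT f \<Longrightarrow> PT (\<lambda>x. f x = (0 :: nat))"
  by (rule PT_eqI[OF PT_null[OF PT_units]]) auto

lemma PT_le [PT_intros]: "PT f \<Longrightarrow> PT g \<Longrightarrow> PT (\<lambda>x. f x \<le> (g x :: nat))"
  by (rule PT_eqI[OF PT_eq_0[OF PT_minus]]) simp_all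

lemma PT_less [PT_intros]: "PT f \<Longrightarrow> PT g \<Longrightarrow> PT (\<lambda>x. f x < (g x :: nat))"
  by (rule PT_eqI[OF PT_le[OF PT_Suc]]) (simp_all add: Suc_le_eq)

lemma PT_min [PT_intros]: "PT f \<Longrightarrow> PT g \<Longrightarrow> PT (\<lambda>x. min (f x) (g x :: nat))"
  unfolding min_def by (intro PT_intros)

lemma PT_poly [PT_intros]: "PT f \<Longrightarrow> PT (\<lambda>x. poly p (f x) :: nat)"
proof (induction p)
  case (pCons a p)
  then show ?case by (simp add: PT_plus PT_times PT_const)
qed (simp add: PT_const)

lemma PT_upt [PT_intros]: "PT f \<Longrightarrow> PT g \<Longrightarrow> PT (\<lambda>x. [f x..<g x])"
proof -
  assume f: "PT f" and g: "PT g"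
  have G: "foldl (\<lambda>s (y :: unit). s @ [length s]) [] us = [0..<length us]" for us
    by (induction us rule: rev_induct) auto
  have sz: "sz [0..<n] \<le> Suc (n * (2 * n + 2))" for n
  proof (induction n)
    case (Suc n)
    then show ?case using sz_append[of "[0..<n]" "[n]"] by simp
  qed simp
  have "PT (\<lambda>n. foldl (\<lambda>s y. s @ [length s]) [] (replicate n ()))"
  \<comment> \<open>Here the increment depends on the accumulator, so the sizes are bounded through
    the explicit form of the partial results instead of by \<open>PT_foldl_add\<close>.\<close>
  proof (rule PT_foldl[where q = "1 + [:0, 1:] * ([:2:] * [:0, 1:] + [:2:])"])
    fix n and us vs :: "unit list"
    assume "replicate n () = us @ vs"
    then have "length us \<le> sz n" using length_replicate[of n "()"] by simp
    then have "length us * (2 * length us + 2) \<le> sz n * (2 * sz n + 2)" by (intro mult_mono) auto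
    then show "sz (foldl (\<lambda>s y. s @ [length s]) [] us) \<le> poly (1 + [:0, 1:] * ([:2:] * [:0, 1:] + [:2:])) (sz n)"
      unfolding G using sz[of "length us"] by simp
  qed (intro PT_intros)+
  then have 0: "PT (\<lambda>n. [0..<n])" by (simp add: G)
  have "PT (\<lambda>x. map (\<lambda>i. i + f x) [0..<g x - f x])"
    by (intro PT_intros PT_comp[OF _ 0] g f PT_comp[OF PT_fst[OF PT_id] f])
  then show ?thesis by (rule PT_eqI) (auto intro: nth_equalityI)
qed

lemma PT_Ball [PT_intros]:
  "PT h \<Longrightarrow> PT (\<lambda>p. P (fst p) (snd p)) \<Longrightarrow> PT (\<lambda>x. \<forall>y\<in>set (h x). P x y)"
  by (rule PT_eqI[OF PT_null[OF PT_filter[OF _ PT_not], of h P]]) (simp_all add: filter_empty_conv)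

lemma PT_Bex [PT_intros]:
  "PT h \<Longrightarrow> PT (\<lambda>p. P (fst p) (snd p)) \<Longrightarrow> PT (\<lambda>x. \<exists>y\<in>set (h x). P x y)"
  by (rule PT_eqI[OF PT_not[OF PT_null[OF PT_filter], of h P]]) (simp_all add: filter_empty_conv)

lemma PT_takeWhile [PT_intros]:
  assumes "PT h" "PT (\<lambda>p. P (fst p) (snd p))"
  shows "PT (\<lambda>x. takeWhile (\<lambda>y. P x y) (h x))"
proof -
  let ?g = "\<lambda>x s y. (fst s \<and> P x y, if fst s \<and> P x y then y # snd s else snd s)"
  have "PT (\<lambda>x. foldl (\<lambda>s y. ?g x s y) (True, []) (h x))"
  proof (rule PT_foldl_add[OF assms(1), where q = "[:3, 1:]"])
    show "sz (?g x s y) \<le> sz s + poly [:3, 1:] (sz x + sz y)" for x s y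
      by (cases s) (use sz_bool[of "fst s \<and> P x y"] sz_bool[of False] sz_ge_1[of "fst s"] in \<open>auto simp: numeral_eq_Suc\<close>)
  qed (intro PT_intros PT_comp2[of P, OF assms(2)])+
  then have "PT (\<lambda>x. rev (snd (foldl (\<lambda>s y. ?g x s y) (True, []) (h x))))" by (intro PT_intros)
  moreover have "foldl (?g x) (False, s) ys = (False, s)" for x s ys
    by (induction ys) auto
  then have "snd (foldl (?g x) (True, s) ys) = rev (takeWhile (P x) ys) @ s" for x s ys
    by (induction ys arbitrary: s) auto
  ultimately show ?thesis by simp
qed

lemma dropWhile_eq_drop_length: "dropWhile P xs = drop (length (takeWhile P xs)) xs"
  by (induction xs) auto

lemma PT_dropWhile [PT_intros]:
  "PT h \<Longrightarrow> PT (\<lambda>p. P (fst p) (snd p)) \<Longrightarrow> PT (\<lambda>x. dropWhile (\<lambda>y. P x y) (h x))"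
  unfolding dropWhile_eq_drop_length by (intro PT_intros)

subsection \<open>Equality\<close>

text \<open>This agrees with \<open>!\<close> inside the list; beyond its end it is uniformly
  \<open>hd []\<close>, so that it is computable for every index.\<close>

definition nthd :: "'a list \<Rightarrow> nat \<Rightarrow> 'a" where
  "nthd xs i = hd (drop i xs)"

lemma nthd_nth [simp]: "i < length xs \<Longrightarrow> nthd xs i = xs ! i"
  by (simp add: nthd_def hd_drop_conv_nth)

lemma PT_nthd [PT_intros]: "PT f \<Longrightarrow> PT g \<Longrightarrow> PT (\<lambda>x. nthd (f x) (g x))"
  unfolding nthd_def by (intro PT_intros)

lemma word_append_inj: "word x @ r = word y @ r' \<Longrightarrow> x = y \<and> r = r'"
proof (induction x arbitrary: y r r')
  case Leaf
  then show ?case by (cases y) auto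
next
  case (Node a b)
  show ?case
  proof (cases y)
    case Leaf
    then show ?thesis using Node.prems by simp
  next
    case y: (Node c d)
    have "word a @ word b @ r = word c @ word d @ r'" using Node.prems y by simp
    from Node.IH(1)[OF this] Node.IH(2)[of r d r'] y show ?thesis by simp
  qed
qed

lemma cw_inj: "cw x = cw y \<Longrightarrow> x = y"
  using word_append_inj[of "enc x" "[]" "enc y" "[]"] by (auto simp: cw_def dest: enc_inj)

text \<open>Equality at every type is reduced to equality of code words, for which the code itself
  has to become a piece of data, a list of truth values.\<close>

lemma PT_word: "PT (\<lambda>x. cw x)"
proof -
  let ?l = "While 2 (Case 2 Skip (Push 0 False ;; Push 0 True) (Push 0 False ;; Push 0 False ;; Push 0 True ;; Push 0 True))"
  have 1: "runs ?l (st (cw v @ r) a (mark u) []) (10 * length u + 1) (st (cw (rev u @ v) @ r) a [] [])" for u v r a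
  proof (induction u arbitrary: v)
    case Nil
    then show ?case using runs_WhileE[of "st (cw v @ r) a [] []" 2] by simp
  next
    case (Cons b u)
    let ?s = "st (cw v @ r) a (mark u) []"
    let ?t = "st (cw (b # v) @ r) a (mark u) []"
    have "runs (Case 2 Skip (Push 0 False ;; Push 0 True) (Push 0 False ;; Push 0 False ;; Push 0 True ;; Push 0 True))
       (st (cw v @ r) a (b # mark u) []) 9 ?t"
    proof (cases b)
      case True
      have "runs (Push 0 False ;; Push 0 False ;; Push 0 True ;; Push 0 True) ?s (2 + (2 + (2 + 2))) ?t"
        using runs_Seq[OF runs_Push0[of False "cw v @ r" a "mark u" "[]"] runs_Seq[OF runs_Push0[of False]
          runs_Seq[OF runs_Push0[of True] runs_Push0[of True]]]] by (simp add: True cw_list)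
      then show ?thesis by (intro runs_mono[OF runs_CaseT[where xs = "mark u"]]) (use True in auto)
    next
      case False
      have "runs (Push 0 False ;; Push 0 True) ?s (2 + 2) ?t"
        using runs_Seq[OF runs_Push0[of False "cw v @ r" a "mark u" "[]"] runs_Push0[of True]]
        by (simp add: False cw_list)
      then show ?thesis by (intro runs_mono[OF runs_CaseF[where xs = "mark u"]]) (use False in auto)
    qed
    then have 2: "runs (Case 2 Skip (Push 0 False ;; Push 0 True) (Push 0 False ;; Push 0 False ;; Push 0 True ;; Push 0 True))
       ((st (cw v @ r) a (mark (b # u)) [])(2 := b # mark u)) 9 ?t" by simp
    have 3: "st (cw v @ r) a (mark (b # u)) [] 2 = True # b # mark u" by simp
    show ?case using runs_mono[OF runs_WhileT[OF 3 2 Cons.IH]] by simp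
  qed
  show ?thesis
  proof (rule PT_I[of "parse 0 ;; Push 0 False ;; ?l" "[:10, 20:]"])
    show "below 4 (parse 0 ;; Push 0 False ;; ?l)" by (simp add: parse_def parse_body_def)
    fix x :: 'a and r a
    have p: "runs (parse 0) (st (cw x @ r) a [] []) (10 * sz x + 3) (st r a (mark (rev (cw x))) [])"
      using parse_correct[of 0 "enc x" r a "[]"] by (simp add: sti_def cw_def sz_def)
    have l: "runs ?l (st (False # r) a (mark (rev (cw x))) []) (10 * sz x + 1) (st (cw (cw x) @ r) a [] [])"
      using 1[of "[]" r a "rev (cw x)"] by (simp add: cw_list sz_def)
    show "runs (parse 0 ;; Push 0 False ;; ?l) (st (cw x @ r) a [] []) (poly [:10, 20:] (sz x)) (st (cw (cw x) @ r) a [] [])"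
      by (rule runs_mono[OF runs_Seq[OF p runs_Seq[OF runs_Push0 l]]]) simp
  qed
qed

lemma list_eq_iff_nthd:
  "xs = ys \<longleftrightarrow> length xs \<le> length ys \<and> length ys \<le> length xs \<and>
     (\<forall>i\<in>set [0..<length xs]. nthd xs i = nthd ys i)"
proof
  assume r: "length xs \<le> length ys \<and> length ys \<le> length xs \<and> (\<forall>i\<in>set [0..<length xs]. nthd xs i = nthd ys i)"
  then have l: "length xs = length ys" by simp
  have "xs ! i = ys ! i" if "i < length xs" for i
    using r that l by (metis atLeastLessThan_iff less_eq_nat.simps(1) nthd_nth set_upt)
  then show "xs = ys" using l by (rule nth_equalityI[rotated])
qed simp

lemma PT_eq [PT_intros]: "PT f \<Longrightarrow> PT g \<Longrightarrow> PT (\<lambda>x. f x = g x)"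
proof -
  assume *: "PT f" "PT g"
  have "PT (\<lambda>p :: bool list \<times> bool list. length (fst p) \<le> length (snd p) \<and> length (snd p) \<le> length (fst p) \<and>
     (\<forall>i\<in>set [0..<length (fst p)]. nthd (fst p) i = nthd (snd p) i))"
    by (intro PT_intros PT_bool_eq)
  then have "PT (\<lambda>p :: bool list \<times> bool list. fst p = snd p)"
    by (rule PT_eqI) (rule list_eq_iff_nthd)
  from PT_comp2[OF this PT_comp[OF *(1) PT_word] PT_comp[OF *(2) PT_word]]
  show ?thesis by (rule PT_eqI) (auto dest: cw_inj)
qed

lemma PT_member [PT_intros]: "PT f \<Longrightarrow> PT g \<Longrightarrow> PT (\<lambda>x. f x \<in> set (g x))"
proof -
  assume "PT f" "PT g"
  then have "PT (\<lambda>x. \<exists>y\<in>set (g x). y = f x)" by (intro PT_intros PT_comp[OF PT_fst[OF PT_id], of f])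
  then show ?thesis by (rule PT_eqI) auto
qed

lemma PT_distinct [PT_intros]:
  fixes f :: "'b::enc \<Rightarrow> 'a::enc list"
  shows "PT f \<Longrightarrow> PT (\<lambda>x. distinct (f x))"
proof -
  have "PT (\<lambda>xs :: 'a list. \<forall>i\<in>set [0..<length xs]. \<forall>j\<in>set [0..<length xs].
     i \<noteq> j \<longrightarrow> nthd xs i \<noteq> nthd xs j)"
    by (intro PT_intros)
  then have "PT (distinct :: 'a list \<Rightarrow> bool)"
    by (rule PT_eqI) (auto simp: distinct_conv_nth)
  then show "PT f \<Longrightarrow> PT (\<lambda>x. distinct (f x))" using PT_comp by blast
qed

section \<open>From polynomial-time functions to machines\<close>

lemma sti_other [simp]:
  "i < 2 \<Longrightarrow> sti i x y c d (Suc 0 - i) = y" "i < 2 \<Longrightarrow> (sti i x y c d)(Suc 0 - i := z) = sti i x z c d"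
  by (auto simp: sti_def less_2_cases_iff)

text \<open>A raw word carries no end marker and its \<open>False\<close> symbols would stop a loop.
  Therefore the loop runs on a signal on stack 2, which is renewed for each symbol and omitted once
  stack \<open>i\<close> is found empty.\<close>

definition raw_move :: "nat \<Rightarrow> com" where
  "raw_move i = Push 2 True ;; While 2 (Case i Skip (Push (1 - i) False ;; Push 2 True) (Push (1 - i) True ;; Push 2 True))"

lemma runs_WhileT':
  "s r = True # xs \<Longrightarrow> s(r := xs) = s0 \<Longrightarrow> runs c s0 T1 s1 \<Longrightarrow> runs (While r c) s1 T2 s2 \<Longrightarrow>
    runs (While r c) s (Suc (T1 + T2)) s2"
  using runs_WhileT by blast

lemma runs_raw_move:
  assumes "i < 2"
  shows "runs (raw_move i) (sti i w y [] []) (10 * length w + 10) (sti i [] (rev w @ y) [] [])"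
proof -
  let ?c = "Case i Skip (Push (1 - i) False ;; Push 2 True) (Push (1 - i) True ;; Push 2 True)"
  have "runs (While 2 ?c) (sti i w y [True] []) (8 * length w + 4) (sti i [] (rev w @ y) [] [])"
  proof (induction w arbitrary: y)
    case Nil
    have "runs ?c (sti i [] y [] []) (Suc 0) (sti i [] y [] [])"
      using assms by (intro runs_CaseE runs_Skip) simp
    then have "runs (While 2 ?c) (sti i [] y [True] []) (Suc (Suc 0 + 1)) (sti i [] y [] [])"
      by (rule runs_WhileT'[of _ _ "[]", rotated 2]) (auto intro: runs_WhileE[unfolded One_nat_def])
    then show ?case by (auto elim: runs_mono)
  next
    case (Cons b w)
    have p: "runs (Push (1 - i) b ;; Push 2 True) (sti i w y [] []) (2 + 2) (sti i w (b # y) [True] [])"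
      using runs_Seq[OF runs_Push[of "1 - i" b "sti i w y [] []"] runs_Push[of 2 True]] assms by simp
    have "runs ?c (sti i (b # w) y [] []) (Suc 4) (sti i w (b # y) [True] [])"
    proof (cases b)
      case True
      then show ?thesis by (intro runs_CaseT[of _ _ w]) (use p assms in auto)
    next
      case False
      then show ?thesis by (intro runs_CaseF[of _ _ w]) (use p assms in auto)
    qed
    then have "runs (While 2 ?c) (sti i (b # w) y [True] []) (Suc (Suc 4 + (8 * length w + 4))) (sti i [] (rev w @ b # y) [] [])"
      by (rule runs_WhileT'[of _ _ "[]", rotated 2, OF _ Cons.IH]) auto
    then show ?case by (auto elim: runs_mono)
  qed
  then have "runs (raw_move i) (sti i w y [] []) (2 + (8 * length w + 4)) (sti i [] (rev w @ y) [] [])"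
    unfolding raw_move_def by (rule runs_Seq[rotated]) (use runs_Push[of 2 True "sti i w y [] []"] in simp)
  then show ?thesis by (rule runs_mono) simp
qed

definition build_list :: com where
  "build_list = Push 0 False ;; Push 2 True ;; While 2 (Case 1 Skip
     (Push 0 False ;; Push 0 True ;; Push 2 True)
     (Push 0 False ;; Push 0 False ;; Push 0 True ;; Push 0 True ;; Push 2 True))"

lemma runs_Push2: "runs (Push 2 b) (st x y a c) 2 (st x y (b # a) c)"
  using runs_Push[of 2 b "st x y a c"] by simp

lemma runs_Push1: "runs (Push 1 b) (st x y a c) 2 (st x (b # y) a c)"
  using runs_Push[of 1 b "st x y a c"] by simp

lemma runs_build_list: "runs build_list (st [] u [] []) (20 * length u + 10) (st (cw (rev u)) [] [] [])"
proof -
  let ?c = "Case 1 Skip (Push 0 False ;; Push 0 True ;; Push 2 True)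
     (Push 0 False ;; Push 0 False ;; Push 0 True ;; Push 0 True ;; Push 2 True)"
  have "runs (While 2 ?c) (st (cw v) u [True] []) (20 * length u + 4) (st (cw (rev u @ v)) [] [] [])" for v
  proof (induction u arbitrary: v)
    case Nil
    have "runs ?c (st (cw v) [] [] []) (Suc 0) (st (cw v) [] [] [])"
      by (intro runs_CaseE runs_Skip) simp
    then have "runs (While 2 ?c) (st (cw v) [] [True] []) (Suc (Suc 0 + 1)) (st (cw v) [] [] [])"
      by (rule runs_WhileT'[of _ _ "[]", rotated 2]) (auto intro: runs_WhileE[unfolded One_nat_def])
    then show ?case by (auto elim: runs_mono)
  next
    case (Cons b u)
    have "runs ?c (st (cw v) (b # u) [] []) 11 (st (cw (b # v)) u [True] [])"
    proof (cases b)
      case True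
      have "runs (Push 0 False ;; Push 0 False ;; Push 0 True ;; Push 0 True ;; Push 2 True)
          (st (cw v) u [] []) (2 + (2 + (2 + (2 + 2)))) (st (cw (b # v)) u [True] [])"
        using runs_Seq[OF runs_Push0[of False "cw v" u "[]" "[]"] runs_Seq[OF runs_Push0[of False]
          runs_Seq[OF runs_Push0[of True] runs_Seq[OF runs_Push0[of True] runs_Push2[of True]]]]]
        by (simp add: True cw_list)
      then show ?thesis by (intro runs_mono[OF runs_CaseT[of _ _ u]]) (use True in auto)
    next
      case False
      have "runs (Push 0 False ;; Push 0 True ;; Push 2 True)
          (st (cw v) u [] []) (2 + (2 + 2)) (st (cw (b # v)) u [True] [])"
        using runs_Seq[OF runs_Push0[of False "cw v" u "[]" "[]"]
          runs_Seq[OF runs_Push0[of True] runs_Push2[of True]]]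
        by (simp add: False cw_list)
      then show ?thesis by (intro runs_mono[OF runs_CaseF[of _ _ u]]) (use False in auto)
    qed
    then have "runs (While 2 ?c) (st (cw v) (b # u) [True] []) (Suc (11 + (20 * length u + 4))) (st (cw (rev u @ b # v)) [] [] [])"
      by (rule runs_WhileT'[of _ _ "[]", rotated 2, OF _ Cons.IH]) auto
    then show ?case by (auto elim: runs_mono)
  qed
  from runs_Seq[OF runs_Push0 runs_Seq[OF runs_Push2 this[of "[]", unfolded cw_list]]]
  have "runs build_list (st [] u [] []) (2 + (2 + (20 * length u + 4))) (st (cw (rev u)) [] [] [])"
    by (simp add: build_list_def cw_list)
  then show ?thesis by (rule runs_mono) simp
qed

definition unbuild_list :: com where
  "unbuild_list = While 0 (Case 0 Skip (Push 1 False) (Case 0 Skip (Case 0 Skip (Push 1 True) Skip) Skip))"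

lemma runs_unbuild_list: "runs unbuild_list (st (cw v) u [] []) (10 * length v + 10) (st [] (rev v @ u) [] [])"
proof -
  let ?c = "Case 0 Skip (Push 1 False) (Case 0 Skip (Case 0 Skip (Push 1 True) Skip) Skip)"
  have "runs (While 0 ?c) (st (cw v) u [] []) (10 * length v + 1) (st [] (rev v @ u) [] [])"
  proof (induction v arbitrary: u)
    case Nil
    show ?case using runs_WhileF[of "st [False] u [] []" 0 "[]" ?c] by (simp add: cw_list)
  next
    case (Cons b v)
    have "runs ?c (st (cw b @ cw v) u [] []) 5 (st (cw v) (b # u) [] [])"
    proof (cases b)
      case True
      show ?thesis
        using runs_mono[OF runs_Case0T[OF runs_Case0F[OF runs_Case0F[OF runs_Push1[of True "cw v" u "[]" "[]"]]]], of 5]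
        by (simp add: True)
    next
      case False
      show ?thesis
        using runs_mono[OF runs_Case0F[OF runs_Push1[of False "cw v" u "[]" "[]"]], of 5] by (simp add: False)
    qed
    then have "runs (While 0 ?c) (st (cw (b # v)) u [] []) (Suc (5 + (10 * length v + 1))) (st [] (rev v @ b # u) [] [])"
      by (rule runs_WhileT'[of _ _ "cw b @ cw v", rotated 2, OF _ Cons.IH]) (auto simp: cw_list)
    then show ?case by (auto elim: runs_mono)
  qed
  then show ?thesis unfolding unbuild_list_def by (rule runs_mono) simp
qed

lemma length_sz_bools: "sz (w :: bool list) \<le> 4 * length w + 1"
proof (induction w)
  case (Cons b w)
  then show ?case using sz_bool[of b] by simp
qed simp

text \<open>The input is expected reversed on stack 1. This suits two callers: a deterministic
  machine, which gets there by one \<open>raw_move\<close>, and a guessing machine, which pushes its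
  word there symbol by symbol.\<close>

lemma PT_program:
  fixes F :: "bool list \<Rightarrow> bool list"
  assumes "PT F"
  obtains c and p :: "nat poly" where "below 4 c" "\<And>u. runs c (st [] u [] []) (poly p (length u)) (st (F (rev u)) [] [] [])"
proof -
  obtain c p where c: "below 4 c"
    "\<And>x r a. runs c (st (cw x @ r) a [] []) (poly p (sz x)) (st (cw (F x) @ r) a [] [])"
    "\<And>x. sz (F x) \<le> poly p (sz x)" by (rule PT_E[OF assms]) blast
  let ?c = "build_list ;; c ;; unbuild_list ;; raw_move 1"
  let ?q = "pcompose p [:1, 4:]"
  have "runs ?c (st [] u [] []) (poly ([:10, 20:] + ?q + 20 * ?q + 20) (length u)) (st (F (rev u)) [] [] [])" for u
  proof -
    have 1: "runs c (st (cw (rev u)) [] [] []) (poly p (sz (rev u))) (st (cw (F (rev u))) [] [] [])"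
      using c(2)[of "rev u" "[]" "[]"] by simp
    have 2: "runs unbuild_list (st (cw (F (rev u))) [] [] []) (10 * length (F (rev u)) + 10) (st [] (rev (F (rev u))) [] [])"
      using runs_unbuild_list[of "F (rev u)" "[]"] by simp
    have 3: "runs (raw_move 1) (st [] (rev (F (rev u))) [] []) (10 * length (F (rev u)) + 10) (st (F (rev u)) [] [] [])"
      using runs_raw_move[of 1 "rev (F (rev u))" "[]"] by (simp add: sti_def)
    have "poly p (sz (rev u)) \<le> poly ?q (length u)"
      using length_sz_bools[of u] by (simp add: poly_pcompose poly_mono_nat)
    moreover have "length (F (rev u)) \<le> poly p (sz (rev u))"
      using c(3)[of "rev u"] length_le_sz[of "F (rev u)"] by linarith
    ultimately show ?thesis
      by (intro runs_mono[OF runs_Seq[OF runs_build_list runs_Seq[OF 1 runs_Seq[OF 2 3]]]]) simp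
  qed
  moreover have "below 4 ?c"
    using c(1) by (simp add: build_list_def unbuild_list_def raw_move_def)
  ultimately show ?thesis using that by blast
qed

lemma tm_outputs_mono: "tm_outputs M w u t \<Longrightarrow> t \<le> t' \<Longrightarrow> tm_outputs M w u t'"
  unfolding tm_outputs_def using order_trans by blast

lemma PT_poly_time_computable:
  assumes "PT F"
  shows "poly_time_computable F"
proof -
  obtain c and p :: "nat poly" where c: "below 4 c"
      "\<And>u. runs c (st [] u [] []) (poly p (length u)) (st (F (rev u)) [] [] [])"
    using PT_program[OF assms] by blast
  let ?c = "raw_move 0 ;; c"
  have b: "below 4 ?c" using c(1) by (simp add: raw_move_def)
  have "tm_outputs (program_machine 4 ?c) w (F w) (poly ([:10, 10:] + p) (length w))" for w
  proof -
    have "runs (raw_move 0) (st w [] [] []) (10 * length w + 10) (st [] (rev w) [] [])"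
      using runs_raw_move[of 0 w "[]"] by (simp add: sti_def)
    from runs_Seq[OF this c(2)[of "rev w"]]
    obtain t where t: "t \<le> 10 * length w + 10 + poly p (length w)" "exec ?c (st w [] [] []) t (st (F w) [] [] [])"
      by (auto simp: runs_def)
    have "st w [] [] [] = (\<lambda>i. if i = 0 then w else [])" by (auto simp: st_def)
    with program_machine_correct(3)[OF b, of w t "st (F w) [] [] []"] t(2)
    have "tm_outputs (program_machine 4 ?c) w (F w) t" by simp
    then show ?thesis by (rule tm_outputs_mono) (use t(1) in simp)
  qed
  then show ?thesis
    unfolding poly_time_computable_def using program_machine_correct(1,2)[OF b] by (metis one_le_numeral)
qed

lemma PT_computable:
  assumes "PT G" "\<And>n. G (binary n) = binary (f n)"
  shows "computable f"
proof -
  obtain M and p :: "nat poly" where M: "turing_machine M" "deterministic M"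
    "\<And>w. tm_outputs M w (G w) (poly p (length w))"
    using PT_poly_time_computable[OF assms(1)] unfolding poly_time_computable_def by blast
  show ?thesis unfolding computable_def using M M(3)[of "binary _"] by (metis assms(2))
qed


section \<open>Guess and check\<close>

definition runs_bounded :: "machine \<Rightarrow> config \<Rightarrow> nat \<Rightarrow> bool" where
  "runs_bounded M c t \<longleftrightarrow> (\<forall>n c'. (tm_step M ^^ n) c c' \<longrightarrow> n \<le> t)"

definition accepts :: "machine \<Rightarrow> config \<Rightarrow> bool" where
  "accepts M c \<longleftrightarrow> (\<exists>n c'. (tm_step M ^^ n) c c' \<and> halted M c' \<and> fst c' = accept_state M)"

lemma runs_bounded_halted: "halted M c \<Longrightarrow> runs_bounded M c t"
  unfolding runs_bounded_def halted_def by (metis le0 relpowp_E2)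

lemma accepts_halted: "halted M c \<Longrightarrow> accepts M c \<longleftrightarrow> fst c = accept_state M"
  unfolding accepts_def halted_def by (metis relpowp_0_I relpowp_E2)

lemma runs_bounded_step:
  "(\<And>c'. tm_step M c c' \<Longrightarrow> runs_bounded M c' t) \<Longrightarrow> runs_bounded M c (Suc t)"
  unfolding runs_bounded_def by (metis Suc_le_mono le0 relpowp_E2)

lemma accepts_step:
  "tm_step M c d \<Longrightarrow> accepts M c \<longleftrightarrow> (\<exists>c'. tm_step M c c' \<and> accepts M c')"
proof -
  assume d: "tm_step M c d"
  show ?thesis
  proof
    assume "accepts M c"
    then obtain n c' where n: "(tm_step M ^^ n) c c'" "halted M c'" "fst c' = accept_state M"
      unfolding accepts_def by blast
    show "\<exists>c'. tm_step M c c' \<and> accepts M c'"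
    proof (cases n)
      case 0
      then have "c = c'" using n(1) by simp
      then show ?thesis using n(2) d unfolding halted_def by blast
    next
      case (Suc m)
      then obtain e where "tm_step M c e" "(tm_step M ^^ m) e c'"
        using n(1) relpowp_Suc_D2[of m "tm_step M" c c'] by blast
      then show ?thesis using n unfolding accepts_def by blast
    qed
  next
    assume "\<exists>c'. tm_step M c c' \<and> accepts M c'"
    then show "accepts M c" unfolding accepts_def by (meson relpowp_Suc_I2)
  qed
qed

lemma runs_bounded_mono: "runs_bounded M c t \<Longrightarrow> t \<le> t' \<Longrightarrow> runs_bounded M c t'"
  unfolding runs_bounded_def by (meson order_trans)

text \<open>
  Nondeterminism is confined to one state \<open>g\<close>; from any other state the machine behaves like the
  deterministic part \<open>J\<close>.
\<close>

lemma deterministic_part: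
  assumes "functional J" "\<And>x. (g, x) \<notin> J" "fst ` K \<subseteq> {g}"
    "(tm_step (local_machine k N s a J) ^^ t) c c'"
  shows "runs_bounded (local_machine k N s a (J \<union> K)) c' n \<Longrightarrow> runs_bounded (local_machine k N s a (J \<union> K)) c (t + n)"
    "accepts (local_machine k N s a (J \<union> K)) c \<longleftrightarrow> accepts (local_machine k N s a (J \<union> K)) c'"
proof -
  let ?M = "local_machine k N s a (J \<union> K)" and ?D = "local_machine k N s a J"
  have tr: "(q, m, q', b) \<in> transitions ?M \<longleftrightarrow> (q, m, q', b) \<in> transitions ?D" if "q \<noteq> g" for q m q' b
  proof -
    have "(q, x) \<notin> K" for x using that assms(3) by force
    then show ?thesis unfolding local_machine_transition_iff by blast
  qed
  have g: "fst c \<noteq> g" if "tm_step ?D c d" for c d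
    using that assms(2) unfolding tm_step_def local_machine_transition_iff by blast
  have same: "tm_step ?M c d' \<longleftrightarrow> tm_step ?D c d'" if "tm_step ?D c d" for c d d'
    using tr[OF g[OF that]] unfolding tm_step_def by blast
  have uniq: "d' = d" if "tm_step ?D c d" "tm_step ?D c d'" for c d d'
  proof -
    have "deterministic ?D" by (rule deterministic_local[OF assms(1)])
    then show ?thesis using that unfolding deterministic_def tm_step_def by (metis prod_eqI)
  qed
  have "(runs_bounded ?M c' n \<longrightarrow> runs_bounded ?M c (t + n)) \<and> accepts ?M c = accepts ?M c'"
    using assms(4)
  proof (induction t arbitrary: c)
    case (Suc t)
    obtain d where d: "tm_step ?D c d" "(tm_step ?D ^^ t) d c'"
      using relpowp_Suc_D2[OF Suc.prems] by blast
    have s: "tm_step ?M c d' \<longleftrightarrow> d' = d" for d'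
      using same[OF d(1)] uniq[OF d(1)] d(1) by blast
    have "accepts ?M c = accepts ?M d" using accepts_step[of ?M c d] unfolding s by simp
    moreover have "runs_bounded ?M d (t + n) \<Longrightarrow> runs_bounded ?M c (Suc t + n)"
      using runs_bounded_step[of ?M c "t + n"] s by simp
    ultimately show ?case using Suc.IH[OF d(2)] by simp
  qed simp
  then show "runs_bounded ?M c' n \<Longrightarrow> runs_bounded ?M c (t + n)" "accepts ?M c \<longleftrightarrow> accepts ?M c'"
    by blast+
qed

fun interleave :: "bool list \<Rightarrow> bool list \<Rightarrow> bool list" where
  "interleave (b # w) (g # u) = b # g # interleave w u"
| "interleave _ _ = []"

lemma length_interleave: "length u = length w \<Longrightarrow> length (interleave w u) = 2 * length w"
  by (induction w u rule: interleave.induct) auto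

lemma word_tape_Nil: "word_tape [] = (\<lambda>_. 0)"
  by (auto simp: word_tape_def)

lemma ntm_decides_iff:
  "ntm_decides M L T \<longleftrightarrow> (\<forall>w. runs_bounded M (init_config M w) (T (length w)) \<and> (w \<in> L \<longleftrightarrow> accepts M (init_config M w)))"
  by (simp add: ntm_decides_def runs_bounded_def accepts_def)

text \<open>The machine pops the input, pushes each bit and then a guessed one onto stack 1, and
  starts the checker, which expects its argument reversed there. Certificates as long as the input
  suffice later because a solution is a set of literals, and there are at most as many literals as
  input bits.\<close>

theorem in_NP_I:
  assumes "PT F" "\<And>u. F u = [True] \<or> F u = []"
    "\<And>w. w \<in> L \<longleftrightarrow> (\<exists>u. length u = length w \<and> F (interleave w u) = [True])"
  shows "in_NP L"
proof -
  obtain D and p :: "nat poly" where D: "below 4 D"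
      "\<And>u. runs D (st [] u [] []) (poly p (length u)) (st (F (rev u)) [] [] [])"
    using PT_program[OF assms(1)] by blast
  define P where "P b g = (Push 1 b ;; Push 1 g)" for b g
  have P: "below 4 (P b g)" for b g by (simp add: P_def)
  obtain s1 I1 n1 where 1: "comp (P False False) 1 3 = (s1, I1, n1)" by (cases "comp (P False False) 1 3")
  obtain s2 I2 n2 where 2: "comp (P False True) 1 n1 = (s2, I2, n2)" by (cases "comp (P False True) 1 n1")
  obtain s3 I3 n3 where 3: "comp (P True False) 1 n2 = (s3, I3, n3)" by (cases "comp (P True False) 1 n2")
  obtain s4 I4 n4 where 4: "comp (P True True) 1 n3 = (s4, I4, n4)" by (cases "comp (P True True) 1 n3")
  obtain s5 I5 n5 where 5: "comp D 0 n4 = (s5, I5, n5)" by (cases "comp D 0 n4")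
  note w1 = comp_within[OF 1 P] and w2 = comp_within[OF 2 P] and w3 = comp_within[OF 3 P]
    and w4 = comp_within[OF 4 P] and w5 = comp_within[OF 5 D(1)]
  have le: "3 \<le> n1" "n1 \<le> n2" "n2 \<le> n3" "n3 \<le> n4" "n4 \<le> n5" using w1 w2 w3 w4 w5 by auto
  \<comment> \<open>State 0 is the exit of the checker, state 1 the guessing state and start, state
    2 accepts. The single instruction of \<open>?A\<close> accepts if the checker has left a
    \<open>True\<close> on stack 0; on an empty result the machine halts in state 0.\<close>
  let ?A = "{(0, 0, 2, 2, Stay, 2)} :: instr set"
  let ?K = "{(1, 0, 0, 0, Stay, s5), (1, 0, 1, 0, MoveRight, s1), (1, 0, 1, 0, MoveRight, s2),
     (1, 0, 2, 0, MoveRight, s3), (1, 0, 2, 0, MoveRight, s4)} :: instr set"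
  define J where "J = (((((?A \<union> I1) \<union> I2) \<union> I3) \<union> I4) \<union> I5)"
  have i0: "instrs_within 4 {0..<3} {..<n5} ?A" using le by (auto simp: instrs_within_def)
  have i1: "instrs_within 4 {3..<n1} {..<n5} I1"
    by (rule instrs_within_mono[OF w1[THEN conjunct2, THEN conjunct2, THEN conjunct1]]) (use le in auto)
  have i2: "instrs_within 4 {n1..<n2} {..<n5} I2"
    by (rule instrs_within_mono[OF w2[THEN conjunct2, THEN conjunct2, THEN conjunct1]]) (use le in auto)
  have i3: "instrs_within 4 {n2..<n3} {..<n5} I3"
    by (rule instrs_within_mono[OF w3[THEN conjunct2, THEN conjunct2, THEN conjunct1]]) (use le in auto)
  have i4: "instrs_within 4 {n3..<n4} {..<n5} I4"
    by (rule instrs_within_mono[OF w4[THEN conjunct2, THEN conjunct2, THEN conjunct1]]) (use le in auto)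
  have i5: "instrs_within 4 {n4..<n5} {..<n5} I5"
    by (rule instrs_within_mono[OF w5[THEN conjunct2, THEN conjunct2, THEN conjunct1]]) (use le in auto)
  have j: "instrs_within 4 ({0..<3} \<union> {3..<n1}) {..<n5} (?A \<union> I1)"
      "instrs_within 4 ({0..<3} \<union> {3..<n1} \<union> {n1..<n2}) {..<n5} ((?A \<union> I1) \<union> I2)"
      "instrs_within 4 ({0..<3} \<union> {3..<n1} \<union> {n1..<n2} \<union> {n2..<n3}) {..<n5} (((?A \<union> I1) \<union> I2) \<union> I3)"
      "instrs_within 4 ({0..<3} \<union> {3..<n1} \<union> {n1..<n2} \<union> {n2..<n3} \<union> {n3..<n4}) {..<n5} ((((?A \<union> I1) \<union> I2) \<union> I3) \<union> I4)"
    unfolding instrs_within_Un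
    by (intro conjI instrs_within_mono[OF i0] instrs_within_mono[OF i1] instrs_within_mono[OF i2]
        instrs_within_mono[OF i3] instrs_within_mono[OF i4]; auto)+
  have f: "functional ?A" "functional I1" "functional I2" "functional I3" "functional I4" "functional I5"
    using w1 w2 w3 w4 w5 by (simp_all add: functional_def[of ?A])
  have fJ: "functional J" unfolding J_def
    by (intro functional_Un[OF _ f(6) j(4) i5] functional_Un[OF _ f(5) j(3) i4] functional_Un[OF _ f(4) j(2) i3]
        functional_Un[OF _ f(3) j(1) i2] functional_Un[OF f(1,2) i0 i1]) (use le in auto)
  have wJ: "instrs_within 4 {..<n5} {..<n5} J"
    unfolding J_def instrs_within_Un
    by (intro conjI instrs_within_mono[OF i0] instrs_within_mono[OF i1] instrs_within_mono[OF i2]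
        instrs_within_mono[OF i3] instrs_within_mono[OF i4] instrs_within_mono[OF i5]) (use le in auto)
  have s: "s1 < n5" "s2 < n5" "s3 < n5" "s4 < n5" "s5 < n5" using w1 w2 w3 w4 w5 le by auto
  have wJK: "instrs_within 4 {..<n5} {..<n5} (J \<union> ?K)"
    using wJ s le unfolding instrs_within_Un by (auto simp: instrs_within_def)
  have low: "(q, r, y, z, d, q') \<in> ?A" if "(q, r, y, z, d, q') \<in> J" "q < 3" for q r y z d q'
  proof -
    have "(q, r, y, z, d, q') \<notin> I1" "(q, r, y, z, d, q') \<notin> I2" "(q, r, y, z, d, q') \<notin> I3"
      "(q, r, y, z, d, q') \<notin> I4" "(q, r, y, z, d, q') \<notin> I5"
      using instrs_withinD(1)[OF i1, of q r y z d q'] instrs_withinD(1)[OF i2, of q r y z d q']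
        instrs_withinD(1)[OF i3, of q r y z d q'] instrs_withinD(1)[OF i4, of q r y z d q']
        instrs_withinD(1)[OF i5, of q r y z d q'] that(2) le by auto
    then show ?thesis using that(1) by (simp add: J_def)
  qed
  have g: "(1, x) \<notin> J" for x
    using low[of 1] by (cases x) auto
  let ?M = "local_machine 4 n5 1 2 (J \<union> ?K)"
  let ?D = "local_machine 4 n5 1 2 J"
  have K: "fst ` ?K \<subseteq> {1}" by simp
  note det = deterministic_part[where J = J and g = 1 and K = ?K and k = 4 and N = n5 and s = 1 and a = 2, OF fJ g K]
  have push: "(tm_step ?D ^^ 4) (q, tapes_of 4 (st w u [] [])) (1, tapes_of 4 (st w (g # b # u) [] []))"
    if "(b, g, q) \<in> {(False, False, s1), (False, True, s2), (True, False, s3), (True, True, s4)}" for b g q w u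
  proof -
    have e: "exec (P b g) (st w u [] []) 4 (st w (g # b # u) [] [])"
      using exec.Seq[OF exec.Push[of 1 b "st w u [] []"] exec.Push[of 1 g]] by (simp add: P_def)
    have "I1 \<subseteq> J" "I2 \<subseteq> J" "I3 \<subseteq> J" "I4 \<subseteq> J" by (auto simp: J_def)
    note sub = this
    from that consider (ff) "\<not> b" "\<not> g" "q = s1" | (ft) "\<not> b" "g" "q = s2" | (tf) "b" "\<not> g" "q = s3" | (tt) "b" "g" "q = s4"
      by auto
    then show ?thesis
    proof cases
      case ff
      then show ?thesis using comp_correct[OF _ 1 sub(1) P wJ] e by simp
    next
      case ft
      then show ?thesis using comp_correct[OF _ 2 sub(2) P wJ] e by simp
    next
      case tf
      then show ?thesis using comp_correct[OF _ 3 sub(3) P wJ] e by simp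
    next
      case tt
      then show ?thesis using comp_correct[OF _ 4 sub(4) P wJ] e by simp
    qed
  qed
  have check: "runs_bounded ?M (s5, tapes_of 4 (st [] u [] [])) (poly p (length u) + 1) \<and>
     accepts ?M (s5, tapes_of 4 (st [] u [] [])) = (F (rev u) = [True])" for u
  proof -
    obtain t where t: "t \<le> poly p (length u)" "exec D (st [] u [] []) t (st (F (rev u)) [] [] [])"
      using D(2)[of u] by (auto simp: runs_def)
    let ?c = "(0, tapes_of 4 (st (F (rev u)) [] [] []))"
    have J5: "I5 \<subseteq> J" by (auto simp: J_def)
    note d = det[OF comp_correct[OF t(2) 5 J5 D(1) wJ]]
    have st0: "tm_step ?M (q, tapes_of 4 z) c' \<longleftrightarrow> (\<exists>r x y d q'. (q, r, x, y, d, q') \<in> J \<union> ?K \<and>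
        (tapes_of 4 z ! r) 0 = x \<and> c' = (q', (tapes_of 4 z)[r := shift d ((tapes_of 4 z ! r)(0 := y))]))" for q z c'
      by (rule local_machine_step_iff[OF length_tapes_of tapes_of_less_3 wJK])
    have "(0, 0, 2, 2, Stay, 2) \<in> J" by (simp add: J_def)
    then have at0: "(0, r, x, y, d, q') \<in> J \<union> ?K \<longleftrightarrow> (r, x, y, d, q') = (0, 2, 2, Stay, 2)" for r x y d q'
      using low[of 0 r x y d q'] by auto
    have at2: "(2, r, x, y, d, q') \<notin> J \<union> ?K" for r x y d q'
      using low[of 2 r x y d q'] by auto
    have h2: "halted ?M (2, tapes_of 4 z)" for z
      unfolding halted_def st0 using at2 by blast
    have "runs_bounded ?M ?c 1 \<and> accepts ?M ?c = (F (rev u) = [True])"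
    proof (cases "F (rev u) = [True]")
      case True
      have s: "tm_step ?M ?c c' \<longleftrightarrow> c' = (2, tapes_of 4 (st [True] [] [] []))" for c'
        unfolding st0 at0 True
        using word_tape_0(2)[of True "[]"] fun_upd_triv[of "word_tape [True]" 0] tapes_of_update[of 0 4 "st [True] [] [] []" "[True]"]
        by (auto simp: tapes_of_nth sym_def)
      show ?thesis
        using runs_bounded_step[of ?M ?c 0] accepts_step[of ?M ?c "(2, tapes_of 4 (st [True] [] [] []))"]
          s h2 runs_bounded_halted accepts_halted True by auto
    next
      case False
      then have "F (rev u) = []" using assms(2) by blast
      then have "halted ?M ?c" unfolding halted_def st0 at0 by (auto simp: tapes_of_nth word_tape_0)
      then show ?thesis using runs_bounded_halted accepts_halted False by auto
    qed
    then show ?thesis using d(1)[of 1] d(2) t(1) by (auto elim: runs_bounded_mono)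
  qed
  have at1: "(1, r, x, y, d, q') \<in> J \<union> ?K \<longleftrightarrow> r = 0 \<and> (1, 0, x, y, d, q') \<in> ?K" for r x y d q'
    using g by auto
  have st1: "tm_step ?M (1, tapes_of 4 z) c' \<longleftrightarrow> (\<exists>y d q'. (1, 0, word_tape (z 0) 0, y, d, q') \<in> ?K \<and>
      c' = (q', (tapes_of 4 z)[0 := shift d ((word_tape (z 0))(0 := y))]))" for z c'
    unfolding local_machine_step_iff[OF length_tapes_of tapes_of_less_3 wJK] at1
    by (auto simp: tapes_of_nth simp del: insert_iff)
  \<comment> \<open>\<open>u\<close> is the reversed interleaving produced so far. Each input bit
    costs one guessing step and four steps for two pushes; the constant 2 pays for starting the
    checker and for the accepting step.\<close>
  have main: "runs_bounded ?M (1, tapes_of 4 (st w u [] [])) (5 * length w + 2 + poly p (length u + 2 * length w)) \<and>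
     accepts ?M (1, tapes_of 4 (st w u [] [])) = (\<exists>v. length v = length w \<and> F (rev u @ interleave w v) = [True])" for w u
  proof (induction w arbitrary: u)
    case Nil
    have s: "tm_step ?M (1, tapes_of 4 (st [] u [] [])) c' \<longleftrightarrow> c' = (s5, tapes_of 4 (st [] u [] []))" for c'
    proof -
      have e: "(tapes_of 4 (st [] u [] []))[0 := shift Stay ((word_tape [])(0 := 0))] = tapes_of 4 (st [] u [] [])"
        using tapes_of_update[of 0 4 "st [] u [] []" "[]"] fun_upd_triv[of "word_tape []" 0] by (simp add: word_tape_0)
      have "(1, 0, word_tape [] 0, y, d, q') \<in> ?K \<longleftrightarrow> y = 0 \<and> d = Stay \<and> q' = s5" for y d q'
        by (auto simp: word_tape_0)
      then show ?thesis unfolding st1 using e by auto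
    qed
    show ?case
      using check[of u] s accepts_step[of ?M "(1, tapes_of 4 (st [] u [] []))" "(s5, tapes_of 4 (st [] u [] []))"]
        runs_bounded_step[of ?M "(1, tapes_of 4 (st [] u [] []))" "poly p (length u) + 1"] by auto
  next
    case (Cons b w)
    let ?c = "(1, tapes_of 4 (st (b # w) u [] []))"
    let ?n = "\<lambda>g. (1, tapes_of 4 (st w (g # b # u) [] []))"
    let ?s = "\<lambda>g. if b then if g then s4 else s3 else if g then s2 else s1"
    have s: "tm_step ?M ?c c' \<longleftrightarrow> (\<exists>g. c' = (?s g, tapes_of 4 (st w u [] [])))" for c'
    proof -
      have p: "(tapes_of 4 (st (b # w) u [] []))[0 := shift MoveRight ((word_tape (b # w))(0 := 0))] = tapes_of 4 (st w u [] [])"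
        unfolding word_tape_pop using tapes_of_update[of 0 4 "st (b # w) u [] []" w] by simp
      have "(1, 0, word_tape (b # w) 0, y, d, q') \<in> ?K \<longleftrightarrow> y = 0 \<and> d = MoveRight \<and> (\<exists>g. q' = ?s g)" for y d q'
        by (cases b) (auto simp: word_tape_0 sym_def ex_bool_eq)
      then show ?thesis unfolding st1 using p by auto
    qed
    have "(b, g, ?s g) \<in> {(False, False, s1), (False, True, s2), (True, False, s3), (True, True, s4)}" for g
      by auto
    note d = det[OF push[OF this]]
    have ih: "runs_bounded ?M (?n g) (5 * length w + 2 + poly p (length u + 2 * length (b # w)))"
      "accepts ?M (?n g) \<longleftrightarrow> (\<exists>v. length v = length w \<and> F (rev u @ b # g # interleave w v) = [True])" for g
      using Cons.IH[of "g # b # u"] by auto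
    have "runs_bounded ?M ?c (Suc (4 + (5 * length w + 2 + poly p (length u + 2 * length (b # w)))))"
    proof (rule runs_bounded_step)
      fix c' assume "tm_step ?M ?c c'"
      then obtain g where c': "c' = (?s g, tapes_of 4 (st w u [] []))" unfolding s by blast
      show "runs_bounded ?M c' (4 + (5 * length w + 2 + poly p (length u + 2 * length (b # w))))"
        unfolding c' by (rule d(1)[OF ih(1)])
    qed
    then have 1: "runs_bounded ?M ?c (5 * length (b # w) + 2 + poly p (length u + 2 * length (b # w)))"
      by (rule runs_bounded_mono) simp
    have "accepts ?M ?c \<longleftrightarrow> (\<exists>g. accepts ?M (?n g))"
    proof -
      have "tm_step ?M ?c (?s True, tapes_of 4 (st w u [] []))" unfolding s by blast
      from accepts_step[OF this] show ?thesis unfolding s d(2)[symmetric] by blast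
    qed
    also have "\<dots> \<longleftrightarrow> (\<exists>g v. length v = length w \<and> F (rev u @ b # g # interleave w v) = [True])"
      using ih(2) by blast
    also have "\<dots> \<longleftrightarrow> (\<exists>v. length v = length (b # w) \<and> F (rev u @ interleave (b # w) v) = [True])"
    proof
      assume "\<exists>g v. length v = length w \<and> F (rev u @ b # g # interleave w v) = [True]"
      then obtain g v where "length v = length w" "F (rev u @ b # g # interleave w v) = [True]" by blast
      then show "\<exists>v. length v = length (b # w) \<and> F (rev u @ interleave (b # w) v) = [True]"
        by (intro exI[of _ "g # v"]) simp
    next
      assume "\<exists>v. length v = length (b # w) \<and> F (rev u @ interleave (b # w) v) = [True]"
      then obtain v where v: "length v = length (b # w)" "F (rev u @ interleave (b # w) v) = [True]" by blast
      then obtain g v' where "v = g # v'" by (cases v) auto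
      then show "\<exists>g v. length v = length w \<and> F (rev u @ b # g # interleave w v) = [True]" using v by auto
    qed
    finally show ?case using 1 by blast
  qed
  have i: "init_config ?M w = (1, tapes_of 4 (st w [] [] []))" for w
    by (simp add: init_config_def tapes_of_def st_def numeral_eq_Suc word_tape_Nil)
  have "ntm_decides ?M L (\<lambda>n. poly ([:2, 5:] + pcompose p [:0, 2:]) n)"
    unfolding ntm_decides_iff i
  proof (intro allI conjI)
    fix w
    show "runs_bounded ?M (1, tapes_of 4 (st w [] [] [])) (poly ([:2, 5:] + pcompose p [:0, 2:]) (length w))"
      using main[of w "[]"] by (elim conjE runs_bounded_mono) (simp add: poly_pcompose mult_2 mult_2_right)
    show "w \<in> L \<longleftrightarrow> accepts ?M (1, tapes_of 4 (st w [] [] []))"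
      using main[of w "[]"] assms(3)[of w] by simp
  qed
  moreover have "turing_machine ?M"
    by (rule turing_machine_local[OF wJK]) (use le in auto)
  ultimately show ?thesis unfolding in_NP_def by blast
qed

section \<open>Sequential composition of machines\<close>

text \<open>Hand-over transitions in \<open>seq_machine\<close> and idle loops in
  \<open>loop_transitions\<close> exist for legal symbols only, so legality has to be preserved
  along runs.\<close>

definition wf_tapes :: "machine \<Rightarrow> tape list \<Rightarrow> bool" where
  "wf_tapes M ts \<longleftrightarrow> length ts = num_tapes M \<and> (\<forall>t\<in>set ts. \<forall>z. t z < num_symbols M)"

lemma shift_less: "(\<And>z. t z < n) \<Longrightarrow> shift d t z < n"
  by (cases d) auto

lemma wf_tapes_step:
  assumes "turing_machine M" "wf_tapes M ts" "tm_step M (q, ts) (q', ts')"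
  shows "wf_tapes M ts'" "q < num_states M" "q' < num_states M"
proof -
  obtain a where a: "(q, map (\<lambda>t. t 0) ts, q', a) \<in> transitions M"
    "ts' = map2 (\<lambda>t (b, d). shift d (t(0 := b))) ts a"
    using assms(3) by (auto simp: tm_step_def)
  have t: "q < num_states M" "q' < num_states M" "length a = num_tapes M" "\<forall>(b, d)\<in>set a. b < num_symbols M"
    using assms(1) a(1) by (auto simp: turing_machine_def)
  then show "q < num_states M" "q' < num_states M" by auto
  have "t' z < num_symbols M" if t': "t' \<in> set ts'" for t' z
  proof -
    obtain i where i: "i < length ts" "i < length a" "t' = (case a ! i of (b, d) \<Rightarrow> shift d ((ts ! i)(0 := b)))"
      using t' unfolding a(2) by (auto simp: in_set_conv_nth split_beta)
    obtain b d where bd: "a ! i = (b, d)" by (cases "a ! i")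
    have b: "b < num_symbols M" using t(4) nth_mem[OF i(2)] bd by auto
    have "(ts ! i) z < num_symbols M" for z using assms(2) i(1) by (auto simp: wf_tapes_def)
    then show ?thesis unfolding i(3) bd using b by (auto intro!: shift_less)
  qed
  then show "wf_tapes M ts'"
    using assms(2) t(3) a(2) by (auto simp: wf_tapes_def)
qed

lemma wf_tapes_init:
  assumes "turing_machine M"
  shows "wf_tapes M (snd (init_config M w))"
proof -
  have "word_tape w z < num_symbols M" for z
    using assms word_tape_less_3[of w z] by (simp add: turing_machine_def)
  then show ?thesis using assms by (auto simp: wf_tapes_def init_config_def turing_machine_def)
qed

lemma wf_tapes_steps:
  assumes "turing_machine M" "(tm_step M ^^ n) (q, ts) (q', ts')" "wf_tapes M ts" "q < num_states M"
  shows "wf_tapes M ts' \<and> q' < num_states M"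
  using assms(2)
proof (induction n arbitrary: q' ts')
  case (Suc n)
  then obtain p us where "(tm_step M ^^ n) (q, ts) (p, us)" "tm_step M (p, us) (q', ts')" by auto
  with Suc.IH wf_tapes_step[OF assms(1)] show ?case by blast
qed (use assms in simp)

definition idle :: "nat list \<Rightarrow> (nat \<times> move) list" where
  "idle m = map (\<lambda>b. (b, Stay)) m"

lemma idle_step: "map2 (\<lambda>t (b, d). shift d (t(0 := b))) ts (idle (map (\<lambda>t. t 0) ts)) = ts"
  by (rule nth_equalityI) (auto simp: idle_def)

lemma length_idle [simp]: "length (idle m) = length m"
  by (simp add: idle_def)

text \<open>Tape 0 is shared, so that the output of \<open>M1\<close> is the input of
  \<open>M2\<close>. The other tapes are kept apart, as \<open>M1\<close> may leave anything on its
  own. Halting is the absence of a transition, so the hand-over consists of a transition for exactly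
  those situations in which \<open>M1\<close> has none.\<close>

definition seq_machine :: "machine \<Rightarrow> machine \<Rightarrow> machine" where
  "seq_machine M1 M2 = (let S = max (num_symbols M1) (num_symbols M2); N = num_states M1 in
     \<lparr>num_tapes = num_tapes M1 + (num_tapes M2 - 1), num_states = N + num_states M2, num_symbols = S,
      start_state = start_state M1, accept_state = N + accept_state M2,
      transitions =
        {(q, r @ m, q', a @ idle m) | q r q' a m.
           (q, r, q', a) \<in> transitions M1 \<and> length m = num_tapes M2 - 1 \<and> set m \<subseteq> {..<S}} \<union>
        {(q, r @ m, N + start_state M2, idle (r @ m)) | q r m. q < N \<and> (\<nexists>q' a. (q, r, q', a) \<in> transitions M1) \<and>
           length r = num_tapes M1 \<and> set r \<subseteq> {..<S} \<and> length m = num_tapes M2 - 1 \<and> set m \<subseteq> {..<S}} \<union>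
        {(N + q, x # m @ r, N + q', hd a # idle m @ tl a) | q x r q' a m. (q, x # r, q', a) \<in> transitions M2 \<and>
           length m = num_tapes M1 - 1 \<and> set m \<subseteq> {..<S}}\<rparr>)"

lemma seq_machine_simps:
  "num_tapes (seq_machine M1 M2) = num_tapes M1 + (num_tapes M2 - 1)"
  "num_states (seq_machine M1 M2) = num_states M1 + num_states M2"
  "num_symbols (seq_machine M1 M2) = max (num_symbols M1) (num_symbols M2)"
  "start_state (seq_machine M1 M2) = start_state M1"
  "accept_state (seq_machine M1 M2) = num_states M1 + accept_state M2"
  by (simp_all add: seq_machine_def Let_def)

lemma seq_machine_trans:
  "(p, s, p', b) \<in> transitions (seq_machine M1 M2) \<longleftrightarrow>
     (\<exists>r a m. s = r @ m \<and> b = a @ idle m \<and> (p, r, p', a) \<in> transitions M1 \<and> length m = num_tapes M2 - 1 \<and>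
        set m \<subseteq> {..<max (num_symbols M1) (num_symbols M2)}) \<or>
     (\<exists>r m. s = r @ m \<and> p' = num_states M1 + start_state M2 \<and> b = idle (r @ m) \<and> p < num_states M1 \<and>
        (\<nexists>q' a. (p, r, q', a) \<in> transitions M1) \<and> length r = num_tapes M1 \<and>
        set r \<subseteq> {..<max (num_symbols M1) (num_symbols M2)} \<and> length m = num_tapes M2 - 1 \<and>
        set m \<subseteq> {..<max (num_symbols M1) (num_symbols M2)}) \<or>
     (\<exists>q x r q' a m. p = num_states M1 + q \<and> s = x # m @ r \<and> p' = num_states M1 + q' \<and> b = hd a # idle m @ tl a \<and>
        (q, x # r, q', a) \<in> transitions M2 \<and> length m = num_tapes M1 - 1 \<and>
        set m \<subseteq> {..<max (num_symbols M1) (num_symbols M2)})"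
  by (simp add: seq_machine_def Let_def)

lemma turing_machineD:
  assumes "turing_machine M"
  shows "1 \<le> num_tapes M" "3 \<le> num_symbols M" "start_state M < num_states M" "accept_state M < num_states M"
    "(q, r, q', a) \<in> transitions M \<Longrightarrow> q < num_states M \<and> q' < num_states M \<and>
        length r = num_tapes M \<and> set r \<subseteq> {..<num_symbols M} \<and>
        length a = num_tapes M \<and> fst ` set a \<subseteq> {..<num_symbols M}"
proof -
  show "1 \<le> num_tapes M" "3 \<le> num_symbols M" "start_state M < num_states M" "accept_state M < num_states M"
    using assms unfolding turing_machine_def by auto
  have "\<forall>(q, r, q', a) \<in> transitions M. q < num_states M \<and> q' < num_states M \<and>
        length r = num_tapes M \<and> (\<forall>b\<in>set r. b < num_symbols M) \<and>
        length a = num_tapes M \<and> (\<forall>(b, d)\<in>set a. b < num_symbols M)"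
    using assms unfolding turing_machine_def by (elim conjE)
  moreover assume "(q, r, q', a) \<in> transitions M"
  ultimately have "case (q, r, q', a) of (q, r, q', a) \<Rightarrow> q < num_states M \<and> q' < num_states M \<and>
        length r = num_tapes M \<and> (\<forall>b\<in>set r. b < num_symbols M) \<and>
        length a = num_tapes M \<and> (\<forall>(b, d)\<in>set a. b < num_symbols M)"
    by (rule bspec)
  then show "q < num_states M \<and> q' < num_states M \<and>
        length r = num_tapes M \<and> set r \<subseteq> {..<num_symbols M} \<and>
        length a = num_tapes M \<and> fst ` set a \<subseteq> {..<num_symbols M}"
    by auto
qed

lemma turing_machineI:
  assumes "1 \<le> num_tapes M" "3 \<le> num_symbols M" "start_state M < num_states M" "accept_state M < num_states M"
    "\<And>q r q' a. (q, r, q', a) \<in> transitions M \<Longrightarrow> q < num_states M \<and> q' < num_states M \<and>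
        length r = num_tapes M \<and> set r \<subseteq> {..<num_symbols M} \<and>
        length a = num_tapes M \<and> fst ` set a \<subseteq> {..<num_symbols M}"
  shows "turing_machine M"
proof -
  have "case t of (q, r, q', a) \<Rightarrow> q < num_states M \<and> q' < num_states M \<and>
        length r = num_tapes M \<and> (\<forall>b\<in>set r. b < num_symbols M) \<and>
        length a = num_tapes M \<and> (\<forall>(b, d)\<in>set a. b < num_symbols M)" if t: "t \<in> transitions M" for t
  proof -
    obtain q r q' a where eq: "t = (q, r, q', a)" by (cases t)
    show ?thesis using assms(5)[OF t[unfolded eq]] unfolding eq by auto
  qed
  then show ?thesis using assms(1-4) unfolding turing_machine_def by (intro conjI ballI)
qed

lemma idle_symbols: "fst ` set (idle m) = set m"
  by (force simp: idle_def)

lemma turing_machine_seq: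
  assumes "turing_machine M1" "turing_machine M2"
  shows "turing_machine (seq_machine M1 M2)"
proof (rule turing_machineI)
  note D1 = turing_machineD[OF assms(1)] and D2 = turing_machineD[OF assms(2)]
  let ?S = "max (num_symbols M1) (num_symbols M2)"
  fix p s p' b
  assume "(p, s, p', b) \<in> transitions (seq_machine M1 M2)"
  then show "p < num_states (seq_machine M1 M2) \<and> p' < num_states (seq_machine M1 M2) \<and>
        length s = num_tapes (seq_machine M1 M2) \<and> set s \<subseteq> {..<num_symbols (seq_machine M1 M2)} \<and>
        length b = num_tapes (seq_machine M1 M2) \<and> fst ` set b \<subseteq> {..<num_symbols (seq_machine M1 M2)}"
    unfolding seq_machine_trans
  proof (elim disjE exE conjE, goal_cases)
    case (1 r a m)
    with D1(5)[OF 1(3)] show ?case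
      by (auto simp: seq_machine_simps image_Un idle_symbols)
  next
    case (2 r m)
    have "fst ` set b = set r \<union> set m" unfolding 2(3) idle_symbols by simp
    with 2 D2(3) show ?case by (simp add: seq_machine_simps)
  next
    case (3 q x r q' a m)
    obtain y a' where a: "a = y # a'" using D2(5)[OF 3(5)] D2(1) by (cases a) auto
    have "fst ` set b = insert (fst y) (set m \<union> fst ` set a')" unfolding 3(4) a by (auto simp: image_Un idle_symbols)
    with 3 D2(5)[OF 3(5)] D1(1) show ?case unfolding a
      by (auto simp: seq_machine_simps less_max_iff_disj)
  qed
qed (use turing_machineD[OF assms(1)] turing_machineD[OF assms(2)] in \<open>auto simp: seq_machine_simps\<close>)

lemma deterministic_seq:
  assumes "turing_machine M1" "turing_machine M2" "deterministic M1" "deterministic M2"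
  shows "deterministic (seq_machine M1 M2)"
  unfolding deterministic_def
proof (intro allI impI)
  note D1 = turing_machineD(5)[OF assms(1)] and D2 = turing_machineD(5)[OF assms(2)]
  fix p s p1 b1 p2 b2
  assume 1: "(p, s, p1, b1) \<in> transitions (seq_machine M1 M2)"
    and 2: "(p, s, p2, b2) \<in> transitions (seq_machine M1 M2)"
  show "p1 = p2 \<and> b1 = b2"
  proof (cases "p < num_states M1")
    case True
    let ?r = "take (num_tapes M1) s" and ?m = "drop (num_tapes M1) s"
    have *: "(\<exists>a. (p, ?r, p', a) \<in> transitions M1 \<and> b = a @ idle ?m) \<or>
        (\<nexists>q' a. (p, ?r, q', a) \<in> transitions M1) \<and> p' = num_states M1 + start_state M2 \<and> b = idle (?r @ ?m)"
      if "(p, s, p', b) \<in> transitions (seq_machine M1 M2)" for p' b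
      using that unfolding seq_machine_trans
    proof (elim disjE exE conjE, goal_cases)
      case (1 r a m)
      with D1[OF 1(3)] show ?case by auto
    next
      case (2 r m)
      then show ?case by auto
    next
      case (3 q x r q' a m)
      then show ?case using True by simp
    qed
    from *[OF 1] *[OF 2] show ?thesis
      using assms(3) unfolding deterministic_def by metis
  next
    case False
    have *: "\<exists>q' a. (p - num_states M1, hd s # drop (num_tapes M1) s, q', a) \<in> transitions M2 \<and> p' = num_states M1 + q' \<and>
        b = hd a # idle (take (num_tapes M1 - 1) (tl s)) @ tl a"
      if "(p, s, p', b) \<in> transitions (seq_machine M1 M2)" for p' b
      using that unfolding seq_machine_trans
    proof (elim disjE exE conjE, goal_cases)
      case (1 r a m)
      with D1[OF 1(3)] False show ?case by auto
    next
      case (2 r m)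
      then show ?case using False by auto
    next
      case (3 q x r q' a m)
      then have "drop (num_tapes M1) s = r"
        using turing_machineD(1)[OF assms(1)] by (simp add: drop_Cons')
      with 3 show ?case by auto
    qed
    from *[OF 1] *[OF 2] show ?thesis
      using assms(4) unfolding deterministic_def by metis
  qed
qed

lemma seq_step_first:
  assumes "tm_step M1 (q, ts) (q', ts')" "wf_tapes M1 ts" "length us = num_tapes M2 - 1"
    "\<forall>u\<in>set us. u 0 < num_symbols M2" "turing_machine M1"
  shows "tm_step (seq_machine M1 M2) (q, ts @ us) (q', ts' @ us)"
proof -
  obtain a where a: "(q, map (\<lambda>t. t 0) ts, q', a) \<in> transitions M1"
    "ts' = map2 (\<lambda>t (b, d). shift d (t(0 := b))) ts a"
    using assms(1) by (auto simp: tm_step_def)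
  have l: "length ts = length a"
    using turing_machineD(5)[OF assms(5) a(1)] by simp
  have "(q, map (\<lambda>t. t 0) (ts @ us), q', a @ idle (map (\<lambda>t. t 0) us)) \<in> transitions (seq_machine M1 M2)"
    unfolding seq_machine_trans using a(1) assms(3,4)
    by (intro disjI1 exI[of _ "map (\<lambda>t. t 0) ts"] exI[of _ a] exI[of _ "map (\<lambda>t. t 0) us"]) (auto simp: less_max_iff_disj)
  moreover have "ts' @ us = map2 (\<lambda>t (b, d). shift d (t(0 := b))) (ts @ us) (a @ idle (map (\<lambda>t. t 0) us))"
    using l by (simp add: a(2) zip_append idle_step)
  ultimately show ?thesis unfolding tm_step_def fst_conv snd_conv by blast
qed

lemma seq_step_middle:
  assumes "halted M1 (q, ts)" "wf_tapes M1 ts" "length us = num_tapes M2 - 1"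
    "\<forall>u\<in>set us. u 0 < num_symbols M2" "q < num_states M1"
  shows "tm_step (seq_machine M1 M2) (q, ts @ us) (num_states M1 + start_state M2, ts @ us)"
proof -
  have n: "(q, map (\<lambda>t. t 0) ts, q', a) \<notin> transitions M1" for q' a
  proof
    assume "(q, map (\<lambda>t. t 0) ts, q', a) \<in> transitions M1"
    then have "tm_step M1 (q, ts) (q', map2 (\<lambda>t (b, d). shift d (t(0 := b))) ts a)"
      by (auto simp: tm_step_def)
    then show False using assms(1) unfolding halted_def by blast
  qed
  have "(q, map (\<lambda>t. t 0) (ts @ us), num_states M1 + start_state M2, idle (map (\<lambda>t. t 0) (ts @ us))) \<in> transitions (seq_machine M1 M2)"
    unfolding seq_machine_trans using assms n
    by (intro disjI2 disjI1 exI[of _ "map (\<lambda>t. t 0) ts"] exI[of _ "map (\<lambda>t. t 0) us"])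
      (auto simp: wf_tapes_def less_max_iff_disj)
  then show ?thesis
    unfolding tm_step_def fst_conv snd_conv using idle_step[of "ts @ us"] by metis
qed

lemma seq_step_second:
  assumes "tm_step M2 (q, t # ts) (q', t' # ts')" "length us = num_tapes M1 - 1"
    "\<forall>u\<in>set us. u 0 < num_symbols M1"
  shows "tm_step (seq_machine M1 M2) (num_states M1 + q, t # us @ ts) (num_states M1 + q', t' # us @ ts')"
proof -
  obtain a where a: "(q, map (\<lambda>t. t 0) (t # ts), q', a) \<in> transitions M2"
    "t' # ts' = map2 (\<lambda>t (b, d). shift d (t(0 := b))) (t # ts) a"
    using assms(1) by (auto simp: tm_step_def)
  obtain y a' where y: "a = y # a'" using a(2) by (cases a) auto
  have "(num_states M1 + q, map (\<lambda>t. t 0) (t # us @ ts), num_states M1 + q', y # idle (map (\<lambda>t. t 0) us) @ a') \<in> transitions (seq_machine M1 M2)"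
    unfolding seq_machine_trans using a(1) assms(2,3)
    by (intro disjI2 exI[of _ q] exI[of _ "t 0"] exI[of _ "map (\<lambda>t. t 0) ts"] exI[of _ q'] exI[of _ a]
        exI[of _ "map (\<lambda>t. t 0) us"]) (auto simp: y less_max_iff_disj)
  moreover have "t' # us @ ts' = map2 (\<lambda>t (b, d). shift d (t(0 := b))) (t # us @ ts) (y # idle (map (\<lambda>t. t 0) us) @ a')"
    using a(2) by (simp add: y zip_append idle_step)
  ultimately show ?thesis unfolding tm_step_def fst_conv snd_conv by - (rule exI, rule conjI)
qed

lemma seq_halted_second:
  assumes "halted M2 (q, t # ts)" "length us = num_tapes M1 - 1" "turing_machine M1"
  shows "halted (seq_machine M1 M2) (num_states M1 + q, t # us @ ts)"
proof -
  have n: "(q, map (\<lambda>t. t 0) (t # ts), q', a) \<notin> transitions M2" for q' a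
  proof
    assume "(q, map (\<lambda>t. t 0) (t # ts), q', a) \<in> transitions M2"
    then have "tm_step M2 (q, t # ts) (q', map2 (\<lambda>t (b, d). shift d (t(0 := b))) (t # ts) a)"
      by (auto simp: tm_step_def)
    then show False using assms(1) unfolding halted_def by blast
  qed
  have "(num_states M1 + q, map (\<lambda>t. t 0) (t # us @ ts), p, b) \<notin> transitions (seq_machine M1 M2)" for p b
    unfolding seq_machine_trans
  proof (intro notI, elim disjE exE conjE, goal_cases)
    case (1 r a m)
    then show ?case using turing_machineD(5)[OF assms(3) 1(3)] by simp
  next
    case (3 q' x r q'' a m)
    then have "x = t 0" "map (\<lambda>t. t 0) us = m" "map (\<lambda>t. t 0) ts = r" "q' = q"
      using assms(2) by (auto simp: append_eq_append_conv)
    then show ?case using 3(5) n by simp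
  qed simp
  then show ?thesis unfolding halted_def tm_step_def by simp
qed

lemma seq_outputs:
  assumes "turing_machine M1" "turing_machine M2" "tm_outputs M1 w u t1" "tm_outputs M2 u v t2"
  shows "tm_outputs (seq_machine M1 M2) w v (t1 + 1 + t2)"
proof -
  let ?M = "seq_machine M1 M2"
  note D1 = turing_machineD[OF assms(1)] and D2 = turing_machineD[OF assms(2)]
  obtain n1 q1 ts1 where 1: "n1 \<le> t1" "(tm_step M1 ^^ n1) (init_config M1 w) (q1, ts1)" "halted M1 (q1, ts1)"
     "hd ts1 = word_tape u"
    using assms(3) by (auto simp: tm_outputs_def)
  obtain n2 q2 ts2 where 2: "n2 \<le> t2" "(tm_step M2 ^^ n2) (init_config M2 u) (q2, ts2)" "halted M2 (q2, ts2)"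
     "hd ts2 = word_tape v"
    using assms(4) by (auto simp: tm_outputs_def)
  let ?us = "replicate (num_tapes M2 - 1) (\<lambda>_. 0) :: tape list"
  have us: "length ?us = num_tapes M2 - 1" "\<forall>u\<in>set ?us. u 0 < num_symbols M2" using D2(2) by auto
  have a: "(tm_step ?M ^^ n) (q, ts @ ?us) (q', ts' @ ?us)"
    if "(tm_step M1 ^^ n) (q, ts) (q', ts')" "wf_tapes M1 ts" "q < num_states M1" for n q ts q' ts'
    using that(1)
  proof (induction n arbitrary: q' ts')
    case (Suc n)
    then obtain p xs where p: "(tm_step M1 ^^ n) (q, ts) (p, xs)" "tm_step M1 (p, xs) (q', ts')" by auto
    have "wf_tapes M1 xs" using wf_tapes_steps[OF assms(1) p(1) that(2,3)] by simp
    from seq_step_first[OF p(2) this us assms(1)] Suc.IH[OF p(1)] show ?case by auto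
  qed simp
  have w1: "wf_tapes M1 ts1 \<and> q1 < num_states M1"
    using wf_tapes_steps[OF assms(1), of n1 "start_state M1" "snd (init_config M1 w)" q1 ts1] 1(2)
      wf_tapes_init[OF assms(1)] D1(3) by (simp add: init_config_def)
  have i: "init_config ?M w = (start_state M1, snd (init_config M1 w) @ ?us)"
    using D1(1) by (simp add: init_config_def seq_machine_simps replicate_add[symmetric])
  have A: "(tm_step ?M ^^ n1) (init_config ?M w) (q1, ts1 @ ?us)"
    unfolding i by (rule a) (use 1(2) wf_tapes_init[OF assms(1)] D1(3) in \<open>auto simp: init_config_def\<close>)
  have B: "tm_step ?M (q1, ts1 @ ?us) (num_states M1 + start_state M2, ts1 @ ?us)"
    by (rule seq_step_middle[OF 1(3) _ us]) (use w1 in auto)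
  obtain xs where xs: "ts1 = word_tape u # xs" using 1(4) w1 D1(1) by (cases ts1) (auto simp: wf_tapes_def)
  have lx: "length xs = num_tapes M1 - 1" "\<forall>u\<in>set xs. u 0 < num_symbols M1"
    using w1 by (auto simp: xs wf_tapes_def)
  have b: "\<exists>t' ts'. ys = t' # ts' \<and> (tm_step ?M ^^ n) (num_states M1 + q, t # xs @ ts) (num_states M1 + q', t' # xs @ ts')"
    if "(tm_step M2 ^^ n) (q, t # ts) (q', ys)" for n q t ts q' ys
    using that
  proof (induction n arbitrary: q' ys)
    case (Suc n)
    then obtain p zs where p: "(tm_step M2 ^^ n) (q, t # ts) (p, zs)" "tm_step M2 (p, zs) (q', ys)" by auto
    from Suc.IH[OF p(1)] obtain z zs' where z: "zs = z # zs'"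
      "(tm_step ?M ^^ n) (num_states M1 + q, t # xs @ ts) (num_states M1 + p, z # xs @ zs')" by blast
    obtain a where "(p, map (\<lambda>t. t 0) (z # zs'), q', a) \<in> transitions M2"
      "ys = map2 (\<lambda>t (b, d). shift d (t(0 := b))) (z # zs') a"
      using p(2) by (auto simp: tm_step_def z(1))
    moreover from this have "length a = num_tapes M2" using D2(5) by blast
    ultimately obtain y ys' where y: "ys = y # ys'" using D2(1) by (cases a) auto
    have "tm_step ?M (num_states M1 + p, z # xs @ zs') (num_states M1 + q', y # xs @ ys')"
      using seq_step_second[OF p(2)[unfolded z(1) y] lx] .
    with z(2) show ?case unfolding y by auto
  qed auto
  obtain t' ts' where t': "ts2 = t' # ts'"
     "(tm_step ?M ^^ n2) (num_states M1 + start_state M2, ts1 @ ?us) (num_states M1 + q2, t' # xs @ ts')"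
    using b[OF 2(2)[unfolded init_config_def]] by (auto simp: xs)
  have h: "halted ?M (num_states M1 + q2, t' # xs @ ts')"
    by (rule seq_halted_second[OF 2(3)[unfolded t'(1)] lx(1) assms(1)])
  have "(tm_step ?M ^^ (n1 + Suc n2)) (init_config ?M w) (num_states M1 + q2, t' # xs @ ts')"
    by (rule relpowp_add_I, rule A, rule relpowp_SucI, rule B, rule t'(2))
  then show ?thesis
    unfolding tm_outputs_def using h 1(1) 2(1,4) t'(1)
    by (intro exI[of _ "n1 + Suc n2"] exI[of _ "(num_states M1 + q2, t' # xs @ ts')"]) auto
qed

text \<open>The number of nonblank cells on the first tape grows by at most one per step. In a
  composed reduction this bounds the instance on which the second machine starts.\<close>

lemma outputs_length:
  assumes "turing_machine M" "tm_outputs M w u t"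
  shows "length u \<le> length w + t"
proof -
  let ?supp = "\<lambda>t :: tape. {z. t z \<noteq> 0}"
  have s: "finite (?supp (shift d (t(0 := b)))) \<and> card (?supp (shift d (t(0 := b)))) \<le> Suc (card (?supp t))"
    if "finite (?supp t)" for t d b
  proof -
    let ?k = "(case d of MoveLeft \<Rightarrow> 1 | Stay \<Rightarrow> 0 | MoveRight \<Rightarrow> - 1) :: int"
    have "?supp (shift d (t(0 := b))) \<subseteq> (\<lambda>z. z + ?k) ` insert 0 (?supp t)"
    proof
      fix z assume "z \<in> ?supp (shift d (t(0 := b)))"
      then have "z - ?k \<in> insert 0 (?supp t)" by (cases d) (auto split: if_splits)
      then show "z \<in> (\<lambda>z. z + ?k) ` insert 0 (?supp t)" by (intro image_eqI[of _ _ "z - ?k"]) auto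
    qed
    moreover have "card ((\<lambda>z. z + ?k) ` insert 0 (?supp t)) \<le> Suc (card (?supp t))"
      using card_image_le[of "insert 0 (?supp t)" "\<lambda>z. z + ?k"] card_insert_le_m1[of "Suc (card (?supp t))" "?supp t" 0] that by simp
    ultimately show ?thesis
      using that by (meson card_mono finite_imageI finite_insert finite_subset le_trans)
  qed
  have wsupp: "?supp (word_tape u) = int ` {..<length u}" for u
  proof
    show "?supp (word_tape u) \<subseteq> int ` {..<length u}"
    proof
      fix z assume "z \<in> ?supp (word_tape u)"
      then have "0 \<le> z" "z < int (length u)" by (auto simp: word_tape_def split: if_splits)
      then show "z \<in> int ` {..<length u}" by (intro image_eqI[of _ _ "nat z"]) auto
    qed
  qed (auto simp: word_tape_def)
  then have wcard: "finite (?supp (word_tape u)) \<and> card (?supp (word_tape u)) = length u" for u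
    by (simp add: card_image)
  obtain n q ts where n: "n \<le> t" "(tm_step M ^^ n) (init_config M w) (q, ts)" "hd ts = word_tape u"
    using assms(2) by (auto simp: tm_outputs_def)
  have "ts \<noteq> [] \<and> finite (?supp (hd ts)) \<and> card (?supp (hd ts)) \<le> length w + n"
    if "(tm_step M ^^ n) (init_config M w) (q, ts)" for n q ts
    using that
  proof (induction n arbitrary: q ts)
    case 0
    then show ?case using wcard[of w] by (auto simp: init_config_def)
  next
    case (Suc n)
    then obtain p us where p: "(tm_step M ^^ n) (init_config M w) (p, us)" "tm_step M (p, us) (q, ts)" by auto
    obtain x us' where us: "us = x # us'" using Suc.IH[OF p(1)] by (cases us) auto
    obtain a where a: "(p, map (\<lambda>t. t 0) us, q, a) \<in> transitions M"
      "ts = map2 (\<lambda>t (b, d). shift d (t(0 := b))) us a"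
      using p(2) by (auto simp: tm_step_def)
    have "length a = num_tapes M" using turing_machineD(5)[OF assms(1) a(1)] by simp
    then obtain b d a' where "a = (b, d) # a'" using turing_machineD(1)[OF assms(1)] by (cases a) auto
    then have "ts \<noteq> [] \<and> hd ts = shift d (x(0 := b))" using a(2) us by simp
    then show ?case using Suc.IH[OF p(1)] s[of x d b] us by auto
  qed
  from this[OF n(2)] wcard[of u] n(1,3) show ?thesis by simp
qed


section \<open>Composing fpt reductions\<close>

lemma length_binary: "n < 2 ^ length (binary n)"
proof (induction n rule: binary.induct)
  case (1 n)
  show ?case
  proof (cases "n = 0")
    case False
    then have "n div 2 < 2 ^ length (binary (n div 2))" using 1 by simp
    then show ?thesis using False by (subst binary.simps) auto
  qed (simp add: binary.simps)
qed

lemma length_binary_mono: "m \<le> n \<Longrightarrow> length (binary m) \<le> length (binary n)"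
proof (induction n arbitrary: m rule: binary.induct)
  case (1 n)
  show ?case
  proof (cases "m = 0")
    case False
    then have "length (binary (m div 2)) \<le> length (binary (n div 2))" using 1 by (auto intro: div_le_mono)
    then show ?thesis using False 1(2) by (subst (1 2) binary.simps) auto
  qed (simp add: binary.simps)
qed

lemma binary_power2: "binary (2 ^ n) = replicate n False @ [True]"
proof (induction n)
  case (Suc n)
  then show ?case by (subst binary.simps) simp
qed (simp add: binary.simps)

text \<open>A power of two has an immediate binary code, here of length linear in that of
  \<open>n\<close>, so this function is computable in polynomial time on binary codes. As
  \<open>n + 1 \<le> 2 ^ length (binary n)\<close>, it dominates \<open>(n + 1) ^ c\<close>.\<close>

definition exp_bound :: "nat \<Rightarrow> nat \<Rightarrow> nat" where
  "exp_bound c n = 2 ^ (c * length (binary n) + c)"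

lemma exp_bound_mono: "m \<le> n \<Longrightarrow> exp_bound c m \<le> exp_bound c n"
  by (simp add: exp_bound_def length_binary_mono)

lemma computable_comp:
  assumes "computable f" "PT G" "\<And>n. G (binary n) = binary (g n)"
  shows "computable (\<lambda>n. g (f n))"
proof -
  obtain M where M: "turing_machine M" "deterministic M" "\<And>n. \<exists>t. tm_outputs M (binary n) (binary (f n)) t"
    using assms(1) unfolding computable_def by blast
  obtain M' and p :: "nat poly" where M': "turing_machine M'" "deterministic M'"
    "\<And>w. tm_outputs M' w (G w) (poly p (length w))"
    using PT_poly_time_computable[OF assms(2)] unfolding poly_time_computable_def by blast
  have "\<exists>t. tm_outputs (seq_machine M M') (binary n) (binary (g (f n))) t" for n
    using M(3)[of n] seq_outputs[OF M(1) M'(1) _ M'(3)[of "binary (f n)"]] assms(3) by metis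
  then show ?thesis unfolding computable_def
    using turing_machine_seq[OF M(1) M'(1)] deterministic_seq[OF M(1) M'(1) M(2) M'(2)] by blast
qed

lemma computable_exp_bound:
  assumes "computable f"
  shows "computable (\<lambda>n. exp_bound c (f n))"
proof (rule computable_comp[OF assms])
  show "PT (\<lambda>w :: bool list. replicate (c * length w + c) False @ [True])"
    by (intro PT_intros)
qed (simp add: exp_bound_def binary_power2)

text \<open>A factor depending on the parameter is pulled out of the polynomial of the second
  machine, as the form \<open>f k * poly p n\<close> of fpt running times demands.\<close>

lemma poly_le_power:
  fixes p :: "nat poly"
  shows "\<exists>c. \<forall>a\<ge>1. \<forall>x. poly p (a * x) \<le> a ^ c * poly p x"
proof (induction p)
  case (pCons b p)
  then obtain c where c: "\<And>a x. a \<ge> 1 \<Longrightarrow> poly p (a * x) \<le> a ^ c * poly p x" by blast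
  have "poly (pCons b p) (a * x) \<le> a ^ Suc c * poly (pCons b p) x" if "a \<ge> 1" for a x :: nat
  proof -
    have "1 * b \<le> a ^ Suc c * b" using that by (intro mult_le_mono1) simp
    moreover have "a * x * poly p (a * x) \<le> a * x * (a ^ c * poly p x)"
      by (rule mult_le_mono2[OF c[OF that]])
    ultimately have "1 * b + a * x * poly p (a * x) \<le> a ^ Suc c * b + a * x * (a ^ c * poly p x)"
      by (rule add_mono)
    then show ?thesis by (simp add: distrib_left mult_ac)
  qed
  then show ?case by blast
qed simp

text \<open>By \<open>outputs_length\<close> the intermediate instance is at most
  \<open>f k + 1\<close> times as long as a polynomial in the input. The second running time then
  has a power of \<open>f k + 1\<close> as its factor, which \<open>exp_bound\<close> absorbs in a
  computable way.\<close>

theorem fpt_reducible_trans_PT: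
  assumes "fpt_reducible P P1" "PT G"
    "\<And>x k. G (encode_instance (x, k)) = encode_instance (H (x, k))"
    "\<And>x k. (x, k) \<in> P1 \<longleftrightarrow> H (x, k) \<in> P2"
    "\<And>x k. snd (H (x, k)) \<le> exp_bound c k"
  shows "fpt_reducible P P2"
proof -
  obtain F f g M and p :: "nat poly" where M: "computable f" "computable g" "turing_machine M" "deterministic M"
    and F: "\<And>x k. ((x, k) \<in> P \<longleftrightarrow> F (x, k) \<in> P1)" "\<And>x k. snd (F (x, k)) \<le> g k"
      "\<And>x k. tm_outputs M (encode_instance (x, k)) (encode_instance (F (x, k)))
                 (f k * poly p (length (encode_instance (x, k))))"
    using assms(1) unfolding fpt_reducible_def by blast
  obtain M' and q :: "nat poly" where M': "turing_machine M'" "deterministic M'"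
    "\<And>w. tm_outputs M' w (G w) (poly q (length w))"
    using PT_poly_time_computable[OF assms(2)] unfolding poly_time_computable_def by blast
  obtain e where e: "\<And>a x. a \<ge> 1 \<Longrightarrow> poly q (a * x) \<le> a ^ e * poly q x"
    using poly_le_power[of q] by blast
  let ?f = "\<lambda>k. exp_bound (Suc e) (f k)" and ?g = "\<lambda>k. exp_bound c (g k)"
  let ?r = "p + 1 + pcompose q ([:0, 1:] + p)"
  have "((x, k) \<in> P \<longleftrightarrow> H (F (x, k)) \<in> P2) \<and> snd (H (F (x, k))) \<le> ?g k \<and>
     tm_outputs (seq_machine M M') (encode_instance (x, k)) (encode_instance (H (F (x, k))))
       (?f k * poly ?r (length (encode_instance (x, k))))" for x k
  proof (intro conjI)
    obtain y l where yl: "F (x, k) = (y, l)" by (cases "F (x, k)")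
    show "(x, k) \<in> P \<longleftrightarrow> H (F (x, k)) \<in> P2" using F(1)[of x k] assms(4) yl by metis
    have "snd (H (y, l)) \<le> exp_bound c l" by (rule assms(5))
    also have "\<dots> \<le> ?g k" using F(2)[of x k] yl by (simp add: exp_bound_mono)
    finally show "snd (H (F (x, k))) \<le> ?g k" by (simp add: yl)
    let ?w = "encode_instance (x, k)" and ?u = "encode_instance (F (x, k))"
    let ?t = "f k * poly p (length ?w)" and ?a = "f k + 1"
    have G: "G ?u = encode_instance (H (F (x, k)))" using assms(3)[of y l] yl by simp
    have "length ?u \<le> length ?w + ?t" by (rule outputs_length[OF M(3) F(3)])
    also have "\<dots> \<le> ?a * (length ?w + poly p (length ?w))" by (simp add: algebra_simps)
    finally have "poly q (length ?u) \<le> poly q (?a * (length ?w + poly p (length ?w)))" by (rule poly_mono_nat)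
    also have "\<dots> \<le> ?a ^ e * poly q (length ?w + poly p (length ?w))" by (rule e) simp
    finally have 1: "poly q (length ?u) \<le> ?a ^ e * poly q (length ?w + poly p (length ?w))" .
    have fk: "?a \<le> 2 ^ length (binary (f k))" using length_binary[of "f k"] by simp
    have "?a ^ e \<le> ?f k"
    proof -
      have "?a ^ e \<le> (2 ^ length (binary (f k))) ^ e" by (rule power_mono[OF fk]) simp
      also have "\<dots> = 2 ^ (e * length (binary (f k)))" by (simp add: power_mult[symmetric] mult.commute)
      also have "\<dots> \<le> ?f k" unfolding exp_bound_def by (rule power_increasing) auto
      finally show ?thesis .
    qed
    moreover have "?a \<le> ?f k"
    proof -
      have "(2::nat) ^ length (binary (f k)) \<le> ?f k" unfolding exp_bound_def by (rule power_increasing) auto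
      then show ?thesis using fk by linarith
    qed
    ultimately have "?t + 1 + poly q (length ?u) \<le>
        ?f k * poly p (length ?w) + ?f k * 1 + ?f k * poly q (length ?w + poly p (length ?w))"
      using 1 by (intro add_mono mult_le_mono1) (auto intro: order_trans[OF 1] mult_le_mono1)
    also have "\<dots> = ?f k * poly ?r (length ?w)" by (simp add: algebra_simps poly_pcompose)
    finally have 2: "?t + 1 + poly q (length ?u) \<le> ?f k * poly ?r (length ?w)" .
    show "tm_outputs (seq_machine M M') ?w (encode_instance (H (F (x, k)))) (?f k * poly ?r (length ?w))"
      using tm_outputs_mono[OF seq_outputs[OF M(3) M'(1) F(3)[of x k] M'(3)] 2] unfolding G .
  qed
  then show ?thesis unfolding fpt_reducible_def
    using computable_exp_bound[OF M(1), of "Suc e"] computable_exp_bound[OF M(2), of c]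
      turing_machine_seq[OF M(3) M'(1)] deterministic_seq[OF M(3) M'(1) M(4) M'(2)]
    by (intro exI[of _ "\<lambda>z. H (F z)"] exI[of _ ?f] exI[of _ ?g] exI[of _ "seq_machine M M'"] exI[of _ ?r]) simp
qed

theorem fpt_reducible_PT:
  assumes "PT G"
    "\<And>x k. G (encode_instance (x, k)) = encode_instance (H (x, k))"
    "\<And>x k. (x, k) \<in> P1 \<longleftrightarrow> H (x, k) \<in> P2"
    "\<And>x k. snd (H (x, k)) \<le> k"
  shows "fpt_reducible P1 P2"
proof -
  obtain M' and q :: "nat poly" where M': "turing_machine M'" "deterministic M'"
    "\<And>w. tm_outputs M' w (G w) (poly q (length w))"
    using PT_poly_time_computable[OF assms(1)] unfolding poly_time_computable_def by blast
  have "computable (\<lambda>n. 1)"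
    by (rule PT_computable[of "\<lambda>w. binary 1"]) (intro PT_intros, simp)
  moreover have "computable (\<lambda>n. n)"
    by (rule PT_computable[of "\<lambda>w. w"]) (intro PT_intros, simp)
  moreover have "tm_outputs M' (encode_instance (x, k)) (encode_instance (H (x, k)))
      (1 * poly q (length (encode_instance (x, k))))" for x k
    using M'(3)[of "encode_instance (x, k)"] assms(2)[of x k] by simp
  ultimately show ?thesis unfolding fpt_reducible_def
    using M'(1,2) assms(3,4)
    by - (rule exI[of _ H], rule exI[of _ "\<lambda>n. 1"], rule exI[of _ "\<lambda>n. n"], rule exI[of _ M'], rule exI[of _ q], simp)
qed

section \<open>Codes of numbers and instances\<close>

definition increment :: "bool list \<Rightarrow> bool list" where
  "increment bs = replicate (length (takeWhile (\<lambda>b. b) bs)) False @ [True] @ tl (dropWhile (\<lambda>b. b) bs)"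

lemma binary_Suc: "binary (Suc n) = increment (binary n)"
proof (induction n rule: binary.induct)
  case (1 n)
  consider "n = 0" | "n \<noteq> 0" "even n" | "n \<noteq> 0" "odd n" by blast
  then show ?case
  proof cases
    case 1
    then show ?thesis by (simp add: binary.simps increment_def)
  next
    case 2
    then have "binary n = False # binary (n div 2)" "binary (Suc n) = True # binary (n div 2)"
      by (subst binary.simps; simp)+
    then show ?thesis by (simp add: increment_def)
  next
    case 3
    then have "binary n = True # binary (n div 2)" "binary (Suc n) = False # binary (Suc (n div 2))"
      by (subst binary.simps; simp)+
    then show ?thesis using 1 3 by (simp add: increment_def)
  qed
qed

lemma length_binary_le: "length (binary n) \<le> n"
  by (induction n rule: binary.induct) (subst binary.simps, auto)

text \<open>The code is obtained by counting up from 0, which takes polynomial time because the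
  argument is given in unary.\<close>

lemma PT_binary [PT_intros]: "PT f \<Longrightarrow> PT (\<lambda>x. binary (f x))"
proof -
  have *: "foldl (\<lambda>s (y :: unit). increment s) [] us = binary (length us)" for us
    by (induction us rule: rev_induct) (simp_all add: binary_Suc binary.simps[of 0])
  have "PT (\<lambda>n. foldl (\<lambda>s y. increment s) [] (replicate n ()))"
  proof (rule PT_foldl[where q = "[:1, 4:]"])
    show "PT (\<lambda>p :: nat \<times> bool list \<times> unit. increment (fst (snd p)))"
      unfolding increment_def by (intro PT_intros)
    fix n :: nat and us vs :: "unit list"
    assume "replicate n () = us @ vs"
    then have "length us \<le> n" using length_replicate[of n "()"] by simp
    then show "sz (foldl (\<lambda>s y. increment s) [] us) \<le> poly [:1, 4:] (sz n)"
      using length_sz_bools[of "binary (length us)"] length_binary_le[of "length us"] by (simp add: *)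
  qed (intro PT_intros)+
  then have "PT binary" by (rule PT_eqI) (simp add: *)
  then show "PT f \<Longrightarrow> PT (\<lambda>x. binary (f x))" using PT_comp by blast
qed

lemma PT_encode_nat [PT_intros]: "PT f \<Longrightarrow> PT (\<lambda>x. encode_nat (f x))"
  unfolding encode_nat_def by (intro PT_intros)

lemma PT_unary [PT_intros]: "PT f \<Longrightarrow> PT (\<lambda>x. unary (f x))"
  unfolding unary_def by (intro PT_intros)

text \<open>In \<open>encode_nat\<close> a \<open>True\<close> at an even position announces a bit
  at the next position, and the first \<open>False\<close> at an even position ends the
  parameter.\<close>

definition num_bits :: "bool list \<Rightarrow> nat" where
  "num_bits y = length (takeWhile (\<lambda>i. 2 * i < length y \<and> nthd y (2 * i)) [0..<length y])"

definition param_bits :: "bool list \<Rightarrow> bool list" where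
  "param_bits y = map (\<lambda>i. nthd y (2 * i + 1)) [0..<num_bits y]"

definition inst_part :: "bool list \<Rightarrow> bool list" where
  "inst_part y = drop (2 * num_bits y + 1) y"

lemma PT_num_bits [PT_intros]: "PT f \<Longrightarrow> PT (\<lambda>x. num_bits (f x))"
  by (rule PT_comp[where g = num_bits], assumption) (unfold num_bits_def[abs_def], intro PT_intros)

lemma PT_param_bits [PT_intros]: "PT f \<Longrightarrow> PT (\<lambda>x. param_bits (f x))"
  by (rule PT_comp[where g = param_bits], assumption) (unfold param_bits_def[abs_def], intro PT_intros)

lemma PT_inst_part [PT_intros]: "PT f \<Longrightarrow> PT (\<lambda>x. inst_part (f x))"
  by (rule PT_comp[where g = inst_part], assumption) (unfold inst_part_def[abs_def], intro PT_intros)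

definition pairs_code :: "bool list \<Rightarrow> bool list" where
  "pairs_code bs = concat (map (\<lambda>b. [True, b]) bs)"

lemma length_pairs_code [simp]: "length (pairs_code bs) = 2 * length bs"
  by (induction bs) (auto simp: pairs_code_def)

lemma pairs_code_nth: "i < length bs \<Longrightarrow> (pairs_code bs @ u) ! (2 * i) \<and> (pairs_code bs @ u) ! (2 * i + 1) = bs ! i"
proof (induction bs arbitrary: i)
  case (Cons b bs)
  then show ?case by (cases i) (auto simp: pairs_code_def)
qed simp

lemma num_bits_pairs: "num_bits (pairs_code bs @ False # x) = length bs"
proof -
  let ?y = "pairs_code bs @ False # x"
  let ?P = "\<lambda>i. 2 * i < length ?y \<and> nthd ?y (2 * i)"
  have "takeWhile ?P [0..<length ?y] = take (length bs) [0..<length ?y]"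
  proof (rule takeWhile_eq_take_P_nth)
    fix i assume i: "i < length bs" "i < length [0..<length ?y]"
    then show "?P ([0..<length ?y] ! i)" using pairs_code_nth[OF i(1), of "False # x"] by (simp del: upt_Suc)
  next
    show "\<not> ?P ([0..<length ?y] ! length bs)" by (simp add: nthd_def del: upt_Suc)
  qed
  then show ?thesis unfolding num_bits_def by (simp del: upt_Suc)
qed

lemma param_bits_pairs: "param_bits (pairs_code bs @ False # x) = bs"
  unfolding param_bits_def num_bits_pairs
  using pairs_code_nth[of _ bs "False # x"] by (intro nth_equalityI) (auto simp: nthd_nth)

lemma inst_part_pairs: "inst_part (pairs_code bs @ False # x) = x"
  by (simp add: inst_part_def num_bits_pairs)

lemma encode_instance_eq: "encode_instance (x, k) = pairs_code (binary k) @ False # x"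
  by (simp add: encode_instance_def encode_nat_def pairs_code_def)

section \<open>Values of binary codes and recognition of instances\<close>

definition bits_value :: "bool list \<Rightarrow> nat" where
  "bits_value bs = foldr (\<lambda>b v. 2 * v + of_bool b) bs 0"

lemma bits_value_binary: "bits_value (binary n) = n"
proof (induction n rule: binary.induct)
  case (1 n)
  then show ?case by (subst binary.simps) (auto simp: bits_value_def)
qed

text \<open>The words \<open>binary n\<close> are those without a leading zero, the highest bit
  being the last. Other words denote no parameter and have to be rejected when membership in
  \<open>classical P\<close> is decided.\<close>

definition canonical :: "bool list \<Rightarrow> bool" where
  "canonical bs \<longleftrightarrow> bs = [] \<or> hd (rev bs)"

lemma canonical_Cons: "canonical (b # bs) \<longleftrightarrow> canonical bs \<and> (bs \<noteq> [] \<or> b)"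
  by (cases bs rule: rev_cases) (auto simp: canonical_def)

lemma bits_value_0: "canonical bs \<Longrightarrow> bits_value bs = 0 \<Longrightarrow> bs = []"
  by (induction bs) (auto simp: canonical_Cons bits_value_def)

lemma binary_bits_value: "canonical bs \<Longrightarrow> binary (bits_value bs) = bs"
proof (induction bs)
  case (Cons b bs)
  have v: "bits_value (b # bs) = 2 * bits_value bs + of_bool b" by (simp add: bits_value_def)
  have "bits_value (b # bs) \<noteq> 0" using bits_value_0[OF Cons.prems] by auto
  then show ?case
    using Cons by (subst binary.simps) (auto simp: v canonical_Cons)
qed (simp add: bits_value_def binary.simps)

lemma canonical_binary: "canonical (binary n)"
proof (induction n rule: binary.induct)
  case (1 n)
  show ?case
  proof (cases "n = 0")
    case False
    then have "binary (n div 2) \<noteq> [] \<or> odd n"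
      using binary.simps[of "n div 2"] by (cases "n = 1") auto
    then show ?thesis using 1 False by (subst binary.simps) (simp add: canonical_Cons)
  qed (simp add: binary.simps canonical_def)
qed

definition is_instance :: "bool list \<Rightarrow> bool" where
  "is_instance y \<longleftrightarrow> y = pairs_code (param_bits y) @ False # inst_part y \<and> canonical (param_bits y)"

lemma PT_is_instance [PT_intros]: "PT f \<Longrightarrow> PT (\<lambda>x. is_instance (f x))"
  by (rule PT_comp[where g = is_instance], assumption) (unfold is_instance_def[abs_def] pairs_code_def canonical_def, intro PT_intros)

lemma classical_iff:
  "y \<in> classical P \<longleftrightarrow> is_instance y \<and> (inst_part y, bits_value (param_bits y)) \<in> P"
proof
  assume "y \<in> classical P"
  then obtain x k where "y = encode_instance (x, k)" "(x, k) \<in> P" by (auto simp: classical_def)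
  then show "is_instance y \<and> (inst_part y, bits_value (param_bits y)) \<in> P"
    by (simp add: encode_instance_eq is_instance_def param_bits_pairs inst_part_pairs bits_value_binary canonical_binary)
next
  assume *: "is_instance y \<and> (inst_part y, bits_value (param_bits y)) \<in> P"
  then have "y = encode_instance (inst_part y, bits_value (param_bits y))"
    by (simp add: encode_instance_eq is_instance_def binary_bits_value)
  then show "y \<in> classical P" using * unfolding classical_def by blast
qed

lemma classical_encode: "encode_instance (x, k) \<in> classical P \<longleftrightarrow> (x, k) \<in> P"
  unfolding classical_iff
  by (simp add: encode_instance_eq is_instance_def param_bits_pairs inst_part_pairs bits_value_binary canonical_binary)

text \<open>
  The parameter is binary and hence may be exponentially large, so it is only ever
  computed in unary up to a cap.
\<close>

definition capped_value :: "nat \<Rightarrow> bool list \<Rightarrow> nat" where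
  "capped_value c bs = foldl (\<lambda>v b. min c (2 * v + of_bool b)) 0 (rev bs)"

lemma capped_value_eq: "capped_value c bs = min c (bits_value bs)"
proof (induction bs)
  case (Cons b bs)
  have "capped_value c (b # bs) = min c (2 * capped_value c bs + of_bool b)"
    by (simp add: capped_value_def)
  also have "\<dots> = min c (bits_value (b # bs))"
    unfolding Cons by (auto simp: bits_value_def min_def)
  finally show ?case .
qed (simp add: capped_value_def bits_value_def)

lemma PT_capped_value [PT_intros]:
  assumes "PT f" "PT g"
  shows "PT (\<lambda>x. capped_value (f x) (g x))"
proof -
  obtain p where p: "\<And>x. sz (f x) \<le> poly p (sz x)" using PT_size[OF assms(1)] by blast
  have "PT (\<lambda>x. foldl (\<lambda>v b. min (f x) (v + v + (if b then 1 else 0))) 0 (rev (g x)))"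
  proof (rule PT_foldl_add[where q = p])
    show "PT (\<lambda>q. min (f (fst q)) (fst (snd q) + fst (snd q) + (if snd (snd q) then 1 else 0)))"
      by (intro PT_intros PT_comp[OF PT_fst[OF PT_id] assms(1)])
    \<comment> \<open>The cap bounds every intermediate value outright, so the doubling cannot
      accumulate.\<close>
    show "sz (min (f x) (v + v + (if b then 1 else 0))) \<le> sz v + poly p (sz x + sz b)" for x v b
    proof -
      have "sz (min (f x) w) \<le> sz (f x)" for w by simp
      with p[of x] poly_mono_nat[of "sz x" "sz x + sz b" p] show ?thesis
        by (meson le_add1 order_trans trans_le_add2)
    qed
  qed (intro PT_intros assms)+
  then show ?thesis
    by (rule PT_eqI) (simp add: capped_value_def of_bool_def mult_2)
qed


section \<open>Codes of hypergraphs\<close>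

lemma unary_append_inj: "unary m @ u = unary n @ v \<Longrightarrow> m = n \<and> u = v"
proof (induction m arbitrary: n)
  case 0
  then show ?case by (cases n) (auto simp: unary_def)
next
  case (Suc m)
  then show ?case by (cases n) (auto simp: unary_def)
qed

lemma unaries_append_inj:
  "concat (map (\<lambda>x. unary (f x)) xs) @ u = concat (map (\<lambda>x. unary (g x)) xs) @ v \<Longrightarrow>
     u = v \<and> (\<forall>x\<in>set xs. f x = g x)"
proof (induction xs)
  case (Cons x xs)
  have "unary (f x) @ (concat (map (\<lambda>x. unary (f x)) xs) @ u) = unary (g x) @ (concat (map (\<lambda>x. unary (g x)) xs) @ v)"
    using Cons.prems by simp
  from unary_append_inj[OF this] have "f x = g x"
    and "concat (map (\<lambda>x. unary (f x)) xs) @ u = concat (map (\<lambda>x. unary (g x)) xs) @ v"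
    by simp_all
  note * = this(1) Cons.IH[OF this(2)]
  show ?case by (intro conjI ballI) (use * in auto)
qed simp

definition matrix :: "nat \<Rightarrow> nat \<Rightarrow> (nat \<Rightarrow> nat \<Rightarrow> bool) \<Rightarrow> bool list" where
  "matrix n m f = concat (map (\<lambda>i. map (f i) [0..<n]) [0..<m])"

lemma length_matrix [simp]: "length (matrix n m f) = m * n"
  by (induction m) (auto simp: matrix_def)

lemma matrix_nth: "i < m \<Longrightarrow> x < n \<Longrightarrow> (matrix n m f @ u) ! (i * n + x) = f i x"
proof (induction m arbitrary: u)
  case (Suc m)
  have e: "matrix n (Suc m) f @ u = matrix n m f @ map (f m) [0..<n] @ u" by (simp add: matrix_def)
  show ?case
  proof (cases "i = m")
    case True
    then show ?thesis unfolding e using Suc.prems by (simp add: nth_append)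
  next
    case False
    then show ?thesis unfolding e using Suc by simp
  qed
qed simp

lemma encode_hypergraph_matrix: "encode_hypergraph n m s = unary n @ unary m @ matrix n m (\<lambda>i x. x \<in> s i)"
  by (simp add: encode_hypergraph_def matrix_def)

text \<open>The problems are sets of codes, so the passage from a code back to the hypergraph rests
  on unique decoding. The remainders \<open>u\<close> and \<open>u'\<close> leave room for a
  correspondence behind the matrix.\<close>

lemma encode_hypergraph_inj:
  assumes "encode_hypergraph n m s @ u = encode_hypergraph n' m' s' @ u'"
    "hypergraph {..<n} {..<m} s" "hypergraph {..<n'} {..<m'} s'"
  shows "n = n'" "m = m'" "i < m \<Longrightarrow> s i = s' i" "u = u'"
proof -
  have 0: "unary n @ (unary m @ matrix n m (\<lambda>i x. x \<in> s i) @ u) = unary n' @ (unary m' @ matrix n' m' (\<lambda>i x. x \<in> s' i) @ u')"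
    using assms(1) by (simp only: encode_hypergraph_matrix append_assoc)
  show n: "n = n'" by (rule conjunct1[OF unary_append_inj[OF 0]])
  note 1 = unary_append_inj[OF conjunct2[OF unary_append_inj[OF 0]]]
  show m: "m = m'" by (rule conjunct1[OF 1])
  have e: "matrix n m (\<lambda>i x. x \<in> s i) @ u = matrix n m (\<lambda>i x. x \<in> s' i) @ u'"
    using conjunct2[OF 1] unfolding n m .
  then show "u = u'" by (simp add: append_eq_append_conv)
  assume i: "i < m"
  have "x \<in> s i \<longleftrightarrow> x \<in> s' i" if "x < n" for x
    using matrix_nth[OF i that, of "\<lambda>i x. x \<in> s i" u] matrix_nth[OF i that, of "\<lambda>i x. x \<in> s' i" u'] e by simp
  moreover have "s i \<subseteq> {..<n}" "s' i \<subseteq> {..<n}"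
    using assms(2,3) i n m by (auto simp: hypergraph_def)
  ultimately show "s i = s' i" by blast
qed

lemma RHS_encode_iff:
  assumes "hypergraph {..<n} {..<m} s"
  shows "(encode_hypergraph n m s, k) \<in> RHS \<longleftrightarrow>
    (\<exists>R1 R2. roman_hitting_set {..<n} {..<m} s R1 R2 \<and> rhs_weight R1 R2 \<le> k)"
proof
  assume "(encode_hypergraph n m s, k) \<in> RHS"
  then obtain n' m' s' R1 R2 where *: "encode_hypergraph n m s = encode_hypergraph n' m' s'"
    "hypergraph {..<n'} {..<m'} s'" "roman_hitting_set {..<n'} {..<m'} s' R1 R2" "rhs_weight R1 R2 \<le> k"
    by (auto simp: RHS_def)
  have "encode_hypergraph n m s @ [] = encode_hypergraph n' m' s' @ []" using *(1) by simp
  note i = encode_hypergraph_inj[OF this assms *(2)]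
  have "roman_hitting_set {..<n} {..<m} s R1 R2"
    using *(3) i by (auto simp: roman_hitting_set_def)
  then show "\<exists>R1 R2. roman_hitting_set {..<n} {..<m} s R1 R2 \<and> rhs_weight R1 R2 \<le> k"
    using *(4) by blast
next
  assume "\<exists>R1 R2. roman_hitting_set {..<n} {..<m} s R1 R2 \<and> rhs_weight R1 R2 \<le> k"
  then show "(encode_hypergraph n m s, k) \<in> RHS" using assms unfolding RHS_def by blast
qed

lemma encode_correspondence_inj:
  "encode_correspondence n \<tau> = encode_correspondence n \<tau>' \<Longrightarrow> x < n \<Longrightarrow> \<tau> x = \<tau>' x"
  using unaries_append_inj[of \<tau> "[0..<n]" "[]" \<tau>' "[]"] by (auto simp: encode_correspondence_def)

lemma RHF_encode_iff:
  assumes "hypergraph {..<n} {..<m} s" "correspondence {..<n} {..<m} s \<tau>"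
  shows "(encode_hypergraph n m s @ encode_correspondence n \<tau>, k) \<in> RHF \<longleftrightarrow>
    (\<exists>f. roman_hitting_function {..<n} {..<m} s \<tau> f \<and> rhf_weight {..<n} f \<le> k)"
proof
  assume "(encode_hypergraph n m s @ encode_correspondence n \<tau>, k) \<in> RHF"
  then obtain n' m' s' \<tau>' f where
    *: "encode_hypergraph n m s @ encode_correspondence n \<tau> = encode_hypergraph n' m' s' @ encode_correspondence n' \<tau>'"
    "hypergraph {..<n'} {..<m'} s'" "roman_hitting_function {..<n'} {..<m'} s' \<tau>' f" "rhf_weight {..<n'} f \<le> k"
    by (auto simp: RHF_def)
  note i = encode_hypergraph_inj[OF *(1) assms(1) *(2)]
  have t: "x < n \<Longrightarrow> \<tau> x = \<tau>' x" for x using encode_correspondence_inj[of n \<tau> \<tau>' x] i by simp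
  have "roman_hitting_function {..<n} {..<m} s \<tau> f"
    using *(3) i t by (auto simp: roman_hitting_function_def Bex_def)
  then show "\<exists>f. roman_hitting_function {..<n} {..<m} s \<tau> f \<and> rhf_weight {..<n} f \<le> k"
    using *(4) i by blast
next
  assume "\<exists>f. roman_hitting_function {..<n} {..<m} s \<tau> f \<and> rhf_weight {..<n} f \<le> k"
  then show "(encode_hypergraph n m s @ encode_correspondence n \<tau>, k) \<in> RHF" using assms unfolding RHF_def by blast
qed

text \<open>Many copies of each edge make it useless to cover single edges.\<close>

definition hitting :: "nat \<Rightarrow> nat \<Rightarrow> (nat \<Rightarrow> nat set) \<Rightarrow> nat \<Rightarrow> bool" where
  "hitting n m s k \<longleftrightarrow> (\<exists>H\<subseteq>{..<n}. card H \<le> k \<and> (\<forall>i<m. s i \<inter> H \<noteq> {}))"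

text \<open>Within weight \<open>2 * k\<close> the set \<open>R1\<close> cannot contain all of more
  than \<open>2 * k\<close> copies of an edge, so \<open>R2\<close> hits one copy and with it all of
  them. The weight then leaves at most \<open>k\<close> vertices for \<open>R2\<close>.\<close>

lemma hitting_rhs:
  assumes "hypergraph {..<n} {..<m} s" "\<And>i. i < m \<Longrightarrow> 2 * k < card {j. j < m \<and> s j = s i}"
  shows "(\<exists>R1 R2. roman_hitting_set {..<n} {..<m} s R1 R2 \<and> rhs_weight R1 R2 \<le> 2 * k) \<longleftrightarrow> hitting n m s k"
proof
  assume "\<exists>R1 R2. roman_hitting_set {..<n} {..<m} s R1 R2 \<and> rhs_weight R1 R2 \<le> 2 * k"
  then obtain R1 R2 where R: "R1 \<subseteq> {..<m}" "R2 \<subseteq> {..<n}" "\<And>i. i < m \<Longrightarrow> s i \<inter> R2 \<noteq> {} \<or> i \<in> R1"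
    "card R1 + 2 * card R2 \<le> 2 * k" by (auto simp: roman_hitting_set_def rhs_weight_def)
  have "s i \<inter> R2 \<noteq> {}" if "i < m" for i
  proof -
    have "finite R1" using R(1) finite_subset by blast
    moreover have "card R1 < card {j. j < m \<and> s j = s i}" using assms(2)[OF that] R(4) by linarith
    ultimately have "\<not> {j. j < m \<and> s j = s i} \<subseteq> R1" using card_mono leD by blast
    then obtain j where "j < m" "s j = s i" "j \<notin> R1" by blast
    then show ?thesis using R(3)[of j] by simp
  qed
  then show "hitting n m s k" unfolding hitting_def using R(2,4) by (intro exI[of _ R2]) auto
next
  assume "hitting n m s k"
  then obtain H where "H \<subseteq> {..<n}" "card H \<le> k" "\<forall>i<m. s i \<inter> H \<noteq> {}" by (auto simp: hitting_def)
  then show "\<exists>R1 R2. roman_hitting_set {..<n} {..<m} s R1 R2 \<and> rhs_weight R1 R2 \<le> 2 * k"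
    by (intro exI[of _ "{}"] exI[of _ H]) (auto simp: roman_hitting_set_def rhs_weight_def)
qed

text \<open>A vertex of value 1 pays for the index assigned to it, and one of value 2 is put into
  \<open>R2\<close>. Several vertices may pay for the same index, so the weight can only
  drop.\<close>

lemma rhf_imp_rhs:
  fixes n m :: nat
  assumes "hypergraph {..<n} {..<m} s" "correspondence {..<n} {..<m} s \<tau>"
    "roman_hitting_function {..<n} {..<m} s \<tau> f"
  shows "\<exists>R1 R2. roman_hitting_set {..<n} {..<m} s R1 R2 \<and> rhs_weight R1 R2 \<le> rhf_weight {..<n} f"
proof -
  let ?A = "{x. x < n \<and> f x = 1}" and ?B = "{x. x < n \<and> f x = 2}"
  have "roman_hitting_set {..<n} {..<m} s (\<tau> ` ?A) ?B"
    unfolding roman_hitting_set_def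
  proof (intro conjI ballI)
    show "\<tau> ` ?A \<subseteq> {..<m}" using assms(2) by (auto simp: correspondence_def)
    show "?B \<subseteq> {..<n}" by auto
    fix i assume i: "i \<in> {..<m}"
    then have "(\<exists>x\<in>s i. f x = 2) \<or> (\<exists>x\<in>{..<n}. \<tau> x = i \<and> f x = 1)" "s i \<subseteq> {..<n}"
      using assms(1,3) by (auto simp: roman_hitting_function_def hypergraph_def)
    then show "s i \<inter> ?B \<noteq> {} \<or> i \<in> \<tau> ` ?A" by auto
  qed
  moreover have "rhs_weight (\<tau> ` ?A) ?B \<le> rhf_weight {..<n} f"
  proof -
    have fin: "finite ?A" "finite ?B"
      by auto
    have "card (\<tau> ` ?A) \<le> card ?A" by (rule card_image_le[OF fin(1)])
    moreover have "card ?A = (\<Sum>x\<in>?A. f x)" "2 * card ?B = (\<Sum>x\<in>?B. f x)" by simp_all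
    moreover have "(\<Sum>x\<in>?A. f x) + (\<Sum>x\<in>?B. f x) = (\<Sum>x\<in>?A \<union> ?B. f x)"
      by (rule sum.union_disjoint[OF fin, symmetric]) auto
    moreover have "(\<Sum>x\<in>?A \<union> ?B. f x) \<le> (\<Sum>x\<in>{..<n}. f x)" by (rule sum_mono2) auto
    ultimately show ?thesis unfolding rhs_weight_def rhf_weight_def by linarith
  qed
  ultimately show ?thesis by blast
qed

lemma hitting_rhf:
  assumes "hypergraph {..<n} {..<m} s" "correspondence {..<n} {..<m} s \<tau>"
    "\<And>i. i < m \<Longrightarrow> 2 * k < card {j. j < m \<and> s j = s i}"
  shows "(\<exists>f. roman_hitting_function {..<n} {..<m} s \<tau> f \<and> rhf_weight {..<n} f \<le> 2 * k) \<longleftrightarrow> hitting n m s k"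
proof
  assume "\<exists>f. roman_hitting_function {..<n} {..<m} s \<tau> f \<and> rhf_weight {..<n} f \<le> 2 * k"
  then show "hitting n m s k"
    using rhf_imp_rhs[OF assms(1,2)] hitting_rhs[OF assms(1,3)] order_trans by meson
next
  assume "hitting n m s k"
  then obtain H where H: "H \<subseteq> {..<n}" "card H \<le> k" "\<forall>i<m. s i \<inter> H \<noteq> {}" by (auto simp: hitting_def)
  let ?f = "\<lambda>x. if x \<in> H then 2 else 0 :: nat"
  have "rhf_weight {..<n} ?f = 2 * card H"
    using H(1) by (simp add: rhf_weight_def sum.If_cases Int_absorb1)
  then show "\<exists>f. roman_hitting_function {..<n} {..<m} s \<tau> f \<and> rhf_weight {..<n} f \<le> 2 * k"
    using H by (intro exI[of _ ?f]) (auto simp: roman_hitting_function_def)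
qed

section \<open>Constraint satisfaction as a hitting problem\<close>

text \<open>
  An instance lists variables with their domains, and clauses whose literals \<open>(b, g, v)\<close> say
  that variable \<open>g\<close> has the value \<open>v\<close> (\<open>b = True\<close>) or does not have it (\<open>b = False\<close>).
\<close>

definition csp_sat :: "('g \<times> 'v list) list \<Rightarrow> (bool \<times> 'g \<times> 'v) list list \<Rightarrow> bool" where
  "csp_sat D Cl \<longleftrightarrow> (\<exists>\<alpha>. (\<forall>d\<in>set D. \<alpha> (fst d) \<in> set (snd d)) \<and>
     (\<forall>cl\<in>set Cl. \<exists>l\<in>set cl. (\<alpha> (fst (snd l)) = snd (snd l)) = fst l))"

text \<open>Without variables the edge of all vertices would be empty and could not be hit; the last
  condition makes such an instance unsatisfiable as well.\<close>

definition csp_wf :: "('g \<times> 'v list) list \<Rightarrow> (bool \<times> 'g \<times> 'v) list list \<Rightarrow> bool" where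
  "csp_wf D Cl \<longleftrightarrow> distinct (map fst D) \<and> (\<forall>cl\<in>set Cl. \<forall>l\<in>set cl. fst (snd l) \<in> fst ` set D) \<and>
     (D \<noteq> [] \<or> [] \<in> set Cl)"

text \<open>
  The vertices are the pairs \<open>(g, v)\<close>. A hitting set with one vertex per variable must pick exactly
  one value for each, so a negative literal can be expressed by the other values. All edges
  are clauses; the first one contains all vertices.
\<close>

definition vertices :: "('g \<times> 'v list) list \<Rightarrow> ('g \<times> 'v) list" where
  "vertices D = concat (map (\<lambda>d. map (\<lambda>v. (fst d, v)) (snd d)) D)"

definition hits :: "(bool \<times> 'g \<times> 'v) list \<Rightarrow> 'g \<times> 'v \<Rightarrow> bool" where
  "hits cl x \<longleftrightarrow> (\<exists>l\<in>set cl. fst (snd l) = fst x \<and> (snd x = snd (snd l)) = fst l)"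

text \<open>This is a tautology about one variable: whatever \<open>undefined\<close> is, each
  vertex of the group hits one of the two literals. The group edge thereby becomes a clause like all
  others.\<close>

definition group_clause :: "'g \<times> 'v list \<Rightarrow> (bool \<times> 'g \<times> 'v) list" where
  "group_clause d = [(True, fst d, undefined), (False, fst d, undefined)]"

text \<open>The clause with all groups is hit by any vertex whatsoever. As edge 0 it admits the
  constant 0 as a correspondence, whose code is a block of \<open>False\<close>.\<close>

definition edge_clauses :: "('g \<times> 'v list) list \<Rightarrow> (bool \<times> 'g \<times> 'v) list list \<Rightarrow> (bool \<times> 'g \<times> 'v) list list" where
  "edge_clauses D Cl = concat (map group_clause D) # map group_clause D @ Cl"

text \<open>One copy more than weight \<open>2 * length D\<close> could cover by single indices, as
  \<open>hitting_rhs\<close> and \<open>hitting_rhf\<close> require.\<close>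

definition rows :: "('g \<times> 'v list) list \<Rightarrow> (bool \<times> 'g \<times> 'v) list list \<Rightarrow> (bool \<times> 'g \<times> 'v) list list" where
  "rows D Cl = concat (replicate (2 * length D + 1) (edge_clauses D Cl))"

definition edge :: "('g \<times> 'v list) list \<Rightarrow> (bool \<times> 'g \<times> 'v) list list \<Rightarrow> nat \<Rightarrow> nat set" where
  "edge D Cl i = {x. x < length (vertices D) \<and> hits (rows D Cl ! i) (vertices D ! x)}"

definition csp_word :: "('g \<times> 'v list) list \<Rightarrow> (bool \<times> 'g \<times> 'v) list list \<Rightarrow> bool list" where
  "csp_word D Cl = unary (length (vertices D)) @ unary (length (rows D Cl)) @
     concat (map (\<lambda>r. map (hits r) (vertices D)) (rows D Cl))"

lemma hits_group_clause: "hits (group_clause d) x \<longleftrightarrow> fst x = fst d"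
  by (auto simp: hits_def group_clause_def)

lemma hits_concat: "hits (concat cls) x \<longleftrightarrow> (\<exists>cl\<in>set cls. hits cl x)"
  by (auto simp: hits_def)

lemma csp_word_eq: "csp_word D Cl = encode_hypergraph (length (vertices D)) (length (rows D Cl)) (edge D Cl)"
proof -
  let ?n = "length (vertices D)" and ?m = "length (rows D Cl)"
  have "map (\<lambda>r. map (hits r) (vertices D)) (rows D Cl) = map (\<lambda>i. map (\<lambda>x. x \<in> edge D Cl i) [0..<?n]) [0..<?m]"
    by (intro nth_equalityI) (auto simp: edge_def)
  then show ?thesis by (simp add: csp_word_def encode_hypergraph_def)
qed

lemma hypergraph_edge: "hypergraph {..<length (vertices D)} {..<length (rows D Cl)} (edge D Cl)"
  by (auto simp: hypergraph_def edge_def)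

lemma vertex_in: "(g, v) \<in> set (vertices D) \<longleftrightarrow> (\<exists>vs. (g, vs) \<in> set D \<and> v \<in> set vs)"
  by (force simp: vertices_def)

lemma set_rows: "set (rows D Cl) = set (edge_clauses D Cl)"
  by (auto simp: rows_def set_replicate_conv_if)

lemma rows_0: "rows D Cl ! 0 = concat (map group_clause D)" "0 < length (rows D Cl)"
  by (simp_all add: rows_def edge_clauses_def)

lemma copies:
  assumes "i < length (rows D Cl)"
  shows "2 * length D < card {j. j < length (rows D Cl) \<and> edge D Cl j = edge D Cl i}"
proof -
  let ?r = "rows D Cl ! i"
  have len: "length (filter P (concat (replicate c xs))) = c * length (filter P xs)" for P :: "'c \<Rightarrow> bool" and c xs
    by (induction c) auto
  have "?r \<in> set (edge_clauses D Cl)" using nth_mem[OF assms] by (simp add: set_rows)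
  then have "0 < length (filter (\<lambda>r. r = ?r) (edge_clauses D Cl))"
    by (auto simp: filter_empty_conv)
  then have "(2 * length D + 1) * 1 \<le> (2 * length D + 1) * length (filter (\<lambda>r. r = ?r) (edge_clauses D Cl))"
    by (intro mult_le_mono2) linarith
  then have "2 * length D + 1 \<le> length (filter (\<lambda>r. r = ?r) (rows D Cl))"
    using len[of "\<lambda>r. r = ?r" "2 * length D + 1" "edge_clauses D Cl", folded rows_def] by simp
  also have "\<dots> = card {j. j < length (rows D Cl) \<and> rows D Cl ! j = ?r}"
    by (rule length_filter_conv_card)
  also have "\<dots> \<le> card {j. j < length (rows D Cl) \<and> edge D Cl j = edge D Cl i}"
    by (rule card_mono) (auto simp: edge_def)
  finally show ?thesis by simp
qed

text \<open>The group edges force a vertex in each of the \<open>length D\<close> groups. Since no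
  more vertices are allowed, there is exactly one in each, that is, an assignment; a negative
  literal is then the same as one of the other values.\<close>

lemma hitting_iff_csp_sat:
  assumes "csp_wf D Cl"
  shows "hitting (length (vertices D)) (length (rows D Cl)) (edge D Cl) (length D) \<longleftrightarrow> csp_sat D Cl"
proof -
  let ?V = "vertices D"
  have all: "(\<forall>i<length (rows D Cl). edge D Cl i \<inter> H \<noteq> {}) \<longleftrightarrow>
      (\<forall>cl\<in>set (edge_clauses D Cl). \<exists>x\<in>H. hits cl (?V ! x))" if "H \<subseteq> {..<length ?V}" for H
    unfolding set_rows[symmetric] all_set_conv_all_nth using that by (auto simp: edge_def)
  have cardD: "card (fst ` set D) = length D"
    using assms distinct_card[of "map fst D"] by (simp add: csp_wf_def)
  show ?thesis
  proof
    assume "hitting (length ?V) (length (rows D Cl)) (edge D Cl) (length D)"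
    then obtain H where H: "H \<subseteq> {..<length ?V}" "card H \<le> length D"
      "\<forall>i<length (rows D Cl). edge D Cl i \<inter> H \<noteq> {}" by (auto simp: hitting_def)
    have h: "\<exists>x\<in>H. hits cl (?V ! x)" if "cl \<in> set (edge_clauses D Cl)" for cl
      using that H(3) all[OF H(1)] by blast
    have fin: "finite H" using H(1) finite_subset by blast
    have gx: "\<exists>x\<in>H. fst (?V ! x) = fst d" if "d \<in> set D" for d
      using h[of "group_clause d"] that by (auto simp: edge_clauses_def hits_group_clause)
    have VD: "fst (?V ! x) \<in> fst ` set D \<and> (\<exists>d\<in>set D. fst d = fst (?V ! x) \<and> snd (?V ! x) \<in> set (snd d))"
      if "x \<in> H" for x
    proof -
      have "?V ! x \<in> set ?V" using that H(1) by (auto intro: nth_mem)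
      then show ?thesis using vertex_in[of "fst (?V ! x)" "snd (?V ! x)" D] by force
    qed
    have im: "(\<lambda>x. fst (?V ! x)) ` H = fst ` set D"
      using gx VD by (force simp: image_iff)
    have "card ((\<lambda>x. fst (?V ! x)) ` H) = card H"
      using card_image_le[OF fin, of "\<lambda>x. fst (?V ! x)"] H(2) im cardD by simp
    then have inj: "inj_on (\<lambda>x. fst (?V ! x)) H" using fin by (simp add: eq_card_imp_inj_on)
    define \<alpha> where "\<alpha> g = snd (?V ! (THE x. x \<in> H \<and> fst (?V ! x) = g))" for g
    have \<alpha>: "\<alpha> (fst (?V ! x)) = snd (?V ! x)" if "x \<in> H" for x
    proof -
      have "(THE y. y \<in> H \<and> fst (?V ! y) = fst (?V ! x)) = x"
        by (rule the_equality) (use that inj in \<open>auto dest: inj_onD\<close>)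
      then show ?thesis by (simp add: \<alpha>_def)
    qed
    have "\<alpha> (fst d) \<in> set (snd d)" if d: "d \<in> set D" for d
    proof -
      obtain x where x: "x \<in> H" "fst (?V ! x) = fst d" using gx[OF d] by blast
      obtain e where e: "e \<in> set D" "fst e = fst (?V ! x)" "snd (?V ! x) \<in> set (snd e)" using VD[OF x(1)] by blast
      have "e = d" using assms d e(1,2) x(2) unfolding csp_wf_def distinct_map by (auto dest: inj_onD)
      then show ?thesis using \<alpha>[OF x(1)] e x by simp
    qed
    moreover have "\<exists>l\<in>set cl. (\<alpha> (fst (snd l)) = snd (snd l)) = fst l" if cl: "cl \<in> set Cl" for cl
    proof -
      obtain x where x: "x \<in> H" "hits cl (?V ! x)" using h[of cl] cl by (auto simp: edge_clauses_def)
      then obtain l where "l \<in> set cl" "fst (snd l) = fst (?V ! x)" "(snd (?V ! x) = snd (snd l)) = fst l"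
        by (auto simp: hits_def)
      then show ?thesis using \<alpha>[OF x(1)] by metis
    qed
    ultimately show "csp_sat D Cl" unfolding csp_sat_def by blast
  next
    assume "csp_sat D Cl"
    then obtain \<alpha> where \<alpha>: "\<And>d. d \<in> set D \<Longrightarrow> \<alpha> (fst d) \<in> set (snd d)"
      "\<And>cl. cl \<in> set Cl \<Longrightarrow> \<exists>l\<in>set cl. (\<alpha> (fst (snd l)) = snd (snd l)) = fst l"
      unfolding csp_sat_def by blast
    have "\<exists>x<length ?V. ?V ! x = (fst d, \<alpha> (fst d))" if "d \<in> set D" for d
    proof -
      have "(fst d, \<alpha> (fst d)) \<in> set ?V" using that \<alpha>(1)[OF that] unfolding vertex_in by (metis prod.collapse)
      then show ?thesis by (simp add: in_set_conv_nth)
    qed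
    then obtain f where f: "\<And>d. d \<in> set D \<Longrightarrow> f d < length ?V \<and> ?V ! f d = (fst d, \<alpha> (fst d))" by metis
    let ?H = "f ` set D"
    have H: "?H \<subseteq> {..<length ?V}" using f by auto
    have "card ?H \<le> length D" using card_image_le[of "set D" f] card_length[of D] by simp
    moreover have "\<exists>x\<in>?H. hits cl (?V ! x)" if cl: "cl \<in> set (edge_clauses D Cl)" for cl
    proof -
      have g: "\<exists>x\<in>?H. hits (group_clause d) (?V ! x)" if "d \<in> set D" for d
        unfolding hits_group_clause using f[OF that] that by (intro bexI[of _ "f d"]) auto
      have c: "\<exists>x\<in>?H. hits cl (?V ! x)" if cl: "cl \<in> set Cl" for cl
      proof -
        obtain l where l: "l \<in> set cl" "(\<alpha> (fst (snd l)) = snd (snd l)) = fst l" using \<alpha>(2)[OF cl] by blast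
        have "fst (snd l) \<in> fst ` set D" using assms cl l(1) unfolding csp_wf_def by blast
        then obtain d where d: "d \<in> set D" "fst d = fst (snd l)" by (metis imageE)
        have "hits cl (?V ! f d)" unfolding hits_def using f[OF d(1)] l d(2) by auto
        then show ?thesis using d(1) by blast
      qed
      consider "cl = concat (map group_clause D)" | d where "d \<in> set D" "cl = group_clause d" | "cl \<in> set Cl"
        using cl by (auto simp: edge_clauses_def)
      then show ?thesis
      proof cases
        case 1
        show ?thesis
        proof (cases "D = []")
          case True
          then show ?thesis using assms \<alpha>(2)[of "[]"] by (auto simp: csp_wf_def)
        next
          case False
          then obtain d where "d \<in> set D" by (cases D) auto
          then show ?thesis using g[of d] 1 by (auto simp: hits_concat)
        qed
      qed (use g c in auto)
    qed
    ultimately show "hitting (length ?V) (length (rows D Cl)) (edge D Cl) (length D)"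
      unfolding hitting_def using H all[OF H] by (intro exI[of _ ?H]) blast
  qed
qed

section \<open>Reductions from constraint satisfaction to the Roman problems\<close>

theorem csp_RHS:
  assumes "csp_wf D Cl"
  shows "(csp_word D Cl, 2 * length D) \<in> RHS \<longleftrightarrow> csp_sat D Cl"
  unfolding csp_word_eq RHS_encode_iff[OF hypergraph_edge] hitting_iff_csp_sat[OF assms, symmetric]
  by (rule hitting_rhs[OF hypergraph_edge copies])

lemma encode_correspondence_0: "encode_correspondence n (\<lambda>_. 0) = replicate n False"
  by (induction n) (auto simp: encode_correspondence_def unary_def replicate_append_same)

theorem csp_RHF:
  assumes "csp_wf D Cl"
  shows "(csp_word D Cl @ replicate (length (vertices D)) False, 2 * length D) \<in> RHF \<longleftrightarrow> csp_sat D Cl"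
proof -
  have "x \<in> edge D Cl 0" if "x < length (vertices D)" for x
  proof -
    have "vertices D ! x \<in> set (vertices D)" using that by simp
    then obtain vs where "(fst (vertices D ! x), vs) \<in> set D"
      using vertex_in[of "fst (vertices D ! x)" "snd (vertices D ! x)" D] by auto
    then show ?thesis using that by (force simp: edge_def rows_0 hits_concat hits_group_clause)
  qed
  then have c: "correspondence {..<length (vertices D)} {..<length (rows D Cl)} (edge D Cl) (\<lambda>_. 0)"
    using rows_0(2) by (auto simp: correspondence_def)
  show ?thesis
    unfolding csp_word_eq encode_correspondence_0[symmetric] RHF_encode_iff[OF hypergraph_edge c]
      hitting_iff_csp_sat[OF assms, symmetric]
    by (rule hitting_rhf[OF hypergraph_edge c copies])
qed

lemma PT_vertices [PT_intros]: "PT D \<Longrightarrow> PT (\<lambda>x. vertices (D x))"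
  unfolding vertices_def by (intro PT_intros)

lemma PT_csp_word [PT_intros]:
  fixes D :: "'a::enc \<Rightarrow> ('g::enc \<times> 'v::enc list) list"
  assumes "PT D" "PT Cl"
  shows "PT (\<lambda>x. csp_word (D x) (Cl x))"
proof -
  have "PT (\<lambda>x. rows (D x) (Cl x))"
    unfolding rows_def edge_clauses_def group_clause_def by (intro PT_intros assms)
  then show ?thesis
    unfolding csp_word_def hits_def by (intro PT_intros PT_comp[OF PT_fst[OF PT_id]] assms)
qed

lemma encode_instance_append: "encode_nat k @ x = encode_instance (x, k)"
  by (simp add: encode_instance_def)

theorem csp_poly_reducible:
  fixes D :: "bool list \<Rightarrow> ('g::enc \<times> 'v::enc list) list"
  assumes "PT D" "PT Cl" "\<And>w. csp_wf (D w) (Cl w)" "\<And>w. w \<in> L \<longleftrightarrow> csp_sat (D w) (Cl w)"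
  shows "poly_reducible L (classical RHS)" "poly_reducible L (classical RHF)"
proof -
  let ?F = "\<lambda>w. encode_nat (2 * length (D w)) @ csp_word (D w) (Cl w)"
  have "PT ?F" by (intro PT_intros assms)
  moreover have "w \<in> L \<longleftrightarrow> ?F w \<in> classical RHS" for w
    unfolding encode_instance_append classical_encode using csp_RHS[OF assms(3)] assms(4) by simp
  ultimately show "poly_reducible L (classical RHS)"
    unfolding poly_reducible_def using PT_poly_time_computable by blast
  let ?F = "\<lambda>w. encode_nat (2 * length (D w)) @ csp_word (D w) (Cl w) @ replicate (length (vertices (D w))) False"
  have "PT ?F" by (intro PT_intros assms)
  moreover have "w \<in> L \<longleftrightarrow> ?F w \<in> classical RHF" for w
    unfolding encode_instance_append classical_encode using csp_RHF[OF assms(3)] assms(4) by simp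
  ultimately show "poly_reducible L (classical RHF)"
    unfolding poly_reducible_def using PT_poly_time_computable by blast
qed

theorem csp_fpt_reducible:
  fixes D :: "bool list \<Rightarrow> ('g::enc \<times> 'v::enc list) list"
  assumes "PT D" "PT Cl" "\<And>w. csp_wf (D w) (Cl w)"
    "\<And>x k. (x, k) \<in> P1 \<longleftrightarrow> csp_sat (D (encode_instance (x, k))) (Cl (encode_instance (x, k)))"
    "\<And>x k. 2 * length (D (encode_instance (x, k))) \<le> exp_bound c k"
    "fpt_reducible P P1"
  shows "fpt_reducible P RHS" "fpt_reducible P RHF"
proof -
  show "fpt_reducible P RHS"
  proof (rule fpt_reducible_trans_PT[OF assms(6)])
    show "PT (\<lambda>w. encode_nat (2 * length (D w)) @ csp_word (D w) (Cl w))" by (intro PT_intros assms)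
    show "encode_nat (2 * length (D (encode_instance (x, k)))) @ csp_word (D (encode_instance (x, k))) (Cl (encode_instance (x, k)))
        = encode_instance ((\<lambda>z. (csp_word (D (encode_instance z)) (Cl (encode_instance z)), 2 * length (D (encode_instance z)))) (x, k))" for x k
      by (simp add: encode_instance_def)
  qed (use csp_RHS[OF assms(3)] assms(4,5) in auto)
  show "fpt_reducible P RHF"
  proof (rule fpt_reducible_trans_PT[OF assms(6)])
    show "PT (\<lambda>w. encode_nat (2 * length (D w)) @ csp_word (D w) (Cl w) @ replicate (length (vertices (D w))) False)"
      by (intro PT_intros assms)
    show "encode_nat (2 * length (D (encode_instance (x, k)))) @ csp_word (D (encode_instance (x, k))) (Cl (encode_instance (x, k)))
         @ replicate (length (vertices (D (encode_instance (x, k))))) False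
        = encode_instance ((\<lambda>z. (csp_word (D (encode_instance z)) (Cl (encode_instance z)) @
           replicate (length (vertices (D (encode_instance z)))) False, 2 * length (D (encode_instance z)))) (x, k))" for x k
      by (simp add: encode_instance_def)
  qed (use csp_RHF[OF assms(3)] assms(4,5) in auto)
qed


section \<open>The tableau of a nondeterministic machine\<close>

text \<open>Halted configurations are made to loop, so that all runs have the same length.\<close>

definition loop_transitions :: "machine \<Rightarrow> (nat \<times> nat list \<times> nat \<times> (nat \<times> move) list) set" where
  "loop_transitions M = transitions M \<union> {(q, r, q, idle r) | q r. q < num_states M \<and> length r = num_tapes M \<and>
     set r \<subseteq> {..<num_symbols M} \<and> (\<nexists>q' a. (q, r, q', a) \<in> transitions M)}"

definition loop_step :: "machine \<Rightarrow> config \<Rightarrow> config \<Rightarrow> bool" where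
  "loop_step M c c' \<longleftrightarrow>
     (\<exists>a. (fst c, map (\<lambda>t. t 0) (snd c), fst c', a) \<in> loop_transitions M \<and>
          snd c' = map2 (\<lambda>t (b, d). shift d (t(0 := b))) (snd c) a)"

lemma finite_moves: "finite (UNIV :: move set)"
proof -
  have "(UNIV :: move set) = {MoveLeft, Stay, MoveRight}" using move.exhaust by auto
  then show ?thesis by (metis finite.emptyI finite.insertI)
qed

lemma finite_loop_transitions:
  assumes "turing_machine M"
  shows "finite (loop_transitions M)"
proof -
  let ?R = "{r. set r \<subseteq> {..<num_symbols M} \<and> length r = num_tapes M}"
  let ?A = "{a :: (nat \<times> move) list. set a \<subseteq> {..<num_symbols M} \<times> UNIV \<and> length a = num_tapes M}"
  have "finite ?R" by (rule finite_lists_length_eq) simp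
  moreover have "finite ?A" by (rule finite_lists_length_eq) (simp add: finite_moves)
  ultimately have fin: "finite ({..<num_states M} \<times> ?R \<times> {..<num_states M} \<times> ?A)"
    by (intro finite_cartesian_product) auto
  have "x \<in> {..<num_states M} \<times> ?R \<times> {..<num_states M} \<times> ?A" if x: "x \<in> loop_transitions M" for x
  proof -
    obtain q r q' a where eq: "x = (q, r, q', a)" by (cases x)
    show ?thesis
    proof (cases "(q, r, q', a) \<in> transitions M")
      case True
      from turing_machineD(5)[OF assms this] show ?thesis unfolding eq by auto
    next
      case False
      then show ?thesis using x unfolding eq loop_transitions_def by (auto simp: idle_def)
    qed
  qed
  then show ?thesis using finite_subset[OF _ fin] by blast
qed

lemma loop_step_iff:
  assumes "wf_tapes M ts" "q < num_states M"
  shows "loop_step M (q, ts) c' \<longleftrightarrow> tm_step M (q, ts) c' \<or> halted M (q, ts) \<and> c' = (q, ts)"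
proof -
  let ?r = "map (\<lambda>t. t 0) ts"
  have h: "halted M (q, ts) \<longleftrightarrow> (\<nexists>q' a. (q, ?r, q', a) \<in> transitions M)"
    unfolding halted_def tm_step_def by force
  have r: "length ?r = num_tapes M" "set ?r \<subseteq> {..<num_symbols M}"
    using assms(1) by (auto simp: wf_tapes_def)
  have "(q, ?r, q', a) \<in> loop_transitions M \<longleftrightarrow>
      (q, ?r, q', a) \<in> transitions M \<or> halted M (q, ts) \<and> q' = q \<and> a = idle ?r" for q' a
    unfolding h loop_transitions_def using r assms(2) by auto
  note lt = this
  have "loop_step M (q, ts) c' \<longleftrightarrow> tm_step M (q, ts) c' \<or>
      halted M (q, ts) \<and> fst c' = q \<and> snd c' = map2 (\<lambda>t (b, d). shift d (t(0 := b))) ts (idle ?r)"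
    unfolding loop_step_def tm_step_def fst_conv snd_conv lt by blast
  then show ?thesis unfolding idle_step by (auto simp: prod_eq_iff)
qed

lemma loop_step_wf:
  assumes "turing_machine M" "loop_step M (q, ts) (q', ts')" "wf_tapes M ts" "q < num_states M"
  shows "wf_tapes M ts' \<and> q' < num_states M"
  using assms(2) wf_tapes_step[OF assms(1,3), of q q' ts'] assms(3,4)
  unfolding loop_step_iff[OF assms(3,4)] by auto

lemma loop_steps:
  assumes "turing_machine M" "(loop_step M ^^ n) (init_config M w) c"
  shows "(\<exists>m\<le>n. (tm_step M ^^ m) (init_config M w) c \<and> (m = n \<or> halted M c)) \<and> wf_tapes M (snd c) \<and> fst c < num_states M"
  using assms(2)
proof (induction n arbitrary: c)
  case 0
  then show ?case using wf_tapes_init[OF assms(1)] turing_machineD(3)[OF assms(1)]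
    by (auto simp: init_config_def)
next
  case (Suc n)
  then obtain d where d: "(loop_step M ^^ n) (init_config M w) d" "loop_step M d c" by auto
  obtain q ts where qts: "d = (q, ts)" by (cases d)
  obtain q' ts' where c: "c = (q', ts')" by (cases c)
  obtain m where m: "m \<le> n" "(tm_step M ^^ m) (init_config M w) d" "m = n \<or> halted M d"
    and wf: "wf_tapes M ts" "q < num_states M" using Suc.IH[OF d(1)] by (auto simp: qts)
  have wf': "wf_tapes M ts' \<and> q' < num_states M"
    using loop_step_wf[OF assms(1) d(2)[unfolded qts c] wf] .
  from d(2)[unfolded qts loop_step_iff[OF wf]] consider "tm_step M d c" | "halted M d" "c = d" by (auto simp: qts)
  then show ?case
  proof cases
    case 1
    then have "m = n" using m(3) unfolding halted_def by blast
    then have "(tm_step M ^^ Suc n) (init_config M w) c" using m(2) 1 by auto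
    then have "\<exists>m\<le>Suc n. (tm_step M ^^ m) (init_config M w) c \<and> (m = Suc n \<or> halted M c)" by blast
    then show ?thesis using wf' c by simp
  next
    case 2
    then have "\<exists>m\<le>Suc n. (tm_step M ^^ m) (init_config M w) c \<and> (m = Suc n \<or> halted M c)"
      using m(1,2) le_SucI by blast
    then show ?thesis using wf' c by simp
  qed
qed

lemma loop_stutter:
  assumes "halted M c" "wf_tapes M (snd c)" "fst c < num_states M"
  shows "(loop_step M ^^ n) c c"
proof (induction n)
  case (Suc n)
  have "loop_step M c c" using loop_step_iff[OF assms(2,3), of c] assms(1) by simp
  with Suc show ?case by auto
qed simp

text \<open>No run has more than \<open>T\<close> steps, so a looping run of length \<open>n\<close>
  beyond that must have reached a halted configuration and stayed there. This replaces runs of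
  varying length by runs of one prescribed length.\<close>

lemma accepts_iff_loop:
  assumes "turing_machine M" "ntm_decides M L T" "T (length w) < n"
  shows "w \<in> L \<longleftrightarrow> (\<exists>c. (loop_step M ^^ n) (init_config M w) c \<and> fst c = accept_state M)"
proof -
  have dec: "w \<in> L \<longleftrightarrow> (\<exists>n c. (tm_step M ^^ n) (init_config M w) c \<and> halted M c \<and> fst c = accept_state M)"
    and bound: "\<And>n c. (tm_step M ^^ n) (init_config M w) c \<Longrightarrow> n \<le> T (length w)"
    using assms(2) unfolding ntm_decides_def by blast+
  show ?thesis
  proof
    assume "w \<in> L"
    then obtain m c where c: "(tm_step M ^^ m) (init_config M w) c" "halted M c" "fst c = accept_state M"
      using dec by blast
    have i: "wf_tapes M (snd (init_config M w))" "start_state M < num_states M"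
      using wf_tapes_init[OF assms(1)] turing_machineD(3)[OF assms(1)] by auto
    have "(loop_step M ^^ m) (init_config M w) c \<and> wf_tapes M (snd c) \<and> fst c < num_states M"
      using c(1)
    proof (induction m arbitrary: c)
      case 0
      then show ?case using i by (auto simp: init_config_def)
    next
      case (Suc m)
      then obtain d where d: "(tm_step M ^^ m) (init_config M w) d" "tm_step M d c" by auto
      obtain q ts where qts: "d = (q, ts)" by (cases d)
      obtain q' ts' where c: "c = (q', ts')" by (cases c)
      have wf: "(loop_step M ^^ m) (init_config M w) d" "wf_tapes M ts" "q < num_states M"
        using Suc.IH[OF d(1)] by (auto simp: qts)
      have "loop_step M d c" unfolding qts loop_step_iff[OF wf(2,3)] using d(2) qts by simp
      then show ?case using wf(1) loop_step_wf[OF assms(1) _ wf(2,3), of q' ts'] by (auto simp: qts c)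
    qed
    then have "(loop_step M ^^ (m + (n - m))) (init_config M w) c"
      using loop_stutter[OF c(2), of "n - m"] by (auto intro: relpowp_add_I)
    moreover have "m \<le> n" using bound[OF c(1)] assms(3) by simp
    ultimately show "\<exists>c. (loop_step M ^^ n) (init_config M w) c \<and> fst c = accept_state M"
      using c(3) by (intro exI[of _ c]) simp
  next
    assume "\<exists>c. (loop_step M ^^ n) (init_config M w) c \<and> fst c = accept_state M"
    then obtain c where c: "(loop_step M ^^ n) (init_config M w) c" "fst c = accept_state M" by blast
    from loop_steps[OF assms(1) c(1)] obtain m where m: "m \<le> n" "(tm_step M ^^ m) (init_config M w) c"
      "m = n \<or> halted M c" by blast
    then have "halted M c" using bound[OF m(2)] assms(3) by auto
    then show "w \<in> L" using dec m(2) c(2) by blast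
  qed
qed

lemma distinct_concat_map:
  "distinct xs \<Longrightarrow> (\<And>x. x \<in> set xs \<Longrightarrow> distinct (f x)) \<Longrightarrow>
     (\<And>x y. x \<in> set xs \<Longrightarrow> y \<in> set xs \<Longrightarrow> x \<noteq> y \<Longrightarrow> set (f x) \<inter> set (f y) = {}) \<Longrightarrow> distinct (concat (map f xs))"
  by (induction xs) auto

lemma ball_concat_map: "(\<forall>y\<in>set (concat (map f xs)). P y) \<longleftrightarrow> (\<forall>x\<in>set xs. \<forall>y\<in>set (f x). P y)"
  by auto

lemma ball_map: "(\<forall>y\<in>set (map f xs). P y) \<longleftrightarrow> (\<forall>x\<in>set xs. P (f x))"
  by auto

lemma ball_upt: "(\<forall>i\<in>set [0..<n]. P i) \<longleftrightarrow> (\<forall>i<n. P i)"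
  by auto

lemma ball_list2: "(\<forall>y\<in>set [a, b]. P y) \<longleftrightarrow> P a \<and> P b"
  by simp

text \<open>The displacement increased by one, so that it is a natural number: cell \<open>z\<close>
  after the move was cell \<open>z + move_code d - 1\<close> before it.\<close>

definition move_code :: "move \<Rightarrow> nat" where
  "move_code d = (case d of MoveLeft \<Rightarrow> 0 | Stay \<Rightarrow> 1 | MoveRight \<Rightarrow> 2)"

lemma shift_move_code: "shift d t z = t (z + int (move_code d) - 1)"
  by (cases d) (auto simp: move_code_def algebra_simps)

text \<open>
  Variable \<open>[t]\<close> holds the index in \<open>ts\<close> of the transition taken at time \<open>t\<close>; variable \<open>[t, j, z]\<close> holds the
  symbol in cell \<open>z - T\<close> of tape \<open>j\<close> at that time, relative to the head. The window of \<open>2 T + 1\<close>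
  cells loses one reliable cell at both ends with each step.
\<close>

locale tableau =
  fixes M :: machine and ts :: "(nat \<times> nat list \<times> nat \<times> (nat \<times> move) list) list" and p :: "nat poly"
  assumes tm: "turing_machine M" and ts: "set ts = loop_transitions M"
begin

text \<open>The machine is fixed while its input varies. For \<open>PT\<close> these tables are
  therefore constants, and \<open>nthd\<close> looks entries up.\<close>

definition "nts = length ts"
definition "src_tab = map fst ts"
definition "rd_tab = map (\<lambda>x. fst (snd x)) ts"
definition "tgt_tab = map (\<lambda>x. fst (snd (snd x))) ts"
definition "wr_tab = map (\<lambda>x. map fst (snd (snd (snd x)))) ts"
definition "mv_tab = map (\<lambda>x. map (\<lambda>y. move_code (snd y)) (snd (snd (snd x)))) ts"
definition "K = num_tapes M"
definition "S = num_symbols M"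
definition "start = start_state M"
definition "acc = accept_state M"

abbreviation "src i \<equiv> nthd src_tab i"
abbreviation "tgt i \<equiv> nthd tgt_tab i"
abbreviation "rd i j \<equiv> nthd (nthd rd_tab i) j"
abbreviation "wr i j \<equiv> nthd (nthd wr_tab i) j"
abbreviation "mv i j \<equiv> nthd (nthd mv_tab i) j"

text \<open>The additional step makes the number of steps exceed the time bound strictly, as
  \<open>accepts_iff_loop\<close> demands, and keeps it positive.\<close>

definition steps :: "bool list \<Rightarrow> nat" where
  "steps w = poly p (length w) + 1"

definition doms :: "nat \<Rightarrow> (nat list \<times> nat list) list" where
  "doms T = map (\<lambda>t. ([t], [0..<nts])) [0..<T] @
     concat (map (\<lambda>t. concat (map (\<lambda>j. map (\<lambda>z. ([t, j, z], [0..<S])) [0..<2 * T + 1]) [0..<K])) [0..<T])"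

definition init_symbol :: "nat \<Rightarrow> bool list \<Rightarrow> nat \<Rightarrow> nat \<Rightarrow> nat" where
  "init_symbol T w j z = (if j = 0 \<and> T \<le> z \<and> z < T + length w then if nthd w (z - T) then 2 else 1 else 0)"

text \<open>Cell \<open>T\<close> is under the head and receives the written symbol; any other cell
  takes its symbol from its source \<open>z + mv i j - 1\<close>. The guards express that the source
  lies in the window, without truncated subtraction. Border cells with a source outside stay
  unconstrained.\<close>

definition cell_clauses :: "nat \<Rightarrow> nat \<Rightarrow> nat \<Rightarrow> nat \<Rightarrow> nat \<Rightarrow> (bool \<times> nat list \<times> nat) list list" where
  "cell_clauses T t i j z =
     (if 1 \<le> z + mv i j \<and> z + mv i j \<le> 2 * T + 1 then
        if z + mv i j - 1 = T then [[(False, [t], i), (True, [t + 1, j, z], wr i j)]]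
        else map (\<lambda>a. [(False, [t], i), (False, [t, j, z + mv i j - 1], a), (True, [t + 1, j, z], a)]) [0..<S]
      else [])"

definition clauses :: "nat \<Rightarrow> bool list \<Rightarrow> (bool \<times> nat list \<times> nat) list list" where
  "clauses T w =
     concat (map (\<lambda>t. map (\<lambda>i. (False, [t], i) # map (\<lambda>i'. (True, [t + 1], i')) (filter (\<lambda>i'. src i' = tgt i) [0..<nts])) [0..<nts]) [0..<T - 1]) @
     [map (\<lambda>i. (True, [0], i)) (filter (\<lambda>i. src i = start) [0..<nts]),
      map (\<lambda>i. (True, [T - 1], i)) (filter (\<lambda>i. tgt i = acc) [0..<nts])] @
     concat (map (\<lambda>t. concat (map (\<lambda>i. map (\<lambda>j. [(False, [t], i), (True, [t, j, T], rd i j)]) [0..<K]) [0..<nts])) [0..<T]) @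
     concat (map (\<lambda>j. map (\<lambda>z. [(True, [0, j, z], init_symbol T w j z)]) [0..<2 * T + 1]) [0..<K]) @
     concat (map (\<lambda>t. concat (map (\<lambda>i. concat (map (\<lambda>j. concat (map (\<lambda>z.
       cell_clauses T t i j z) [0..<2 * T + 1])) [0..<K])) [0..<nts])) [0..<T - 1])"

lemma PT_steps: "PT steps"
  unfolding steps_def[abs_def] by (intro PT_intros)

lemma PT_doms: "PT (\<lambda>w. doms (steps w))"
  by (rule PT_comp[OF PT_steps]) (unfold doms_def[abs_def], intro PT_intros)

lemma PT_clauses: "PT (\<lambda>w. clauses (steps w) w)"
proof -
  have "PT (\<lambda>x :: nat \<times> bool list. clauses (fst x) (snd x))"
    unfolding clauses_def init_symbol_def cell_clauses_def by (intro PT_intros)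
  from PT_comp2[OF this PT_steps PT_id] show ?thesis .
qed

lemma tables:
  assumes "i < nts" "ts ! i = (q, r, q', a)"
  shows "src i = q" "tgt i = q'" "j < length r \<Longrightarrow> rd i j = r ! j"
    "j < length a \<Longrightarrow> wr i j = fst (a ! j)" "j < length a \<Longrightarrow> mv i j = move_code (snd (a ! j))"
  using assms by (simp_all add: nts_def src_tab_def tgt_tab_def rd_tab_def wr_tab_def mv_tab_def)

lemma loop_transition_wf:
  assumes "(q, r, q', a) \<in> loop_transitions M"
  shows "length r = K" "length a = K" "set r \<subseteq> {..<S}" "fst ` set a \<subseteq> {..<S}"
proof -
  have "length r = K \<and> length a = K \<and> set r \<subseteq> {..<S} \<and> fst ` set a \<subseteq> {..<S}"
  proof (cases "(q, r, q', a) \<in> transitions M")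
    case True
    from turing_machineD(5)[OF tm this] show ?thesis by (simp add: K_def S_def)
  next
    case False
    then show ?thesis using assms by (auto simp: loop_transitions_def K_def S_def idle_def)
  qed
  then show "length r = K" "length a = K" "set r \<subseteq> {..<S}" "fst ` set a \<subseteq> {..<S}" by auto
qed

lemma clauses_ball:
  "(\<forall>cl\<in>set (clauses T w). P cl) \<longleftrightarrow>
     (\<forall>t<T - 1. \<forall>i<nts. P ((False, [t], i) # map (\<lambda>i'. (True, [t + 1], i')) (filter (\<lambda>i'. src i' = tgt i) [0..<nts]))) \<and>
     P (map (\<lambda>i. (True, [0], i)) (filter (\<lambda>i. src i = start) [0..<nts])) \<and>
     P (map (\<lambda>i. (True, [T - 1], i)) (filter (\<lambda>i. tgt i = acc) [0..<nts])) \<and>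
     (\<forall>t<T. \<forall>i<nts. \<forall>j<K. P [(False, [t], i), (True, [t, j, T], rd i j)]) \<and>
     (\<forall>j<K. \<forall>z<2 * T + 1. P [(True, [0, j, z], init_symbol T w j z)]) \<and>
     (\<forall>t<T - 1. \<forall>i<nts. \<forall>j<K. \<forall>z<2 * T + 1. \<forall>cl\<in>set (cell_clauses T t i j z). P cl)"
  unfolding clauses_def set_append ball_Un ball_concat_map ball_map ball_upt ball_list2 conj_assoc ..

lemma doms_ball:
  "(\<forall>d\<in>set (doms T). P d) \<longleftrightarrow> (\<forall>t<T. P ([t], [0..<nts])) \<and>
     (\<forall>t<T. \<forall>j<K. \<forall>z<2 * T + 1. P ([t, j, z], [0..<S]))"
  unfolding doms_def set_append ball_Un ball_concat_map ball_map ball_upt ..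

lemma doms_groups:
  "t < T \<Longrightarrow> [t] \<in> fst ` set (doms T)"
  "t < T \<Longrightarrow> j < K \<Longrightarrow> z \<le> 2 * T \<Longrightarrow> [t, j, z] \<in> fst ` set (doms T)"
  unfolding doms_def by (force simp: image_iff simp del: upt_Suc)+

lemma csp_wf_tableau:
  assumes "1 \<le> T"
  shows "csp_wf (doms T) (clauses T w)"
  unfolding csp_wf_def
proof (intro conjI)
  let ?L = "concat (map (\<lambda>t. concat (map (\<lambda>j. map (\<lambda>z. [t, j, z]) [0..<2 * T + 1]) [0..<K])) [0..<T])"
  have "distinct ?L"
    by (intro distinct_concat_map) (auto simp: distinct_map inj_on_def)
  moreover have "map fst (doms T) = map (\<lambda>t. [t]) [0..<T] @ ?L"
    unfolding doms_def by (simp add: map_concat comp_def del: upt_Suc)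
  ultimately show "distinct (map fst (doms T))"
    by (auto simp: distinct_map inj_on_def simp del: upt_Suc)
  show "\<forall>cl\<in>set (clauses T w). \<forall>l\<in>set cl. fst (snd l) \<in> fst ` set (doms T)"
    unfolding clauses_ball using assms doms_groups
    by (auto simp: cell_clauses_def)
  show "doms T \<noteq> [] \<or> [] \<in> set (clauses T w)"
    using assms by (simp add: doms_def)
qed

lemma sat_imp_run:
  assumes "csp_sat (doms T) (clauses T w)" "1 \<le> T"
  shows "\<exists>c. (loop_step M ^^ T) (init_config M w) c \<and> fst c = accept_state M"
proof -
  obtain \<alpha> where D: "\<forall>d\<in>set (doms T). \<alpha> (fst d) \<in> set (snd d)"
    and Cl: "\<forall>cl\<in>set (clauses T w). \<exists>l\<in>set cl. (\<alpha> (fst (snd l)) = snd (snd l)) = fst l"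
    using assms(1) unfolding csp_sat_def by blast
  define \<delta> where "\<delta> t = \<alpha> [t]" for t
  have \<delta>: "\<delta> t < nts" if "t < T" for t
    using D that unfolding doms_ball \<delta>_def by (simp del: upt_Suc)
  have dom: "\<alpha> [t, j, z] < S" if "t < T" "j < K" "z \<le> 2 * T" for t j z
    using D that unfolding doms_ball by (simp del: upt_Suc)
  have next_state: "src (\<delta> (t + 1)) = tgt (\<delta> t)" if "t < T - 1" for t
    using Cl that \<delta>[of t] unfolding clauses_ball \<delta>_def by fastforce
  have first: "src (\<delta> 0) = start" using Cl unfolding clauses_ball \<delta>_def by fastforce
  have last: "tgt (\<delta> (T - 1)) = acc" using Cl unfolding clauses_ball \<delta>_def by fastforce
  have read: "\<alpha> [t, j, T] = rd (\<delta> t) j" if "t < T" "j < K" for t j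
    using Cl that \<delta>[of t] unfolding clauses_ball \<delta>_def by fastforce
  have init: "\<alpha> [0, j, z] = init_symbol T w j z" if "j < K" "z \<le> 2 * T" for j z
    using Cl that unfolding clauses_ball by fastforce
  have cell: "\<alpha> [t + 1, j, z] = (if z + mv (\<delta> t) j - 1 = T then wr (\<delta> t) j else \<alpha> [t, j, z + mv (\<delta> t) j - 1])"
    if "t < T - 1" "j < K" "z \<le> 2 * T" "1 \<le> z + mv (\<delta> t) j" "z + mv (\<delta> t) j \<le> 2 * T + 1" for t j z
  proof -
    have "t < T" using that(1) by simp
    then have c: "\<exists>l\<in>set cl. (\<alpha> (fst (snd l)) = snd (snd l)) = fst l" if "cl \<in> set (cell_clauses T t (\<delta> t) j z)" for cl
    proof -
      have "\<forall>t<T - 1. \<forall>i<nts. \<forall>j<K. \<forall>z<2 * T + 1. \<forall>cl\<in>set (cell_clauses T t i j z).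
          \<exists>l\<in>set cl. (\<alpha> (fst (snd l)) = snd (snd l)) = fst l"
        using Cl unfolding clauses_ball by (elim conjE)
      moreover have "z < 2 * T + 1" using \<open>z \<le> 2 * T\<close> by simp
      ultimately show ?thesis using that \<open>t < T - 1\<close> \<open>j < K\<close> \<delta>[OF \<open>t < T\<close>] by blast
    qed
    show ?thesis
    proof (cases "z + mv (\<delta> t) j - 1 = T")
      case True
      then show ?thesis using c[of "[(False, [t], \<delta> t), (True, [t + 1, j, z], wr (\<delta> t) j)]"] that
        by (simp add: cell_clauses_def \<delta>_def)
    next
      case False
      let ?a = "\<alpha> [t, j, z + mv (\<delta> t) j - 1]"
      have "?a < S" by (rule dom) (use that in auto)
      then show ?thesis
        using c[of "[(False, [t], \<delta> t), (False, [t, j, z + mv (\<delta> t) j - 1], ?a), (True, [t + 1, j, z], ?a)]"] that False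
        by (simp add: cell_clauses_def \<delta>_def)
    qed
  qed
  define act where "act t = snd (snd (snd (ts ! \<delta> t)))" for t
  \<comment> \<open>The configurations are rebuilt from the chosen transitions alone. That each
    transition is enabled follows afterwards from the cell variables through the invariant.\<close>
  define C where "C = rec_nat (init_config M w)
     (\<lambda>t c. (tgt (\<delta> t), map2 (\<lambda>x (b, d). shift d (x(0 := b))) (snd c) (act t)))"
  have C0: "C 0 = init_config M w" and CS: "C (Suc t) = (tgt (\<delta> t), map2 (\<lambda>x (b, d). shift d (x(0 := b))) (snd (C t)) (act t))" for t
    by (simp_all add: C_def)
  have tr: "(src (\<delta> t), fst (snd (ts ! \<delta> t)), tgt (\<delta> t), act t) \<in> loop_transitions M"
    "length (fst (snd (ts ! \<delta> t))) = K" "length (act t) = K"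
    "j < K \<Longrightarrow> rd (\<delta> t) j = fst (snd (ts ! \<delta> t)) ! j"
    "j < K \<Longrightarrow> wr (\<delta> t) j = fst (act t ! j)" "j < K \<Longrightarrow> mv (\<delta> t) j = move_code (snd (act t ! j))"
    if "t < T" for t j
  proof -
    obtain q r q' a where e: "ts ! \<delta> t = (q, r, q', a)" by (cases "ts ! \<delta> t")
    note tb = tables[OF \<delta>[OF that] e]
    have i: "(q, r, q', a) \<in> loop_transitions M" using \<delta>[OF that] ts e nth_mem[of "\<delta> t" ts] by (simp add: nts_def)
    note wf = loop_transition_wf[OF i]
    show "(src (\<delta> t), fst (snd (ts ! \<delta> t)), tgt (\<delta> t), act t) \<in> loop_transitions M"
      "length (fst (snd (ts ! \<delta> t))) = K" "length (act t) = K"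
      "j < K \<Longrightarrow> rd (\<delta> t) j = fst (snd (ts ! \<delta> t)) ! j"
      "j < K \<Longrightarrow> wr (\<delta> t) j = fst (act t ! j)" "j < K \<Longrightarrow> mv (\<delta> t) j = move_code (snd (act t ! j))"
      using tb wf i by (simp_all add: act_def e)
  qed
  \<comment> \<open>At time \<open>t\<close> only the cells with \<open>t \<le> z\<close> and
    \<open>z + t \<le> 2 * T\<close> are trusted. The head cell \<open>T\<close> satisfies this for
    all \<open>t < T\<close>, which is all that reading requires.\<close>
  have inv: "fst (C t) = src (\<delta> t) \<and> length (snd (C t)) = K \<and>
      (\<forall>j<K. \<forall>z. t \<le> z \<and> z + t \<le> 2 * T \<longrightarrow> (snd (C t) ! j) (int z - int T) = \<alpha> [t, j, z])" if "t < T" for t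
    using that
  proof (induction t)
    case 0
    have "(snd (C 0) ! j) (int z - int T) = \<alpha> [0, j, z]" if "j < K" "z \<le> 2 * T" for j z
    proof -
      have "(snd (C 0) ! j) (int z - int T) = init_symbol T w j z"
        using that(1) by (cases j) (auto simp: C0 init_config_def K_def init_symbol_def word_tape_def nat_diff_distrib)
      then show ?thesis using init[OF that] by simp
    qed
    then show ?case using first turing_machineD(1)[OF tm] by (auto simp: C0 init_config_def start_def K_def)
  next
    case (Suc t)
    then have t: "t < T" "t < T - 1" by auto
    note IH = Suc.IH[OF t(1)]
    have "(snd (C (Suc t)) ! j) (int z - int T) = \<alpha> [Suc t, j, z]" if j: "j < K" and z: "Suc t \<le> z" "z + Suc t \<le> 2 * T" for j z
    proof -
      let ?m = "mv (\<delta> t) j"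
      obtain b d where bd: "act t ! j = (b, d)" by (cases "act t ! j")
      have m: "?m = move_code d" "wr (\<delta> t) j = b" using tr[OF t(1)] j bd by auto
      have m2: "?m \<le> 2" by (cases d) (auto simp: m move_code_def)
      have "(snd (C (Suc t)) ! j) (int z - int T) = shift d ((snd (C t) ! j)(0 := b)) (int z - int T)"
        using j IH tr(3)[OF t(1)] by (simp add: CS bd)
      also have "\<dots> = ((snd (C t) ! j)(0 := b)) (int (z + ?m - 1) - int T)"
        unfolding shift_move_code m(1) using z by (simp add: algebra_simps of_nat_diff)
      also have "\<dots> = (if z + ?m - 1 = T then b else \<alpha> [t, j, z + ?m - 1])"
      proof -
        have "t \<le> z + ?m - 1 \<and> z + ?m - 1 + t \<le> 2 * T" using z m2 by linarith
        then show ?thesis using IH j by auto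
      qed
      also have "\<dots> = \<alpha> [t + 1, j, z]"
        using cell[OF t(2) j, of z] z m2 m(2) by simp
      finally show ?thesis by simp
    qed
    then show ?case using next_state[OF t(2)] IH tr(3)[OF t(1)] by (simp add: CS)
  qed
  have step: "loop_step M (C t) (C (Suc t))" if "t < T" for t
  proof -
    have "map (\<lambda>x. x 0) (snd (C t)) = fst (snd (ts ! \<delta> t))"
    proof (rule nth_equalityI)
      show "length (map (\<lambda>x. x 0) (snd (C t))) = length (fst (snd (ts ! \<delta> t)))" using inv[OF that] tr(2)[OF that] by simp
      fix j assume "j < length (map (\<lambda>x. x 0) (snd (C t)))"
      then have j: "j < K" using inv[OF that] by simp
      have "t \<le> T \<and> T + t \<le> 2 * T" using that by simp
      then have "(snd (C t) ! j) (int T - int T) = \<alpha> [t, j, T]" using inv[OF that] j by blast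
      then show "map (\<lambda>x. x 0) (snd (C t)) ! j = fst (snd (ts ! \<delta> t)) ! j"
        using read[OF that j] tr(4)[OF that j] inv[OF that] j by simp
    qed
    then have "(fst (C t), map (\<lambda>x. x 0) (snd (C t)), fst (C (Suc t)), act t) \<in> loop_transitions M"
      using tr(1)[OF that] inv[OF that] by (simp add: CS)
    then show ?thesis unfolding loop_step_def by (auto simp: CS)
  qed
  have "(loop_step M ^^ T) (C 0) (C T)" unfolding relpowp_fun_conv using step by blast
  moreover have "fst (C T) = accept_state M" using last CS[of "T - 1"] assms(2) by (simp add: acc_def)
  ultimately show ?thesis unfolding C0 by blast
qed

lemma run_imp_sat:
  assumes "(loop_step M ^^ T) (init_config M w) c" "fst c = accept_state M" "1 \<le> T"
  shows "csp_sat (doms T) (clauses T w)"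
proof -
  obtain C where C: "C 0 = init_config M w" "C T = c" "\<And>t. t < T \<Longrightarrow> loop_step M (C t) (C (Suc t))"
    using assms(1) unfolding relpowp_fun_conv by blast
  have wf: "wf_tapes M (snd (C t))" if "t \<le> T" for t
  proof -
    have "(loop_step M ^^ t) (init_config M w) (C t)"
      unfolding relpowp_fun_conv using C that by (intro exI[of _ C]) auto
    then show ?thesis using loop_steps[OF tm] by blast
  qed
  have "\<exists>i<nts. \<exists>a. ts ! i = (fst (C t), map (\<lambda>x. x 0) (snd (C t)), fst (C (Suc t)), a) \<and>
     snd (C (Suc t)) = map2 (\<lambda>x (b, d). shift d (x(0 := b))) (snd (C t)) a" if "t < T" for t
    using C(3)[OF that] unfolding loop_step_def ts[symmetric] in_set_conv_nth nts_def by metis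
  then obtain \<delta> act where \<delta>: "\<And>t. t < T \<Longrightarrow> \<delta> t < nts \<and> ts ! \<delta> t = (fst (C t), map (\<lambda>x. x 0) (snd (C t)), fst (C (Suc t)), act t) \<and>
     snd (C (Suc t)) = map2 (\<lambda>x (b, d). shift d (x(0 := b))) (snd (C t)) (act t)" by metis
  define \<alpha> where "\<alpha> g = (case g of [t] \<Rightarrow> \<delta> t | [t, j, z] \<Rightarrow> (snd (C t) ! j) (int z - int T) | _ \<Rightarrow> 0)" for g :: "nat list"
  have \<alpha>: "\<alpha> [t] = \<delta> t" "\<alpha> [t, j, z] = (snd (C t) ! j) (int z - int T)" for t j z by (simp_all add: \<alpha>_def)
  have len: "length (snd (C t)) = K" if "t \<le> T" for t using wf[OF that] by (simp add: wf_tapes_def K_def)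
  have sym: "(snd (C t) ! j) z < S" if "t \<le> T" "j < K" for t j z
    using wf[OF that(1)] that(2) by (simp add: wf_tapes_def K_def S_def)
  have tb: "src (\<delta> t) = fst (C t)" "tgt (\<delta> t) = fst (C (Suc t))" "j < K \<Longrightarrow> rd (\<delta> t) j = (snd (C t) ! j) 0"
     "length (act t) = K" "j < K \<Longrightarrow> wr (\<delta> t) j = fst (act t ! j)" "j < K \<Longrightarrow> mv (\<delta> t) j = move_code (snd (act t ! j))"
    if "t < T" for t j
  proof -
    have e: "ts ! \<delta> t = (fst (C t), map (\<lambda>x. x 0) (snd (C t)), fst (C (Suc t)), act t)" "\<delta> t < nts" using \<delta>[OF that] by auto
    have "(fst (C t), map (\<lambda>x. x 0) (snd (C t)), fst (C (Suc t)), act t) \<in> loop_transitions M"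
      using e ts nth_mem[of "\<delta> t" ts] by (simp add: nts_def)
    note wf = loop_transition_wf[OF this]
    show "src (\<delta> t) = fst (C t)" "tgt (\<delta> t) = fst (C (Suc t))" "j < K \<Longrightarrow> rd (\<delta> t) j = (snd (C t) ! j) 0"
     "length (act t) = K" "j < K \<Longrightarrow> wr (\<delta> t) j = fst (act t ! j)" "j < K \<Longrightarrow> mv (\<delta> t) j = move_code (snd (act t ! j))"
      using tables[OF e(2,1)] wf by simp_all
  qed
  have cellc: "\<exists>l\<in>set cl. (\<alpha> (fst (snd l)) = snd (snd l)) = fst l"
    if t: "t < T - 1" and i: "i < nts" and j: "j < K" and z: "z < 2 * T + 1" and cl: "cl \<in> set (cell_clauses T t i j z)" for t i j z cl
  proof (cases "i = \<delta> t")
    case False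
    then have "(False, [t], i) \<in> set cl" using cl by (auto simp: cell_clauses_def split: if_splits)
    then show ?thesis using False by (intro bexI[of _ "(False, [t], i)"]) (auto simp: \<alpha>)
  next
    case True
    have tT: "t < T" using t by simp
    obtain b d where bd: "act t ! j = (b, d)" by (cases "act t ! j")
    have m: "mv i j = move_code d" "wr i j = b" using tb[OF tT] j bd True by auto
    have zm: "1 \<le> z + mv i j" using cl by (auto simp: cell_clauses_def split: if_splits)
    have "\<alpha> [t + 1, j, z] = shift d ((snd (C t) ! j)(0 := b)) (int z - int T)"
      using \<delta>[OF tT] j tb(4)[OF tT] len[of t] tT by (simp add: \<alpha> bd)
    also have "\<dots> = ((snd (C t) ! j)(0 := b)) (int (z + mv i j - 1) - int T)"
      unfolding shift_move_code m(1)[symmetric] using zm by (simp add: algebra_simps of_nat_diff)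
    also have "\<dots> = (if z + mv i j - 1 = T then b else \<alpha> [t, j, z + mv i j - 1])"
      by (auto simp: \<alpha>)
    finally have *: "\<alpha> [t + 1, j, z] = (if z + mv i j - 1 = T then wr i j else \<alpha> [t, j, z + mv i j - 1])"
      using m(2) by simp
    then show ?thesis
      using cl by (auto simp: cell_clauses_def split: if_splits)
  qed
  have "\<forall>cl\<in>set (clauses T w). \<exists>l\<in>set cl. (\<alpha> (fst (snd l)) = snd (snd l)) = fst l"
    unfolding clauses_ball
  proof (intro conjI allI impI)
    fix t i assume t: "t < T - 1" "i < nts"
    then have "\<delta> (t + 1) < nts" "src (\<delta> (t + 1)) = tgt (\<delta> t)" using \<delta>[of "t + 1"] tb(1)[of "t + 1"] tb(2)[of t] by auto
    then show "\<exists>l\<in>set ((False, [t], i) # map (\<lambda>i'. (True, [t + 1], i')) (filter (\<lambda>i'. src i' = tgt i) [0..<nts])).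
        (\<alpha> (fst (snd l)) = snd (snd l)) = fst l"
      by (cases "i = \<delta> t") (auto simp: \<alpha>)
  next
    show "\<exists>l\<in>set (map (\<lambda>i. (True, [0], i)) (filter (\<lambda>i. src i = start) [0..<nts])). (\<alpha> (fst (snd l)) = snd (snd l)) = fst l"
      using \<delta>[of 0] tb(1)[of 0] assms(3) C(1) by (auto simp: \<alpha> init_config_def start_def)
  next
    show "\<exists>l\<in>set (map (\<lambda>i. (True, [T - 1], i)) (filter (\<lambda>i. tgt i = acc) [0..<nts])). (\<alpha> (fst (snd l)) = snd (snd l)) = fst l"
      using \<delta>[of "T - 1"] tb(2)[of "T - 1"] assms(2,3) C(2) by (auto simp: \<alpha> acc_def)
  next
    fix t i j assume "t < T" "i < nts" "j < K"
    then show "\<exists>l\<in>set [(False, [t], i), (True, [t, j, T], rd i j)]. (\<alpha> (fst (snd l)) = snd (snd l)) = fst l"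
      using tb(3)[of t j] by (cases "i = \<delta> t") (auto simp: \<alpha>)
  next
    fix j z assume "j < K" "z < 2 * T + 1"
    then have "\<alpha> [0, j, z] = init_symbol T w j z"
      by (cases j) (auto simp: \<alpha> C(1) init_config_def K_def init_symbol_def word_tape_def nat_diff_distrib)
    then show "\<exists>l\<in>set [(True, [0, j, z], init_symbol T w j z)]. (\<alpha> (fst (snd l)) = snd (snd l)) = fst l" by simp
  qed (use cellc in blast)
  moreover have "\<forall>d\<in>set (doms T). \<alpha> (fst d) \<in> set (snd d)"
    unfolding doms_ball using \<delta> sym by (simp add: \<alpha>)
  ultimately show ?thesis unfolding csp_sat_def by blast
qed

end

theorem NP_hard_RHS_RHF: "NP_hard (classical RHS)" "NP_hard (classical RHF)"
proof -
  have "poly_reducible L (classical RHS) \<and> poly_reducible L (classical RHF)" if NP: "in_NP L" for L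
  proof -
    obtain M and p :: "nat poly" where M: "turing_machine M" "ntm_decides M L (\<lambda>n. poly p n)"
      using NP unfolding in_NP_def by blast
    obtain ts where "set ts = loop_transitions M"
      using finite_list[OF finite_loop_transitions[OF M(1)]] by blast
    then interpret tableau M ts p using M(1) by unfold_locales
    have wf: "csp_wf (doms (steps w)) (clauses (steps w) w)" for w
      by (rule csp_wf_tableau) (simp add: steps_def)
    have "w \<in> L \<longleftrightarrow> csp_sat (doms (steps w)) (clauses (steps w) w)" for w
    proof -
      have s: "poly p (length w) < steps w" "1 \<le> steps w" by (simp_all add: steps_def)
      show ?thesis
        using accepts_iff_loop[OF M s(1)] sat_imp_run[OF _ s(2)] run_imp_sat[OF _ _ s(2)] by blast
    qed
    then show ?thesis using csp_poly_reducible[OF PT_doms PT_clauses wf] by blast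
  qed
  then show "NP_hard (classical RHS)" "NP_hard (classical RHF)" unfolding NP_hard_def by blast+
qed

section \<open>Parsing circuits\<close>

definition tokens :: "bool list \<Rightarrow> nat list" where
  "tokens w = rev (snd (foldl (\<lambda>s b. if b then (fst s + 1, snd s) else (0, fst s # snd s)) (0, []) w))"

lemma tokens_unary: "tokens (concat (map unary ns)) = ns"
proof -
  let ?f = "\<lambda>s b. if b then (fst s + 1, snd s) else (0 :: nat, fst s # snd s)"
  have u: "foldl ?f (c, a) (unary n) = (0, (c + n) # a)" for c a n
    by (induction n arbitrary: c) (simp_all add: unary_def)
  have "foldl ?f (0, a) (concat (map unary ns)) = (0, rev ns @ a)" for a
    by (induction ns arbitrary: a) (simp_all add: u)
  then show ?thesis by (simp add: tokens_def)
qed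

lemma PT_tokens [PT_intros]: "PT f \<Longrightarrow> PT (\<lambda>x. tokens (f x))"
proof (rule PT_comp[where g = tokens], assumption)
  let ?g = "\<lambda>x s b. if b then (fst s + 1, snd s) else (0 :: nat, fst s # snd s)"
  have "PT (\<lambda>w :: bool list. foldl (\<lambda>s b. ?g w s b) (0, []) w)"
  proof (rule PT_foldl_add[where q = "[:5:]"])
    show "sz (?g x s b) \<le> sz s + poly [:5:] (sz x + sz b)" for x :: "bool list" and s b
      by (cases s) simp
  qed (intro PT_intros)+
  then show "PT tokens" unfolding tokens_def[abs_def] by (intro PT_intros)
qed

text \<open>A gate is represented by a tag and the list of its in-neighbours.\<close>

fun gate_of :: "nat \<times> nat list \<Rightarrow> gate" where
  "gate_of (n, js) = (if n = 0 then Input else if n = 1 then Neg (hd js) else if n = 2 then Conj js else Disj js)"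

text \<open>The tag bits merge with the unary numbers behind them, which makes the code of a circuit
  a plain sequence of unary numbers: \<open>[True, False]\<close> is the number 1,
  \<open>[True, True]\<close> raises the following length by two, \<open>[False, False]\<close> is
  two zeros, and \<open>[False, True]\<close> is a zero followed by an argument raised by
  one.\<close>

fun gate_tokens :: "gate \<Rightarrow> nat list" where
  "gate_tokens Input = [0, 0]"
| "gate_tokens (Neg j) = [0, Suc j]"
| "gate_tokens (Conj js) = 1 # length js # js"
| "gate_tokens (Disj js) = (length js + 2) # js"

lemma unary_Suc: "unary (Suc n) = True # unary n" "unary 0 = [False]"
  by (simp_all add: unary_def)

lemma encode_gate_tokens: "encode_gate g = concat (map unary (gate_tokens g))"
  by (cases g) (simp_all add: encode_list_def unary_Suc)

lemma encode_circuit_tokens: "encode_circuit C = concat (map unary (length C # concat (map gate_tokens C)))"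
proof -
  have "concat (map encode_gate C) = concat (map unary (concat (map gate_tokens C)))"
    by (induction C) (simp_all add: encode_gate_tokens)
  then show ?thesis by (simp add: encode_circuit_def encode_list_def)
qed

text \<open>
  The parser state consists of the gates read so far (in reverse) and a mode: 0 expects a new
  gate, 1 and 2 follow the tokens 0 and 1, and 3 and 4 read the arguments of a conjunction or disjunction.
\<close>

type_synonym parser_state = "(nat \<times> nat list) list \<times> nat \<times> nat \<times> nat list"

definition parse_step :: "parser_state \<Rightarrow> nat \<Rightarrow> parser_state" where
  "parse_step s n = (let gs = fst s; mode = fst (snd s); rem = fst (snd (snd s)); args = snd (snd (snd s)) in
     if mode = 0 then if n = 0 then (gs, 1, 0, []) else if n = 1 then (gs, 2, 0, []) else (gs, 4, n - 2, [])
     else if mode = 1 then if n = 0 then ((0, []) # gs, 0, 0, []) else ((1, [n - 1]) # gs, 0, 0, [])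
     else if mode = 2 then (gs, 3, n, [])
     else if rem \<le> 1 then ((mode - 1, rev (n # args)) # gs, 0, 0, []) else (gs, mode, rem - 1, n # args))"

definition parse_gates :: "bool list \<Rightarrow> (nat \<times> nat list) list" where
  "parse_gates w = rev (fst (foldl parse_step ([], 0, 0, []) (tl (tokens w))))"

fun tag_args :: "gate \<Rightarrow> nat \<times> nat list" where
  "tag_args Input = (0, [])"
| "tag_args (Neg j) = (1, [j])"
| "tag_args (Conj js) = (2, js)"
| "tag_args (Disj js) = (3, js)"

lemma gate_of_tag_args: "gate_of (tag_args g) = g"
  by (cases g) auto

text \<open>In modes 3 and 4 the parser always consumes at least one argument, so the list has to be
  nonempty; gates of a circuit have at least two.\<close>

lemma parse_args:
  "js \<noteq> [] \<Longrightarrow> 3 \<le> m \<Longrightarrow> foldl parse_step (gs, m, length js, args) js = ((m - 1, rev args @ js) # gs, 0, 0, [])"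
proof (induction js arbitrary: args)
  case (Cons j js)
  have 1: "parse_step (gs, m, length (j # js), args) j =
     (if js = [] then ((m - 1, rev (j # args)) # gs, 0, 0, []) else (gs, m, length js, j # args))"
    using Cons.prems(2) by (simp add: parse_step_def Let_def Suc_le_eq)
  show ?case
  proof (cases "js = []")
    case True
    then show ?thesis using 1 by simp
  next
    case False
    then show ?thesis using 1 Cons.IH[of "j # args"] Cons.prems(2) by simp
  qed
qed simp

lemma parse_start:
  "parse_step (gs, 0, 0, []) (Suc 0) = (gs, 2, 0, [])" "parse_step (gs, 2, 0, []) n = (gs, 3, n, [])"
  "parse_step (gs, 0, 0, []) (Suc (Suc n)) = (gs, 4, n, [])"
  by (simp_all add: parse_step_def Let_def)

lemma parse_gate:
  assumes "case g of Conj js \<Rightarrow> 2 \<le> length js | Disj js \<Rightarrow> 2 \<le> length js | _ \<Rightarrow> True"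
  shows "foldl parse_step (gs, 0, 0, []) (gate_tokens g) = (tag_args g # gs, 0, 0, [])"
proof (cases g)
  case (Conj js)
  then have "js \<noteq> []" using assms by auto
  then show ?thesis using parse_args[of js 3 gs "[]"] Conj by (simp add: parse_start)
next
  case (Disj js)
  then have "js \<noteq> []" using assms by auto
  then show ?thesis using parse_args[of js 4 gs "[]"] Disj by (simp add: parse_start)
next
  case Input
  then show ?thesis by (simp add: parse_step_def Let_def)
next
  case (Neg j)
  then show ?thesis by (simp add: parse_step_def Let_def)
qed

lemma parse_encode_circuit:
  assumes "circuit C"
  shows "map gate_of (parse_gates (encode_circuit C)) = C"
proof -
  have "\<forall>g\<in>set C. case g of Conj js \<Rightarrow> 2 \<le> length js | Disj js \<Rightarrow> 2 \<le> length js | _ \<Rightarrow> True"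
    using assms by (auto simp: circuit_def all_set_conv_all_nth)
  then have "foldl parse_step (gs, 0, 0, []) (concat (map gate_tokens C)) = (rev (map tag_args C) @ gs, 0, 0, [])" for gs
    by (induction C arbitrary: gs) (simp_all add: parse_gate)
  then show ?thesis
    unfolding parse_gates_def encode_circuit_tokens tokens_unary
    by (simp add: rev_map comp_def gate_of_tag_args)
qed

lemma sz_snoc: "sz (xs @ [x]) = Suc (sz xs + sz x)"
  using sz_append[of xs "[x]"] by simp

lemma PT_parse_gates [PT_intros]: "PT f \<Longrightarrow> PT (\<lambda>x. parse_gates (f x))"
proof (rule PT_comp[where g = parse_gates], assumption)
  have "PT (\<lambda>w :: bool list. foldl (\<lambda>s n. parse_step s n) ([], 0, 0, []) (tl (tokens w)))"
  proof (rule PT_foldl_add[where q = "[:30, 3:]"])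
    show "PT (\<lambda>p :: bool list \<times> parser_state \<times> nat. parse_step (fst (snd p)) (snd (snd p)))"
      unfolding parse_step_def by (intro PT_intros)
    show "sz (parse_step s n) \<le> sz s + poly [:30, 3:] (sz x + sz n)" for x :: "bool list" and s n
      by (cases s) (auto simp: parse_step_def Let_def sz_snoc)
  qed (intro PT_intros)+
  then show "PT parse_gates" unfolding parse_gates_def[abs_def] by (intro PT_intros)
qed

definition args_of :: "nat \<times> nat list \<Rightarrow> nat list" where
  "args_of g = (if fst g = 0 then [] else if fst g = 1 then [hd (snd g)] else snd g)"

lemma preds_gate_of: "preds (gate_of g) = args_of g"
  by (cases g) (auto simp: args_of_def)

definition gate_code :: "nat \<times> nat list \<Rightarrow> bool list" where
  "gate_code g = (if fst g = 0 then [False, False] else if fst g = 1 then [False, True] @ unary (hd (snd g))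
     else (if fst g = 2 then [True, False] else [True, True]) @ unary (length (snd g)) @ concat (map unary (snd g)))"

lemma encode_gate_of: "encode_gate (gate_of g) = gate_code g"
  by (cases g) (auto simp: gate_code_def encode_list_def)

text \<open>The parser never fails. Words that are no codes are recognised by encoding its result
  once more and comparing.\<close>

definition is_circuit_code :: "bool list \<Rightarrow> bool" where
  "is_circuit_code w \<longleftrightarrow> (let gs = parse_gates w in
     w = unary (length gs) @ concat (map gate_code gs) \<and> gs \<noteq> [] \<and>
     (\<forall>i\<in>set [0..<length gs]. distinct (args_of (nthd gs i)) \<and> (\<forall>j\<in>set (args_of (nthd gs i)). j < i) \<and>
        (2 \<le> fst (nthd gs i) \<longrightarrow> 2 \<le> length (snd (nthd gs i)))))"

lemma is_circuit_code_iff: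
  "is_circuit_code w \<longleftrightarrow> circuit (map gate_of (parse_gates w)) \<and> w = encode_circuit (map gate_of (parse_gates w))"
proof -
  have e: "encode_circuit (map gate_of gs) = unary (length gs) @ concat (map gate_code gs)" for gs
    by (simp add: encode_circuit_def encode_list_def comp_def encode_gate_of)
  have "(case gate_of g of Conj js \<Rightarrow> 2 \<le> length js | Disj js \<Rightarrow> 2 \<le> length js | _ \<Rightarrow> True) \<longleftrightarrow>
      (2 \<le> fst g \<longrightarrow> 2 \<le> length (snd g))" for g
    by (cases g) auto
  then show ?thesis
    unfolding is_circuit_code_def Let_def e circuit_def by (auto simp: preds_gate_of)
qed

lemma PT_is_circuit_code [PT_intros]: "PT f \<Longrightarrow> PT (\<lambda>x. is_circuit_code (f x))"
  by (rule PT_comp[where g = is_circuit_code], assumption)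
    (unfold is_circuit_code_def[abs_def] gate_code_def args_of_def, intro PT_intros)

lemma circuit_code_iff:
  "(w, k) \<in> weighted_circuit_sat t d \<longleftrightarrow> (let C = map gate_of (parse_gates w) in
     is_circuit_code w \<and> weft C \<le> t \<and> circuit_depth C \<le> d \<and> weighted_satisfiable C k)"
proof
  assume "(w, k) \<in> weighted_circuit_sat t d"
  then obtain C where "w = encode_circuit C" "circuit C" "weft C \<le> t" "circuit_depth C \<le> d" "weighted_satisfiable C k"
    by (auto simp: weighted_circuit_sat_def)
  then show "let C = map gate_of (parse_gates w) in
     is_circuit_code w \<and> weft C \<le> t \<and> circuit_depth C \<le> d \<and> weighted_satisfiable C k"
    unfolding is_circuit_code_iff Let_def by (simp add: parse_encode_circuit)
next
  assume "let C = map gate_of (parse_gates w) in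
     is_circuit_code w \<and> weft C \<le> t \<and> circuit_depth C \<le> d \<and> weighted_satisfiable C k"
  then show "(w, k) \<in> weighted_circuit_sat t d"
    unfolding is_circuit_code_iff Let_def weighted_circuit_sat_def by blast
qed


section \<open>Depth and weft\<close>

definition path_to :: "circuit \<Rightarrow> nat \<Rightarrow> nat list \<Rightarrow> bool" where
  "path_to C i p \<longleftrightarrow> p \<noteq> [] \<and> set p \<subseteq> {..<length C} \<and> C ! hd p = Input \<and> last p = i \<and>
     successively (\<lambda>u v. u \<in> set (preds (C ! v))) p"

definition weight_of_path :: "circuit \<Rightarrow> nat list \<Rightarrow> nat" where
  "weight_of_path C p = length (filter (\<lambda>v. large (C ! v)) p)"

lemma input_output_path_to: "input_output_path C p \<longleftrightarrow> path_to C (length C - 1) p"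
  by (auto simp: input_output_path_def path_to_def)

lemma circuit_preds_less: "circuit C \<Longrightarrow> i < length C \<Longrightarrow> j \<in> set (preds (C ! i)) \<Longrightarrow> j < i"
  by (auto simp: circuit_def)

lemma circuit_no_preds: "circuit C \<Longrightarrow> i < length C \<Longrightarrow> preds (C ! i) = [] \<Longrightarrow> C ! i = Input"
  by (cases "C ! i") (auto simp: circuit_def dest!: spec[of _ i])

lemma path_to_Input: "i < length C \<Longrightarrow> C ! i = Input \<Longrightarrow> path_to C i p \<longleftrightarrow> p = [i]"
proof
  assume i: "C ! i = Input" and p: "path_to C i p"
  obtain q where q: "p = q @ [i]" using p by (cases p rule: rev_cases) (auto simp: path_to_def)
  have "q = []"
  proof (rule ccontr)
    assume "q \<noteq> []"
    then have "last q \<in> set (preds (C ! i))" using p by (auto simp: q path_to_def successively_append_iff)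
    then show False using i by simp
  qed
  then show "p = [i]" using q by simp
qed (auto simp: path_to_def)

lemma path_to_step:
  assumes "i < length C" "C ! i \<noteq> Input"
  shows "path_to C i p \<longleftrightarrow> (\<exists>j q. j \<in> set (preds (C ! i)) \<and> path_to C j q \<and> p = q @ [i])"
proof
  assume p: "path_to C i p"
  obtain q where q: "p = q @ [i]" using p by (cases p rule: rev_cases) (auto simp: path_to_def)
  have ne: "q \<noteq> []" using p assms(2) by (auto simp: q path_to_def)
  then have "last q \<in> set (preds (C ! i))" "path_to C (last q) q"
    using p by (auto simp: q path_to_def successively_append_iff)
  then show "\<exists>j q. j \<in> set (preds (C ! i)) \<and> path_to C j q \<and> p = q @ [i]" using q by blast
next
  assume "\<exists>j q. j \<in> set (preds (C ! i)) \<and> path_to C j q \<and> p = q @ [i]"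
  then show "path_to C i p" using assms(1) by (auto simp: path_to_def successively_append_iff)
qed

lemma path_exists:
  assumes "circuit C" "i < length C"
  shows "\<exists>p. path_to C i p"
  using assms(2)
proof (induction i rule: less_induct)
  case (less i)
  show ?case
  proof (cases "C ! i = Input")
    case True
    then show ?thesis using path_to_Input less.prems by blast
  next
    case False
    then obtain j where j: "j \<in> set (preds (C ! i))" using circuit_no_preds[OF assms(1) less.prems]
      by (cases "preds (C ! i)") auto
    then have "j < i" using circuit_preds_less[OF assms(1) less.prems] by simp
    then obtain p where "path_to C j p" using less.IH[of j] less.prems by auto
    then show ?thesis using path_to_step[OF less.prems False] j by blast
  qed
qed

lemma path_length:
  assumes "circuit C" "path_to C i p" "i < length C"
  shows "length p \<le> Suc i"
  using assms(2,3)
proof (induction i arbitrary: p rule: less_induct)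
  case (less i)
  show ?case
  proof (cases "C ! i = Input")
    case True
    then show ?thesis using path_to_Input less.prems by simp
  next
    case False
    then obtain j q where j: "j \<in> set (preds (C ! i))" "path_to C j q" "p = q @ [i]"
      using path_to_step less.prems by blast
    have "j < i" using circuit_preds_less[OF assms(1) less.prems(2) j(1)] .
    then show ?thesis using less.IH[OF _ j(2)] less.prems(2) j(3) by simp
  qed
qed

text \<open>\<open>Max\<close> is meaningful here: paths have at most \<open>length C\<close> nodes,
  and there is one because every gate other than an input has an earlier argument, so a descent from
  the output ends at an input.\<close>

lemma depth_weft_le:
  assumes "circuit C"
  shows "circuit_depth C \<le> d \<longleftrightarrow> (\<forall>p. path_to C (length C - 1) p \<longrightarrow> length p - 1 \<le> d)"
    "weft C \<le> t \<longleftrightarrow> (\<forall>p. path_to C (length C - 1) p \<longrightarrow> weight_of_path C p \<le> t)"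
proof -
  have i: "length C - 1 < length C" using assms by (simp add: circuit_def)
  have len: "length p \<le> length C" if "path_to C (length C - 1) p" for p
    using path_length[OF assms that i] i by simp
  have bd: "finite {f p | p. path_to C (length C - 1) p} \<and> {f p | p. path_to C (length C - 1) p} \<noteq> {}"
    if "\<And>p. f p \<le> length p" for f :: "nat list \<Rightarrow> nat"
  proof
    have "{f p | p. path_to C (length C - 1) p} \<subseteq> {..length C}" using len that order_trans by blast
    then show "finite {f p | p. path_to C (length C - 1) p}" using finite_subset by blast
    show "{f p | p. path_to C (length C - 1) p} \<noteq> {}" using path_exists[OF assms i] by blast
  qed
  show "circuit_depth C \<le> d \<longleftrightarrow> (\<forall>p. path_to C (length C - 1) p \<longrightarrow> length p - 1 \<le> d)"
    unfolding circuit_depth_def input_output_path_to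
    using bd[of "\<lambda>p. length p - 1"] by (subst Max_le_iff) auto
  show "weft C \<le> t \<longleftrightarrow> (\<forall>p. path_to C (length C - 1) p \<longrightarrow> weight_of_path C p \<le> t)"
    unfolding weft_def input_output_path_to weight_of_path_def
    using bd[of "\<lambda>p. length (filter (\<lambda>v. large (C ! v)) p)"] by (subst Max_le_iff) auto
qed

text \<open>The shape of a node records whether its depth is at most \<open>n\<close> and if so, its weft.\<close>

fun shape :: "circuit \<Rightarrow> nat \<Rightarrow> nat \<Rightarrow> nat option" where
  "shape C 0 i = (if C ! i = Input then Some 0 else None)"
| "shape C (Suc n) i = (if C ! i = Input then Some 0
     else if \<exists>j\<in>set (preds (C ! i)). shape C n j = None then None
     else Some (foldl max 0 (map (\<lambda>j. the (shape C n j)) (preds (C ! i))) + (if large (C ! i) then 1 else 0)))"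

lemma foldl_max: "foldl max (m :: nat) xs = Max (insert m (set xs))"
proof (induction xs arbitrary: m)
  case (Cons x xs)
  then show ?case by (cases "xs = []") (simp_all add: max.assoc)
qed simp

lemma shape_sound:
  assumes "circuit C" "i < length C" "shape C n i = Some L" "path_to C i p"
  shows "length p - 1 \<le> n \<and> weight_of_path C p \<le> L"
  using assms(2-)
proof (induction n arbitrary: i L p)
  case 0
  then have "C ! i = Input" "L = 0" by (auto split: if_splits)
  then show ?case using path_to_Input[OF 0(1)] 0(3) by (simp add: weight_of_path_def large_def)
next
  case (Suc n)
  show ?case
  proof (cases "C ! i = Input")
    case True
    then show ?thesis using path_to_Input[OF Suc.prems(1)] Suc.prems(3) by (simp add: weight_of_path_def large_def)
  next
    case False
    then obtain j q where j: "j \<in> set (preds (C ! i))" "path_to C j q" "p = q @ [i]"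
      using path_to_step Suc.prems by blast
    have "j < i" using circuit_preds_less[OF assms(1) Suc.prems(1) j(1)] .
    obtain l where l: "shape C n j = Some l" using Suc.prems(2) False j(1) by (auto split: if_splits)
    have q: "length q - 1 \<le> n \<and> weight_of_path C q \<le> l"
      using Suc.IH[OF _ l j(2)] \<open>j < i\<close> Suc.prems(1) by simp
    have ne: "q \<noteq> []" using j(2) by (simp add: path_to_def)
    have L: "L = foldl max 0 (map (\<lambda>j. the (shape C n j)) (preds (C ! i))) + (if large (C ! i) then 1 else 0)"
      using Suc.prems(2) False by (auto split: if_splits)
    have "the (shape C n j) \<le> foldl max 0 (map (\<lambda>j. the (shape C n j)) (preds (C ! i)))"
      unfolding foldl_max using j(1) by (intro Max_ge) auto
    then have "l + (if large (C ! i) then 1 else 0) \<le> L" unfolding L using l by simp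
    then show ?thesis using q ne unfolding j(3) by (cases q) (auto simp: weight_of_path_def)
  qed
qed

text \<open>A path attaining the value \<open>L\<close> is produced along with it, so that a
  computed weft above the bound really refutes the bound.\<close>

lemma shape_complete:
  assumes "circuit C" "i < length C" "\<And>p. path_to C i p \<Longrightarrow> length p - 1 \<le> n"
  shows "\<exists>L p. shape C n i = Some L \<and> path_to C i p \<and> weight_of_path C p = L"
  using assms(2-)
proof (induction n arbitrary: i)
  case 0
  have "C ! i = Input"
  proof (rule ccontr)
    assume n: "C ! i \<noteq> Input"
    obtain p where p: "path_to C i p" using path_exists[OF assms(1) 0(1)] by blast
    then obtain j q where "path_to C j q" "p = q @ [i]" using path_to_step[OF 0(1) n] by blast
    then show False using 0(2)[OF p] by (simp add: path_to_def)
  qed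
  then show ?case using path_to_Input[OF 0(1)] by (simp add: weight_of_path_def large_def)
next
  case (Suc n)
  show ?case
  proof (cases "C ! i = Input")
    case True
    then show ?thesis using path_to_Input[OF Suc.prems(1)] by (simp add: weight_of_path_def large_def)
  next
    case False
    have IH: "\<exists>L p. shape C n j = Some L \<and> path_to C j p \<and> weight_of_path C p = L" if j: "j \<in> set (preds (C ! i))" for j
    proof (rule Suc.IH)
      show "j < length C" using circuit_preds_less[OF assms(1) Suc.prems(1) j] Suc.prems(1) by simp
      fix q assume q: "path_to C j q"
      then have "path_to C i (q @ [i])" using path_to_step[OF Suc.prems(1) False] j by blast
      from Suc.prems(2)[OF this] q show "length q - 1 \<le> n" by (cases q) (auto simp: path_to_def)
    qed
    then have nn: "\<not> (\<exists>j\<in>set (preds (C ! i)). shape C n j = None)" by force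
    let ?m = "foldl max 0 (map (\<lambda>j. the (shape C n j)) (preds (C ! i)))"
    have ne: "preds (C ! i) \<noteq> []" using circuit_no_preds[OF assms(1) Suc.prems(1)] False by blast
    have "?m \<in> insert 0 (set (map (\<lambda>j. the (shape C n j)) (preds (C ! i))))" unfolding foldl_max by (rule Max_in) auto
    moreover have "the (shape C n j) \<le> ?m" if "j \<in> set (preds (C ! i))" for j
      unfolding foldl_max using that by (intro Max_ge) auto
    ultimately obtain j where j: "j \<in> set (preds (C ! i))" "the (shape C n j) = ?m"
    proof (cases "?m = 0")
      case True
      obtain j where "j \<in> set (preds (C ! i))" using ne by (cases "preds (C ! i)") auto
      with \<open>\<And>j. j \<in> set (preds (C ! i)) \<Longrightarrow> the (shape C n j) \<le> ?m\<close>[OF this] True that show ?thesis by fastforce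
    next
      case False
      then show ?thesis using \<open>?m \<in> insert 0 _\<close> that by auto
    qed
    obtain p where p: "path_to C j p" "weight_of_path C p = ?m" using IH[OF j(1)] j(2) by auto
    have "path_to C i (p @ [i])" using path_to_step[OF Suc.prems(1) False] j(1) p(1) by blast
    moreover have "weight_of_path C (p @ [i]) = ?m + (if large (C ! i) then 1 else 0)"
      using p(2) by (simp add: weight_of_path_def)
    ultimately show ?thesis using False nn by auto
  qed
qed

lemma depth_weft_shape:
  assumes "circuit C"
  shows "circuit_depth C \<le> d \<and> weft C \<le> t \<longleftrightarrow> (\<exists>L\<le>t. shape C d (length C - 1) = Some L)"
proof -
  have i: "length C - 1 < length C" using assms by (simp add: circuit_def)
  show ?thesis
    unfolding depth_weft_le[OF assms]
  proof
    assume *: "(\<forall>p. path_to C (length C - 1) p \<longrightarrow> length p - 1 \<le> d) \<and>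
      (\<forall>p. path_to C (length C - 1) p \<longrightarrow> weight_of_path C p \<le> t)"
    then obtain L p where "shape C d (length C - 1) = Some L" "path_to C (length C - 1) p" "weight_of_path C p = L"
      using shape_complete[OF assms i, of d] by blast
    with * show "\<exists>L\<le>t. shape C d (length C - 1) = Some L" by blast
  next
    assume "\<exists>L\<le>t. shape C d (length C - 1) = Some L"
    then obtain L where L: "L \<le> t" "shape C d (length C - 1) = Some L" by blast
    show "(\<forall>p. path_to C (length C - 1) p \<longrightarrow> length p - 1 \<le> d) \<and>
      (\<forall>p. path_to C (length C - 1) p \<longrightarrow> weight_of_path C p \<le> t)"
      using shape_sound[OF assms i L(2)] L(1) by (meson order_trans)
  qed
qed

section \<open>Normal forms of circuits of weft two\<close>

text \<open>
  A set of \<open>k\<close> true inputs is an increasing sequence \<open>x 1 < \<dots> < x k\<close>, completed by the sentinels \<open>x 0\<close> and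
  \<open>x (k + 1)\<close>. An atom \<open>(P, V)\<close> states that \<open>V = map x P\<close>. An input is false iff it lies in a gap between
  consecutive positions, so both values of a bounded fan-in circuit are disjunctions of atoms.
  A normal form is a disjunction of options, which are conjunctions of disjunctions of atoms.
\<close>

type_synonym atom = "nat list \<times> nat list"
type_synonym nf = "atom list list list"

text \<open>Input \<open>y\<close> is represented by the value \<open>Suc y\<close>, which leaves 0
  and \<open>N + 1\<close> to the sentinels.\<close>

definition true_atoms :: "atom list \<Rightarrow> nat \<Rightarrow> atom list" where
  "true_atoms A y = filter (\<lambda>a. Suc y \<in> set (snd a)) A"

definition false_atoms :: "atom list \<Rightarrow> nat \<Rightarrow> atom list" where
  "false_atoms A y = filter (\<lambda>a. \<exists>i\<in>set [0..<length (fst a)]. \<exists>j\<in>set [0..<length (fst a)].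
     nthd (fst a) j = Suc (nthd (fst a) i) \<and> nthd (snd a) i < Suc y \<and> Suc y < nthd (snd a) j) A"

text \<open>At weft 0 the conjunction of two clauses is their intersection: a true atom in both
  exists once the relevant positions of both fit into one tuple. In the range up to weft 2, a large
  gate meets only arguments with a single option, since their weft is at most 1. The last case
  multiplies the numbers of options, which is harmless at constant depth.\<close>

definition and_nf :: "bool \<Rightarrow> nat \<Rightarrow> nf list \<Rightarrow> nf" where
  "and_nf lg L Xs =
     (if L = 0 then [[filter (\<lambda>a. a \<in> set (hd (hd (nthd Xs 1)))) (hd (hd (nthd Xs 0)))]]
      else if lg then [concat (map (\<lambda>X. hd X) Xs)]
      else concat (map (\<lambda>a. map (\<lambda>b. a @ b) (nthd Xs 1)) (nthd Xs 0)))"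

text \<open>At weft 2 the options are collected. A large gate of weft 1 has arguments of weft 0,
  which are single clauses and can be merged. In the last case the disjunction is distributed over
  the clauses, so that one option remains.\<close>

definition or_nf :: "bool \<Rightarrow> nat \<Rightarrow> nf list \<Rightarrow> nf" where
  "or_nf lg L Xs =
     (if 1 < L then concat Xs
      else if lg then [[concat (map (\<lambda>X. hd (hd X)) Xs)]]
      else [concat (map (\<lambda>a. map (\<lambda>b. a @ b) (hd (nthd Xs 1))) (hd (nthd Xs 0)))])"

text \<open>An entry consists of a validity flag, the weft, and normal forms for the values true and false.\<close>

type_synonym entry = "bool \<times> nat \<times> nf \<times> nf"

definition entry_of :: "atom list \<Rightarrow> (nat \<times> nat list) list \<Rightarrow> entry list \<Rightarrow> nat \<Rightarrow> entry" where
  "entry_of A gs tbl i = (let g = nthd gs i; es = map (\<lambda>j. nthd tbl j) (args_of g); lg = 2 < length (args_of g);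
       L = foldl max 0 (map (\<lambda>e. fst (snd e)) es) + (if lg then 1 else 0);
       Ts = map (\<lambda>e. fst (snd (snd e))) es; Fs = map (\<lambda>e. snd (snd (snd e))) es in
     if fst g = 0 then (True, 0, [[true_atoms A i]], [[false_atoms A i]])
     else if \<exists>e\<in>set es. \<not> fst e then (False, 0, [], [])
     else if fst g = 1 then (True, L, hd Fs, hd Ts)
     else if fst g = 2 then (True, L, and_nf lg L Ts, or_nf lg L Fs)
     else (True, L, or_nf lg L Ts, and_nf lg L Fs))"

text \<open>Level 0 is invalid throughout, so validity at level \<open>Suc n\<close> means depth at
  most \<open>n\<close>. The recursion is on a constant and not along the circuit:
  \<open>PT_table\<close> then follows from the closure properties, with a polynomial for each level
  and no separate estimate of the sizes of normal forms.\<close>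

fun table :: "nat \<Rightarrow> atom list \<Rightarrow> (nat \<times> nat list) list \<Rightarrow> entry list" where
  "table 0 A gs = map (\<lambda>i. (False, 0, [], [])) gs"
| "table (Suc n) A gs = map (\<lambda>i. entry_of A gs (table n A gs) i) [0..<length gs]"

lemma PT_foldl_max [PT_intros]: "PT f \<Longrightarrow> PT (\<lambda>x. foldl max 0 (f x) :: nat)"
proof -
  assume "PT f"
  then have "PT (\<lambda>x. foldl (\<lambda>s y. if s \<le> y then y else s) 0 (f x))"
    by (intro PT_foldl_add[where q = "[:0, 1:]"] PT_intros) simp_all
  then show ?thesis by (simp add: max_def[abs_def])
qed

lemma PT_table: "PT (\<lambda>p. table n (fst p) (snd p))"
proof (induction n)
  case 0
  show ?case unfolding table.simps by (intro PT_intros)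
next
  case (Suc n)
  have "PT (\<lambda>q :: (atom list \<times> (nat \<times> nat list) list) \<times> entry list \<times> nat.
      entry_of (fst (fst q)) (snd (fst q)) (fst (snd q)) (snd (snd q)))"
    unfolding entry_of_def true_atoms_def false_atoms_def and_nf_def or_nf_def args_of_def by (intro PT_intros)
  from PT_comp3[OF this[unfolded case_prod_beta], of "\<lambda>p. fst p" "\<lambda>p. table n (fst (fst p)) (snd (fst p))" "\<lambda>p. snd p"]
  have 1: "PT (\<lambda>p :: (atom list \<times> (nat \<times> nat list) list) \<times> nat. entry_of (fst (fst p)) (snd (fst p)) (table n (fst (fst p)) (snd (fst p))) (snd p))"
    using PT_comp[OF PT_fst[OF PT_id] Suc] by (simp add: PT_fst PT_snd PT_id)
  show ?case unfolding table.simps by (rule PT_map[OF _ 1]) (intro PT_intros)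
qed

lemma length_table [simp]: "length (table n A gs) = length gs"
  by (cases n) auto

lemma table_shape:
  assumes "circuit (map gate_of gs)" "i < length gs"
  shows "fst (table (Suc n) A gs ! i) \<longleftrightarrow> shape (map gate_of gs) n i \<noteq> None"
    "shape (map gate_of gs) n i = Some L \<Longrightarrow> fst (snd (table (Suc n) A gs ! i)) = L"
proof -
  let ?C = "map gate_of gs"
  have inp: "?C ! i = Input \<longleftrightarrow> fst (gs ! i) = 0" if "i < length gs" for i
    using that by (cases "gs ! i") auto
  have pr: "preds (?C ! i) = args_of (gs ! i)" if "i < length gs" for i using that by (simp add: preds_gate_of)
  have lt: "j < length gs" if "i < length gs" "j \<in> set (args_of (gs ! i))" for i j
    using circuit_preds_less[OF assms(1), of i j] that pr by simp
  have "(fst (table (Suc n) A gs ! i) \<longleftrightarrow> shape ?C n i \<noteq> None) \<and>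
      (\<forall>L. shape ?C n i = Some L \<longrightarrow> fst (snd (table (Suc n) A gs ! i)) = L)"
    using assms(2)
  proof (induction n arbitrary: i)
    case 0
    show ?case
    proof (cases "fst (gs ! i) = 0")
      case True
      then show ?thesis using 0 inp[OF 0] by (simp add: entry_of_def Let_def)
    next
      case False
      then have "args_of (gs ! i) \<noteq> []" using circuit_no_preds[OF assms(1), of i] 0 inp[OF 0] pr[OF 0] by auto
      then obtain j where j: "j \<in> set (args_of (gs ! i))" by (cases "args_of (gs ! i)") auto
      then have "\<exists>e\<in>(\<lambda>j. nthd (table 0 A gs) j) ` set (args_of (gs ! i)). \<not> fst e"
      proof -
        have "\<not> fst (nthd (table 0 A gs) j)" using lt[OF 0 j] by simp
        then show ?thesis using j by blast
      qed
      then show ?thesis using 0 False inp[OF 0] by (simp add: entry_of_def Let_def)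
    qed
  next
    case (Suc n)
    note i = Suc.prems
    show ?case
    proof (cases "fst (gs ! i) = 0")
      case True
      then show ?thesis using i inp[OF i] by (simp add: entry_of_def Let_def)
    next
      case False
      let ?t = "table (Suc n) A gs"
      have e: "table (Suc (Suc n)) A gs ! i = entry_of A gs ?t i" using i by simp
      have ok: "fst (nthd ?t j) \<longleftrightarrow> shape ?C n j \<noteq> None" "shape ?C n j = Some L \<Longrightarrow> fst (snd (nthd ?t j)) = L"
        if "j \<in> set (args_of (gs ! i))" for j L
        using Suc.IH[OF lt[OF i that]] lt[OF i that] by (simp_all del: table.simps)
      show ?thesis
      proof (cases "\<exists>j\<in>set (args_of (gs ! i)). shape ?C n j = None")
        case True
        then have "\<exists>e\<in>(\<lambda>j. nthd ?t j) ` set (args_of (gs ! i)). \<not> fst e" using ok(1) by auto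
        then show ?thesis unfolding e using True False inp[OF i] pr[OF i] i
          by (simp add: entry_of_def Let_def del: table.simps)
      next
        case F2: False
        then have "\<not> (\<exists>e\<in>(\<lambda>j. nthd ?t j) ` set (args_of (gs ! i)). \<not> fst e)" using ok(1) by auto
        moreover have "foldl max 0 (map (\<lambda>j. fst (snd (nthd ?t j))) (args_of (gs ! i))) =
            foldl max 0 (map (\<lambda>j. the (shape ?C n j)) (args_of (gs ! i)))"
          using ok(2) F2 by (intro arg_cong[of _ _ "foldl max 0"] map_cong) auto
        ultimately show ?thesis unfolding e using F2 False inp[OF i] pr[OF i] i
          by (simp add: entry_of_def Let_def comp_def large_def del: table.simps)
      qed
    qed
  qed
  then show "fst (table (Suc n) A gs ! i) \<longleftrightarrow> shape (map gate_of gs) n i \<noteq> None"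
    "shape (map gate_of gs) n i = Some L \<Longrightarrow> fst (snd (table (Suc n) A gs ! i)) = L" by blast+
qed

section \<open>Truth of atoms, clauses and normal forms along an increasing sequence\<close>

locale positions =
  fixes A :: "atom list" and x :: "nat \<Rightarrow> nat" and k r N :: nat
  assumes A_complete: "length P = r \<Longrightarrow> set P \<subseteq> {..k + 1} \<Longrightarrow> (P, map x P) \<in> set A"
    and A_sound: "a \<in> set A \<Longrightarrow> length (fst a) = r \<and> set (fst a) \<subseteq> {..k + 1}"
    and x_mono: "p < q \<Longrightarrow> q \<le> k + 1 \<Longrightarrow> x p < x q"
    and x_bounds: "x 0 = 0" "x (k + 1) = N + 1"
begin

definition holds_atom :: "atom \<Rightarrow> bool" where
  "holds_atom a \<longleftrightarrow> a \<in> set A \<and> snd a = map x (fst a)"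

definition holds_clause :: "atom list \<Rightarrow> bool" where
  "holds_clause c \<longleftrightarrow> (\<exists>a\<in>set c. holds_atom a)"

definition holds_option :: "atom list list \<Rightarrow> bool" where
  "holds_option ops \<longleftrightarrow> (\<forall>c\<in>set ops. holds_clause c)"

definition holds_nf :: "nf \<Rightarrow> bool" where
  "holds_nf X \<longleftrightarrow> (\<exists>ops\<in>set X. holds_option ops)"

lemma holds_simps [simp]:
  "holds_clause (c @ c') \<longleftrightarrow> holds_clause c \<or> holds_clause c'"
  "holds_clause (concat cs) \<longleftrightarrow> (\<exists>c\<in>set cs. holds_clause c)"
  "holds_option [c] \<longleftrightarrow> holds_clause c"
  "holds_option (ops @ ops') \<longleftrightarrow> holds_option ops \<and> holds_option ops'"
  "holds_option (concat opss) \<longleftrightarrow> (\<forall>ops\<in>set opss. holds_option ops)"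
  "holds_nf [ops] \<longleftrightarrow> holds_option ops"
  "holds_nf (concat Xs) \<longleftrightarrow> (\<exists>X\<in>set Xs. holds_nf X)"
  by (auto simp: holds_clause_def holds_option_def holds_nf_def)

text \<open>A clause of weft 0 is decided by a bounded number of positions.\<close>

definition covers :: "nat \<Rightarrow> atom list \<Rightarrow> bool \<Rightarrow> bool" where
  "covers n c b \<longleftrightarrow> (holds_clause c \<longrightarrow> b) \<and>
     (b \<longrightarrow> (\<exists>Q\<subseteq>{..k + 1}. card Q \<le> 2 ^ n \<and>
        (\<forall>P. length P = r \<longrightarrow> set P \<subseteq> {..k + 1} \<longrightarrow> Q \<subseteq> set P \<longrightarrow> (P, map x P) \<in> set c)))"

lemma covers_iff:
  assumes "covers n c b" "2 ^ n \<le> r"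
  shows "holds_clause c \<longleftrightarrow> b"
proof
  assume b
  then obtain Q where Q: "Q \<subseteq> {..k + 1}" "card Q \<le> 2 ^ n"
    "\<And>P. length P = r \<Longrightarrow> set P \<subseteq> {..k + 1} \<Longrightarrow> Q \<subseteq> set P \<Longrightarrow> (P, map x P) \<in> set c"
    using assms(1) unfolding covers_def by blast
  have fin: "finite Q" using Q(1) finite_subset by blast
  \<comment> \<open>The deciding positions are padded to an \<open>r\<close>-tuple by repeating
    position 0.\<close>
  let ?P = "sorted_list_of_set Q @ replicate (r - card Q) 0"
  have P: "length ?P = r" "set ?P \<subseteq> {..k + 1}" "Q \<subseteq> set ?P" using fin Q(1,2) assms(2) by (auto split: if_splits)
  have "holds_atom (?P, map x ?P)" unfolding holds_atom_def using A_complete[OF P(1,2)] by simp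
  then show "holds_clause c" using Q(3)[OF P] unfolding holds_clause_def by blast
qed (use assms(1) in \<open>simp add: covers_def\<close>)

text \<open>The form is stricter at lower weft: a single clause at weft 0, a single option at weft
  1. Nothing is claimed beyond weft 2, since such a node cannot feed one of weft at most 2.\<close>

definition nf_sem :: "nat \<Rightarrow> nat \<Rightarrow> nf \<Rightarrow> bool \<Rightarrow> bool" where
  "nf_sem n L X b \<longleftrightarrow> (L = 0 \<longrightarrow> (\<exists>c. X = [[c]] \<and> covers n c b)) \<and>
     (L = 1 \<longrightarrow> (\<exists>ops. X = [ops] \<and> (holds_option ops \<longleftrightarrow> b))) \<and> (L = 2 \<longrightarrow> (holds_nf X \<longleftrightarrow> b))"

lemma nf_sem_1:
  assumes "nf_sem n L X b" "L \<le> 1" "2 ^ n \<le> r"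
  shows "\<exists>ops. X = [ops] \<and> (holds_option ops \<longleftrightarrow> b)"
proof (cases "L = 0")
  case True
  then obtain c where "X = [[c]]" "covers n c b" using assms(1) by (auto simp: nf_sem_def)
  then show ?thesis using covers_iff[OF _ assms(3)] by simp
qed (use assms in \<open>auto simp: nf_sem_def\<close>)

lemma nf_sem_2:
  assumes "nf_sem n L X b" "L \<le> 2" "2 ^ n \<le> r"
  shows "holds_nf X \<longleftrightarrow> b"
proof (cases "L \<le> 1")
  case True
  then show ?thesis using nf_sem_1[OF assms(1) _ assms(3)] by auto
next
  case False
  then have "L = 2" using assms(2) by simp
  then show ?thesis using assms(1) by (simp add: nf_sem_def)
qed

lemma covers_mono: "covers n c b \<Longrightarrow> covers (Suc n) c b"
  unfolding covers_def by (meson order_trans power_increasing one_le_numeral le_Suc_eq order_refl)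

lemma nf_sem_Suc: "nf_sem n L X b \<Longrightarrow> nf_sem (Suc n) L X b"
  unfolding nf_sem_def using covers_mono by blast

lemma covers_or: "covers n c b \<Longrightarrow> covers n c' b' \<Longrightarrow> covers n (c @ c') (b \<or> b')"
  unfolding covers_def by (simp, blast)

text \<open>A tuple that contains the deciding positions of both sides has its atom in both clauses.
  This is why atoms speak of tuples, and why the number of positions doubles from one level to the
  next.\<close>

lemma covers_and:
  assumes "covers n c b" "covers n c' b'"
  shows "covers (Suc n) (filter (\<lambda>a. a \<in> set c') c) (b \<and> b')"
  unfolding covers_def
proof (intro conjI impI)
  assume "holds_clause (filter (\<lambda>a. a \<in> set c') c)"
  then have "holds_clause c" "holds_clause c'" by (auto simp: holds_clause_def)
  then show b b' using assms by (auto simp: covers_def)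
next
  assume "b \<and> b'"
  then obtain Q Q' where Q: "Q \<subseteq> {..k + 1}" "card Q \<le> 2 ^ n"
      "\<And>P. length P = r \<Longrightarrow> set P \<subseteq> {..k + 1} \<Longrightarrow> Q \<subseteq> set P \<Longrightarrow> (P, map x P) \<in> set c"
    and Q': "Q' \<subseteq> {..k + 1}" "card Q' \<le> 2 ^ n"
      "\<And>P. length P = r \<Longrightarrow> set P \<subseteq> {..k + 1} \<Longrightarrow> Q' \<subseteq> set P \<Longrightarrow> (P, map x P) \<in> set c'"
    using assms unfolding covers_def by meson
  have "card (Q \<union> Q') \<le> 2 ^ Suc n" using card_Un_le[of Q Q'] Q(2) Q'(2) by simp
  then show "\<exists>Q\<subseteq>{..k + 1}. card Q \<le> 2 ^ Suc n \<and>
        (\<forall>P. length P = r \<longrightarrow> set P \<subseteq> {..k + 1} \<longrightarrow> Q \<subseteq> set P \<longrightarrow> (P, map x P) \<in> set (filter (\<lambda>a. a \<in> set c') c))"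
    using Q(1,3) Q'(1,3) by (intro exI[of _ "Q \<union> Q'"]) auto
qed

lemma two_args: "2 \<le> length ps \<Longrightarrow> \<not> 2 < length ps \<Longrightarrow> \<exists>i j. ps = [i, j]"
proof -
  assume "2 \<le> length ps" "\<not> 2 < length ps"
  then have "length ps = Suc (Suc 0)" by simp
  then show ?thesis by (auto simp: length_Suc_conv)
qed

lemma and_nf_sem:
  assumes "\<And>j. j \<in> set ps \<Longrightarrow> nf_sem n (l j) (X j) (b j) \<and> l j + (if lg then 1 else 0) \<le> L"
    "lg = (2 < length ps)" "2 \<le> length ps" "2 ^ n \<le> r"
  shows "nf_sem (Suc n) L (and_nf lg L (map X ps)) (\<forall>j\<in>set ps. b j)"
proof (cases lg)
  case True
  then obtain j0 where "j0 \<in> set ps" using assms(2) by (cases ps) auto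
  then have L0: "L \<noteq> 0" using assms(1) True by fastforce
  show ?thesis
  proof (cases "L \<le> 2")
    case L2: True
    have one: "\<exists>ops. X j = [ops] \<and> (holds_option ops \<longleftrightarrow> b j)" if "j \<in> set ps" for j
      using nf_sem_1[OF conjunct1[OF assms(1)[OF that]] _ assms(4)] assms(1)[OF that] True L2 by auto
    then have "holds_option (hd (X j)) \<longleftrightarrow> b j" if "j \<in> set ps" for j using that by force
    then show ?thesis using L0 True by (auto simp: nf_sem_def and_nf_def)
  qed (auto simp: nf_sem_def)
next
  case False
  obtain i j where ps: "ps = [i, j]" using two_args[OF assms(3)] assms(2) False by auto
  have s: "nf_sem n (l i) (X i) (b i)" "l i \<le> L" "nf_sem n (l j) (X j) (b j)" "l j \<le> L"
    using assms(1)[of i] assms(1)[of j] ps False by auto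
  consider "L = 0" | "L = 1" | "L = 2" | "2 < L" by linarith
  then show ?thesis
  proof cases
    case 1
    then obtain c c' where "X i = [[c]]" "covers n c (b i)" "X j = [[c']]" "covers n c' (b j)"
      using s by (auto simp: nf_sem_def)
    then show ?thesis using covers_and 1 by (simp add: nf_sem_def and_nf_def ps nthd_def)
  next
    case 2
    then obtain o1 o2 where "X i = [o1]" "holds_option o1 \<longleftrightarrow> b i" "X j = [o2]" "holds_option o2 \<longleftrightarrow> b j"
      using nf_sem_1[OF s(1) _ assms(4)] nf_sem_1[OF s(3) _ assms(4)] s(2,4) by auto
    then show ?thesis using 2 False by (simp add: nf_sem_def and_nf_def ps nthd_def)
  next
    case 3
    have h: "holds_nf (X i) \<longleftrightarrow> b i" "holds_nf (X j) \<longleftrightarrow> b j"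
      using nf_sem_2[OF s(1) _ assms(4)] nf_sem_2[OF s(3) _ assms(4)] s(2,4) 3 by auto
    have "holds_nf (concat (map (\<lambda>a. map (\<lambda>b. a @ b) (X j)) (X i))) \<longleftrightarrow> holds_nf (X i) \<and> holds_nf (X j)"
      by (auto simp: holds_nf_def)
    then show ?thesis using 3 False h by (simp add: nf_sem_def and_nf_def ps nthd_def)
  qed (simp add: nf_sem_def)
qed

lemma or_nf_sem:
  assumes "\<And>j. j \<in> set ps \<Longrightarrow> nf_sem n (l j) (X j) (b j) \<and> l j + (if lg then 1 else 0) \<le> L"
    "lg = (2 < length ps)" "2 \<le> length ps" "2 ^ n \<le> r"
  shows "nf_sem (Suc n) L (or_nf lg L (map X ps)) (\<exists>j\<in>set ps. b j)"
proof -
  consider "L = 2" | "2 < L" | "L \<le> 1" lg | "L \<le> 1" "\<not> lg" by linarith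
  then show ?thesis
  proof cases
    case 1
    have "holds_nf (X j) \<longleftrightarrow> b j" if "j \<in> set ps" for j
      using nf_sem_2[OF conjunct1[OF assms(1)[OF that]] _ assms(4)] assms(1)[OF that] 1 by auto
    then show ?thesis using 1 by (auto simp: nf_sem_def or_nf_def)
  next
    case 2
    then show ?thesis by (simp add: nf_sem_def)
  next
    case 3
    then obtain j0 where "j0 \<in> set ps" using assms(2) by (cases ps) auto
    then have L: "L = 1" using assms(1)[of j0] 3 by auto
    have "\<exists>c. X j = [[c]] \<and> covers n c (b j)" if "j \<in> set ps" for j
      using assms(1)[OF that] 3 by (auto simp: nf_sem_def)
    then have "holds_clause (hd (hd (X j))) \<longleftrightarrow> b j" if "j \<in> set ps" for j
      using that covers_iff[OF _ assms(4)] by force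
    then show ?thesis using 3(2) by (auto simp: nf_sem_def or_nf_def L)
  next
    case 4
    obtain i j where ps: "ps = [i, j]" using two_args[OF assms(3)] assms(2) 4 by auto
    have s: "nf_sem n (l i) (X i) (b i)" "l i \<le> L" "nf_sem n (l j) (X j) (b j)" "l j \<le> L"
      using assms(1)[of i] assms(1)[of j] ps 4 by auto
    show ?thesis
    proof (cases "L = 0")
      case True
      then obtain c c' where "X i = [[c]]" "covers n c (b i)" "X j = [[c']]" "covers n c' (b j)"
        using s by (auto simp: nf_sem_def)
      then show ?thesis using covers_mono[OF covers_or] True 4 by (simp add: nf_sem_def or_nf_def ps nthd_def)
    next
      case False
      then obtain o1 o2 where o: "X i = [o1]" "holds_option o1 \<longleftrightarrow> b i" "X j = [o2]" "holds_option o2 \<longleftrightarrow> b j"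
        using nf_sem_1[OF s(1) _ assms(4)] nf_sem_1[OF s(3) _ assms(4)] s(2,4) 4 by auto
      have "holds_option (concat (map (\<lambda>a. map (\<lambda>b. a @ b) o2) o1)) \<longleftrightarrow> holds_option o1 \<or> holds_option o2"
        unfolding holds_option_def by auto
      then show ?thesis using o False 4 by (simp add: nf_sem_def or_nf_def ps nthd_def)
    qed
  qed
qed

lemma x_less_iff: "p \<le> k + 1 \<Longrightarrow> q \<le> k + 1 \<Longrightarrow> x p < x q \<longleftrightarrow> p < q"
  using x_mono[of p q] x_mono[of q p] by (cases p q rule: linorder_cases) auto

lemma true_atoms_sem:
  assumes "y < N"
  shows "covers 1 (true_atoms A y) (\<exists>p\<in>{1..k}. x p = Suc y)"
  unfolding covers_def
proof (intro conjI impI)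
  assume "holds_clause (true_atoms A y)"
  then obtain a where a: "a \<in> set A" "snd a = map x (fst a)" "Suc y \<in> set (snd a)"
    by (auto simp: holds_clause_def holds_atom_def true_atoms_def)
  then obtain p where p: "p \<in> set (fst a)" "x p = Suc y" by auto
  then have "p \<le> k + 1" using A_sound[OF a(1)] by auto
  moreover have "p \<noteq> 0" using p(2) x_bounds by (cases p) auto
  moreover have "p \<noteq> k + 1" using p(2) x_bounds assms by auto
  ultimately show "\<exists>p\<in>{1..k}. x p = Suc y" using p(2) by (intro bexI[of _ p]) auto
next
  assume "\<exists>p\<in>{1..k}. x p = Suc y"
  then obtain p where p: "p \<in> {1..k}" "x p = Suc y" by blast
  then show "\<exists>Q\<subseteq>{..k + 1}. card Q \<le> 2 ^ 1 \<and>
        (\<forall>P. length P = r \<longrightarrow> set P \<subseteq> {..k + 1} \<longrightarrow> Q \<subseteq> set P \<longrightarrow> (P, map x P) \<in> set (true_atoms A y))"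
    using A_complete by (intro exI[of _ "{p}"]) (auto simp: true_atoms_def image_iff intro!: bexI[of _ p])
qed

lemma false_atoms_sem:
  assumes "y < N"
  shows "covers 1 (false_atoms A y) (\<not> (\<exists>p\<in>{1..k}. x p = Suc y))"
  unfolding covers_def
proof (intro conjI impI)
  assume "holds_clause (false_atoms A y)"
  then obtain a i j where a: "a \<in> set A" "snd a = map x (fst a)" "i < length (fst a)" "j < length (fst a)"
    "nthd (fst a) j = Suc (nthd (fst a) i)" "nthd (snd a) i < Suc y" "Suc y < nthd (snd a) j"
    by (auto simp: holds_clause_def holds_atom_def false_atoms_def)
  let ?p = "fst a ! i"
  have p: "fst a ! j = Suc ?p" "x ?p < Suc y" "Suc y < x (Suc ?p)" using a by auto
  have pk: "Suc ?p \<le> k + 1" using A_sound[OF a(1)] nth_mem[OF a(4)] p(1) by auto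
  show "\<not> (\<exists>q\<in>{1..k}. x q = Suc y)"
  proof
    assume "\<exists>q\<in>{1..k}. x q = Suc y"
    then obtain q where "q \<in> {1..k}" and xq: "x q = Suc y" by blast
    then have q: "q \<le> k + 1" "x q = Suc y" by auto
    have "?p < q" using x_less_iff[of ?p q] p(2) q pk by simp
    moreover have "q < Suc ?p" using x_less_iff[of q "Suc ?p"] p(3) q pk by simp
    ultimately show False by simp
  qed
next
  assume n: "\<not> (\<exists>p\<in>{1..k}. x p = Suc y)"
  \<comment> \<open>\<open>?p\<close> is the last position with a value before \<open>Suc y\<close>.
    It exists and has a successor thanks to the sentinels; as no position has the value
    \<open>Suc y\<close>, the successor lies beyond it.\<close>
  let ?p = "Max {p. p \<le> k \<and> x p < Suc y}"
  have fin: "finite {p. p \<le> k \<and> x p < Suc y}" by (rule finite_subset[of _ "{..k}"]) auto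
  have "0 \<in> {p. p \<le> k \<and> x p < Suc y}" using x_bounds by simp
  then have "?p \<in> {p. p \<le> k \<and> x p < Suc y}" by (intro Max_in[OF fin]) blast
  then have p: "?p \<le> k" "x ?p < Suc y" unfolding mem_Collect_eq by simp_all
  have "Suc y < x (Suc ?p)"
  proof (rule ccontr)
    assume "\<not> Suc y < x (Suc ?p)"
    moreover have "?p \<noteq> k" using calculation x_bounds(2) assms by auto
    then have "Suc ?p \<in> {1..k}" using p(1) by simp
    then have "x (Suc ?p) \<noteq> Suc y" using n by blast
    ultimately have "Suc ?p \<in> {p. p \<le> k \<and> x p < Suc y}" using \<open>Suc ?p \<in> {1..k}\<close> by auto
    from Max_ge[OF fin this] show False by (metis Suc_n_not_le_n)
  qed
  with p obtain q where q: "q \<le> k" "x q < Suc y" "Suc y < x (Suc q)" by blast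
  have "(P, map x P) \<in> set (false_atoms A y)" if P: "length P = r" "set P \<subseteq> {..k + 1}" "{q, Suc q} \<subseteq> set P" for P
  proof -
    have "q \<in> set P" "Suc q \<in> set P" using P(3) by auto
    then obtain i j where ij: "i < length P" "P ! i = q" "j < length P" "P ! j = Suc q"
      unfolding in_set_conv_nth by blast
    have "\<exists>i\<in>set [0..<length P]. \<exists>j\<in>set [0..<length P]. nthd P j = Suc (nthd P i) \<and>
        nthd (map x P) i < Suc y \<and> Suc y < nthd (map x P) j"
      by (rule bexI[of _ i], rule bexI[of _ j]) (use ij q in auto)
    then show ?thesis using A_complete[OF P(1,2)] unfolding false_atoms_def by simp
  qed
  then show "\<exists>Q\<subseteq>{..k + 1}. card Q \<le> 2 ^ 1 \<and>
        (\<forall>P. length P = r \<longrightarrow> set P \<subseteq> {..k + 1} \<longrightarrow> Q \<subseteq> set P \<longrightarrow> (P, map x P) \<in> set (false_atoms A y))"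
    using q(1) by (intro exI[of _ "{q, Suc q}"]) (auto simp: card_insert_if)
qed

text \<open>Both truth values are carried along, since a negation swaps them and the laws of De
  Morgan send the false value of a conjunction to \<open>or_nf\<close>.\<close>

lemma table_sem:
  assumes C: "circuit (map gate_of gs)" and N: "length gs = N"
    and v: "valuation (map gate_of gs) v" "\<And>y. y < N \<Longrightarrow> fst (gs ! y) = 0 \<Longrightarrow> v y \<longleftrightarrow> (\<exists>p\<in>{1..k}. x p = Suc y)"
    and r: "2 ^ n \<le> r"
  shows "i < N \<Longrightarrow> table n A gs ! i = (True, L, X, Y) \<Longrightarrow> nf_sem n L X (v i) \<and> nf_sem n L Y (\<not> v i)"
  using r
proof (induction n arbitrary: i L X Y)
  case 0
  then show ?case using N by simp
next
  case (Suc n)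
  have r: "2 ^ n \<le> r" using Suc.prems(3) by simp
  have i: "i < N" "i < length gs" using Suc.prems(1) N by auto
  let ?g = "gs ! i" and ?t = "table n A gs"
  let ?ps = "args_of ?g" and ?lg = "2 < length (args_of ?g)"
  let ?l = "\<lambda>j. fst (snd (?t ! j))" and ?X = "\<lambda>j. fst (snd (snd (?t ! j)))" and ?Y = "\<lambda>j. snd (snd (snd (?t ! j)))"
  have lt: "j < i" "j < length gs" if "j \<in> set ?ps" for j
    using circuit_preds_less[OF C, of i j] that i by (auto simp: preds_gate_of)
  have es: "map (\<lambda>j. nthd ?t j) ?ps = map (\<lambda>j. ?t ! j) ?ps"
    using lt(2) by (intro map_cong) auto
  have "entry_of A gs ?t i = (True, L, X, Y)" using Suc.prems(2) i by simp
  note e = this[unfolded entry_of_def Let_def nthd_nth[OF i(2)] es]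
  show ?case
  proof (cases "fst ?g = 0")
    case True
    then have "L = 0" "X = [[true_atoms A i]]" "Y = [[false_atoms A i]]"
      using e by auto
    moreover have "covers (Suc n) (true_atoms A i) (v i)"
      using true_atoms_sem[OF i(1)] v(2)[OF i(1) True] covers_mono by (induction n) auto
    moreover have "covers (Suc n) (false_atoms A i) (\<not> v i)"
      using false_atoms_sem[OF i(1)] v(2)[OF i(1) True] covers_mono by (induction n) auto
    ultimately show ?thesis by (simp add: nf_sem_def)
  next
    case False
    define M where "M = foldl max 0 (map ?l ?ps) + (if ?lg then 1 else 0)"
    have ok: "fst (?t ! j)" if "j \<in> set ?ps" for j
    proof (rule ccontr)
      assume "\<not> fst (?t ! j)"
      then have "\<exists>e\<in>set (map (\<lambda>j. ?t ! j) ?ps). \<not> fst e" using that by auto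
      then show False using e False by simp
    qed
    then have nok: "\<not> (\<exists>e\<in>set (map (\<lambda>j. ?t ! j) ?ps). \<not> fst e)" by auto
    have sem: "nf_sem n (?l j) (?X j) (v j) \<and> nf_sem n (?l j) (?Y j) (\<not> v j)" and le: "?l j + (if ?lg then 1 else 0) \<le> M"
      if "j \<in> set ?ps" for j
    proof -
      have "?t ! j = (True, ?l j, ?X j, ?Y j)" using ok[OF that] by (simp add: prod_eq_iff)
      then show "nf_sem n (?l j) (?X j) (v j) \<and> nf_sem n (?l j) (?Y j) (\<not> v j)"
        using Suc.IH[of j] lt[OF that] r N by blast
      have "?l j \<le> foldl max 0 (map ?l ?ps)" unfolding foldl_max using that by (intro Max_ge) auto
      then show "?l j + (if ?lg then 1 else 0) \<le> M" by (simp add: M_def)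
    qed
    have val: "case gate_of ?g of Input \<Rightarrow> True | Neg j \<Rightarrow> v i = (\<not> v j) | Conj js \<Rightarrow> v i = (\<forall>j\<in>set js. v j)
        | Disj js \<Rightarrow> v i = (\<exists>j\<in>set js. v j)" using v(1) i(2) by (auto simp: valuation_def)
    have two: "2 \<le> length ?ps" if "fst ?g \<noteq> 1"
      using C i(2) that False by (cases ?g) (auto simp: circuit_def args_of_def split: if_splits dest!: spec[of _ i])
    consider "fst ?g = 1" | "fst ?g = 2" | "2 < fst ?g" using False by linarith
    then show ?thesis
    proof cases
      case 1
      then obtain j where j: "?ps = [j]" "gate_of ?g = Neg j" by (cases ?g) (auto simp: args_of_def)
      have "L = ?l j" "X = ?Y j" "Y = ?X j"
        using e 1 False nok j by auto
      then show ?thesis using sem[of j] val j by (auto intro: nf_sem_Suc)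
    next
      case 2
      then have g: "gate_of ?g = Conj ?ps" by (cases ?g) (auto simp: args_of_def)
      have eq: "L = M" "X = and_nf ?lg M (map ?X ?ps)" "Y = or_nf ?lg M (map ?Y ?ps)"
        using e[unfolded if_not_P[OF False] if_not_P[OF nok] map_map comp_def, folded M_def] 2 by auto
      have "nf_sem (Suc n) L X (\<forall>j\<in>set ?ps. v j)" unfolding eq
        by (rule and_nf_sem[OF _ refl two r]) (use sem le 2 in auto)
      moreover have "nf_sem (Suc n) L Y (\<exists>j\<in>set ?ps. \<not> v j)" unfolding eq
        by (rule or_nf_sem[OF _ refl two r]) (use sem le 2 in auto)
      moreover have "v i = (\<forall>j\<in>set ?ps. v j)" using val unfolding g by simp
      ultimately show ?thesis by simp
    next
      case 3
      then have g: "gate_of ?g = Disj ?ps" by (cases ?g) (auto simp: args_of_def)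
      have eq: "L = M" "X = or_nf ?lg M (map ?X ?ps)" "Y = and_nf ?lg M (map ?Y ?ps)"
        using e[unfolded if_not_P[OF False] if_not_P[OF nok] map_map comp_def, folded M_def] 3 by auto
      have "nf_sem (Suc n) L X (\<exists>j\<in>set ?ps. v j)" unfolding eq
        by (rule or_nf_sem[OF _ refl two r]) (use sem le 3 in auto)
      moreover have "nf_sem (Suc n) L Y (\<forall>j\<in>set ?ps. \<not> v j)" unfolding eq
        by (rule and_nf_sem[OF _ refl two r]) (use sem le 3 in auto)
      moreover have "v i = (\<exists>j\<in>set ?ps. v j)" using val unfolding g by simp
      ultimately show ?thesis by simp
    qed
  qed
qed

end

section \<open>Valuations, and true inputs as increasing sequences\<close>

lemma valuation_exists: "\<exists>v. valuation C v \<and> (\<forall>i<length C. C ! i = Input \<longrightarrow> (v i \<longleftrightarrow> i \<in> S))" if C: "circuit C"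
proof -
  let ?ok = "\<lambda>v i. case C ! i of Input \<Rightarrow> v i = (i \<in> S) | Neg j \<Rightarrow> v i = (\<not> v j)
        | Conj js \<Rightarrow> v i = (\<forall>j\<in>set js. v j) | Disj js \<Rightarrow> v i = (\<exists>j\<in>set js. v j)"
  have "\<exists>v. \<forall>i<n. ?ok v i" if "n \<le> length C" for n
    using that
  proof (induction n)
    case (Suc n)
    then obtain v where v: "\<forall>i<n. ?ok v i" by auto
    let ?b = "case C ! n of Input \<Rightarrow> n \<in> S | Neg j \<Rightarrow> \<not> v j | Conj js \<Rightarrow> \<forall>j\<in>set js. v j | Disj js \<Rightarrow> \<exists>j\<in>set js. v j"
    have less: "j < i" if "i \<le> n" "j \<in> set (preds (C ! i))" for i j
      using circuit_preds_less[OF C, of i j] that Suc.prems by simp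
    have "?ok (v(n := ?b)) i" if "i < Suc n" for i
    proof (cases "i = n")
      case True
      then show ?thesis using less[of n] by (auto split: gate.split)
    next
      case False
      then have i: "i < n" using that by simp
      then have "j \<noteq> n" if "j \<in> set (preds (C ! i))" for j using less[of i j] that by auto
      then show ?thesis using v[rule_format, OF i] False by (cases "C ! i") auto
    qed
    then show ?case by blast
  qed simp
  from this[of "length C"] obtain v where v: "\<forall>i<length C. ?ok v i" by blast
  have "valuation C v" unfolding valuation_def using v by (auto split: gate.splits)
  moreover have "\<forall>i<length C. C ! i = Input \<longrightarrow> (v i \<longleftrightarrow> i \<in> S)" using v by (auto split: gate.splits)
  ultimately show ?thesis by blast
qed

definition position_seq :: "circuit \<Rightarrow> nat \<Rightarrow> (nat \<Rightarrow> nat) \<Rightarrow> bool" where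
  "position_seq C k x \<longleftrightarrow> x 0 = 0 \<and> x (k + 1) = length C + 1 \<and> (\<forall>p q. p < q \<longrightarrow> q \<le> k + 1 \<longrightarrow> x p < x q) \<and>
     (\<forall>p\<in>{1..k}. \<exists>y<length C. C ! y = Input \<and> x p = Suc y)"

text \<open>The sorted list of the true inputs, shifted by one, is the sequence between the
  sentinels. Conversely, strict growth makes the positions \<open>1\<close> to \<open>k\<close> name
  distinct inputs, so that the weight is exactly \<open>k\<close>.\<close>

lemma weighted_satisfiable_iff:
  assumes "circuit C"
  shows "weighted_satisfiable C k \<longleftrightarrow> (\<exists>x v. position_seq C k x \<and> valuation C v \<and>
     (\<forall>y<length C. C ! y = Input \<longrightarrow> (v y \<longleftrightarrow> (\<exists>p\<in>{1..k}. x p = Suc y))) \<and> v (length C - 1))"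
proof
  assume "weighted_satisfiable C k"
  then obtain v where v: "valuation C v" "v (length C - 1)" "card {i. i < length C \<and> C ! i = Input \<and> v i} = k"
    unfolding weighted_satisfiable_def by blast
  let ?S = "{i. i < length C \<and> C ! i = Input \<and> v i}"
  let ?ys = "sorted_list_of_set ?S"
  have ys: "set ?ys = ?S" "length ?ys = k" "sorted_wrt (<) ?ys" using v(3) by simp_all
  define x where "x p = (if p = 0 then 0 else if p \<le> k then Suc (?ys ! (p - 1)) else length C + 1)" for p
  have in_S: "?ys ! (p - 1) \<in> ?S" if "p \<in> {1..k}" for p
  proof -
    have "p - 1 < length ?ys" unfolding ys(2) using that by auto
    then have "?ys ! (p - 1) \<in> set ?ys" by (rule nth_mem)
    then show ?thesis unfolding ys(1) .
  qed
  have "x p < x q" if "p < q" "q \<le> k + 1" for p q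
  proof (cases "p = 0 \<or> q = k + 1")
    case True
    then show ?thesis using that in_S[of p] by (auto simp: x_def)
  next
    case False
    then have "p - 1 < q - 1" "q - 1 < length ?ys" unfolding ys(2) using that by auto
    then have "?ys ! (p - 1) < ?ys ! (q - 1)" by (rule sorted_wrt_nth_less[OF ys(3)])
    then show ?thesis using that False by (simp add: x_def)
  qed
  then have "position_seq C k x"
    unfolding position_seq_def using in_S by (auto simp: x_def)
  moreover have "v y \<longleftrightarrow> (\<exists>p\<in>{1..k}. x p = Suc y)" if "y < length C" "C ! y = Input" for y
  proof
    assume "v y"
    then have "y \<in> set ?ys" using that ys(1) by simp
    then obtain i where "i < k" "?ys ! i = y" unfolding in_set_conv_nth ys(2) by blast
    then show "\<exists>p\<in>{1..k}. x p = Suc y" by (intro bexI[of _ "Suc i"]) (auto simp: x_def)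
  next
    assume "\<exists>p\<in>{1..k}. x p = Suc y"
    then obtain p where p: "p \<in> {1..k}" "x p = Suc y" by blast
    then have "?ys ! (p - 1) = y" by (auto simp: x_def)
    then show "v y" using in_S[OF p(1)] by simp
  qed
  ultimately show "\<exists>x v. position_seq C k x \<and> valuation C v \<and>
     (\<forall>y<length C. C ! y = Input \<longrightarrow> (v y \<longleftrightarrow> (\<exists>p\<in>{1..k}. x p = Suc y))) \<and> v (length C - 1)"
    using v(1,2) by blast
next
  assume "\<exists>x v. position_seq C k x \<and> valuation C v \<and>
     (\<forall>y<length C. C ! y = Input \<longrightarrow> (v y \<longleftrightarrow> (\<exists>p\<in>{1..k}. x p = Suc y))) \<and> v (length C - 1)"
  then obtain x v where x: "position_seq C k x" and v: "valuation C v"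
     "\<And>y. y < length C \<Longrightarrow> C ! y = Input \<Longrightarrow> v y \<longleftrightarrow> (\<exists>p\<in>{1..k}. x p = Suc y)" "v (length C - 1)" by blast
  have "{i. i < length C \<and> C ! i = Input \<and> v i} = (\<lambda>p. x p - 1) ` {1..k}"
  proof
    show "{i. i < length C \<and> C ! i = Input \<and> v i} \<subseteq> (\<lambda>p. x p - 1) ` {1..k}"
    proof
      fix i assume "i \<in> {i. i < length C \<and> C ! i = Input \<and> v i}"
      then obtain p where "p \<in> {1..k}" "x p = Suc i" using v(2)[of i] by blast
      then show "i \<in> (\<lambda>p. x p - 1) ` {1..k}" by (intro image_eqI[of _ _ p]) auto
    qed
    show "(\<lambda>p. x p - 1) ` {1..k} \<subseteq> {i. i < length C \<and> C ! i = Input \<and> v i}"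
    proof
      fix i assume "i \<in> (\<lambda>p. x p - 1) ` {1..k}"
      then obtain p where p: "p \<in> {1..k}" "i = x p - 1" by blast
      then obtain y where "y < length C" "C ! y = Input" "x p = Suc y" using x unfolding position_seq_def by blast
      then show "i \<in> {i. i < length C \<and> C ! i = Input \<and> v i}" using v(2)[of y] p by auto
    qed
  qed
  moreover have "inj_on (\<lambda>p. x p - 1) {1..k}"
  proof (rule linorder_inj_onI')
    fix p q assume pq: "p \<in> {1..k}" "q \<in> {1..k}" "p < q"
    have "x a < x b" if "a < b" "b \<le> k + 1" for a b using x that unfolding position_seq_def by blast
    from this[of 0 p] this[of p q] pq have "x 0 < x p" "x p < x q" by auto
    then show "x p - 1 \<noteq> x q - 1" by linarith
  qed
  ultimately have "card {i. i < length C \<and> C ! i = Input \<and> v i} = k" by (simp add: card_image)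
  then show "weighted_satisfiable C k" unfolding weighted_satisfiable_def using v by blast
qed

text \<open>The cap \<open>length C + 1\<close> exceeds every possible weight, so capping cannot
  turn an unsatisfiable parameter into a satisfiable one. It keeps the unary value of the parameter
  polynomial in the input.\<close>

lemma weighted_satisfiable_cap:
  "weighted_satisfiable C (min (length C + 1) k) \<longleftrightarrow> weighted_satisfiable C k"
proof -
  have le: "card {i. i < length C \<and> C ! i = Input \<and> v i} \<le> length C" for v
    using card_mono[of "{..<length C}" "{i. i < length C \<and> C ! i = Input \<and> v i}"] by auto
  have "card {i. i < length C \<and> C ! i = Input \<and> v i} = min (length C + 1) k \<longleftrightarrow>
      card {i. i < length C \<and> C ! i = Input \<and> v i} = k" for v
    using le[of v] by linarith
  then show ?thesis unfolding weighted_satisfiable_def by simp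
qed


section \<open>Hardness for W[2]\<close>

text \<open>The sentinels are fixed by restricting the domains, without any clauses: the extreme
  values occur at the extreme positions and nowhere else.\<close>

definition tuple_dom :: "(nat \<times> nat list) list \<Rightarrow> nat \<Rightarrow> nat list \<Rightarrow> nat list list \<Rightarrow> nat list list" where
  "tuple_dom gs k P Vs = filter (\<lambda>V. \<forall>i\<in>set [0..<length P]. (nthd V i = 0 \<longleftrightarrow> nthd P i = 0) \<and>
     (nthd V i = length gs + 1 \<longleftrightarrow> nthd P i = k + 1)) Vs"

definition tuple_vals :: "(nat \<times> nat list) list \<Rightarrow> nat list" where
  "tuple_vals gs = 0 # map Suc (filter (\<lambda>i. fst (nthd gs i) = 0) [0..<length gs]) @ [length gs + 1]"

definition tuples :: "nat \<Rightarrow> (nat \<times> nat list) list \<Rightarrow> nat \<Rightarrow> (nat list \<times> nat list list) list" where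
  "tuples r gs k = map (\<lambda>P. (P, tuple_dom gs k P (List.n_lists r (tuple_vals gs)))) (List.n_lists r [0..<k + 2])"

text \<open>Comparing the strict order in both directions also compares equality: a position carries
  the same value wherever it occurs, in two tuples or twice in one.\<close>

definition compatible :: "atom \<Rightarrow> atom \<Rightarrow> bool" where
  "compatible a a' \<longleftrightarrow> (\<forall>i\<in>set [0..<length (fst a)]. \<forall>j\<in>set [0..<length (fst a')].
     (nthd (fst a) i < nthd (fst a') j) = (nthd (snd a) i < nthd (snd a') j) \<and>
     (nthd (fst a') j < nthd (fst a) i) = (nthd (snd a') j < nthd (snd a) i))"

text \<open>The variable \<open>[]\<close> selects the option to be satisfied; tuples have positive
  length, so its name is free. Without options its domain is empty and the instance
  unsatisfiable.\<close>

definition nf_doms :: "(nat list \<times> nat list list) list \<Rightarrow> nf \<Rightarrow> (nat list \<times> nat list list) list" where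
  "nf_doms D X = ([], map (\<lambda>n. [n]) [0..<length X]) # D"

text \<open>Clauses of options that are not selected are satisfied by their first literal. Atoms
  outside \<open>A\<close> never hold, and the filter ensures that all literals refer to existing
  variables.\<close>

definition nf_clauses :: "atom list \<Rightarrow> nf \<Rightarrow> (bool \<times> nat list \<times> nat list) list list" where
  "nf_clauses A X = concat (map (\<lambda>a. map (\<lambda>a'. [(False, a), (False, a')]) (filter (\<lambda>a'. \<not> compatible a a') A)) A) @
     concat (map (\<lambda>n. map (\<lambda>c. (False, [], [n]) # map (\<lambda>a. (True, a)) (filter (\<lambda>a. a \<in> set A) c)) (nthd X n)) [0..<length X])"

lemma n_lists_Suc: "List.n_lists (Suc n) xs = concat (map (\<lambda>ys. map (\<lambda>y. y # ys) xs) (List.n_lists n xs))"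
  by simp

lemma PT_n_lists [PT_intros]: "PT f \<Longrightarrow> PT (\<lambda>x. List.n_lists r (f x))"
proof (induction r)
  case (Suc r)
  then show ?case unfolding n_lists_Suc by (intro PT_intros PT_comp[OF PT_fst[OF PT_id]]) auto
qed (simp add: PT_const)

lemma PT_tuples [PT_intros]: "PT f \<Longrightarrow> PT g \<Longrightarrow> PT (\<lambda>x. tuples r (f x) (g x))"
  by (rule PT_comp2[of "tuples r"]) (unfold tuples_def tuple_dom_def tuple_vals_def, intro PT_intros)

lemma PT_nf_doms [PT_intros]: "PT f \<Longrightarrow> PT g \<Longrightarrow> PT (\<lambda>x. nf_doms (f x) (g x))"
  unfolding nf_doms_def by (intro PT_intros)

lemma PT_nf_clauses [PT_intros]: "PT f \<Longrightarrow> PT g \<Longrightarrow> PT (\<lambda>x. nf_clauses (f x) (g x))"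
  by (rule PT_comp2[of nf_clauses]) (unfold nf_clauses_def compatible_def, intro PT_intros)

lemma set_vertices_tuples:
  "a \<in> set (vertices (tuples r gs k)) \<longleftrightarrow> fst a \<in> set (List.n_lists r [0..<k + 2]) \<and>
     snd a \<in> set (tuple_dom gs k (fst a) (List.n_lists r (tuple_vals gs)))"
  by (cases a) (auto simp: tuples_def vertices_def)

lemma nf_csp_wf:
  assumes "1 \<le> r"
  shows "csp_wf (nf_doms (tuples r gs k) X) (nf_clauses (vertices (tuples r gs k)) X)"
proof -
  have "[] \<notin> set (List.n_lists r [0..<k + 2])" using assms by (auto simp: set_n_lists)
  moreover have "distinct (List.n_lists r [0..<k + 2])" by (rule distinct_n_lists) simp
  ultimately have "distinct (map fst (nf_doms (tuples r gs k) X))"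
    by (simp add: nf_doms_def tuples_def comp_def del: upt_Suc)
  moreover have "fst a \<in> fst ` set (tuples r gs k)" if "a \<in> set (vertices (tuples r gs k))" for a
    using that unfolding set_vertices_tuples by (force simp: tuples_def)
  ultimately show ?thesis
    unfolding csp_wf_def by (auto simp: nf_doms_def nf_clauses_def)
qed

text \<open>Tuples overlap and get their values independently; compatibility makes them describe one
  sequence. The constant tuple of \<open>p\<close> yields \<open>x p\<close>, and comparison with
  the constant tuples determines all others.\<close>

lemma nf_csp_sat:
  fixes k :: nat
  assumes C: "circuit (map gate_of gs)" and r: "1 \<le> r"
  defines "A \<equiv> vertices (tuples r gs k)"
  shows "csp_sat (nf_doms (tuples r gs k) X) (nf_clauses A X) \<longleftrightarrow>
     (\<exists>x. position_seq (map gate_of gs) k x \<and> positions.holds_nf A x X)"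
    and "position_seq (map gate_of gs) k x \<Longrightarrow> positions A x k r (length gs)"
proof -
  let ?N = "length gs" and ?Ps = "List.n_lists r [0..<k + 2]"
  have P: "P \<in> set ?Ps \<longleftrightarrow> length P = r \<and> set P \<subseteq> {..k + 1}" for P
    by (auto simp: set_n_lists)
  have inp: "gate_of (gs ! i) = Input \<longleftrightarrow> fst (gs ! i) = 0" for i by (cases "gs ! i") auto
  have vals: "y \<in> set (tuple_vals gs) \<longleftrightarrow> y = 0 \<or> y = ?N + 1 \<or> (\<exists>i<?N. fst (gs ! i) = 0 \<and> y = Suc i)" for y
    by (auto simp: tuple_vals_def image_iff)
  have dom: "V \<in> set (tuple_dom gs k P (List.n_lists r (tuple_vals gs))) \<longleftrightarrow> length V = r \<and> set V \<subseteq> set (tuple_vals gs) \<and>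
     (\<forall>i<r. (V ! i = 0 \<longleftrightarrow> P ! i = 0) \<and> (V ! i = ?N + 1 \<longleftrightarrow> P ! i = k + 1))" if "length P = r" for P V
    using that by (auto simp: tuple_dom_def set_n_lists)
  have A: "a \<in> set A \<longleftrightarrow> fst a \<in> set ?Ps \<and> snd a \<in> set (tuple_dom gs k (fst a) (List.n_lists r (tuple_vals gs)))" for a
    unfolding A_def by (rule set_vertices_tuples)
  have xP: "map x P \<in> set (tuple_dom gs k P (List.n_lists r (tuple_vals gs)))"
    if x: "position_seq (map gate_of gs) k x" and PP: "length P = r" "set P \<subseteq> {..k + 1}" for x P
  proof -
    have b: "x p \<in> set (tuple_vals gs) \<and> (x p = 0 \<longleftrightarrow> p = 0) \<and> (x p = ?N + 1 \<longleftrightarrow> p = k + 1)" if "p \<le> k + 1" for p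
    proof -
      have "p = 0 \<or> p = k + 1 \<or> p \<in> {1..k}" using that by auto
      then consider "p = 0" | "p = k + 1" | "p \<in> {1..k}" by blast
      then show ?thesis
      proof cases
        case 3
        then obtain y where y: "y < ?N" "map gate_of gs ! y = Input" "x p = Suc y"
          using x unfolding position_seq_def length_map by blast
        then show ?thesis using 3 inp by (auto simp: vals)
      qed (use x in \<open>auto simp: position_seq_def vals\<close>)
    qed
    have "P ! i \<le> k + 1" if "i < r" for i using subsetD[OF PP(2), of "P ! i"] that PP(1) by simp
    then show ?thesis unfolding dom[OF PP(1)] using b PP by auto
  qed
  show pos: "positions A x k r (length gs)" if x: "position_seq (map gate_of gs) k x" for x
  proof
    show "(P, map x P) \<in> set A" if "length P = r" "set P \<subseteq> {..k + 1}" for P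
      unfolding A using P xP[OF x that] that by simp
    show "length (fst a) = r \<and> set (fst a) \<subseteq> {..k + 1}" if "a \<in> set A" for a
      using that unfolding A P by simp
  qed (use x in \<open>auto simp: position_seq_def\<close>)
  have comp_x: "compatible (P, map x P) (P', map x P')"
    if x: "position_seq (map gate_of gs) k x" and "set P \<subseteq> {..k + 1}" "set P' \<subseteq> {..k + 1}" for x P P'
  proof -
    have "x p < x q \<longleftrightarrow> p < q" if "p \<le> k + 1" "q \<le> k + 1" for p q
      using positions.x_less_iff[OF pos[OF x] that] .
    moreover have "P ! i \<le> k + 1" if "i < length P" for i using subsetD[OF \<open>set P \<subseteq> {..k + 1}\<close>, of "P ! i"] that by simp
    moreover have "P' ! i \<le> k + 1" if "i < length P'" for i using subsetD[OF \<open>set P' \<subseteq> {..k + 1}\<close>, of "P' ! i"] that by simp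
    ultimately show ?thesis by (simp add: compatible_def)
  qed
  show "csp_sat (nf_doms (tuples r gs k) X) (nf_clauses A X) \<longleftrightarrow>
     (\<exists>x. position_seq (map gate_of gs) k x \<and> positions.holds_nf A x X)"
  proof
    assume "csp_sat (nf_doms (tuples r gs k) X) (nf_clauses A X)"
    then obtain \<alpha> where D: "\<forall>d\<in>set (nf_doms (tuples r gs k) X). \<alpha> (fst d) \<in> set (snd d)"
      and Cl: "\<forall>cl\<in>set (nf_clauses A X). \<exists>l\<in>set cl. (\<alpha> (fst (snd l)) = snd (snd l)) = fst l"
      unfolding csp_sat_def by blast
    obtain n where n: "n < length X" "\<alpha> [] = [n]" using D by (auto simp: nf_doms_def)
    have \<alpha>: "\<alpha> P \<in> set (tuple_dom gs k P (List.n_lists r (tuple_vals gs)))" if "P \<in> set ?Ps" for P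
      using D that by (auto simp: nf_doms_def tuples_def)
    have \<alpha>A: "(P, \<alpha> P) \<in> set A" if "P \<in> set ?Ps" for P unfolding A using \<alpha>[OF that] that by simp
    have compat: "compatible (P, \<alpha> P) (P', \<alpha> P')" if PP: "P \<in> set ?Ps" "P' \<in> set ?Ps" for P P'
    proof (rule ccontr)
      assume "\<not> compatible (P, \<alpha> P) (P', \<alpha> P')"
      then have "[(False, P, \<alpha> P), (False, P', \<alpha> P')] \<in> set (nf_clauses A X)"
        using \<alpha>A[OF PP(1)] \<alpha>A[OF PP(2)] unfolding nf_clauses_def by auto
      from Cl[rule_format, OF this] show False by auto
    qed
    define x where "x p = \<alpha> (replicate r p) ! 0" for p
    have rep: "replicate r p \<in> set ?Ps" if "p \<le> k + 1" for p using that unfolding P by auto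
    have len: "length (\<alpha> P) = r" if "P \<in> set ?Ps" for P using \<alpha>[OF that] dom that P by blast
    have cmp: "(P ! i < P' ! j) = (\<alpha> P ! i < \<alpha> P' ! j) \<and> (P' ! j < P ! i) = (\<alpha> P' ! j < \<alpha> P ! i)"
      if "P \<in> set ?Ps" "P' \<in> set ?Ps" "i < r" "j < r" for P P' i j
      using compat[OF that(1,2)] that len[OF that(1)] len[OF that(2)] P by (simp add: compatible_def)
    \<comment> \<open>Against the constant tuple of \<open>Q ! i\<close> neither position is
      smaller, hence neither value is.\<close>
    have \<alpha>x: "\<alpha> Q = map x Q" if Q: "Q \<in> set ?Ps" for Q
    proof (rule nth_equalityI)
      show "length (\<alpha> Q) = length (map x Q)" using len[OF Q] Q P by simp
      fix i assume "i < length (\<alpha> Q)"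
      then have i: "i < r" "i < length Q" using len[OF Q] Q P by auto
      have "Q ! i \<in> {..k + 1}" using Q P nth_mem[OF i(2)] by blast
      then have "Q ! i \<le> k + 1" by simp
      from cmp[OF Q rep[OF this] i(1), of 0] r show "\<alpha> Q ! i = map x Q ! i"
        using i by (simp add: x_def)
    qed
    have mono: "x p < x q" if "p < q" "q \<le> k + 1" for p q
      using cmp[OF rep[of p] rep[of q], of 0 0] that r by (simp add: x_def)
    have xv: "x p \<in> set (tuple_vals gs)" "x p = 0 \<longleftrightarrow> p = 0" "x p = ?N + 1 \<longleftrightarrow> p = k + 1" if "p \<le> k + 1" for p
    proof -
      have d: "\<alpha> (replicate r p) \<in> set (tuple_dom gs k (replicate r p) (List.n_lists r (tuple_vals gs)))" by (rule \<alpha>[OF rep[OF that]])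
      have l: "length (replicate r p) = r" by simp
      have "0 < r" using r by simp
      then show "x p \<in> set (tuple_vals gs)" "x p = 0 \<longleftrightarrow> p = 0" "x p = ?N + 1 \<longleftrightarrow> p = k + 1"
        using d[unfolded dom[OF l]] unfolding x_def by (auto simp: subset_iff)
    qed
    have "\<exists>y<length gs. gate_of (gs ! y) = Input \<and> x p = Suc y" if "p \<in> {1..k}" for p
      using xv[of p] that unfolding vals inp by auto
    then have "\<exists>y<length (map gate_of gs). map gate_of gs ! y = Input \<and> x p = Suc y" if "p \<in> {1..k}" for p
      using that by (metis length_map nth_map)
    then have x: "position_seq (map gate_of gs) k x"
      unfolding position_seq_def using xv(2)[of 0] xv(3)[of "k + 1"] mono by simp
    interpret positions A x k r "length gs" by (rule pos[OF x])
    have "holds_clause c" if c: "c \<in> set (X ! n)" for c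
    proof -
      have "(False, [], [n]) # map (\<lambda>a. (True, a)) (filter (\<lambda>a. a \<in> set A) c) \<in> set (nf_clauses A X)"
        using n(1) c unfolding nf_clauses_def by auto
      from Cl[rule_format, OF this] n(2) obtain a where a: "a \<in> set c" "a \<in> set A" "\<alpha> (fst a) = snd a" by auto
      then have "fst a \<in> set ?Ps" using A by blast
      then show ?thesis unfolding holds_clause_def holds_atom_def using a \<alpha>x by auto
    qed
    then have "holds_nf X" unfolding holds_nf_def holds_option_def using n(1) nth_mem by blast
    then show "\<exists>x. position_seq (map gate_of gs) k x \<and> positions.holds_nf A x X" using x by blast
  next
    assume "\<exists>x. position_seq (map gate_of gs) k x \<and> positions.holds_nf A x X"
    then obtain x where x: "position_seq (map gate_of gs) k x" and h: "positions.holds_nf A x X" by blast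
    interpret positions A x k r "length gs" by (rule pos[OF x])
    obtain n where n: "n < length X" "holds_option (X ! n)" using h unfolding holds_nf_def by (auto simp: in_set_conv_nth)
    define \<alpha> where "\<alpha> P = (if P = [] then [n] else map x P)" for P
    have ne: "P \<noteq> []" if "P \<in> set ?Ps" for P using that r unfolding P by auto
    have "\<alpha> (fst d) \<in> set (snd d)" if dd: "d \<in> set (nf_doms (tuples r gs k) X)" for d
    proof -
      consider "d = ([], map (\<lambda>n. [n]) [0..<length X])" | Q where "Q \<in> set ?Ps" "d = (Q, tuple_dom gs k Q (List.n_lists r (tuple_vals gs)))"
        using dd unfolding nf_doms_def tuples_def by (auto simp del: upt_Suc)
      then show ?thesis
      proof cases
        case 1
        then show ?thesis using n(1) by (simp add: \<alpha>_def)
      next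
        case 2
        then show ?thesis using xP[OF x, of Q] P ne by (simp add: \<alpha>_def)
      qed
    qed
    moreover have "\<exists>l\<in>set cl. (\<alpha> (fst (snd l)) = snd (snd l)) = fst l" if cl: "cl \<in> set (nf_clauses A X)" for cl
    proof -
      consider a a' where "a \<in> set A" "a' \<in> set A" "\<not> compatible a a'" "cl = [(False, a), (False, a')]"
        | m c where "m < length X" "c \<in> set (X ! m)" "cl = (False, [], [m]) # map (\<lambda>a. (True, a)) (filter (\<lambda>a. a \<in> set A) c)"
        using cl unfolding nf_clauses_def by auto
      then show ?thesis
      proof cases
        case 1
        have PP: "fst a \<in> set ?Ps" "fst a' \<in> set ?Ps" using 1 A by blast+
        have "\<not> (snd a = map x (fst a) \<and> snd a' = map x (fst a'))"
          using comp_x[OF x, of "fst a" "fst a'"] PP 1(3) P by (metis prod.collapse)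
        then show ?thesis using ne[OF PP(1)] ne[OF PP(2)] by (auto simp: 1(4) \<alpha>_def)
      next
        case 2
        show ?thesis
        proof (cases "m = n")
          case True
          then obtain a where a: "a \<in> set c" "a \<in> set A" "snd a = map x (fst a)"
            using n(2) 2(2) unfolding holds_option_def holds_clause_def holds_atom_def by blast
          have "fst a \<noteq> []" by (rule ne[OF conjunct1[OF A[THEN iffD1, OF a(2)]]])
          then have "\<alpha> (fst a) = snd a" using a(3) by (simp add: \<alpha>_def)
          moreover have "(True, a) \<in> set cl" using a(1,2) by (simp add: 2(3))
          ultimately show ?thesis by (intro bexI[of _ "(True, a)"]) simp_all
        next
          case False
          then show ?thesis by (simp add: 2(3) \<alpha>_def)
        qed
      qed
    qed
    ultimately show "csp_sat (nf_doms (tuples r gs k) X) (nf_clauses A X)" unfolding csp_sat_def by blast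
  qed
qed

section \<open>The reduction from weighted satisfiability of circuits of weft two\<close>

context
  fixes d :: nat
begin

text \<open>A false input involves the two positions of a gap, and each of the \<open>d\<close>
  levels at most doubles their number; \<open>covers_iff\<close> asks for tuples of at least that
  length.\<close>

definition wr :: nat where "wr = 2 ^ Suc d"
definition wgates :: "bool list \<Rightarrow> (nat \<times> nat list) list" where "wgates y = parse_gates (inst_part y)"
definition wparam :: "bool list \<Rightarrow> nat" where "wparam y = capped_value (length (wgates y) + 1) (param_bits y)"
definition wtuples :: "bool list \<Rightarrow> (nat list \<times> nat list list) list" where "wtuples y = tuples wr (wgates y) (wparam y)"
definition wentry :: "bool list \<Rightarrow> entry" where
  "wentry y = nthd (table (Suc d) (vertices (wtuples y)) (wgates y)) (length (wgates y) - 1)"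
definition wvalid :: "bool list \<Rightarrow> bool" where
  "wvalid y \<longleftrightarrow> is_circuit_code (inst_part y) \<and> fst (wentry y) \<and> fst (snd (wentry y)) \<le> 2"
text \<open>Words that are no circuit codes, or exceed depth or weft, are sent to the unsatisfiable
  instance with no variables and an empty clause.\<close>

definition wdoms :: "bool list \<Rightarrow> (nat list \<times> nat list list) list" where
  "wdoms y = (if wvalid y then nf_doms (wtuples y) (fst (snd (snd (wentry y)))) else [])"
definition wclauses :: "bool list \<Rightarrow> (bool \<times> nat list \<times> nat list) list list" where
  "wclauses y = (if wvalid y then nf_clauses (vertices (wtuples y)) (fst (snd (snd (wentry y)))) else [[]])"

lemma PT_wgates: "PT wgates" unfolding wgates_def[abs_def] by (intro PT_intros)
lemma PT_wparam: "PT wparam" unfolding wparam_def[abs_def] by (intro PT_intros PT_wgates)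
lemma PT_wtuples: "PT wtuples" unfolding wtuples_def[abs_def] by (intro PT_intros PT_wgates PT_wparam)
lemma PT_wentry: "PT wentry" unfolding wentry_def[abs_def]
  by (rule PT_nthd[OF PT_comp2[OF PT_table]]) (intro PT_intros PT_wgates PT_wtuples)+
lemma PT_wvalid: "PT wvalid" unfolding wvalid_def[abs_def] by (intro PT_intros PT_wentry)
lemma PT_wdoms: "PT wdoms" unfolding wdoms_def[abs_def] by (intro PT_intros PT_wvalid PT_wtuples PT_wentry)
lemma PT_wclauses: "PT wclauses" unfolding wclauses_def[abs_def] by (intro PT_intros PT_wvalid PT_wtuples PT_wentry)

lemma wr: "1 \<le> wr" "2 ^ Suc d \<le> wr" by (simp_all add: wr_def)

lemma wcsp_wf: "csp_wf (wdoms y) (wclauses y)"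
proof (cases "wvalid y")
  case True
  then show ?thesis using nf_csp_wf[OF wr(1)] by (simp add: wdoms_def wclauses_def wtuples_def)
next
  case False
  then show ?thesis by (simp add: wdoms_def wclauses_def csp_wf_def)
qed

lemma wcsp_sat:
  "(w, k) \<in> weighted_circuit_sat 2 d \<longleftrightarrow> csp_sat (wdoms (encode_instance (w, k))) (wclauses (encode_instance (w, k)))"
proof -
  let ?y = "encode_instance (w, k)"
  let ?gs = "wgates ?y" and ?C = "map gate_of (wgates ?y)"
  let ?A = "vertices (wtuples ?y)" and ?k = "wparam ?y" and ?N = "length (wgates ?y)"
  have ip: "inst_part ?y = w" by (simp add: encode_instance_eq inst_part_pairs)
  have k: "?k = min (length ?C + 1) k"
    by (simp add: wparam_def capped_value_eq encode_instance_eq param_bits_pairs bits_value_binary)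
  have gs: "?gs = parse_gates w" by (simp add: wgates_def ip)
  have valid: "wvalid ?y \<longleftrightarrow> is_circuit_code w \<and> circuit_depth ?C \<le> d \<and> weft ?C \<le> 2"
  proof (cases "is_circuit_code w")
    case True
    then have C: "circuit ?C" by (simp add: is_circuit_code_iff gs)
    then have N: "?N - 1 < length ?gs" by (simp add: circuit_def)
    show ?thesis
      unfolding depth_weft_shape[OF C] using table_shape[OF C N, where n = d and A = ?A] True N
      by (auto simp: wvalid_def ip wentry_def simp del: table.simps)
  qed (simp add: wvalid_def ip)
  show ?thesis
  proof (cases "wvalid ?y")
    case False
    then have "\<not> csp_sat (wdoms ?y) (wclauses ?y)" by (simp add: wdoms_def wclauses_def csp_sat_def)
    moreover have "(w, k) \<notin> weighted_circuit_sat 2 d"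
      using False unfolding valid circuit_code_iff gs by (auto simp: Let_def)
    ultimately show ?thesis by blast
  next
    case True
    then have C: "circuit ?C" using valid by (simp add: is_circuit_code_iff gs)
    then have N: "?N - 1 < ?N" by (simp add: circuit_def)
    obtain L X Y where e: "wentry ?y = (True, L, X, Y)" "L \<le> 2"
      using True by (cases "wentry ?y") (auto simp: wvalid_def)
    then have t: "table (Suc d) ?A ?gs ! (?N - 1) = (True, L, X, Y)"
      using N by (simp add: wentry_def del: table.simps)
    have inp: "gate_of (?gs ! i) = Input \<longleftrightarrow> fst (?gs ! i) = 0" for i by (cases "?gs ! i") auto
    have "csp_sat (wdoms ?y) (wclauses ?y) \<longleftrightarrow> (\<exists>x. position_seq ?C ?k x \<and> positions.holds_nf ?A x X)"
      using nf_csp_sat(1)[OF C wr(1), of ?k X] True e by (simp add: wdoms_def wclauses_def wtuples_def)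
    also have "\<dots> \<longleftrightarrow> weighted_satisfiable ?C ?k"
      unfolding weighted_satisfiable_iff[OF C]
    proof
      assume "\<exists>x. position_seq ?C ?k x \<and> positions.holds_nf ?A x X"
      then obtain x where x: "position_seq ?C ?k x" "positions.holds_nf ?A x X" by blast
      interpret positions ?A x ?k wr ?N using nf_csp_sat(2)[OF C wr(1) x(1)] by (simp add: wtuples_def)
      obtain v where v: "valuation ?C v" "\<forall>i<length ?C. ?C ! i = Input \<longrightarrow> (v i \<longleftrightarrow> i \<in> {y. \<exists>p\<in>{1..?k}. x p = Suc y})"
        using valuation_exists[OF C] by blast
      have "nf_sem (Suc d) L X (v (?N - 1))"
        by (rule conjunct1[OF table_sem[OF C refl v(1) _ wr(2) N t]]) (use v(2) inp in auto)
      from nf_sem_2[OF this e(2) wr(2)] x(2) have "v (?N - 1)" by simp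
      then show "\<exists>x v. position_seq ?C ?k x \<and> valuation ?C v \<and>
         (\<forall>y<length ?C. ?C ! y = Input \<longrightarrow> (v y \<longleftrightarrow> (\<exists>p\<in>{1..?k}. x p = Suc y))) \<and> v (length ?C - 1)"
        using x(1) v by (intro exI[of _ x] exI[of _ v]) auto
    next
      assume "\<exists>x v. position_seq ?C ?k x \<and> valuation ?C v \<and>
         (\<forall>y<length ?C. ?C ! y = Input \<longrightarrow> (v y \<longleftrightarrow> (\<exists>p\<in>{1..?k}. x p = Suc y))) \<and> v (length ?C - 1)"
      then obtain x v where x: "position_seq ?C ?k x" and v: "valuation ?C v"
        "\<And>y. y < length ?C \<Longrightarrow> ?C ! y = Input \<Longrightarrow> v y \<longleftrightarrow> (\<exists>p\<in>{1..?k}. x p = Suc y)" "v (length ?C - 1)" by blast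
      interpret positions ?A x ?k wr ?N using nf_csp_sat(2)[OF C wr(1) x] by (simp add: wtuples_def)
      have "nf_sem (Suc d) L X (v (?N - 1))"
        by (rule conjunct1[OF table_sem[OF C refl v(1) _ wr(2) N t]]) (use v(2) inp in auto)
      from nf_sem_2[OF this e(2) wr(2)] v(3) have "holds_nf X" by simp
      then show "\<exists>x. position_seq ?C ?k x \<and> positions.holds_nf ?A x X" using x by blast
    qed
    also have "\<dots> \<longleftrightarrow> weighted_satisfiable ?C k" unfolding k by (rule weighted_satisfiable_cap)
    also have "\<dots> \<longleftrightarrow> (w, k) \<in> weighted_circuit_sat 2 d"
      using True unfolding valid circuit_code_iff gs by (auto simp: Let_def)
    finally show ?thesis by blast
  qed
qed

text \<open>\<open>k + 2\<close> positions and tuples of length \<open>wr\<close> give at most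
  \<open>(k + 2) ^ wr\<close> groups, besides the variable that selects an option. With
  \<open>k + 2 \<le> 2 ^ (length (binary k) + 1)\<close> this becomes a power of two; the remaining
  factor 4 goes into the constant \<open>wr + 2\<close>.\<close>

lemma wdoms_length: "2 * length (wdoms (encode_instance (w, k))) \<le> exp_bound (wr + 2) k"
proof -
  let ?y = "encode_instance (w, k)"
  let ?l = "length (binary k)"
  have kle: "wparam ?y \<le> k"
    by (simp add: wparam_def capped_value_eq encode_instance_eq param_bits_pairs bits_value_binary)
  have "length (wdoms ?y) \<le> 1 + (wparam ?y + 2) ^ wr"
    by (simp add: wdoms_def nf_doms_def wtuples_def tuples_def length_n_lists)
  also have "(wparam ?y + 2) ^ wr \<le> (2 ^ (?l + 1)) ^ wr"
  proof (rule power_mono)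
    have "k + 1 \<le> 2 ^ ?l" using length_binary[of k] by simp
    moreover have "(1::nat) \<le> 2 ^ ?l" by simp
    ultimately show "wparam ?y + 2 \<le> 2 ^ (?l + 1)" using kle by simp
  qed simp
  also have "1 + (2 ^ (?l + 1)) ^ wr \<le> 2 * (2 :: nat) ^ ((?l + 1) * wr)"
  proof -
    have "(1::nat) \<le> 2 ^ ((?l + 1) * wr)" by simp
    then show ?thesis unfolding power_mult[symmetric] by linarith
  qed
  finally have "2 * length (wdoms ?y) \<le> 2 ^ ((?l + 1) * wr + 2)" by simp
  also have "\<dots> \<le> exp_bound (wr + 2) k"
    unfolding exp_bound_def by (rule power_increasing) (simp_all add: algebra_simps)
  finally show ?thesis .
qed

end

theorem W_hard_RHS_RHF: "W_hard 2 RHS" "W_hard 2 RHF"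
proof -
  have "fpt_reducible P RHS \<and> fpt_reducible P RHF" if P: "in_W 2 P" for P
  proof -
    obtain d where "fpt_reducible P (weighted_circuit_sat 2 d)" using P unfolding in_W_def by blast
    from csp_fpt_reducible[OF PT_wdoms PT_wclauses wcsp_wf wcsp_sat wdoms_length this] show ?thesis by blast
  qed
  then show "W_hard 2 RHS" "W_hard 2 RHF" unfolding W_hard_def by blast+
qed

section \<open>Monotone covering problems\<close>

text \<open>
  Both problems ask for at most \<open>k\<close> of \<open>p\<close> literals such that each clause, a set of indices
  of pairs of literals, contains a pair with both literals chosen.
\<close>

type_synonym cover_instance = "nat \<times> (nat \<times> nat) list \<times> nat list list"

definition covers :: "(nat \<times> nat) list \<Rightarrow> nat list list \<Rightarrow> nat set \<Rightarrow> bool" where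
  "covers prs cls S \<longleftrightarrow> (\<forall>cl\<in>set cls. \<exists>j\<in>set cl. fst (nthd prs j) \<in> S \<and> snd (nthd prs j) \<in> S)"

definition coverable :: "cover_instance \<Rightarrow> nat \<Rightarrow> bool" where
  "coverable J k \<longleftrightarrow> (\<exists>S\<subseteq>{..<fst J}. card S \<le> k \<and> covers (fst (snd J)) (snd (snd J)) S)"

definition cover_wf :: "cover_instance \<Rightarrow> bool" where
  "cover_wf J \<longleftrightarrow> (\<forall>q\<in>set (fst (snd J)). fst q < fst J \<and> snd q < fst J) \<and>
     (\<forall>cl\<in>set (snd (snd J)). distinct cl \<and> set cl \<subseteq> {..<length (fst (snd J))})"

lemma covers_mono: "covers prs cls S \<Longrightarrow> S \<subseteq> S' \<Longrightarrow> covers prs cls S'"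
  unfolding covers_def by blast

definition even_bits :: "bool list \<Rightarrow> bool list" where
  "even_bits v = map (\<lambda>i. nthd v (2 * i)) (filter (\<lambda>i. 2 * i < length v) [0..<length v])"

definition odd_bits :: "bool list \<Rightarrow> bool list" where
  "odd_bits v = map (\<lambda>i. nthd v (2 * i + 1)) (filter (\<lambda>i. 2 * i < length v) [0..<length v])"

lemma PT_even_bits [PT_intros]: "PT f \<Longrightarrow> PT (\<lambda>x. even_bits (f x))"
  by (rule PT_comp[where g = even_bits], assumption) (unfold even_bits_def[abs_def], intro PT_intros)

lemma PT_odd_bits [PT_intros]: "PT f \<Longrightarrow> PT (\<lambda>x. odd_bits (f x))"
  by (rule PT_comp[where g = odd_bits], assumption) (unfold odd_bits_def[abs_def], intro PT_intros)

lemma interleave_nth: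
  "length u = length w \<Longrightarrow> i < length w \<Longrightarrow> interleave w u ! (2 * i) = w ! i \<and> interleave w u ! (2 * i + 1) = u ! i"
proof (induction w u arbitrary: i rule: interleave.induct)
  case (1 b w g u)
  then show ?case by (cases i) auto
qed auto

lemma even_odd_bits_interleave:
  assumes "length u = length w"
  shows "even_bits (interleave w u) = w" "odd_bits (interleave w u) = u"
proof -
  note l = length_interleave[OF assms]
  have "[0..<2 * length w] = [0..<length w] @ [length w..<2 * length w]"
    using upt_add_eq_append[of 0 "length w" "length w"] by (simp add: mult_2)
  then have f: "filter (\<lambda>i. 2 * i < 2 * length w) [0..<2 * length w] = [0..<length w]" by simp
  show "even_bits (interleave w u) = w"
    unfolding even_bits_def l f using interleave_nth[OF assms] l by (intro nth_equalityI) auto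
  show "odd_bits (interleave w u) = u"
    unfolding odd_bits_def l f using interleave_nth[OF assms] l assms by (intro nth_equalityI) auto
qed

text \<open>Depth and weft are bounded by potentials on the nodes: \<open>lev\<close> grows along
  every edge, \<open>wt\<close> never falls and grows at every large gate.\<close>

lemma path_levels:
  fixes lev wt :: "nat \<Rightarrow> nat"
  assumes C: "circuit C"
    and step: "\<And>i j. i < length C \<Longrightarrow> j \<in> set (preds (C ! i)) \<Longrightarrow>
      lev j < lev i \<and> wt j + (if large (C ! i) then 1 else 0) \<le> wt i"
  shows "i < length C \<Longrightarrow> path_to C i p \<Longrightarrow> length p - 1 \<le> lev i \<and> weight_of_path C p \<le> wt i"
proof (induction i arbitrary: p rule: less_induct)
  case (less i)
  show ?case
  proof (cases "C ! i = Input")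
    case True
    then have "p = [i]" using less.prems path_to_Input by blast
    then show ?thesis using True by (simp add: weight_of_path_def large_def)
  next
    case False
    then obtain j q where j: "j \<in> set (preds (C ! i))" "path_to C j q" "p = q @ [i]"
      using path_to_step less.prems by blast
    have "j < i" using circuit_preds_less[OF C less.prems(1) j(1)] .
    then have q: "length q - 1 \<le> lev j" "weight_of_path C q \<le> wt j" using less.IH[OF _ _ j(2)] less.prems(1) by auto
    have "q \<noteq> []" using j(2) by (simp add: path_to_def)
    then have "length p - 1 = Suc (length q - 1)" using j(3) by (cases q) auto
    moreover have "weight_of_path C p = weight_of_path C q + (if large (C ! i) then 1 else 0)"
      by (simp add: weight_of_path_def j(3))
    ultimately show ?thesis using q step[OF less.prems(1) j(1)] by linarith
  qed
qed

text \<open>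
  Input 0 only serves to build the constants; the constants pad the arguments of the
  gates, which must have at least two distinct ones.
\<close>

definition cover_gates :: "nat \<Rightarrow> (nat \<times> nat) list \<Rightarrow> nat list list \<Rightarrow> (nat \<times> nat list) list" where
  "cover_gates p prs cls =
     replicate (p + 1) (0, []) @ [(1, [0]), (2, [0, p + 1]), (2, [p + 1, 0]), (3, [0, p + 1]), (3, [p + 1, 0])] @
     map (\<lambda>q. (2, [fst q + 1, if fst q = snd q then p + 4 else snd q + 1])) prs @
     map (\<lambda>cl. (3, (p + 2) # (p + 3) # map (\<lambda>j. p + 6 + j) cl)) cls @
     [(2, (p + 4) # (p + 5) # map (\<lambda>i. p + 6 + length prs + i) [0..<length cls])]"

lemma PT_cover_gates [PT_intros]: "PT f \<Longrightarrow> PT g \<Longrightarrow> PT h \<Longrightarrow> PT (\<lambda>x. cover_gates (f x) (g x) (h x))"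
  by (rule PT_comp3[of cover_gates]) (unfold cover_gates_def, intro PT_intros)

section \<open>The monotone circuit of a covering instance\<close>

context
  fixes p :: nat and prs :: "(nat \<times> nat) list" and cls :: "nat list list"
  assumes wf: "cover_wf (p, prs, cls)"
begin

abbreviation "cgates \<equiv> cover_gates p prs cls"
abbreviation "ccircuit \<equiv> map gate_of (cover_gates p prs cls)"
abbreviation "pair_pos \<equiv> p + 6"
abbreviation "clause_pos \<equiv> p + 6 + length prs"
abbreviation "top_pos \<equiv> p + 6 + length prs + length cls"

lemma length_cgates: "length cgates = top_pos + 1"
  by (simp add: cover_gates_def)

lemma cgates_nth:
  "i \<le> p \<Longrightarrow> cgates ! i = (0, [])"
  "cgates ! (p + 1) = (1, [0])" "cgates ! (p + 2) = (2, [0, p + 1])" "cgates ! (p + 3) = (2, [p + 1, 0])"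
  "cgates ! (p + 4) = (3, [0, p + 1])" "cgates ! (p + 5) = (3, [p + 1, 0])"
  "j < length prs \<Longrightarrow> cgates ! (pair_pos + j) =
     (2, [fst (prs ! j) + 1, if fst (prs ! j) = snd (prs ! j) then p + 4 else snd (prs ! j) + 1])"
  "l < length cls \<Longrightarrow> cgates ! (clause_pos + l) = (3, (p + 2) # (p + 3) # map (\<lambda>j. pair_pos + j) (cls ! l))"
  "cgates ! top_pos = (2, (p + 4) # (p + 5) # map (\<lambda>i. clause_pos + i) [0..<length cls])"
  by (simp_all add: cover_gates_def nth_append del: replicate_Suc)

lemma cgates_cases:
  assumes "i < length cgates"
  obtains "i \<le> p" | "i = p + 1" | "i = p + 2" | "i = p + 3" | "i = p + 4" | "i = p + 5"
    | j where "j < length prs" "i = pair_pos + j" | l where "l < length cls" "i = clause_pos + l" | "i = top_pos"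
proof -
  consider "i \<le> p" | "i = p + 1" | "i = p + 2" | "i = p + 3" | "i = p + 4" | "i = p + 5"
    | "pair_pos \<le> i" "i < clause_pos" | "clause_pos \<le> i" "i < top_pos" | "i = top_pos"
    using assms unfolding length_cgates by linarith
  then show ?thesis
  proof cases
    case 7
    then have "i - pair_pos < length prs" "i = pair_pos + (i - pair_pos)" by auto
    then show ?thesis using that(7) by blast
  next
    case 8
    then have "i - clause_pos < length cls" "i = clause_pos + (i - clause_pos)" by auto
    then show ?thesis using that(8) by blast
  qed (use that in blast)+
qed

lemma pairs_less: "j < length prs \<Longrightarrow> fst (prs ! j) < p \<and> snd (prs ! j) < p"
  using wf by (simp add: cover_wf_def)

lemma clause_wf: "l < length cls \<Longrightarrow> distinct (cls ! l) \<and> set (cls ! l) \<subseteq> {..<length prs}"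
  using wf by (simp add: cover_wf_def)

text \<open>The levels are the inputs, the negation, the constants, the pairs, the clauses and the
  output. Only clause gates and the output gate can have more than two arguments, which gives weft
  2.\<close>

lemma ccircuit_step:
  defines "lev \<equiv> \<lambda>i. if i \<le> p then 0 else if i = p + 1 then 1 else if i < pair_pos then 2 else if i < clause_pos then 3
    else if i < top_pos then 4 else (5 :: nat)"
    and "wt \<equiv> \<lambda>i. if i < clause_pos then 0 else if i < top_pos then 1 else (2 :: nat)"
  assumes "i < length cgates"
  shows "distinct (args_of (cgates ! i)) \<and> (2 \<le> fst (cgates ! i) \<longrightarrow> 2 \<le> length (snd (cgates ! i))) \<and>
    (\<forall>j\<in>set (args_of (cgates ! i)). j < i \<and> lev j < lev i \<and>
       wt j + (if 2 < length (args_of (cgates ! i)) then 1 else 0) \<le> wt i)"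
  using assms(3)
proof (cases rule: cgates_cases)
  case (7 j)
  then show ?thesis using pairs_less[OF 7(1)] unfolding 7(2) cgates_nth(7)[OF 7(1)]
    by (auto simp: args_of_def lev_def wt_def)
next
  case (8 l)
  then show ?thesis using clause_wf[OF 8(1)] unfolding 8(2) cgates_nth(8)[OF 8(1)]
    by (auto simp: args_of_def lev_def wt_def distinct_map)
next
  case 9
  then show ?thesis unfolding 9 cgates_nth(9)
    by (auto simp: args_of_def lev_def wt_def distinct_map)
qed (simp_all only: cgates_nth, simp_all add: args_of_def lev_def wt_def)

lemma circuit_ccircuit: "circuit ccircuit"
proof -
  have "case gate_of g of Conj js \<Rightarrow> 2 \<le> length js | Disj js \<Rightarrow> 2 \<le> length js | _ \<Rightarrow> True"
    if "2 \<le> fst g \<longrightarrow> 2 \<le> length (snd g)" for g using that by (cases g) auto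
  then show ?thesis
    unfolding circuit_def using ccircuit_step length_cgates by (auto simp: preds_gate_of)
qed

lemma depth_weft_ccircuit: "circuit_depth ccircuit \<le> 5" "weft ccircuit \<le> 2"
proof -
  have "length q - 1 \<le> 5 \<and> weight_of_path ccircuit q \<le> 2" if "path_to ccircuit (length ccircuit - 1) q" for q
  proof -
    note * = path_levels[OF circuit_ccircuit _ _ that, where
      lev = "\<lambda>i. if i \<le> p then 0 else if i = p + 1 then 1 else if i < pair_pos then 2 else if i < clause_pos then 3
        else if i < top_pos then 4 else (5 :: nat)"
      and wt = "\<lambda>i. if i < clause_pos then 0 else if i < top_pos then 1 else (2 :: nat)"]
    have "length q - 1 \<le> (if top_pos \<le> p then 0 else if top_pos = p + 1 then 1 else if top_pos < pair_pos then 2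
        else if top_pos < clause_pos then 3 else if top_pos < top_pos then 4 else (5 :: nat)) \<and>
      weight_of_path ccircuit q \<le> (if top_pos < clause_pos then 0 else if top_pos < top_pos then 1 else (2 :: nat))"
      using *[unfolded length_map length_cgates add_diff_cancel_right'] ccircuit_step
      by (simp add: preds_gate_of large_def length_cgates)
    then show ?thesis by auto
  qed
  then show "circuit_depth ccircuit \<le> 5" "weft ccircuit \<le> 2"
    unfolding depth_weft_le[OF circuit_ccircuit] by blast+
qed

lemma valuation_ccircuit:
  assumes "valuation ccircuit v"
  shows "v top_pos \<longleftrightarrow> covers prs cls {i. i < p \<and> v (Suc i)}"
proof -
  have g: "case gate_of (cgates ! i) of Input \<Rightarrow> True | Neg j \<Rightarrow> v i = (\<not> v j)
      | Conj js \<Rightarrow> v i = (\<forall>j\<in>set js. v j) | Disj js \<Rightarrow> v i = (\<exists>j\<in>set js. v j)" if "i \<le> top_pos" for i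
    using assms that unfolding valuation_def by (auto simp: length_cgates)
  have neg: "v (p + 1) \<longleftrightarrow> \<not> v 0" using g[of "p + 1"] by (simp only: cgates_nth) simp
  have F: "\<not> v (p + 2)" "\<not> v (p + 3)" and T: "v (p + 4)" "v (p + 5)"
    using g[of "p + 2"] g[of "p + 3"] g[of "p + 4"] g[of "p + 5"] neg by (simp_all only: cgates_nth) simp_all
  have pr: "v (pair_pos + j) \<longleftrightarrow> fst (nthd prs j) \<in> {i. i < p \<and> v (Suc i)} \<and> snd (nthd prs j) \<in> {i. i < p \<and> v (Suc i)}"
    if "j < length prs" for j
    using g[of "pair_pos + j"] T pairs_less[OF that] that by (simp only: cgates_nth(7)[OF that]) (auto split: if_splits)
  have cl: "v (clause_pos + l) \<longleftrightarrow> (\<exists>j\<in>set (cls ! l). v (pair_pos + j))" if "l < length cls" for l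
    using g[of "clause_pos + l"] F that by (simp only: cgates_nth(8)[OF that]) auto
  have "v top_pos \<longleftrightarrow> (\<forall>l<length cls. v (clause_pos + l))"
  proof -
    have "v top_pos \<longleftrightarrow> (\<forall>j\<in>set ((p + 4) # (p + 5) # map (\<lambda>i. clause_pos + i) [0..<length cls]). v j)"
      using g[of top_pos] by (simp only: cgates_nth(9)) simp
    also have "\<dots> \<longleftrightarrow> (\<forall>l\<in>set [0..<length cls]. v (clause_pos + l))"
      by (simp only: T list.set set_map ball_simps simp_thms)
    finally show ?thesis by (simp add: Ball_def)
  qed
  also have "\<dots> \<longleftrightarrow> (\<forall>l<length cls. \<exists>j\<in>set (cls ! l). v (pair_pos + j))" using cl by blast
  also have "\<dots> \<longleftrightarrow> (\<forall>l<length cls. \<exists>j\<in>set (cls ! l). fst (nthd prs j) \<in> {i. i < p \<and> v (Suc i)} \<and> snd (nthd prs j) \<in> {i. i < p \<and> v (Suc i)})"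
    using pr clause_wf by (meson lessThan_iff subsetD)
  also have "\<dots> \<longleftrightarrow> covers prs cls {i. i < p \<and> v (Suc i)}" unfolding covers_def all_set_conv_all_nth ..
  finally show ?thesis .
qed

text \<open>Circuits ask for exactly so many true inputs, covering for at most so many. Since
  covering is monotone, a solution can be enlarged to exactly \<open>min p k\<close> literals with
  input 0 left false; conversely, a true input 0 only lowers the number of chosen literals.\<close>

lemma weighted_satisfiable_ccircuit: "weighted_satisfiable ccircuit (min p k) \<longleftrightarrow> coverable (p, prs, cls) k"
proof -
  have inp: "ccircuit ! i = Input \<longleftrightarrow> i \<le> p" if "i < length ccircuit" for i
  proof -
    have i: "i < length cgates" using that by simp
    then show ?thesis
      unfolding nth_map[OF i] by (cases rule: cgates_cases) (simp_all only: cgates_nth, simp_all)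
  qed
  have inputs: "{i. i < length ccircuit \<and> ccircuit ! i = Input \<and> v i} = {i. i \<le> p \<and> v i}" for v
    using inp length_cgates by auto
  have last: "length ccircuit - 1 = top_pos" by (simp add: length_cgates)
  show ?thesis
  proof
    assume "weighted_satisfiable ccircuit (min p k)"
    then obtain v where v: "valuation ccircuit v" "v top_pos" "card {i. i \<le> p \<and> v i} = min p k"
      unfolding weighted_satisfiable_def inputs last by blast
    let ?S = "{i. i < p \<and> v (Suc i)}"
    have "card ?S = card (Suc ` ?S)" by (simp add: card_image)
    also have "\<dots> \<le> card {i. i \<le> p \<and> v i}" by (rule card_mono) auto
    finally have "card ?S \<le> k" using v(3) by simp
    moreover have "?S \<subseteq> {..<p}" by auto
    ultimately show "coverable (p, prs, cls) k"
      using v(2)[unfolded valuation_ccircuit[OF v(1)]] unfolding coverable_def by auto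
  next
    assume "coverable (p, prs, cls) k"
    then obtain S where S: "S \<subseteq> {..<p}" "card S \<le> k" "covers prs cls S" by (auto simp: coverable_def)
    have "card S \<le> min p k" using card_mono[OF _ S(1)] S(2) by simp
    then obtain S' where S': "S \<subseteq> S'" "S' \<subseteq> {..<p}" "card S' = min p k"
      using exists_subset_between[of S "min p k" "{..<p}"] S(1) by auto
    obtain v where v: "valuation ccircuit v"
      "\<forall>i<length ccircuit. ccircuit ! i = Input \<longrightarrow> (v i \<longleftrightarrow> i \<in> Suc ` S')"
      using valuation_exists[OF circuit_ccircuit] by blast
    have vi: "v i \<longleftrightarrow> i \<in> Suc ` S'" if "i \<le> p" for i
      using v(2) inp[of i] that length_cgates by simp
    then have "{i. i \<le> p \<and> v i} = Suc ` S'" using S'(2) by auto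
    then have "card {i. i \<le> p \<and> v i} = min p k" using S'(3) by (simp add: card_image)
    moreover have "{i. i < p \<and> v (Suc i)} = S'" using vi S'(2) by auto
    then have "v top_pos" unfolding valuation_ccircuit[OF v(1)] using covers_mono[OF S(3) S'(1)] by simp
    ultimately show "weighted_satisfiable ccircuit (min p k)"
      unfolding weighted_satisfiable_def inputs last using v(1) by blast
  qed
qed

end

section \<open>Membership in W[2] and in NP for covering problems\<close>

locale cover_problem =
  fixes P :: parameterized_problem and I :: "bool list \<Rightarrow> cover_instance"
  assumes PT_I: "PT I" and wf: "cover_wf (I x)" and bound: "fst (I x) \<le> length x"
    and correct: "(x, k) \<in> P \<longleftrightarrow> coverable (I x) k"
begin

theorem in_W: "in_W 2 P"
proof -
  define gs where "gs x = cover_gates (fst (I x)) (fst (snd (I x))) (snd (snd (I x)))" for x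
  have PT_inst: "PT (\<lambda>y. I (inst_part y))" by (rule PT_comp[OF PT_inst_part[OF PT_id] PT_I])
  have "fpt_reducible P (weighted_circuit_sat 2 5)"
  proof (rule fpt_reducible_PT)
    show "PT (\<lambda>y. encode_nat (capped_value (fst (I (inst_part y))) (param_bits y)) @
        unary (length (gs (inst_part y))) @ concat (map (\<lambda>g. gate_code g) (gs (inst_part y))))"
      unfolding gs_def gate_code_def by (intro PT_intros PT_inst)
    let ?H = "\<lambda>z. (encode_circuit (map gate_of (gs (fst z))), min (fst (I (fst z))) (snd z))"
    fix x :: "bool list" and k :: nat
    let ?y = "encode_instance (x, k)"
    have y: "inst_part ?y = x" "capped_value c (param_bits ?y) = min c k" for c
      by (simp_all add: encode_instance_eq inst_part_pairs param_bits_pairs capped_value_eq bits_value_binary)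
    show "encode_nat (capped_value (fst (I (inst_part ?y))) (param_bits ?y)) @
        unary (length (gs (inst_part ?y))) @ concat (map (\<lambda>g. gate_code g) (gs (inst_part ?y))) = encode_instance (?H (x, k))"
      unfolding y by (simp add: encode_instance_def encode_circuit_def encode_list_def comp_def encode_gate_of)
    show "snd (?H (x, k)) \<le> k" by simp
    have w: "cover_wf (fst (I x), fst (snd (I x)), snd (snd (I x)))" using wf[of x] by simp
    have enc: "circuit (map gate_of (gs x))" "weft (map gate_of (gs x)) \<le> 2" "circuit_depth (map gate_of (gs x)) \<le> 5"
      "weighted_satisfiable (map gate_of (gs x)) (min (fst (I x)) k) \<longleftrightarrow> (x, k) \<in> P"
      unfolding gs_def using circuit_ccircuit[OF w] depth_weft_ccircuit[OF w] weighted_satisfiable_ccircuit[OF w]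
      by (simp_all add: correct)
    show "(x, k) \<in> P \<longleftrightarrow> ?H (x, k) \<in> weighted_circuit_sat 2 5"
    proof
      assume "(x, k) \<in> P"
      then show "?H (x, k) \<in> weighted_circuit_sat 2 5" using enc unfolding weighted_circuit_sat_def by auto
    next
      assume "?H (x, k) \<in> weighted_circuit_sat 2 5"
      then have "weighted_satisfiable (map gate_of (gs x)) (min (fst (I x)) k)"
        unfolding circuit_code_iff using parse_encode_circuit[OF enc(1)] by (auto simp: Let_def)
      then show "(x, k) \<in> P" using enc by simp
    qed
  qed
  then show ?thesis unfolding in_W_def by (intro exI[of _ 5]) simp
qed

definition verifier :: "bool list \<Rightarrow> bool list" where
  "verifier v = (let y = even_bits v; u = odd_bits v; J = I (inst_part y) in
     if is_instance y \<and> length (filter (\<lambda>i. nthd u i) [0..<fst J]) \<le> capped_value (length y) (param_bits y) \<and>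
       (\<forall>cl\<in>set (snd (snd J)). \<exists>j\<in>set cl. nthd u (fst (nthd (fst (snd J)) j)) \<and> nthd u (snd (nthd (fst (snd J)) j)))
     then [True] else [])"

lemma PT_verifier: "PT verifier"
  unfolding verifier_def[abs_def] Let_def
  by (intro PT_intros PT_comp[OF _ PT_I])

lemma verifier_interleave:
  assumes "length u = length y"
  shows "verifier (interleave y u) = [True] \<longleftrightarrow> is_instance y \<and>
    card {i. i < fst (I (inst_part y)) \<and> u ! i} \<le> bits_value (param_bits y) \<and>
    covers (fst (snd (I (inst_part y)))) (snd (snd (I (inst_part y)))) {i. i < fst (I (inst_part y)) \<and> u ! i}"
proof -
  let ?J = "I (inst_part y)"
  have le: "fst ?J \<le> length y" using bound[of "inst_part y"] by (simp add: inst_part_def)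
  have nth: "nthd u i = u ! i" if "i < fst ?J" for i using that le assms by simp
  have len: "length (filter (\<lambda>i. nthd u i) [0..<fst ?J]) = card {i. i < fst ?J \<and> u ! i}"
  proof -
    have "length (filter (\<lambda>i. nthd u i) [0..<fst ?J]) = card (set (filter (\<lambda>i. nthd u i) [0..<fst ?J]))"
      by (rule distinct_card[symmetric]) simp
    also have "set (filter (\<lambda>i. nthd u i) [0..<fst ?J]) = {i. i < fst ?J \<and> u ! i}" using nth by auto
    finally show ?thesis .
  qed
  have "card {i. i < fst ?J \<and> u ! i} \<le> card {..<fst ?J}" by (rule card_mono) auto
  \<comment> \<open>At most \<open>length y\<close> literals exist, so capping the parameter at
    \<open>length y\<close> does not change the comparison.\<close>
  then have cap: "card {i. i < fst ?J \<and> u ! i} \<le> capped_value (length y) (param_bits y) \<longleftrightarrow>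
      card {i. i < fst ?J \<and> u ! i} \<le> bits_value (param_bits y)"
    using le by (simp add: capped_value_eq)
  have "fst (nthd (fst (snd ?J)) j) < fst ?J \<and> snd (nthd (fst (snd ?J)) j) < fst ?J"
    if "cl \<in> set (snd (snd ?J))" "j \<in> set cl" for cl j
  proof -
    have "j < length (fst (snd ?J))" using wf[of "inst_part y"] that unfolding cover_wf_def by blast
    then show ?thesis using wf[of "inst_part y"] unfolding cover_wf_def by simp
  qed
  then have "(\<forall>cl\<in>set (snd (snd ?J)). \<exists>j\<in>set cl. nthd u (fst (nthd (fst (snd ?J)) j)) \<and> nthd u (snd (nthd (fst (snd ?J)) j))) \<longleftrightarrow>
      covers (fst (snd ?J)) (snd (snd ?J)) {i. i < fst ?J \<and> u ! i}"
    unfolding covers_def using nth by (intro ball_cong bex_cong refl) simp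
  then show ?thesis
    by (simp add: verifier_def Let_def even_odd_bits_interleave[OF assms] len cap)
qed

text \<open>By \<open>bound\<close>, the characteristic vector of a set of literals fits into a
  certificate of the length of the instance; surplus bits of the certificate are ignored by the
  verifier.\<close>

theorem in_NP: "in_NP (classical P)"
proof (rule in_NP_I)
  show "PT verifier" by (rule PT_verifier)
  show "verifier u = [True] \<or> verifier u = []" for u by (simp add: verifier_def Let_def)
  fix y
  let ?J = "I (inst_part y)"
  have le: "fst ?J \<le> length y" using bound[of "inst_part y"] by (simp add: inst_part_def)
  have "y \<in> classical P \<longleftrightarrow> is_instance y \<and> coverable ?J (bits_value (param_bits y))"
    unfolding classical_iff correct ..
  also have "\<dots> \<longleftrightarrow> (\<exists>u. length u = length y \<and> verifier (interleave y u) = [True])"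
  proof
    assume *: "is_instance y \<and> coverable ?J (bits_value (param_bits y))"
    then obtain S where S: "S \<subseteq> {..<fst ?J}" "card S \<le> bits_value (param_bits y)"
      "covers (fst (snd ?J)) (snd (snd ?J)) S" unfolding coverable_def by blast
    let ?u = "map (\<lambda>i. i \<in> S) [0..<length y]"
    have "{i. i < fst ?J \<and> ?u ! i} = S" using S(1) le by auto
    then have "verifier (interleave y ?u) = [True]" using verifier_interleave[of ?u y] * S by simp
    then show "\<exists>u. length u = length y \<and> verifier (interleave y u) = [True]" by (intro exI[of _ ?u]) simp
  next
    assume "\<exists>u. length u = length y \<and> verifier (interleave y u) = [True]"
    then obtain u where u: "length u = length y" "verifier (interleave y u) = [True]" by blast
    have "{i. i < fst ?J \<and> u ! i} \<subseteq> {..<fst ?J}" by auto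
    then show "is_instance y \<and> coverable ?J (bits_value (param_bits y))"
      using u(2)[unfolded verifier_interleave[OF u(1)]] unfolding coverable_def by blast
  qed
  finally show "y \<in> classical P \<longleftrightarrow> (\<exists>u. length u = length y \<and> verifier (interleave y u) = [True])" .
qed

end

section \<open>Roman hitting as a covering problem\<close>

definition vertex_count :: "bool list \<Rightarrow> nat" where
  "vertex_count w = length (takeWhile (\<lambda>b. b) w)"

definition edge_count :: "bool list \<Rightarrow> nat" where
  "edge_count w = vertex_count (drop (vertex_count w + 1) w)"

definition incidences :: "bool list \<Rightarrow> bool list" where
  "incidences w = drop (edge_count w + 1) (drop (vertex_count w + 1) w)"

definition edge_list :: "bool list \<Rightarrow> nat \<Rightarrow> nat list" where
  "edge_list w i = filter (\<lambda>x. nthd (incidences w) (i * vertex_count w + x)) [0..<vertex_count w]"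

text \<open>The header is read off without failure for any word, so it is encoded again for
  comparison. The inequality guarantees a full matrix and leaves room for a correspondence behind
  it.\<close>

definition hypergraph_code :: "bool list \<Rightarrow> bool" where
  "hypergraph_code w \<longleftrightarrow> w = unary (vertex_count w) @ unary (edge_count w) @ incidences w \<and>
     edge_count w * vertex_count w \<le> length (incidences w)"

definition hypergraph_rest :: "bool list \<Rightarrow> bool list" where
  "hypergraph_rest w = drop (edge_count w * vertex_count w) (incidences w)"

lemma PT_vertex_count [PT_intros]: "PT f \<Longrightarrow> PT (\<lambda>x. vertex_count (f x))"
  by (rule PT_comp[where g = vertex_count], assumption) (unfold vertex_count_def[abs_def], intro PT_intros)

lemma PT_edge_count [PT_intros]: "PT f \<Longrightarrow> PT (\<lambda>x. edge_count (f x))"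
  by (rule PT_comp[where g = edge_count], assumption) (unfold edge_count_def[abs_def], intro PT_intros)

lemma PT_incidences [PT_intros]: "PT f \<Longrightarrow> PT (\<lambda>x. incidences (f x))"
  by (rule PT_comp[where g = incidences], assumption) (unfold incidences_def[abs_def], intro PT_intros)

lemma PT_edge_list [PT_intros]: "PT f \<Longrightarrow> PT g \<Longrightarrow> PT (\<lambda>x. edge_list (f x) (g x))"
  by (rule PT_comp2[of edge_list]) (unfold edge_list_def, intro PT_intros)

lemma PT_hypergraph_code [PT_intros]: "PT f \<Longrightarrow> PT (\<lambda>x. hypergraph_code (f x))"
  by (rule PT_comp[where g = hypergraph_code], assumption) (unfold hypergraph_code_def[abs_def], intro PT_intros)

lemma PT_hypergraph_rest [PT_intros]: "PT f \<Longrightarrow> PT (\<lambda>x. hypergraph_rest (f x))"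
  by (rule PT_comp[where g = hypergraph_rest], assumption) (unfold hypergraph_rest_def[abs_def], intro PT_intros)

lemma vertex_count_unary: "vertex_count (unary n @ u) = n"
proof -
  have "takeWhile (\<lambda>b. b) (replicate n True @ False # u) = replicate n True" by (induction n) auto
  then show ?thesis by (simp add: vertex_count_def unary_def)
qed

lemma hypergraph_header:
  "vertex_count (unary n @ unary m @ u) = n" "edge_count (unary n @ unary m @ u) = m"
  "incidences (unary n @ unary m @ u) = u"
proof -
  have d: "drop (n + 1) (unary n @ v) = v" for n v by (simp add: unary_def)
  show n: "vertex_count (unary n @ unary m @ u) = n" by (rule vertex_count_unary)
  show m: "edge_count (unary n @ unary m @ u) = m"
    unfolding edge_count_def n d by (rule vertex_count_unary)
  show "incidences (unary n @ unary m @ u) = u" unfolding incidences_def n m d ..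
qed

lemma matrix_take:
  "m * n \<le> length u \<Longrightarrow> matrix n m (\<lambda>i x. u ! (i * n + x)) = take (m * n) u"
proof (induction m)
  case (Suc m)
  have "map (\<lambda>x. u ! (m * n + x)) [0..<n] = take n (drop (m * n) u)"
    using Suc.prems by (intro nth_equalityI) (auto simp: ac_simps)
  then show ?case using Suc by (simp add: matrix_def take_add add.commute[of n])
qed (simp add: matrix_def)

lemma index_less: "i < m \<Longrightarrow> x < n \<Longrightarrow> i * n + x < m * (n :: nat)"
proof -
  assume "i < m" "x < n"
  then have "i * n + x < Suc i * n" by simp
  also have "\<dots> \<le> m * n" using \<open>i < m\<close> by (intro mult_right_mono) auto
  finally show ?thesis .
qed

lemma hypergraph_edge_list: "hypergraph {..<vertex_count w} {..<edge_count w} (\<lambda>i. set (edge_list w i))"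
  by (auto simp: hypergraph_def edge_list_def)

lemma hypergraph_code_encode:
  assumes "hypergraph_code w"
  shows "w = encode_hypergraph (vertex_count w) (edge_count w) (\<lambda>i. set (edge_list w i)) @ hypergraph_rest w"
proof -
  let ?n = "vertex_count w" and ?m = "edge_count w" and ?u = "incidences w"
  have le: "?m * ?n \<le> length ?u" using assms by (simp add: hypergraph_code_def)
  have "x \<in> set (edge_list w i) \<longleftrightarrow> ?u ! (i * ?n + x)" if "i < ?m" "x < ?n" for i x
    using index_less[OF that] le that by (simp add: edge_list_def)
  then have "matrix ?n ?m (\<lambda>i x. x \<in> set (edge_list w i)) = matrix ?n ?m (\<lambda>i x. ?u ! (i * ?n + x))"
    unfolding matrix_def by (intro arg_cong[where f = concat] map_cong refl) auto
  also have "\<dots> = take (?m * ?n) ?u" using le by (rule matrix_take)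
  finally show ?thesis
    using assms unfolding hypergraph_code_def encode_hypergraph_matrix hypergraph_rest_def by simp
qed

lemma encode_hypergraph_code:
  assumes "w = encode_hypergraph n m s @ u"
  shows "hypergraph_code w" "vertex_count w = n" "edge_count w = m" "hypergraph_rest w = u"
    "i < m \<Longrightarrow> x < n \<Longrightarrow> x \<in> set (edge_list w i) \<longleftrightarrow> x \<in> s i"
proof -
  have w: "w = unary n @ unary m @ matrix n m (\<lambda>i x. x \<in> s i) @ u"
    using assms by (simp add: encode_hypergraph_matrix)
  note h = hypergraph_header[of n m "matrix n m (\<lambda>i x. x \<in> s i) @ u", folded w]
  show "hypergraph_code w" unfolding hypergraph_code_def h using w by simp
  show "vertex_count w = n" "edge_count w = m" using h by simp_all
  show "hypergraph_rest w = u" unfolding hypergraph_rest_def h by simp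
  assume "i < m" "x < n"
  then show "x \<in> set (edge_list w i) \<longleftrightarrow> x \<in> s i"
    unfolding edge_list_def h using index_less[of i m x n] matrix_nth[of i m x n "\<lambda>i x. x \<in> s i" u] by simp
qed

lemma card_blocks:
  fixes n :: nat
  assumes "A \<subseteq> {..<n}" "B \<subseteq> {..<n}" "finite C"
  shows "card (A \<union> (+) n ` B \<union> (+) (2 * n) ` C) = card A + card B + card C"
proof -
  have fin: "finite A" "finite B" using assms finite_subset by blast+
  have "card (A \<union> (+) n ` B \<union> (+) (2 * n) ` C) = card (A \<union> (+) n ` B) + card ((+) (2 * n) ` C)"
    using fin assms by (intro card_Un_disjoint) auto
  also have "card (A \<union> (+) n ` B) = card A + card ((+) n ` B)"
    using fin assms by (intro card_Un_disjoint) auto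
  finally show ?thesis by (simp add: card_image)
qed

lemma sum_indicators:
  fixes n :: nat
  assumes "A \<subseteq> {..<n}" "B \<subseteq> {..<n}"
  shows "(\<Sum>x<n. of_bool (x \<in> A) + of_bool (x \<in> B) :: nat) = card A + card B"
proof -
  have "(\<Sum>x<n. of_bool (x \<in> A) :: nat) = card A" if "A \<subseteq> {..<n}" for A
  proof -
    have "(\<Sum>x<n. of_bool (x \<in> A) :: nat) = (\<Sum>x\<in>A. 1)"
      by (rule sum.mono_neutral_cong_right) (use that in auto)
    then show ?thesis by simp
  qed
  then show ?thesis using assms by (simp add: sum.distrib)
qed

lemma covers_map_upt:
  "covers prs (map c [0..<m]) S \<longleftrightarrow> (\<forall>i<m. \<exists>j\<in>set (c i). fst (nthd prs j) \<in> S \<and> snd (nthd prs j) \<in> S)"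
  unfolding covers_def by auto

text \<open>
  Choosing both \<open>x\<close> and \<open>n + x\<close> stands for the vertex \<open>x\<close> in \<open>R2\<close>, and choosing \<open>2 n + i\<close>
  for the index \<open>i\<close> in \<open>R1\<close>.
\<close>

definition rhs_cover :: "nat \<Rightarrow> nat \<Rightarrow> (nat \<Rightarrow> nat list) \<Rightarrow> cover_instance" where
  "rhs_cover n m e = (2 * n + m, map (\<lambda>j. if j < n then (j, n + j) else (n + j, n + j)) [0..<n + m],
     map (\<lambda>i. e i @ [n + i]) [0..<m])"

lemma rhs_cover_wf:
  assumes "\<And>i. distinct (e i) \<and> set (e i) \<subseteq> {..<n}"
  shows "cover_wf (rhs_cover n m e)"
  using assms unfolding cover_wf_def rhs_cover_def by fastforce

lemma covers_rhs:
  assumes "\<And>i. set (e i) \<subseteq> {..<n}"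
  shows "covers (fst (snd (rhs_cover n m e))) (snd (snd (rhs_cover n m e))) S \<longleftrightarrow>
    (\<forall>i<m. (\<exists>x\<in>set (e i). x \<in> S \<and> n + x \<in> S) \<or> 2 * n + i \<in> S)"
proof -
  let ?prs = "fst (snd (rhs_cover n m e))"
  have 1: "nthd ?prs x = (x, n + x)" if "x \<in> set (e i)" for x i
  proof -
    have "x < n" using assms[of i] that by blast
    then show ?thesis by (simp add: rhs_cover_def)
  qed
  have 2: "nthd ?prs (n + i) = (2 * n + i, 2 * n + i)" if "i < m" for i
    using that by (simp add: rhs_cover_def)
  have "covers ?prs (snd (snd (rhs_cover n m e))) S \<longleftrightarrow>
      (\<forall>i<m. \<exists>j\<in>set (e i @ [n + i]). fst (nthd ?prs j) \<in> S \<and> snd (nthd ?prs j) \<in> S)"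
    unfolding rhs_cover_def snd_conv by (rule covers_map_upt)
  also have "\<dots> \<longleftrightarrow> (\<forall>i<m. (\<exists>x\<in>set (e i). x \<in> S \<and> n + x \<in> S) \<or> 2 * n + i \<in> S)"
    by (simp add: 1 2 disj_commute cong: bex_cong)
  finally show ?thesis .
qed

text \<open>A literal chosen without its partner costs weight and hits nothing, so it is dropped
  when \<open>R2\<close> is formed. The three blocks of literals are disjoint, which makes their
  number the weight.\<close>

lemma coverable_rhs:
  assumes "\<And>i. set (e i) \<subseteq> {..<n}"
  shows "coverable (rhs_cover n m e) k \<longleftrightarrow>
    (\<exists>R1 R2. roman_hitting_set {..<n} {..<m} (\<lambda>i. set (e i)) R1 R2 \<and> rhs_weight R1 R2 \<le> k)"
proof
  assume "coverable (rhs_cover n m e) k"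
  then obtain S where S: "S \<subseteq> {..<2 * n + m}" "card S \<le> k"
    "\<forall>i<m. (\<exists>x\<in>set (e i). x \<in> S \<and> n + x \<in> S) \<or> 2 * n + i \<in> S"
    unfolding coverable_def covers_rhs[OF assms] by (auto simp: rhs_cover_def)
  let ?R1 = "{i. i < m \<and> 2 * n + i \<in> S}" and ?R2 = "{x. x < n \<and> x \<in> S \<and> n + x \<in> S}"
  have "?R2 \<union> (+) n ` ?R2 \<union> (+) (2 * n) ` ?R1 \<subseteq> S" by auto
  moreover have "finite S" using S(1) finite_subset by blast
  ultimately have "card (?R2 \<union> (+) n ` ?R2 \<union> (+) (2 * n) ` ?R1) \<le> card S" by (intro card_mono)
  moreover have "card (?R2 \<union> (+) n ` ?R2 \<union> (+) (2 * n) ` ?R1) = card ?R2 + card ?R2 + card ?R1"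
    by (rule card_blocks) auto
  ultimately have "rhs_weight ?R1 ?R2 \<le> k" using S(2) unfolding rhs_weight_def by linarith
  moreover have "roman_hitting_set {..<n} {..<m} (\<lambda>i. set (e i)) ?R1 ?R2"
    unfolding roman_hitting_set_def using S(3) assms by fastforce
  ultimately show "\<exists>R1 R2. roman_hitting_set {..<n} {..<m} (\<lambda>i. set (e i)) R1 R2 \<and> rhs_weight R1 R2 \<le> k" by blast
next
  assume "\<exists>R1 R2. roman_hitting_set {..<n} {..<m} (\<lambda>i. set (e i)) R1 R2 \<and> rhs_weight R1 R2 \<le> k"
  then obtain R1 R2 where R: "R1 \<subseteq> {..<m}" "R2 \<subseteq> {..<n}" "\<forall>i<m. set (e i) \<inter> R2 \<noteq> {} \<or> i \<in> R1"
    "rhs_weight R1 R2 \<le> k" by (auto simp: roman_hitting_set_def)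
  let ?S = "R2 \<union> (+) n ` R2 \<union> (+) (2 * n) ` R1"
  have "card ?S = card R2 + card R2 + card R1"
    by (rule card_blocks[OF R(2) R(2)]) (use R(1) finite_subset in blast)
  then have card: "card ?S \<le> k" using R(4) by (simp add: rhs_weight_def)
  have sub: "?S \<subseteq> {..<2 * n + m}" using R(1,2) by auto
  have hit: "\<forall>i<m. (\<exists>x\<in>set (e i). x \<in> ?S \<and> n + x \<in> ?S) \<or> 2 * n + i \<in> ?S"
  proof (intro allI impI)
    fix i assume "i < m"
    then have "set (e i) \<inter> R2 \<noteq> {} \<or> i \<in> R1" using R(3) by blast
    then show "(\<exists>x\<in>set (e i). x \<in> ?S \<and> n + x \<in> ?S) \<or> 2 * n + i \<in> ?S" by auto
  qed
  have f: "fst (rhs_cover n m e) = 2 * n + m" by (simp add: rhs_cover_def)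
  show "coverable (rhs_cover n m e) k"
    unfolding coverable_def covers_rhs[OF assms] f by (rule exI[of _ ?S], rule conjI[OF sub conjI[OF card hit]])
qed

text \<open>Choosing one or both of \<open>x\<close> and \<open>n + x\<close> stands for the value 1 or 2 at \<open>x\<close>.\<close>

definition rhf_cover :: "nat \<Rightarrow> nat \<Rightarrow> (nat \<Rightarrow> nat list) \<Rightarrow> nat list \<Rightarrow> cover_instance" where
  "rhf_cover n m e ts = (2 * n, map (\<lambda>j. if j < n then (j, n + j) else (j - n, j - n)) [0..<3 * n],
     map (\<lambda>i. e i @ map (\<lambda>x. n + x) (filter (\<lambda>x. nthd ts x = i) [0..<n]) @
        map (\<lambda>x. 2 * n + x) (filter (\<lambda>x. nthd ts x = i) [0..<n])) [0..<m])"

lemma rhf_cover_wf: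
  assumes "\<And>i. distinct (e i) \<and> set (e i) \<subseteq> {..<n}"
  shows "cover_wf (rhf_cover n m e ts)"
  using assms unfolding cover_wf_def rhf_cover_def by (fastforce simp: distinct_map)

lemma covers_rhf:
  assumes "\<And>i. set (e i) \<subseteq> {..<n}"
  shows "covers (fst (snd (rhf_cover n m e ts))) (snd (snd (rhf_cover n m e ts))) S \<longleftrightarrow>
    (\<forall>i<m. (\<exists>x\<in>set (e i). x \<in> S \<and> n + x \<in> S) \<or> (\<exists>x<n. nthd ts x = i \<and> (x \<in> S \<or> n + x \<in> S)))"
proof -
  let ?prs = "fst (snd (rhf_cover n m e ts))"
  have 1: "nthd ?prs x = (x, n + x)" if "x \<in> set (e i)" for x i
  proof -
    have "x < n" using assms[of i] that by blast
    then show ?thesis by (simp add: rhf_cover_def)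
  qed
  have 2: "nthd ?prs (n + x) = (x, x)" "nthd ?prs (2 * n + x) = (n + x, n + x)" if "x < n" for x
    using that by (simp_all add: rhf_cover_def)
  have "covers ?prs (snd (snd (rhf_cover n m e ts))) S \<longleftrightarrow> (\<forall>i<m. \<exists>j\<in>set (e i @ map (\<lambda>x. n + x) (filter (\<lambda>x. nthd ts x = i) [0..<n]) @
        map (\<lambda>x. 2 * n + x) (filter (\<lambda>x. nthd ts x = i) [0..<n])). fst (nthd ?prs j) \<in> S \<and> snd (nthd ?prs j) \<in> S)"
    unfolding rhf_cover_def snd_conv by (rule covers_map_upt)
  also have "\<dots> \<longleftrightarrow>
      (\<forall>i<m. (\<exists>x\<in>set (e i). fst (nthd ?prs x) \<in> S \<and> snd (nthd ?prs x) \<in> S) \<or>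
         (\<exists>x\<in>{x. x < n \<and> nthd ts x = i}. (fst (nthd ?prs (n + x)) \<in> S \<and> snd (nthd ?prs (n + x)) \<in> S) \<or>
            (fst (nthd ?prs (2 * n + x)) \<in> S \<and> snd (nthd ?prs (2 * n + x)) \<in> S)))"
    by (intro all_cong1 imp_cong refl) (simp only: set_append set_map set_filter bex_Un bex_simps, auto)
  also have "\<dots> \<longleftrightarrow> (\<forall>i<m. (\<exists>x\<in>set (e i). x \<in> S \<and> n + x \<in> S) \<or> (\<exists>x<n. nthd ts x = i \<and> (x \<in> S \<or> n + x \<in> S)))"
    by (simp add: 1 2 Bex_def conj_assoc cong: bex_cong conj_cong)
  finally show ?thesis .
qed

lemma coverable_rhf:
  assumes "\<And>i. set (e i) \<subseteq> {..<n}"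
    and tau: "correspondence {..<n} {..<m} (\<lambda>i. set (e i)) (nthd ts)"
  shows "coverable (rhf_cover n m e ts) k \<longleftrightarrow>
    (\<exists>f. roman_hitting_function {..<n} {..<m} (\<lambda>i. set (e i)) (nthd ts) f \<and> rhf_weight {..<n} f \<le> k)"
proof
  assume "coverable (rhf_cover n m e ts) k"
  then obtain S where S: "S \<subseteq> {..<2 * n}" "card S \<le> k"
    "\<forall>i<m. (\<exists>x\<in>set (e i). x \<in> S \<and> n + x \<in> S) \<or> (\<exists>x<n. nthd ts x = i \<and> (x \<in> S \<or> n + x \<in> S))"
    unfolding coverable_def covers_rhf[OF assms(1)] by (auto simp: rhf_cover_def)
  let ?A = "{x. x < n \<and> x \<in> S}" and ?B = "{x. x < n \<and> n + x \<in> S}"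
  define f :: "nat \<Rightarrow> nat" where "f x = of_bool (x \<in> ?A) + of_bool (x \<in> ?B)" for x
  have "rhf_weight {..<n} f = card ?A + card ?B"
    unfolding rhf_weight_def f_def by (rule sum_indicators) auto
  \<comment> \<open>The empty third block brings the sum into the form of
    \<open>card_blocks\<close>.\<close>
  also have "\<dots> = card (?A \<union> (+) n ` ?B \<union> (+) (2 * n) ` {})"
    by (subst card_blocks) auto
  also have "\<dots> \<le> card S" using S(1) finite_subset by (intro card_mono) auto
  finally have "rhf_weight {..<n} f \<le> k" using S(2) by simp
  moreover have "(\<exists>x\<in>set (e i). f x = 2) \<or> (\<exists>x\<in>{..<n}. nthd ts x = i \<and> f x = 1)" if i: "i < m" for i
  proof (cases "\<exists>x\<in>set (e i). x \<in> S \<and> n + x \<in> S")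
    case True
    then obtain x where "x \<in> set (e i)" "x \<in> S" "n + x \<in> S" by blast
    moreover have "x < n" using calculation(1) assms(1)[of i] by auto
    ultimately show ?thesis by (intro disjI1 bexI[of _ x]) (simp_all add: f_def)
  next
    case False
    then obtain x where x: "x < n" "nthd ts x = i" "x \<in> S \<or> n + x \<in> S" using S(3) i by blast
    \<comment> \<open>The correspondence assigns to \<open>x\<close> an edge containing it. If both
      literals of \<open>x\<close> were chosen, the first alternative would hold; so exactly one of
      them is, and the value at \<open>x\<close> is 1 and not 2.\<close>
    have "x \<in> set (e i)" using tau x(1,2) by (auto simp: correspondence_def)
    then have "f x = 1" using False x by (auto simp: f_def)
    then show ?thesis using x by blast
  qed
  moreover have "f x \<in> {0, 1, 2}" for x by (auto simp: f_def)
  ultimately show "\<exists>f. roman_hitting_function {..<n} {..<m} (\<lambda>i. set (e i)) (nthd ts) f \<and> rhf_weight {..<n} f \<le> k"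
    unfolding roman_hitting_function_def by (intro exI[of _ f]) simp
next
  assume "\<exists>f. roman_hitting_function {..<n} {..<m} (\<lambda>i. set (e i)) (nthd ts) f \<and> rhf_weight {..<n} f \<le> k"
  then obtain f where f: "\<forall>x\<in>{..<n}. f x \<in> {0, 1, 2}"
    "\<forall>i\<in>{..<m}. (\<exists>x\<in>set (e i). f x = 2) \<or> (\<exists>x\<in>{..<n}. nthd ts x = i \<and> f x = 1)" "rhf_weight {..<n} f \<le> k"
    unfolding roman_hitting_function_def by blast
  let ?A = "{x. x < n \<and> f x \<noteq> 0}" and ?B = "{x. x < n \<and> f x = 2}"
  let ?S = "?A \<union> (+) n ` ?B \<union> (+) (2 * n) ` {}"
  have "card ?S = card ?A + card ?B"
    by (subst card_blocks) auto
  also have "\<dots> = (\<Sum>x<n. of_bool (x \<in> ?A) + of_bool (x \<in> ?B))"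
    by (rule sum_indicators[symmetric]) auto
  also have "\<dots> = rhf_weight {..<n} f"
    unfolding rhf_weight_def
  proof (rule sum.cong[OF refl])
    fix x assume "x \<in> {..<n}"
    then show "of_bool (x \<in> ?A) + of_bool (x \<in> ?B) = f x" using f(1)[rule_format, of x] by auto
  qed
  finally have card: "card ?S \<le> k" using f(3) by simp
  have sub: "?S \<subseteq> {..<2 * n}" by auto
  have hit: "\<forall>i<m. (\<exists>x\<in>set (e i). x \<in> ?S \<and> n + x \<in> ?S) \<or> (\<exists>x<n. nthd ts x = i \<and> (x \<in> ?S \<or> n + x \<in> ?S))"
  proof (intro allI impI)
    fix i assume i: "i < m"
    consider x where "x \<in> set (e i)" "f x = 2" | x where "x < n" "nthd ts x = i" "f x = 1" using f(2) i by blast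
    then show "(\<exists>x\<in>set (e i). x \<in> ?S \<and> n + x \<in> ?S) \<or> (\<exists>x<n. nthd ts x = i \<and> (x \<in> ?S \<or> n + x \<in> ?S))"
    proof cases
      case 1
      then have "x < n" using assms(1)[of i] by auto
      then show ?thesis using 1 by (intro disjI1 bexI[of _ x]) auto
    next
      case 2
      then show ?thesis by (intro disjI2 exI[of _ x]) auto
    qed
  qed
  have f: "fst (rhf_cover n m e ts) = 2 * n" by (simp add: rhf_cover_def)
  show "coverable (rhf_cover n m e ts) k"
    unfolding coverable_def covers_rhf[OF assms(1)] f by (rule exI[of _ ?S], rule conjI[OF sub conjI[OF card hit]])
qed

lemma not_coverable_empty: "\<not> coverable (0, [], [[]]) k"
  by (simp add: coverable_def covers_def)

lemma edge_list_wf: "distinct (edge_list w i) \<and> set (edge_list w i) \<subseteq> {..<vertex_count w}"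
  by (auto simp: edge_list_def)

lemma hypergraph_code_length:
  "hypergraph_code w \<Longrightarrow> length w = vertex_count w + edge_count w + 2 + edge_count w * vertex_count w + length (hypergraph_rest w)"
proof -
  assume w: "hypergraph_code w"
  then have "length w = length (unary (vertex_count w) @ unary (edge_count w) @ incidences w)"
    unfolding hypergraph_code_def by simp
  also have "\<dots> = vertex_count w + edge_count w + 2 + length (incidences w)" by (simp add: unary_def)
  finally show ?thesis using w by (simp add: hypergraph_code_def hypergraph_rest_def)
qed

text \<open>There are \<open>2 * n + m\<close> literals, which is within the length of the code as
  soon as the incidence matrix has a row of length \<open>n\<close>. Without edges the empty choice
  solves everything, and an instance without literals takes the place of the general one.\<close>

definition rhs_instance :: "bool list \<Rightarrow> cover_instance" where
  "rhs_instance w = (if hypergraph_code w \<and> hypergraph_rest w = [] then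
     if edge_count w = 0 then (0, [], []) else rhs_cover (vertex_count w) (edge_count w) (edge_list w)
     else (0, [], [[]]))"

interpretation RHS: cover_problem RHS rhs_instance
proof
  show "PT rhs_instance" unfolding rhs_instance_def[abs_def] rhs_cover_def by (intro PT_intros)
  fix w :: "bool list" and k :: nat
  let ?n = "vertex_count w" and ?m = "edge_count w"
  show "cover_wf (rhs_instance w)"
    using rhs_cover_wf[OF edge_list_wf] by (simp add: rhs_instance_def) (simp add: cover_wf_def)
  show "fst (rhs_instance w) \<le> length w"
  proof (cases "hypergraph_code w \<and> ?m \<noteq> 0")
    case True
    then have "1 * ?n \<le> ?m * ?n" by (intro mult_right_mono) auto
    then have "2 * ?n + ?m \<le> length w" using hypergraph_code_length[OF conjunct1[OF True]] by linarith
    moreover have "fst (rhs_instance w) \<le> 2 * ?n + ?m" by (simp add: rhs_instance_def rhs_cover_def)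
    ultimately show ?thesis by (rule order_trans[rotated])
  qed (auto simp: rhs_instance_def)
  show "(w, k) \<in> RHS \<longleftrightarrow> coverable (rhs_instance w) k"
  proof (cases "hypergraph_code w \<and> hypergraph_rest w = []")
    case True
    then have w: "w = encode_hypergraph ?n ?m (\<lambda>i. set (edge_list w i))"
      using hypergraph_code_encode[of w] by simp
    have "(w, k) \<in> RHS \<longleftrightarrow> (\<exists>R1 R2. roman_hitting_set {..<?n} {..<?m} (\<lambda>i. set (edge_list w i)) R1 R2 \<and> rhs_weight R1 R2 \<le> k)"
      using RHS_encode_iff[OF hypergraph_edge_list[of w], of k] unfolding w[symmetric] .
    also have "\<dots> \<longleftrightarrow> coverable (rhs_cover ?n ?m (edge_list w)) k"
      by (rule coverable_rhs[symmetric]) (simp add: edge_list_wf)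
    also have "\<dots> \<longleftrightarrow> coverable (rhs_instance w) k"
    proof (cases "?m = 0")
      case 0: True
      then have "coverable (rhs_cover ?n ?m (edge_list w)) k" "coverable (0, [], []) k"
        by (auto simp: coverable_def covers_def rhs_cover_def intro!: exI[of _ "{}"])
      then show ?thesis using True 0 by (simp add: rhs_instance_def)
    qed (use True in \<open>simp add: rhs_instance_def\<close>)
    finally show ?thesis .
  next
    case False
    have "(w, k) \<notin> RHS"
    proof
      assume "(w, k) \<in> RHS"
      then obtain n m s where "w = encode_hypergraph n m s @ []" by (auto simp: RHS_def)
      from encode_hypergraph_code(1,4)[OF this] False show False by blast
    qed
    then show ?thesis using not_coverable_empty False unfolding rhs_instance_def by auto
  qed
qed

text \<open>\<open>tokens\<close> accepts every word and forgets an unfinished number at its end;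
  comparison with the encoded result rejects such words.\<close>

definition rhf_code :: "bool list \<Rightarrow> bool" where
  "rhf_code w \<longleftrightarrow> hypergraph_code w \<and> length (tokens (hypergraph_rest w)) = vertex_count w \<and>
     hypergraph_rest w = concat (map (\<lambda>t. unary t) (tokens (hypergraph_rest w))) \<and>
     (\<forall>x\<in>set [0..<vertex_count w]. nthd (tokens (hypergraph_rest w)) x < edge_count w \<and>
        x \<in> set (edge_list w (nthd (tokens (hypergraph_rest w)) x)))"

definition rhf_instance :: "bool list \<Rightarrow> cover_instance" where
  "rhf_instance w = (if rhf_code w then
     rhf_cover (vertex_count w) (edge_count w) (edge_list w) (tokens (hypergraph_rest w)) else (0, [], [[]]))"

lemma length_unaries: "length ts \<le> length (concat (map (\<lambda>t. unary t) ts))"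
  by (induction ts) (auto simp: unary_def)

interpretation RHF: cover_problem RHF rhf_instance
proof
  show "PT rhf_instance" unfolding rhf_instance_def[abs_def] rhf_code_def rhf_cover_def by (intro PT_intros)
  fix w :: "bool list" and k :: nat
  let ?n = "vertex_count w" and ?m = "edge_count w" and ?r = "hypergraph_rest w"
  let ?ts = "tokens (hypergraph_rest w)"
  show "cover_wf (rhf_instance w)"
    using rhf_cover_wf[OF edge_list_wf] by (simp add: rhf_instance_def) (simp add: cover_wf_def)
  show "fst (rhf_instance w) \<le> length w"
  proof (cases "rhf_code w")
    case True
    \<comment> \<open>Each value of the correspondence takes at least one symbol, which pays for the
      second literal of its vertex.\<close>
    then have "?n \<le> length ?r" using length_unaries[of ?ts] by (simp add: rhf_code_def)
    then show ?thesis using hypergraph_code_length[of w] True by (simp add: rhf_instance_def rhf_cover_def rhf_code_def)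
  qed (simp add: rhf_instance_def)
  show "(w, k) \<in> RHF \<longleftrightarrow> coverable (rhf_instance w) k"
  proof (cases "rhf_code w")
    case True
    then have code: "hypergraph_code w" and len: "length ?ts = ?n" and r: "?r = concat (map unary ?ts)"
      and tau: "correspondence {..<?n} {..<?m} (\<lambda>i. set (edge_list w i)) (nthd ?ts)"
      by (auto simp: rhf_code_def correspondence_def)
    have "map (nthd ?ts) [0..<?n] = ?ts" using len by (intro nth_equalityI) auto
    moreover have "encode_correspondence ?n (nthd ?ts) = concat (map unary (map (nthd ?ts) [0..<?n]))"
      by (simp add: encode_correspondence_def comp_def)
    ultimately have "encode_correspondence ?n (nthd ?ts) = concat (map unary ?ts)" by simp
    then have w: "w = encode_hypergraph ?n ?m (\<lambda>i. set (edge_list w i)) @ encode_correspondence ?n (nthd ?ts)"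
      using hypergraph_code_encode[OF code] r by simp
    have "(w, k) \<in> RHF \<longleftrightarrow>
      (\<exists>f. roman_hitting_function {..<?n} {..<?m} (\<lambda>i. set (edge_list w i)) (nthd ?ts) f \<and> rhf_weight {..<?n} f \<le> k)"
      using RHF_encode_iff[OF hypergraph_edge_list[of w] tau, of k] unfolding w[symmetric] .
    also have "\<dots> \<longleftrightarrow> coverable (rhf_cover ?n ?m (edge_list w) ?ts) k"
      by (rule coverable_rhf[symmetric]) (simp_all add: edge_list_wf tau)
    finally show ?thesis using True by (simp add: rhf_instance_def)
  next
    case False
    have "(w, k) \<notin> RHF"
    proof
      assume "(w, k) \<in> RHF"
      then obtain n m s \<tau> where w: "w = encode_hypergraph n m s @ encode_correspondence n \<tau>"
        and tau: "correspondence {..<n} {..<m} s \<tau>" by (auto simp: RHF_def)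
      note c = encode_hypergraph_code[OF w]
      have "encode_correspondence n \<tau> = concat (map unary (map \<tau> [0..<n]))"
        by (simp add: encode_correspondence_def comp_def)
      then have t: "?ts = map \<tau> [0..<n]" "?r = concat (map unary (map \<tau> [0..<n]))"
        unfolding c(4) by (simp_all only: tokens_unary)
      have "\<tau> x < m \<and> x \<in> set (edge_list w (\<tau> x))" if "x < n" for x
        using tau c(5)[of "\<tau> x" x] that by (simp add: correspondence_def)
      then have "rhf_code w"
        unfolding rhf_code_def t(1) c(2,3) using c(1) t(2) by simp
      with False show False by blast
    qed
    then show ?thesis using not_coverable_empty False unfolding rhf_instance_def by auto
  qed
qed

theorem theorem3:
  shows "NP_complete (classical RHF) \<and> NP_complete (classical RHS) \<and>
         W_complete 2 RHF \<and> W_complete 2 RHS"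
  unfolding NP_complete_def W_complete_def
  using RHF.in_NP RHS.in_NP RHF.in_W RHS.in_W NP_hard_RHS_RHF W_hard_RHS_RHF by blast

end
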